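(* Let $\sigma_\ell,g_\ell$ ($\ell\in L$) satisfy the structural assumption stated in the context. Let $\bar u\in L^2(\mathbb{R}^d)$ be deterministic with compact support, and suppose that the mesh $\mathcal{T}_h$ covers the support of the exact solution $u(t)$ of $$du+\sum_{\ell\in L}\operatorname{div}_x\bigl(\sigma_\ell g_\ell(u)\bigr)\circ dW^\ell_t=0,\qquad u(0)=\bar u,$$ for all $t\in[0,T]$. Let $u_h$, $\{q_{h,\ell}\}_{\ell\in L}$ be the LDG approximation defined in the context (with the interior and boundary numerical fluxes given there, penalty parameters $\eta^e_{u,\ell},\eta^e_{q,\ell}\ge 0$), and let $\tau_n(t)=t\wedge\tau_n$ be the stopped times defined in the context. Then for all $t\in[0,T]$, $$\mathbb{E}\bigl[\|u_h(\tau_n(t))\|_{2}^2\bigr]-\|u_h(0)\|_{2}^2+\mathbb{E}\Biggl[\sum_{e\in\mathcal{E}_h}\int_0^{\tau_n(t)}\sum_{\ell\in L}\int_e|\sigma_\ell\cdot n_e|\Bigl(\eta^e_{q,\ell}\llbracket u_h\rrbracket^2+\eta^e_{u,\ell}\llbracket q_{h,\ell}\rrbracket^2\Bigr)(s)\,d\mathcal{H}^{d-1}(x)\,ds\Biggr]\le 0 ,$$ where the last term on the left is non-negative and can be discarded. Thus, in particular, $\mathbb{E}\bigl[\|u_h(\tau_n(t))\|_2^2\bigr]\le\|u_h(0)\|_2^2$. Once global existence of the LDG solution on $[0,T]$ has been established, one may let $n\to\infty$ and obtain the corresponding estimate without stopping for each deterministic $t\in[0,T]$.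
   Context: Setting. $T>0$, $d\ge1$, $L$ is a finite index set, $\{W^\ell\}_{\ell\in L}$ are independent real Wiener processes on a filtered probability space satisfying the usual conditions. $D\subset\mathbb{R}^d$ is a bounded polygonal (polyhedral) domain, chosen large enough to contain the support of $u(t)$ for all $t\in[0,T]$; $\|\cdot\|_2$ is the $L^2(D)$ norm. Structural assumption. For each $\ell\in L$: $\sigma_\ell\in[L^2(\mathbb{R}^d)]^d$, $\operatorname{div}_x\sigma_\ell=0$, and the normal traces $\sigma_\ell\cdot n$ are well defined in $L^2$ on the mesh faces; $g_\ell\in C^2(\mathbb{R})$ and there are $C_\ell>0$, $r_\ell\in\mathbb{N}$ with $|g_\ell(u)|\le C_\ell(1+|u|^{r_\ell})$ for all $u\in\mathbb{R}$. Mesh. $\mathcal{T}_h$ is a conforming shape-regular partition of $D$ into polyhedra $K$, $\mathcal{E}_h$ the set of its faces, $\mathcal{V}^k=\{v\in L^2(D): v|_K\in\mathcal{P}^k(K)\ \forall K\in\mathcal{T}_h\}$, $k\ge0$. In sums over $e\subset\partial K$, $n_e$ is the unit normal outward to $K$; in sums over $e\in\mathcal{E}_h$, $n_e$ is a fixed unit normal to $e$. For an interior face with normal $n_e$, $\llbracket v\rrbracket$ is the trace of $v$ from the element into which $n_e$ points minus the trace from the other element, and $\{\!\{v\}\!\}$ is the mean of the two traces. On faces $e\subset\partial D$ zeroth-order extrapolation is used: the exterior trace is taken equal to the interior one, so jumps vanish there. LDG scheme. Find adapted continuous processes $u_h(t)\in\mathcal{V}^k$, $q_{h,\ell}(t)\in\mathcal{V}^k$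 ($\ell\in L$) such that for all $K\in\mathcal{T}_h$ and $\varphi,\psi_\ell\in\mathcal{V}^k$ $$d\int_K\varphi u_h\,dx=\sum_{\ell\in L}b_K(u_h,q_{h,\ell},\varphi)\,dt-\sum_{\ell\in L}\int_K\varphi q_{h,\ell}\,dx\,dW^\ell_t,$$ $$\int_K\psi_\ell q_{h,\ell}\,dx=-\int_K(\nabla\psi_\ell\cdot\sigma_\ell)g_\ell(u_h)\,dx+\sum_{e\subset\partial K}\int_e\psi_\ell\,\mathcal{F}^e_{g_\ell(u)}\,d\mathcal{H}^{d-1},$$ $$b_K(u_h,q_{h,\ell},\varphi)=-\tfrac12\int_K(\nabla\varphi\cdot\sigma_\ell)g_\ell'(u_h)q_{h,\ell}\,dx+\tfrac12\sum_{e\subset\partial K}\int_e\varphi\,\mathcal{F}^e_{g_\ell'(u)q_\ell}\,d\mathcal{H}^{d-1},$$ with traces of $\varphi,\psi_\ell$ from inside $K$, and $u_h(0)$ the $L^2$-projection of $\bar u$ onto $\mathcal{V}^k$. Numerical fluxes. On interior faces $$\mathcal{F}^e_{g_\ell'(u)q_\ell}=(\sigma_\ell\cdot n_e)\Bigl(\tfrac{\llbracket g_\ell(u_h)\rrbracket}{\llbracket u_h\rrbracket}\{\!\{q_{h,\ell}\}\!\}+\eta^e_{q,\ell}\,\mathrm{sgn}(\sigma_\ell\cdot n_e)\llbracket u_h\rrbracket\Bigr),\quad \mathcal{F}^e_{g_\ell(u)}=(\sigma_\ell\cdot n_e)\Bigl(\{\!\{g_\ell(u_h)\}\!\}+\eta^e_{u,\ell}\,\mathrm{sgn}(\sigma_\ell\cdot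 n_e)\llbracket q_{h,\ell}\rrbracket\Bigr),$$ with the quotient read as $g_\ell'(u_h)$ when $\llbracket u_h\rrbracket=0$ and constants $\eta^e_{u,\ell},\eta^e_{q,\ell}\ge0$. On faces $e=\partial K\cap\partial D$: $\mathcal{F}^e_{g_\ell'(u)q_\ell}=(\sigma_\ell\cdot n_e)g_\ell'(u_h|_K)q_{h,\ell}|_K$ and $\mathcal{F}^e_{g_\ell(u)}=(\sigma_\ell\cdot n_e)g_\ell(u_h|_K)$. Local solution and stopping. Expanding $u_h$ on each $K$ in a basis $\{\phi^K_m\}_{m=0}^{N_k}$ of $\mathcal{P}^k(K)$ gives a coefficient matrix $\mathbf{u}(t)\in\mathbb{R}^{(N_k+1)\times|\mathcal{T}_h|}$; $u_h$ is the maximal strong solution on $[0,\tau_{\max})$. With $\|\cdot\|_F$ the Frobenius norm, $\tau_n:=\inf\{t\ge0:\|\mathbf{u}(t)\|_F\ge n\}$ and $\tau_n(t):=t\wedge\tau_n$ for $n\in\mathbb{N}$, so $\tau_n\uparrow\tau_{\max}$.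
   Formalization: Added assumption: almost surely, for t in [0,T] before τ_max, (σ_ℓ·n)u_h = 0 a.e. on the faces in ∂D. Without it the boundary fluxes leave the unsigned term (σ_ℓ·n)u_h g_ℓ'(u_h)q_{h,ℓ} and the inequality can fail, even if the mesh covers the support of the exact solution. *)

theory Defs
  imports "HOL-Probability.Probability"
begin

section \<open>Smooth functions and test functions\<close>

primrec C_k :: "nat \<Rightarrow> ('a::euclidean_space \<Rightarrow> real) \<Rightarrow> bool" where
  "C_k 0 f \<longleftrightarrow> continuous_on UNIV f"
| "C_k (Suc k) f \<longleftrightarrow> (\<forall>x. f differentiable (at x)) \<and>
     (\<forall>b\<in>Basis. C_k k (\<lambda>x. frechet_derivative f (at x) b))"

definition grad :: "(real^'n::finite \<Rightarrow> real) \<Rightarrow> real^'n \<Rightarrow> real^'n" where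
  "grad f x = (\<chi> i. frechet_derivative f (at x) (axis i 1))"

definition test_functions :: "(real^'n::finite \<Rightarrow> real) set" where
  "test_functions = {\<phi>. (\<forall>k. C_k k \<phi>) \<and> compact (closure {x. \<phi> x \<noteq> 0})}"

definition square_integrable :: "(real^'n::finite \<Rightarrow> 'b::euclidean_space) \<Rightarrow> bool" where
  "square_integrable f \<longleftrightarrow>
     f \<in> borel_measurable lborel \<and> integrable lborel (\<lambda>x. (norm (f x))\<^sup>2)"

text \<open>Divergence-free in the sense of distributions.\<close>

definition div_free :: "(real^'n::finite \<Rightarrow> real^'n) \<Rightarrow> bool" where
  "div_free \<sigma> \<longleftrightarrow> (\<forall>\<phi>\<in>test_functions. (LINT x|lborel. \<sigma> x \<bullet> grad \<phi> x) = 0)"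

definition L2_norm :: "(real^'n::finite) set \<Rightarrow> (real^'n \<Rightarrow> real) \<Rightarrow> real" where
  "L2_norm D f = sqrt (LINT x:D|lborel. (f x)\<^sup>2)"

section \<open>Hausdorff measure\<close>

text \<open>The normalization by \<^term>\<open>unit_ball_vol\<close> makes the s-dimensional measure agree with
  Lebesgue measure on s-dimensional affine subspaces.  For s = 0 the convention
  \<^term>\<open>(0::real) ^ 0 = 1\<close> gives counting measure.\<close>

definition hausdorff_gauge :: "nat \<Rightarrow> 'a::metric_space set \<Rightarrow> ennreal" where
  "hausdorff_gauge s C =
     (if C = {} then 0 else ennreal (unit_ball_vol (real s) * (diameter C / 2) ^ s))"

definition hausdorff_pre :: "nat \<Rightarrow> real \<Rightarrow> 'a::metric_space set \<Rightarrow> ennreal" where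
  "hausdorff_pre s \<delta> A =
     (INF C\<in>{C::nat \<Rightarrow> 'a set. A \<subseteq> (\<Union>i. C i) \<and> (\<forall>i. bounded (C i) \<and> diameter (C i) \<le> \<delta>)}.
        (\<Sum>i. hausdorff_gauge s (C i)))"

definition hausdorff_outer :: "nat \<Rightarrow> 'a::metric_space set \<Rightarrow> ennreal" where
  "hausdorff_outer s A = (SUP \<delta>\<in>{0<..}. hausdorff_pre s \<delta> A)"

definition hausdorff :: "nat \<Rightarrow> 'a::metric_space measure" where
  "hausdorff s = measure_of UNIV (sets borel) (hausdorff_outer s)"

text \<open>\<open>hausdorff_outer\<close> is a metric outer measure, so Borel sets are Caratheodory measurable and
  \<open>measure_of\<close> does not degenerate (\<open>emeasure_hausdorff\<close> below).\<close>

lemma hausdorff_pre_le: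
  assumes "A \<subseteq> (\<Union>i::nat. C i)" "\<And>i. bounded (C i) \<and> diameter (C i) \<le> \<delta>"
  shows "hausdorff_pre s \<delta> A \<le> (\<Sum>i. hausdorff_gauge s (C i))"
  unfolding hausdorff_pre_def by (rule INF_lower) (use assms in auto)

lemma hausdorff_pre_mono: "A \<subseteq> B \<Longrightarrow> hausdorff_pre s \<delta> A \<le> hausdorff_pre s \<delta> B"
  unfolding hausdorff_pre_def by (rule INF_superset_mono) auto

lemma hausdorff_pre_antimono: "\<delta> \<le> \<delta>' \<Longrightarrow> hausdorff_pre s \<delta>' A \<le> hausdorff_pre s \<delta> A"
  unfolding hausdorff_pre_def by (rule INF_superset_mono) (auto intro: order_trans)

lemma hausdorff_pre_subadditive:
  "hausdorff_pre s \<delta> (\<Union>n::nat. A n) \<le> (\<Sum>n. hausdorff_pre s \<delta> (A n))"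
proof (rule ennreal_le_epsilon)
  fix e :: real
  assume fin: "(\<Sum>n. hausdorff_pre s \<delta> (A n)) < top" and e: "0 < e"
  have "\<exists>C. A n \<subseteq> (\<Union>i::nat. C i) \<and> (\<forall>i. bounded (C i) \<and> diameter (C i) \<le> \<delta>) \<and>
     (\<Sum>i. hausdorff_gauge s (C i)) \<le> hausdorff_pre s \<delta> (A n) + ennreal (e * (1/2) ^ Suc n)" for n
  proof -
    have "hausdorff_pre s \<delta> (A n) < top"
      using fin by (metis ennreal_suminf_lessD)
    then have "hausdorff_pre s \<delta> (A n) < hausdorff_pre s \<delta> (A n) + ennreal (e * (1/2) ^ Suc n)"
      using e ennreal_add_left_cancel_less[of "hausdorff_pre s \<delta> (A n)" 0 "ennreal (e * (1/2) ^ Suc n)"]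
      by (simp add: less_top[symmetric] del: power_Suc)
    then obtain C where "A n \<subseteq> (\<Union>i::nat. C i)" "\<forall>i. bounded (C i) \<and> diameter (C i) \<le> \<delta>"
      "(\<Sum>i. hausdorff_gauge s (C i)) < hausdorff_pre s \<delta> (A n) + ennreal (e * (1/2) ^ Suc n)"
      unfolding hausdorff_pre_def[of s \<delta> "A n"] INF_less_iff by (auto simp del: power_Suc)
    then show ?thesis by (meson less_imp_le)
  qed
  then obtain C where C: "\<And>n. A n \<subseteq> (\<Union>i::nat. C n i)"
     "\<And>n i. bounded (C n i) \<and> diameter (C n i) \<le> \<delta>"
     "\<And>n. (\<Sum>i. hausdorff_gauge s (C n i)) \<le> hausdorff_pre s \<delta> (A n) + ennreal (e * (1/2) ^ Suc n)"
    by metis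
  have "hausdorff_pre s \<delta> (\<Union>n. A n) \<le> (\<Sum>i. hausdorff_gauge s (case_prod C (prod_decode i)))"
  proof (rule hausdorff_pre_le)
    show "(\<Union>n. A n) \<subseteq> (\<Union>i. case_prod C (prod_decode i))"
    proof
      fix x assume "x \<in> (\<Union>n. A n)"
      then obtain n i where "x \<in> C n i" using C(1) by blast
      then have "x \<in> case_prod C (prod_decode (prod_encode (n, i)))" by simp
      then show "x \<in> (\<Union>i. case_prod C (prod_decode i))" by (rule UN_I[OF UNIV_I])
    qed
  qed (use C(2) in \<open>auto split: prod.split\<close>)
  also have "\<dots> = (\<Sum>n. \<Sum>i. hausdorff_gauge s (C n i))"
    by (rule suminf_ennreal_2dimen[where f = "\<lambda>p. hausdorff_gauge s (case_prod C p)"]) simp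
  also have "\<dots> \<le> (\<Sum>n. hausdorff_pre s \<delta> (A n) + ennreal (e * (1/2) ^ Suc n))"
    by (intro suminf_le C) auto
  also have "\<dots> = (\<Sum>n. hausdorff_pre s \<delta> (A n)) + (\<Sum>n. ennreal (e * (1/2) ^ Suc n))"
    by (intro suminf_add[symmetric]) auto
  also have "(\<Sum>n. ennreal (e * (1/2) ^ Suc n)) = ennreal e"
    using e sums_mult[OF power_half_series, of e] by (intro suminf_ennreal_eq) auto
  finally show "hausdorff_pre s \<delta> (\<Union>n. A n) \<le> (\<Sum>n. hausdorff_pre s \<delta> (A n)) + ennreal e" .
qed

lemma hausdorff_outer_mono: "A \<subseteq> B \<Longrightarrow> hausdorff_outer s A \<le> hausdorff_outer s B"
  unfolding hausdorff_outer_def by (intro SUP_mono) (auto intro: hausdorff_pre_mono)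

lemma hausdorff_outer_empty: "hausdorff_outer s ({} :: 'a::metric_space set) = 0"
proof -
  have "hausdorff_pre s \<delta> ({}::'a set) \<le> 0" if "\<delta> > 0" for \<delta>
    using hausdorff_pre_le[of "{}" "\<lambda>_. {}::'a set" \<delta> s] that
    by (simp add: hausdorff_gauge_def diameter_def)
  then show ?thesis unfolding hausdorff_outer_def by (auto intro!: antisym SUP_least)
qed

lemma hausdorff_outer_subadditive:
  "hausdorff_outer s (\<Union>n::nat. A n) \<le> (\<Sum>n. hausdorff_outer s (A n))"
proof -
  have "hausdorff_pre s \<delta> (\<Union>n. A n) \<le> (\<Sum>n. hausdorff_outer s (A n))" if "\<delta> > 0" for \<delta>
  proof -
    have "hausdorff_pre s \<delta> (\<Union>n. A n) \<le> (\<Sum>n. hausdorff_pre s \<delta> (A n))"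
      by (rule hausdorff_pre_subadditive)
    also have "\<dots> \<le> (\<Sum>n. hausdorff_outer s (A n))"
      unfolding hausdorff_outer_def using that by (intro suminf_le SUP_upper) auto
    finally show ?thesis .
  qed
  then show ?thesis by (subst hausdorff_outer_def) (auto intro!: SUP_least)
qed

lemma hausdorff_outer_Un: "hausdorff_outer s (A \<union> B) \<le> hausdorff_outer s A + hausdorff_outer s B"
proof -
  define E where "E = (\<lambda>n::nat. if n = 0 then A else if n = 1 then B else {})"
  have "E 0 = A" "E 1 = B" by (simp_all add: E_def)
  then have "A \<union> B \<subseteq> (\<Union>n. E n)" by blast
  then have "hausdorff_outer s (A \<union> B) \<le> (\<Sum>n. hausdorff_outer s (E n))"
    using hausdorff_outer_mono hausdorff_outer_subadditive order_trans by blast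
  also have "\<dots> = (\<Sum>n\<in>{0,1}. hausdorff_outer s (E n))"
    by (rule suminf_finite) (auto simp: E_def hausdorff_outer_empty)
  finally show ?thesis by (simp add: E_def)
qed

lemma hausdorff_outer_separated:
  assumes r: "r > 0" and AB: "\<And>x y. x \<in> A \<Longrightarrow> y \<in> B \<Longrightarrow> r \<le> dist x y"
  shows "hausdorff_outer s A + hausdorff_outer s B \<le> hausdorff_outer s (A \<union> B)"
proof -
  have *: "hausdorff_pre s \<delta> A + hausdorff_pre s \<delta> B \<le> hausdorff_pre s \<delta> (A \<union> B)"
    if \<delta>: "0 < \<delta>" "\<delta> < r" for \<delta>
    unfolding hausdorff_pre_def[of s \<delta> "A \<union> B"]
  proof (rule INF_greatest, clarsimp)
    fix C :: "nat \<Rightarrow> 'a set"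
    assume cov: "A \<subseteq> (\<Union>i. C i)" "B \<subseteq> (\<Union>i. C i)"
      and C: "\<forall>i. bounded (C i) \<and> diameter (C i) \<le> \<delta>"
    define CA where "CA = (\<lambda>i. if C i \<inter> A = {} then {} else C i)"
    define CB where "CB = (\<lambda>i. if C i \<inter> B = {} then {} else C i)"
    have disj: "C i \<inter> A = {} \<or> C i \<inter> B = {}" for i
    proof (rule ccontr)
      assume "\<not> ?thesis"
      then obtain x y where "x \<in> C i" "x \<in> A" "y \<in> C i" "y \<in> B" by auto
      then have "r \<le> diameter (C i)"
        using AB C diameter_bounded_bound[of "C i" x y] by fastforce
      then show False using C \<delta> by (metis leD order_trans)
    qed
    have "hausdorff_pre s \<delta> A \<le> (\<Sum>i. hausdorff_gauge s (CA i))"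
    proof (rule hausdorff_pre_le)
      show "A \<subseteq> (\<Union>i. CA i)"
      proof
        fix x assume x: "x \<in> A"
        with cov obtain i where "x \<in> C i" by blast
        with x have "x \<in> CA i" by (auto simp: CA_def)
        then show "x \<in> (\<Union>i. CA i)" by blast
      qed
      show "bounded (CA i) \<and> diameter (CA i) \<le> \<delta>" for i
        using C \<delta> by (cases "C i \<inter> A = {}") (simp_all add: CA_def)
    qed
    moreover have "hausdorff_pre s \<delta> B \<le> (\<Sum>i. hausdorff_gauge s (CB i))"
    proof (rule hausdorff_pre_le)
      show "B \<subseteq> (\<Union>i. CB i)"
      proof
        fix x assume x: "x \<in> B"
        with cov obtain i where "x \<in> C i" by blast
        with x have "x \<in> CB i" by (auto simp: CB_def)
        then show "x \<in> (\<Union>i. CB i)" by blast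
      qed
      show "bounded (CB i) \<and> diameter (CB i) \<le> \<delta>" for i
        using C \<delta> by (cases "C i \<inter> B = {}") (simp_all add: CB_def)
    qed
    ultimately have "hausdorff_pre s \<delta> A + hausdorff_pre s \<delta> B
       \<le> (\<Sum>i. hausdorff_gauge s (CA i)) + (\<Sum>i. hausdorff_gauge s (CB i))" by (rule add_mono)
    also have "\<dots> = (\<Sum>i. hausdorff_gauge s (CA i) + hausdorff_gauge s (CB i))"
      by (intro suminf_add) auto
    also have "\<dots> \<le> (\<Sum>i. hausdorff_gauge s (C i))"
      using disj by (intro suminf_le) (auto simp: CA_def CB_def hausdorff_gauge_def)
    finally show "hausdorff_pre s \<delta> A + hausdorff_pre s \<delta> B \<le> (\<Sum>i. hausdorff_gauge s (C i))" .
  qed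
  have **: "hausdorff_pre s a A + hausdorff_pre s b B \<le> hausdorff_outer s (A \<union> B)"
    if "a > 0" "b > 0" for a b
  proof -
    define d where "d = min (min a b) (r/2)"
    have d: "0 < d" "d < r" "d \<le> a" "d \<le> b" using that r by (auto simp: d_def)
    have "hausdorff_pre s a A + hausdorff_pre s b B \<le> hausdorff_pre s d A + hausdorff_pre s d B"
      using d by (intro add_mono hausdorff_pre_antimono)
    also have "\<dots> \<le> hausdorff_pre s d (A \<union> B)" using * d by auto
    also have "\<dots> \<le> hausdorff_outer s (A \<union> B)"
      unfolding hausdorff_outer_def using d by (intro SUP_upper) auto
    finally show ?thesis .
  qed
  have "hausdorff_outer s A + hausdorff_pre s b B \<le> hausdorff_outer s (A \<union> B)" if "b > 0" for b
    unfolding hausdorff_outer_def[of s A] using ** that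
    by (subst ennreal_SUP_add_left[symmetric]) (auto intro!: SUP_least)
  then have "(SUP b\<in>{0<..}. hausdorff_outer s A + hausdorff_pre s b B) \<le> hausdorff_outer s (A \<union> B)"
    by (intro SUP_least) auto
  then show ?thesis
    unfolding hausdorff_outer_def[of s B]
    by (subst ennreal_SUP_add_right) auto
qed

lemma hausdorff_outer_separated_sum:
  fixes R :: "nat \<Rightarrow> 'a::metric_space set"
  assumes sep: "\<And>i j. i < j \<Longrightarrow> j < n \<Longrightarrow> \<exists>r>0. \<forall>x\<in>R i. \<forall>y\<in>R j. r \<le> dist x y"
  shows "(\<Sum>i<n. hausdorff_outer s (R i)) \<le> hausdorff_outer s (\<Union>i<n. R i)"
  using sep
proof (induction n)
  case 0
  then show ?case by simp
next
  case (Suc n)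
  have "\<forall>i\<in>{..<n}. \<exists>r. 0 < r \<and> (\<forall>x\<in>R i. \<forall>y\<in>R n. r \<le> dist x y)"
    using Suc.prems[of _ n] by simp
  from bchoice[OF this] obtain r where
    r': "\<forall>i\<in>{..<n}. 0 < r i \<and> (\<forall>x\<in>R i. \<forall>y\<in>R n. r i \<le> dist x y)" ..
  have r: "\<And>i. i < n \<Longrightarrow> 0 < r i"
    "\<And>i x y. i < n \<Longrightarrow> x \<in> R i \<Longrightarrow> y \<in> R n \<Longrightarrow> r i \<le> dist x y"
    using r' by auto
  define \<rho> where "\<rho> = Min (insert 1 (r ` {..<n}))"
  have \<rho>: "\<rho> > 0" using r by (auto simp: \<rho>_def)
  have \<rho>': "\<rho> \<le> r i" if "i < n" for i using that by (auto simp: \<rho>_def)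
  have "(\<Sum>i<Suc n. hausdorff_outer s (R i)) \<le> hausdorff_outer s (\<Union>i<n. R i) + hausdorff_outer s (R n)"
    using Suc by (auto intro!: add_right_mono)
  also have "\<dots> \<le> hausdorff_outer s ((\<Union>i<n. R i) \<union> R n)"
    by (rule hausdorff_outer_separated[OF \<rho>]) (use r \<rho>' in \<open>force\<close>)
  also have "(\<Union>i<n. R i) \<union> R n = (\<Union>i<Suc n. R i)" by (auto simp: less_Suc_eq)
  finally show ?case .
qed

lemma closed_lambda_system_hausdorff:
  fixes S :: "'a::metric_space set"
  assumes S: "closed S"
  shows "hausdorff_outer s (X \<inter> S) + hausdorff_outer s (X - S) \<le> hausdorff_outer s X"
proof (cases "S = {} \<or> hausdorff_outer s X = top")
  case True
  then show ?thesis by (auto simp: hausdorff_outer_empty)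
next
  case False
  then have ne: "S \<noteq> {}" and fin: "hausdorff_outer s X < top" by (auto simp: less_top)
  let ?h = "hausdorff_outer s"
  define Y where "Y = (\<lambda>n::nat. {x\<in>X. inverse (real (Suc n)) \<le> infdist x S})"
  define R where "R = (\<lambda>n. Y (Suc n) - Y n)"
  have Ymono: "Y n \<subseteq> Y (n + k)" for n k
  proof -
    have "inverse (real (Suc (n + k))) \<le> inverse (real (Suc n))" by (intro le_imp_inverse_le) auto
    then show ?thesis unfolding Y_def using order_trans by blast
  qed
  have dd: "infdist x S \<le> infdist y S + dist x y" for x y
    using infdist_triangle[of x S y] by (simp add: dist_commute)
  have sep: "\<exists>r>0. \<forall>x\<in>R i. \<forall>y\<in>R j. r \<le> dist x y" if "i + 2 \<le> j" for i j
  proof (intro exI[of _ "inverse (real (i+2)) - inverse (real (i+3))"] conjI ballI)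
    show "inverse (real (i+2)) - inverse (real (i+3)) > 0"
      using less_imp_inverse_less[of "real (i+2)" "real (i+3)"] by simp
    fix x y assume x: "x \<in> R i" and y: "y \<in> R j"
    have "inverse (real (i+2)) \<le> infdist x S" using x by (auto simp: R_def Y_def algebra_simps)
    moreover have "infdist y S < inverse (real (Suc j))" using y by (auto simp: R_def Y_def)
    moreover have "inverse (real (Suc j)) \<le> inverse (real (i+3))" using that by (simp add: field_simps)
    ultimately show "inverse (real (i+2)) - inverse (real (i+3)) \<le> dist x y"
      using dd[of x y] by linarith
  qed
  have part: "(\<Sum>i<n. ?h (R (2*i+c))) \<le> ?h X" for n c
  proof -
    have "(\<Sum>i<n. ?h (R (2*i+c))) \<le> ?h (\<Union>i<n. R (2*i+c))"
      by (rule hausdorff_outer_separated_sum) (auto intro!: sep)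
    also have "\<dots> \<le> ?h X" by (rule hausdorff_outer_mono) (auto simp: R_def Y_def)
    finally show ?thesis .
  qed
  have "(\<Sum>i<n. ?h (R i)) \<le> ?h X + ?h X" for n
  proof -
    have "(\<Sum>i<n. ?h (R i)) \<le> (\<Sum>i<2*n. ?h (R i))" by (rule sum_mono2) auto
    also have "\<dots> = (\<Sum>i<n. ?h (R (2*i+0))) + (\<Sum>i<n. ?h (R (2*i+1)))"
      by (induction n) (auto simp: algebra_simps)
    also have "\<dots> \<le> ?h X + ?h X" using part by (intro add_mono) blast+
    finally show ?thesis .
  qed
  then have "(\<Sum>i. ?h (R i)) \<le> ?h X + ?h X"
    unfolding suminf_eq_SUP by (intro SUP_least)
  then have sumfin: "(\<Sum>i. ?h (R i)) < top" using fin by (simp add: le_less_trans ennreal_add_less_top)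
  have tail: "?h (X - S) \<le> ?h (Y n) + (\<Sum>k. ?h (R (k + n)))" for n
  proof -
    have "X - S \<subseteq> Y n \<union> (\<Union>k. R (k + n))"
    proof
      fix x assume x: "x \<in> X - S"
      then have "infdist x S > 0" using S ne
        by (metis DiffD2 in_closed_iff_infdist_zero infdist_nonneg less_eq_real_def)
      then obtain m where "inverse (real (Suc m)) < infdist x S" using reals_Archimedean by blast
      then have "x \<in> Y m" using x by (auto simp: Y_def)
      then have ex: "\<exists>m. x \<in> Y m" by blast
      define l where "l = (LEAST m. x \<in> Y m)"
      have l: "x \<in> Y l" unfolding l_def using ex by (rule LeastI_ex)
      show "x \<in> Y n \<union> (\<Union>k. R (k + n))"
      proof (cases "l \<le> n")
        case True
        then show ?thesis using Ymono[of l "n - l"] l by auto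
      next
        case False
        then have "x \<notin> Y (l - 1)" unfolding l_def by (metis Suc_diff_1 less_Suc_eq not_less_Least not_less_zero nat_neq_iff linorder_not_le)
        then have "x \<in> R ((l - 1 - n) + n)" using False l by (auto simp: R_def)
        then show ?thesis by blast
      qed
    qed
    then have "?h (X - S) \<le> ?h (Y n \<union> (\<Union>k. R (k + n)))" by (rule hausdorff_outer_mono)
    also have "\<dots> \<le> ?h (Y n) + ?h (\<Union>k. R (k + n))" by (rule hausdorff_outer_Un)
    also have "\<dots> \<le> ?h (Y n) + (\<Sum>k. ?h (R (k + n)))"
      by (intro add_left_mono hausdorff_outer_subadditive)
    finally show ?thesis .
  qed
  have lim: "(\<lambda>n. \<Sum>k. ?h (R (k + n))) \<longlonglongrightarrow> 0"
  proof -
    define f where "f = (\<lambda>k. enn2real (?h (R k)))"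
    have hf: "?h (R k) = ennreal (f k)" for k
      unfolding f_def using sumfin by (metis ennreal_enn2real ennreal_suminf_lessD)
    have f0: "f k \<ge> 0" for k by (simp add: f_def)
    have sm: "summable f"
      using sumfin by (intro summable_suminf_not_top f0) (auto simp: hf)
    have "(\<lambda>n. \<Sum>k. f (k + n)) \<longlonglongrightarrow> 0" by (rule suminf_exist_split2[OF sm])
    then have "(\<lambda>n. ennreal (\<Sum>k. f (k + n))) \<longlonglongrightarrow> ennreal 0" by (intro tendsto_ennrealI)
    moreover have "(\<Sum>k. ?h (R (k + n))) = ennreal (\<Sum>k. f (k + n))" for n
      unfolding hf using f0 sm by (intro suminf_ennreal2) (auto simp: summable_iff_shift)
    ultimately show ?thesis by simp
  qed
  have "?h (X \<inter> S) + ?h (X - S) \<le> ?h X + (\<Sum>k. ?h (R (k + n)))" for n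
  proof -
    have "?h (X \<inter> S) + ?h (X - S) \<le> (?h (X \<inter> S) + ?h (Y n)) + (\<Sum>k. ?h (R (k + n)))"
      using add_left_mono[OF tail[of n], of "?h (X \<inter> S)"] by (simp add: add.assoc)
    also have "?h (X \<inter> S) + ?h (Y n) \<le> ?h ((X \<inter> S) \<union> Y n)"
    proof (rule hausdorff_outer_separated[of "inverse (real (Suc n))"])
      fix x y assume "x \<in> X \<inter> S" "y \<in> Y n"
      then show "inverse (real (Suc n)) \<le> dist x y"
        using infdist_le[of x S y] by (auto simp: Y_def dist_commute)
    qed auto
    also have "\<dots> \<le> ?h X" by (rule hausdorff_outer_mono) (auto simp: Y_def)
    finally show ?thesis by (auto intro: add_right_mono)
  qed
  moreover have "(\<lambda>n. ?h X + (\<Sum>k. ?h (R (k + n)))) \<longlonglongrightarrow> ?h X + 0"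
    by (intro tendsto_add tendsto_const lim)
  ultimately show ?thesis by (metis (no_types, lifting) LIMSEQ_le_const add.right_neutral)
qed

lemma emeasure_hausdorff:
  assumes "A \<in> sets borel"
  shows "emeasure (hausdorff s) A = hausdorff_outer s (A :: 'a::metric_space set)"
proof -
  let ?h = "hausdorff_outer s :: 'a set \<Rightarrow> ennreal"
  interpret sigma_algebra UNIV "UNIV :: 'a set set" using sigma_algebra_Pow[of UNIV] by simp
  have oms: "outer_measure_space UNIV ?h"
    by (auto simp: outer_measure_space_def positive_def increasing_def countably_subadditive_def
        hausdorff_outer_empty intro: hausdorff_outer_mono hausdorff_outer_subadditive)
  have ms: "measure_space UNIV (lambda_system UNIV UNIV ?h) ?h"
    by (rule caratheodory_lemma[OF oms])
  have "S \<in> lambda_system UNIV UNIV ?h" if "closed S" for S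
  proof -
    have "?h (X \<inter> S) + ?h (X - S) = ?h X" for X
    proof (rule antisym[OF closed_lambda_system_hausdorff[OF that]])
      have "(X \<inter> S) \<union> (X - S) = X" by blast
      then show "?h X \<le> ?h (X \<inter> S) + ?h (X - S)"
        using hausdorff_outer_Un[of s "X \<inter> S" "X - S"] by simp
    qed
    then show ?thesis unfolding lambda_system_eq by simp
  qed
  then have "sigma_sets UNIV {S. closed S} \<subseteq> lambda_system UNIV UNIV ?h"
    using ms unfolding measure_space_def by (intro sigma_algebra.sigma_sets_subset) auto
  then have sub: "sets borel \<subseteq> lambda_system UNIV UNIV ?h"
    unfolding borel_eq_closed by (subst sets_measure_of) auto
  show ?thesis
    unfolding hausdorff_def
  proof (rule emeasure_measure_of_sigma)
    show "sigma_algebra UNIV (sets borel)" using sets.sigma_algebra_axioms[of borel] by simp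
    show "positive (sets borel) ?h" by (auto simp: positive_def hausdorff_outer_empty)
    show "countably_additive (sets borel) ?h"
      using ms sub unfolding measure_space_def countably_additive_def by blast
  qed fact
qed

section \<open>Polyhedral meshes\<close>

record 'n mesh =
  elems :: "(real^'n) set set"
  faces :: "(real^'n) set set"
  fnormal :: "(real^'n) set \<Rightarrow> real^'n"

definition polyhedral :: "(real^'n::finite) set \<Rightarrow> bool" where
  "polyhedral A \<longleftrightarrow> (\<exists>P. finite P \<and> P \<noteq> {} \<and>
     (\<forall>p\<in>P. polytope p \<and> interior p \<noteq> {}) \<and> A = \<Union>P)"

definition polyhedral_domain :: "(real^'n::finite) set \<Rightarrow> bool" where
  "polyhedral_domain D \<longleftrightarrow> D \<noteq> {} \<and> open D \<and> connected D \<and> bounded D \<and>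
     interior (closure D) = D \<and> polyhedral (closure D)"

definition faces_of :: "'n::finite mesh \<Rightarrow> (real^'n) set \<Rightarrow> (real^'n) set set" where
  "faces_of m K = {e\<in>faces m. e \<subseteq> frontier K}"

definition adjacent :: "'n::finite mesh \<Rightarrow> (real^'n) set \<Rightarrow> (real^'n) set set" where
  "adjacent m e = {K\<in>elems m. e \<subseteq> frontier K}"

definition unit_normal :: "(real^'n::finite) set \<Rightarrow> real^'n \<Rightarrow> bool" where
  "unit_normal e n \<longleftrightarrow> norm n = 1 \<and> (\<forall>x\<in>e. \<forall>y\<in>e. n \<bullet> (x - y) = 0)"

definition is_outward_normal :: "(real^'n::finite) set \<Rightarrow> (real^'n) set \<Rightarrow> real^'n \<Rightarrow> bool" where
  "is_outward_normal K e n \<longleftrightarrow> unit_normal e n \<and>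
     (\<forall>x\<in>rel_interior e. \<exists>\<epsilon>>0. \<forall>s. 0 < s \<and> s < \<epsilon> \<longrightarrow>
        x - s *\<^sub>R n \<in> interior K \<and> x + s *\<^sub>R n \<notin> K)"

definition outward_normal :: "(real^'n::finite) set \<Rightarrow> (real^'n) set \<Rightarrow> real^'n" where
  "outward_normal K e = (THE n. is_outward_normal K e n)"

text \<open>Elements are closed and need not be convex.  Conformity: the boundary of each element is
  the union of faces of the mesh, the relative interior of a face meets no other face, and a face
  is shared by exactly two elements unless it lies on the boundary of the domain.\<close>

definition conforming_mesh :: "(real^'n::finite) set \<Rightarrow> 'n mesh \<Rightarrow> bool" where
  "conforming_mesh D m \<longleftrightarrow>
     finite (elems m) \<and> finite (faces m) \<and>
     (\<forall>K\<in>elems m. polyhedral K) \<and>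
     closure D = \<Union>(elems m) \<and>
     (\<forall>K\<in>elems m. \<forall>K'\<in>elems m. K \<noteq> K' \<longrightarrow> interior K \<inter> interior K' = {}) \<and>
     (\<forall>e\<in>faces m. polytope e \<and> aff_dim e = int CARD('n) - 1 \<and> unit_normal e (fnormal m e)) \<and>
     (\<forall>K\<in>elems m. frontier K = \<Union>(faces_of m K)) \<and>
     (\<forall>K\<in>elems m. \<forall>e\<in>faces_of m K. \<exists>n. is_outward_normal K e n) \<and>
     (\<forall>e\<in>faces m. \<forall>e'\<in>faces m. e \<noteq> e' \<longrightarrow> rel_interior e \<inter> e' = {}) \<and>
     (\<forall>e\<in>faces m. card (adjacent m e) = (if e \<subseteq> frontier D then 1 else 2))"

definition shape_regular :: "real \<Rightarrow> 'n::finite mesh \<Rightarrow> bool" where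
  "shape_regular \<kappa> m \<longleftrightarrow>
     (\<forall>K\<in>elems m. \<exists>x r. r > 0 \<and> ball x r \<subseteq> K \<and> diameter K \<le> \<kappa> * r)"

text \<open>The element on the other side of e; on a boundary face it is K itself, so that the exterior
  trace equals the interior one (zeroth-order extrapolation).\<close>

definition neighbour :: "'n::finite mesh \<Rightarrow> (real^'n) set \<Rightarrow> (real^'n) set \<Rightarrow> (real^'n) set" where
  "neighbour m K e =
     (if \<exists>K'\<in>adjacent m e. K' \<noteq> K then THE K'. K' \<in> adjacent m e \<and> K' \<noteq> K else K)"

section \<open>Broken polynomial spaces\<close>

text \<open>A broken polynomial is represented by the family of its polynomial pieces: v K is the
  polynomial that v coincides with on K.  Its values on the boundary of K are the traces of v from
  inside K.\<close>

type_synonym 'n broken = "(real^'n) set \<Rightarrow> real^'n \<Rightarrow> real"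

text \<open>Polynomials of total degree at most k.\<close>

definition polys :: "nat \<Rightarrow> (real^'n::finite \<Rightarrow> real) set" where
  "polys k = {p. \<exists>c. p = (\<lambda>x. \<Sum>\<alpha> | (\<Sum>i\<in>UNIV. \<alpha> i) \<le> k. c \<alpha> * (\<Prod>i\<in>UNIV. (x $ i) ^ \<alpha> i))}"

definition dg_space :: "'n::finite mesh \<Rightarrow> nat \<Rightarrow> 'n broken set" where
  "dg_space m k = {v. \<forall>K\<in>elems m. v K \<in> polys k}"

definition dg_fun :: "'n::finite mesh \<Rightarrow> 'n broken \<Rightarrow> real^'n \<Rightarrow> real" where
  "dg_fun m v x = (\<Sum>K\<in>elems m. indicator (interior K) x * v K x)"

definition is_L2_projection ::
  "(real^'n::finite) set \<Rightarrow> 'n mesh \<Rightarrow> nat \<Rightarrow> (real^'n \<Rightarrow> real) \<Rightarrow> 'n broken \<Rightarrow> bool" where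
  "is_L2_projection D m k f v \<longleftrightarrow> v \<in> dg_space m k \<and>
     (\<forall>\<phi>\<in>dg_space m k.
        (LINT x:D|lborel. dg_fun m \<phi> x * dg_fun m v x) = (LINT x:D|lborel. dg_fun m \<phi> x * f x))"

text \<open>The jump with respect to the fixed face normal: the trace from the element into which the
  normal points minus the trace from the element for which the normal is outward.\<close>

definition face_jump ::
  "'n::finite mesh \<Rightarrow> 'n broken \<Rightarrow> (real^'n) set \<Rightarrow> real^'n \<Rightarrow> real" where
  "face_jump m v e x =
     (if card (adjacent m e) = 2
      then v (THE K. K \<in> adjacent m e \<and> outward_normal K e = - fnormal m e) x
         - v (THE K. K \<in> adjacent m e \<and> outward_normal K e = fnormal m e) x
      else 0)"

definition local_basis :: "'n::finite mesh \<Rightarrow> nat \<Rightarrow> nat \<Rightarrow> (nat \<Rightarrow> 'n broken) \<Rightarrow> bool" where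
  "local_basis m k N \<phi> \<longleftrightarrow> (\<forall>K\<in>elems m.
     (\<forall>j\<le>N. \<phi> j K \<in> polys k) \<and>
     (\<forall>p\<in>polys k. \<exists>c. p = (\<lambda>x. \<Sum>j\<le>N. c j * \<phi> j K x)) \<and>
     (\<forall>c. (\<lambda>x. \<Sum>j\<le>N. c j * \<phi> j K x) = (\<lambda>x. 0) \<longrightarrow> (\<forall>j\<le>N. c j = 0)))"

definition coef_matrix ::
  "nat \<Rightarrow> (nat \<Rightarrow> 'n::finite broken) \<Rightarrow> 'n broken \<Rightarrow> nat \<Rightarrow> (real^'n) set \<Rightarrow> real" where
  "coef_matrix N \<phi> v j K =
     (THE c. (\<forall>i>N. c i = 0) \<and> v K = (\<lambda>x. \<Sum>i\<le>N. c i * \<phi> i K x)) j"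

definition frobenius_norm :: "'n::finite mesh \<Rightarrow> nat \<Rightarrow> (nat \<Rightarrow> (real^'n) set \<Rightarrow> real) \<Rightarrow> real" where
  "frobenius_norm m N c = sqrt (\<Sum>j\<le>N. \<Sum>K\<in>elems m. (c j K)\<^sup>2)"

section \<open>The data of the scheme and the numerical fluxes\<close>

text \<open>\<open>ntrace \<l> e\<close> is the normal trace of \<open>sigma \<l>\<close> on the face e with respect to the fixed normal
  of e.\<close>

record ('l, 'n) scheme =
  sigma :: "'l \<Rightarrow> real^'n \<Rightarrow> real^'n"
  ntrace :: "'l \<Rightarrow> (real^'n) set \<Rightarrow> real^'n \<Rightarrow> real"
  gfun :: "'l \<Rightarrow> real \<Rightarrow> real"
  eta_u :: "'l \<Rightarrow> (real^'n) set \<Rightarrow> real"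
  eta_q :: "'l \<Rightarrow> (real^'n) set \<Rightarrow> real"

text \<open>The normal trace of an L2 field with zero divergence is, by definition, determined by
  Green's formula on each element; here it is required to be an L2 function on the faces.  The inner
  product of the two unit normals is a sign.\<close>

definition has_normal_trace ::
  "'n::finite mesh \<Rightarrow> (real^'n \<Rightarrow> real^'n) \<Rightarrow> ((real^'n) set \<Rightarrow> real^'n \<Rightarrow> real) \<Rightarrow> bool" where
  "has_normal_trace m \<sigma> \<gamma> \<longleftrightarrow>
     (\<forall>e\<in>faces m. \<gamma> e \<in> borel_measurable borel \<and>
        set_integrable (hausdorff (CARD('n) - 1)) e (\<lambda>x. (\<gamma> e x)\<^sup>2)) \<and>
     (\<forall>K\<in>elems m. \<forall>v. C_k 1 v \<longrightarrow>
        (LINT x:K|lborel. \<sigma> x \<bullet> grad v x) =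
        (\<Sum>e\<in>faces_of m K. LINT x:e|hausdorff (CARD('n) - 1).
           (outward_normal K e \<bullet> fnormal m e) * \<gamma> e x * v x))"

definition structural_assumption :: "'l set \<Rightarrow> 'n::finite mesh \<Rightarrow> ('l, 'n) scheme \<Rightarrow> bool" where
  "structural_assumption L m P \<longleftrightarrow> (\<forall>\<l>\<in>L.
     square_integrable (sigma P \<l>) \<and> div_free (sigma P \<l>) \<and>
     has_normal_trace m (sigma P \<l>) (ntrace P \<l>) \<and>
     C_k 2 (gfun P \<l>) \<and>
     (\<exists>C>0. \<exists>r::nat. \<forall>u. \<bar>gfun P \<l> u\<bar> \<le> C * (1 + \<bar>u\<bar> ^ r)))"

definition diff_quot :: "(real \<Rightarrow> real) \<Rightarrow> real \<Rightarrow> real \<Rightarrow> real" where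
  "diff_quot g a b = (if b = a then deriv g a else (g b - g a) / (b - a))"

text \<open>\<open>sigma \<cdot> n\<close> on a face of K, with n the normal outward to K.\<close>

definition sigma_n ::
  "'n::finite mesh \<Rightarrow> ('l, 'n) scheme \<Rightarrow> 'l \<Rightarrow> (real^'n) set \<Rightarrow> (real^'n) set \<Rightarrow> real^'n \<Rightarrow> real" where
  "sigma_n m P \<l> K e x = (outward_normal K e \<bullet> fnormal m e) * ntrace P \<l> e x"

text \<open>Both fluxes are taken with respect to the normal outward to K.  On a boundary face
  \<open>neighbour m K e = K\<close> and they reduce to \<open>(\<sigma> \<cdot> n) g'(u) q\<close> and \<open>(\<sigma> \<cdot> n) g(u)\<close>.\<close>

definition flux_gq ::
  "'n::finite mesh \<Rightarrow> ('l, 'n) scheme \<Rightarrow> 'l \<Rightarrow> 'n broken \<Rightarrow> 'n broken \<Rightarrow>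
   (real^'n) set \<Rightarrow> (real^'n) set \<Rightarrow> real^'n \<Rightarrow> real" where
  "flux_gq m P \<l> u q K e x =
     (let K' = neighbour m K e; sn = sigma_n m P \<l> K e x in
      sn * (diff_quot (gfun P \<l>) (u K x) (u K' x) * ((q K x + q K' x) / 2)
            + eta_q P \<l> e * sgn sn * (u K' x - u K x)))"

definition flux_g ::
  "'n::finite mesh \<Rightarrow> ('l, 'n) scheme \<Rightarrow> 'l \<Rightarrow> 'n broken \<Rightarrow> 'n broken \<Rightarrow>
   (real^'n) set \<Rightarrow> (real^'n) set \<Rightarrow> real^'n \<Rightarrow> real" where
  "flux_g m P \<l> u q K e x =
     (let K' = neighbour m K e; sn = sigma_n m P \<l> K e x in
      sn * ((gfun P \<l> (u K x) + gfun P \<l> (u K' x)) / 2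
            + eta_u P \<l> e * sgn sn * (q K' x - q K x)))"

definition b_form ::
  "'n::finite mesh \<Rightarrow> ('l, 'n) scheme \<Rightarrow> 'l \<Rightarrow> (real^'n) set \<Rightarrow> 'n broken \<Rightarrow> 'n broken \<Rightarrow>
   'n broken \<Rightarrow> real" where
  "b_form m P \<l> K u q \<phi> =
     - (1/2) * (LINT x:K|lborel.
          (grad (\<phi> K) x \<bullet> sigma P \<l> x) * deriv (gfun P \<l>) (u K x) * q K x)
     + (1/2) * (\<Sum>e\<in>faces_of m K. LINT x:e|hausdorff (CARD('n) - 1).
          \<phi> K x * flux_gq m P \<l> u q K e x)"

definition q_equation ::
  "'n::finite mesh \<Rightarrow> ('l, 'n) scheme \<Rightarrow> nat \<Rightarrow> 'l \<Rightarrow> 'n broken \<Rightarrow> 'n broken \<Rightarrow> bool" where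
  "q_equation m P k \<l> u q \<longleftrightarrow> (\<forall>K\<in>elems m. \<forall>\<psi>\<in>dg_space m k.
     (LINT x:K|lborel. \<psi> K x * q K x) =
     - (LINT x:K|lborel. (grad (\<psi> K) x \<bullet> sigma P \<l> x) * gfun P \<l> (u K x))
     + (\<Sum>e\<in>faces_of m K. LINT x:e|hausdorff (CARD('n) - 1).
          \<psi> K x * flux_g m P \<l> u q K e x))"

section \<open>Wiener processes and stochastic integrals\<close>

text \<open>Time is \<open>[0,\<infinity>)\<close>; values at negative indices are irrelevant throughout.\<close>

definition usual_filtration :: "'w measure \<Rightarrow> (real \<Rightarrow> 'w measure) \<Rightarrow> bool" where
  "usual_filtration M F \<longleftrightarrow>
     complete_measure M \<and>
     (\<forall>t\<ge>0. subalgebra M (F t)) \<and>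
     (\<forall>s t. 0 \<le> s \<and> s \<le> t \<longrightarrow> sets (F s) \<subseteq> sets (F t)) \<and>
     null_sets M \<subseteq> sets (F 0) \<and>
     (\<forall>t\<ge>0. (\<Inter>s\<in>{t<..}. sets (F s)) \<subseteq> sets (F t))"

definition wiener_process ::
  "'w measure \<Rightarrow> (real \<Rightarrow> 'w measure) \<Rightarrow> (real \<Rightarrow> 'w \<Rightarrow> real) \<Rightarrow> bool" where
  "wiener_process M F W \<longleftrightarrow>
     (AE \<omega> in M. W 0 \<omega> = 0) \<and>
     (\<forall>\<omega>\<in>space M. continuous_on {0..} (\<lambda>t. W t \<omega>)) \<and>
     (\<forall>t\<ge>0. W t \<in> borel_measurable (F t)) \<and>
     (\<forall>s t. 0 \<le> s \<and> s < t \<longrightarrow>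
        distributed M lborel (\<lambda>\<omega>. W t \<omega> - W s \<omega>) (normal_density 0 (sqrt (t - s))) \<and>
        prob_space.indep_set M (sets (F s))
          {(\<lambda>\<omega>. W t \<omega> - W s \<omega>) -` B \<inter> space M | B. B \<in> sets borel})"

definition independent_wiener_processes ::
  "'w measure \<Rightarrow> (real \<Rightarrow> 'w measure) \<Rightarrow> 'l set \<Rightarrow> ('l \<Rightarrow> real \<Rightarrow> 'w \<Rightarrow> real) \<Rightarrow> bool" where
  "independent_wiener_processes M F L W \<longleftrightarrow>
     (\<forall>\<l>\<in>L. wiener_process M F (W \<l>)) \<and>
     prob_space.indep_vars M (\<lambda>\<l>. Pi\<^sub>M {0..} (\<lambda>t. borel)) (\<lambda>\<l> \<omega>. \<lambda>t\<in>{0..}. W \<l> t \<omega>) L"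

definition progressive ::
  "(real \<Rightarrow> 'w measure) \<Rightarrow> real \<Rightarrow> (real \<Rightarrow> 'w \<Rightarrow> real) \<Rightarrow> bool" where
  "progressive F S H \<longleftrightarrow> (\<forall>t\<in>{0..S}.
     (\<lambda>(s, \<omega>). H s \<omega>) \<in> borel_measurable (restrict_space borel {0..t} \<Otimes>\<^sub>M F t))"

definition continuous_adapted ::
  "'w measure \<Rightarrow> (real \<Rightarrow> 'w measure) \<Rightarrow> real \<Rightarrow> (real \<Rightarrow> 'w \<Rightarrow> real) \<Rightarrow> bool" where
  "continuous_adapted M F S I \<longleftrightarrow>
     (\<forall>\<omega>\<in>space M. continuous_on {0..S} (\<lambda>t. I t \<omega>)) \<and>
     (\<forall>t\<in>{0..S}. I t \<in> borel_measurable (F t))"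

text \<open>The simple process with jump times \<open>p 0 \<le> \<dots> \<le> p N\<close> and the bounded value
  \<open>\<xi> i\<close>, known at time \<open>p i\<close>, on \<open>(p i, p (i+1)]\<close>.\<close>

definition simple_process ::
  "'w measure \<Rightarrow> (real \<Rightarrow> 'w measure) \<Rightarrow> nat \<Rightarrow> (nat \<Rightarrow> real) \<Rightarrow> (nat \<Rightarrow> 'w \<Rightarrow> real) \<Rightarrow> bool" where
  "simple_process M F N p \<xi> \<longleftrightarrow> 0 \<le> p 0 \<and> (\<forall>i<N. p i \<le> p (Suc i) \<and>
     \<xi> i \<in> borel_measurable (F (p i)) \<and> (\<exists>B. \<forall>\<omega>\<in>space M. \<bar>\<xi> i \<omega>\<bar> \<le> B))"

definition simple_val ::
  "nat \<Rightarrow> (nat \<Rightarrow> real) \<Rightarrow> (nat \<Rightarrow> 'w \<Rightarrow> real) \<Rightarrow> real \<Rightarrow> 'w \<Rightarrow> real" where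
  "simple_val N p \<xi> s \<omega> = (\<Sum>i<N. if p i < s \<and> s \<le> p (Suc i) then \<xi> i \<omega> else 0)"

definition simple_integral ::
  "(real \<Rightarrow> 'w \<Rightarrow> real) \<Rightarrow> nat \<Rightarrow> (nat \<Rightarrow> real) \<Rightarrow> (nat \<Rightarrow> 'w \<Rightarrow> real) \<Rightarrow> real \<Rightarrow> 'w \<Rightarrow> real" where
  "simple_integral W N p \<xi> t \<omega> =
     (\<Sum>i<N. \<xi> i \<omega> * (W (min t (p (Suc i))) \<omega> - W (min t (p i)) \<omega>))"

text \<open>I is (a version of) the Ito integral process of H with respect to W on \<open>[0,S]\<close>: it is the
  limit, uniformly on \<open>[0,S]\<close> in probability, of the integrals of simple processes that approximate H
  in \<open>L\<^sup>2(0,S)\<close> in probability.\<close>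

definition has_ito_integral ::
  "'w measure \<Rightarrow> (real \<Rightarrow> 'w measure) \<Rightarrow> (real \<Rightarrow> 'w \<Rightarrow> real) \<Rightarrow> real \<Rightarrow>
   (real \<Rightarrow> 'w \<Rightarrow> real) \<Rightarrow> (real \<Rightarrow> 'w \<Rightarrow> real) \<Rightarrow> bool" where
  "has_ito_integral M F W S H I \<longleftrightarrow>
     progressive F S H \<and> continuous_adapted M F S I \<and>
     (\<exists>(N :: nat \<Rightarrow> nat) p \<xi>.
        (\<forall>j. simple_process M F (N j) (p j) (\<xi> j)) \<and>
        (\<forall>\<epsilon>>0. (\<lambda>j. measure M {\<omega>\<in>space M. ennreal \<epsilon> <
            (\<integral>\<^sup>+ s\<in>{0..S}. ennreal ((simple_val (N j) (p j) (\<xi> j) s \<omega> - H s \<omega>)\<^sup>2) \<partial>lborel)})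
          \<longlonglongrightarrow> 0) \<and>
        (\<forall>\<epsilon>>0. (\<lambda>j. measure M {\<omega>\<in>space M. \<exists>t\<in>{0..S}.
            \<epsilon> < \<bar>simple_integral W (N j) (p j) (\<xi> j) t \<omega> - I t \<omega>\<bar>}) \<longlonglongrightarrow> 0))"

text \<open>Quadratic covariation, as a limit in probability along partitions of vanishing mesh size.\<close>

definition has_covariation ::
  "'w measure \<Rightarrow> (real \<Rightarrow> 'w measure) \<Rightarrow> real \<Rightarrow> (real \<Rightarrow> 'w \<Rightarrow> real) \<Rightarrow>
   (real \<Rightarrow> 'w \<Rightarrow> real) \<Rightarrow> (real \<Rightarrow> 'w \<Rightarrow> real) \<Rightarrow> bool" where
  "has_covariation M F S X Y C \<longleftrightarrow> continuous_adapted M F S C \<and>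
     (\<forall>t\<in>{0..S}. \<forall>\<epsilon>>0. \<exists>\<delta>>0. \<forall>(N::nat) p.
        p 0 = 0 \<and> p N = t \<and> (\<forall>i<N. p i \<le> p (Suc i) \<and> p (Suc i) - p i < \<delta>) \<longrightarrow>
        measure M {\<omega>\<in>space M.
          \<epsilon> < \<bar>(\<Sum>i<N. (X (p (Suc i)) \<omega> - X (p i) \<omega>) * (Y (p (Suc i)) \<omega> - Y (p i) \<omega>)) - C t \<omega>\<bar>}
          < \<epsilon>)"

definition has_stratonovich_integral ::
  "'w measure \<Rightarrow> (real \<Rightarrow> 'w measure) \<Rightarrow> (real \<Rightarrow> 'w \<Rightarrow> real) \<Rightarrow> real \<Rightarrow>
   (real \<Rightarrow> 'w \<Rightarrow> real) \<Rightarrow> (real \<Rightarrow> 'w \<Rightarrow> real) \<Rightarrow> bool" where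
  "has_stratonovich_integral M F W S X J \<longleftrightarrow> continuous_adapted M F S X \<and>
     (\<exists>I C. has_ito_integral M F W S X I \<and> has_covariation M F S X W C \<and>
        (\<forall>t\<in>{0..S}. \<forall>\<omega>\<in>space M. J t \<omega> = I t \<omega> + C t \<omega> / 2))"

section \<open>The exact solution\<close>

text \<open>A weak (distributional) solution of the Stratonovich equation.\<close>

definition exact_solution ::
  "'w measure \<Rightarrow> (real \<Rightarrow> 'w measure) \<Rightarrow> 'l set \<Rightarrow> ('l \<Rightarrow> real \<Rightarrow> 'w \<Rightarrow> real) \<Rightarrow> real \<Rightarrow>
   ('l, 'n::finite) scheme \<Rightarrow> (real^'n \<Rightarrow> real) \<Rightarrow> (real \<Rightarrow> 'w \<Rightarrow> real^'n \<Rightarrow> real) \<Rightarrow> bool" where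
  "exact_solution M F L W T P ubar u \<longleftrightarrow>
     (\<forall>\<omega>\<in>space M. \<forall>t\<in>{0..T}. square_integrable (u t \<omega>)) \<and>
     (\<forall>\<phi>\<in>test_functions.
        continuous_adapted M F T (\<lambda>t \<omega>. LINT x|lborel. \<phi> x * u t \<omega> x) \<and>
        (\<forall>\<omega>\<in>space M. \<forall>t\<in>{0..T}. \<forall>\<l>\<in>L.
           integrable lborel (\<lambda>x. (grad \<phi> x \<bullet> sigma P \<l> x) * gfun P \<l> (u t \<omega> x))) \<and>
        (\<exists>J.
           (\<forall>\<l>\<in>L. has_stratonovich_integral M F (W \<l>) T
              (\<lambda>t \<omega>. LINT x|lborel. (grad \<phi> x \<bullet> sigma P \<l> x) * gfun P \<l> (u t \<omega> x)) (J \<l>)) \<and>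
           (AE \<omega> in M. \<forall>t\<in>{0..T}.
              (LINT x|lborel. \<phi> x * u t \<omega> x) =
              (LINT x|lborel. \<phi> x * ubar x) + (\<Sum>\<l>\<in>L. J \<l> t \<omega>))))"

definition mesh_covers_support ::
  "'w measure \<Rightarrow> real \<Rightarrow> 'n::finite mesh \<Rightarrow> (real \<Rightarrow> 'w \<Rightarrow> real^'n \<Rightarrow> real) \<Rightarrow> bool" where
  "mesh_covers_support M T m u \<longleftrightarrow>
     (AE \<omega> in M. \<forall>t\<in>{0..T}. AE x in lborel. x \<notin> \<Union>(elems m) \<longrightarrow> u t \<omega> x = 0)"

section \<open>The LDG approximation\<close>

definition hit_time ::
  "'n::finite mesh \<Rightarrow> nat \<Rightarrow> (nat \<Rightarrow> 'n broken) \<Rightarrow> ('w \<Rightarrow> ereal) \<Rightarrow> (real \<Rightarrow> 'w \<Rightarrow> 'n broken) \<Rightarrow>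
   nat \<Rightarrow> 'w \<Rightarrow> ereal" where
  "hit_time m N \<beta> \<tau>max u n \<omega> = Inf (ereal ` {t. 0 \<le> t \<and> ereal t < \<tau>max \<omega> \<and>
     real n \<le> frobenius_norm m N (coef_matrix N \<beta> (u t \<omega>))})"

definition stopped_time ::
  "'n::finite mesh \<Rightarrow> nat \<Rightarrow> (nat \<Rightarrow> 'n broken) \<Rightarrow> ('w \<Rightarrow> ereal) \<Rightarrow> (real \<Rightarrow> 'w \<Rightarrow> 'n broken) \<Rightarrow>
   nat \<Rightarrow> real \<Rightarrow> 'w \<Rightarrow> real" where
  "stopped_time m N \<beta> \<tau>max u n t \<omega> = real_of_ereal (min (ereal t) (hit_time m N \<beta> \<tau>max u n \<omega>))"

definition dg_process ::
  "'w measure \<Rightarrow> (real \<Rightarrow> 'w measure) \<Rightarrow> 'n::finite mesh \<Rightarrow> nat \<Rightarrow> nat \<Rightarrow> (nat \<Rightarrow> 'n broken) \<Rightarrow>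
   ('w \<Rightarrow> ereal) \<Rightarrow> (real \<Rightarrow> 'w \<Rightarrow> 'n broken) \<Rightarrow> bool" where
  "dg_process M F m k N \<beta> \<tau>max v \<longleftrightarrow>
     (\<forall>\<omega>\<in>space M. \<forall>t\<ge>0. ereal t < \<tau>max \<omega> \<longrightarrow> v t \<omega> \<in> dg_space m k) \<and>
     (\<forall>j\<le>N. \<forall>K\<in>elems m.
        (\<forall>\<omega>\<in>space M. continuous_on {t. 0 \<le> t \<and> ereal t < \<tau>max \<omega>}
           (\<lambda>t. coef_matrix N \<beta> (v t \<omega>) j K)) \<and>
        (\<forall>t\<ge>0. (\<lambda>\<omega>. if ereal t < \<tau>max \<omega> then coef_matrix N \<beta> (v t \<omega>) j K else 0)
           \<in> borel_measurable (F t)))"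

text \<open>The maximal strong solution on \<open>[0,\<tau>max)\<close>: the equation holds up to each of the times
  \<open>hit_time n\<close>, and the coefficients of u are unbounded on \<open>[0,\<tau>max)\<close> whenever \<open>\<tau>max < \<infinity>\<close>.\<close>

definition ldg_solution ::
  "'w measure \<Rightarrow> (real \<Rightarrow> 'w measure) \<Rightarrow> 'l set \<Rightarrow> ('l \<Rightarrow> real \<Rightarrow> 'w \<Rightarrow> real) \<Rightarrow>
   'n::finite mesh \<Rightarrow> ('l, 'n) scheme \<Rightarrow> nat \<Rightarrow> nat \<Rightarrow> (nat \<Rightarrow> 'n broken) \<Rightarrow>
   'n broken \<Rightarrow> ('w \<Rightarrow> ereal) \<Rightarrow> (real \<Rightarrow> 'w \<Rightarrow> 'n broken) \<Rightarrow> ('l \<Rightarrow> real \<Rightarrow> 'w \<Rightarrow> 'n broken) \<Rightarrow>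
   bool" where
  "ldg_solution M F L W m P k N \<beta> u0 \<tau>max u q \<longleftrightarrow>
     (\<forall>t\<ge>0. {\<omega>\<in>space M. \<tau>max \<omega> \<le> ereal t} \<in> sets (F t)) \<and>
     (AE \<omega> in M. 0 < \<tau>max \<omega>) \<and>
     (AE \<omega> in M. \<tau>max \<omega> < \<infinity> \<longrightarrow>
        (\<forall>r. \<exists>t\<ge>0. ereal t < \<tau>max \<omega> \<and> r \<le> frobenius_norm m N (coef_matrix N \<beta> (u t \<omega>)))) \<and>
     dg_process M F m k N \<beta> \<tau>max u \<and> (\<forall>\<l>\<in>L. dg_process M F m k N \<beta> \<tau>max (q \<l>)) \<and>
     (AE \<omega> in M. \<forall>K\<in>elems m. u 0 \<omega> K = u0 K) \<and>
     (AE \<omega> in M. \<forall>t\<ge>0. ereal t < \<tau>max \<omega> \<longrightarrow>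
        (\<forall>\<l>\<in>L. q_equation m P k \<l> (u t \<omega>) (q \<l> t \<omega>))) \<and>
     (\<forall>n::nat. \<forall>K\<in>elems m. \<forall>\<phi>\<in>dg_space m k. \<exists>I.
        (\<forall>\<l>\<in>L. \<forall>S>0. has_ito_integral M F (W \<l>) S
           (\<lambda>s \<omega>. if ereal s \<le> hit_time m N \<beta> \<tau>max u n \<omega> \<and> ereal s < \<tau>max \<omega>
                  then LINT x:K|lborel. \<phi> K x * q \<l> s \<omega> K x else 0) (I \<l>)) \<and>
        (AE \<omega> in M. \<forall>t\<ge>0.
           (LINT x:K|lborel. \<phi> K x * u (stopped_time m N \<beta> \<tau>max u n t \<omega>) \<omega> K x) =
           (LINT x:K|lborel. \<phi> K x * u 0 \<omega> K x)
           + (LINT s:{0..stopped_time m N \<beta> \<tau>max u n t \<omega>}|lborel.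
                \<Sum>\<l>\<in>L. b_form m P \<l> K (u s \<omega>) (q \<l> s \<omega>) \<phi>)
           - (\<Sum>\<l>\<in>L. I \<l> t \<omega>)))"

text \<open>The operative discrete form of the assumption that the mesh covers the support of the
  solution: the numerical solution carries nothing across the boundary of the domain.  This does
  not follow from \<^const>\<open>mesh_covers_support\<close>.  Since the boundary fluxes are the plain
  one-sided ones, the energy balance otherwise contains the integral of \<open>(\<sigma> \<cdot> n) u g'(u) q\<close> over the
  boundary, which has no sign.\<close>

definition no_boundary_transport ::
  "'w measure \<Rightarrow> 'l set \<Rightarrow> real \<Rightarrow> (real^'n::finite) set \<Rightarrow> 'n mesh \<Rightarrow> ('l, 'n) scheme \<Rightarrow>
   ('w \<Rightarrow> ereal) \<Rightarrow> (real \<Rightarrow> 'w \<Rightarrow> 'n broken) \<Rightarrow> bool" where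
  "no_boundary_transport M L T D m P \<tau>max u \<longleftrightarrow>
     (AE \<omega> in M. \<forall>t\<in>{0..T}. ereal t < \<tau>max \<omega> \<longrightarrow>
        (\<forall>\<l>\<in>L. \<forall>K\<in>elems m. \<forall>e\<in>faces_of m K. e \<subseteq> frontier D \<longrightarrow>
           (AE x in hausdorff (CARD('n) - 1). x \<in> e \<longrightarrow> sigma_n m P \<l> K e x * u t \<omega> K x = 0)))"

definition dissipation ::
  "'l set \<Rightarrow> 'n::finite mesh \<Rightarrow> ('l, 'n) scheme \<Rightarrow>
   (real \<Rightarrow> 'w \<Rightarrow> 'n broken) \<Rightarrow> ('l \<Rightarrow> real \<Rightarrow> 'w \<Rightarrow> 'n broken) \<Rightarrow> real \<Rightarrow> 'w \<Rightarrow> real" where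
  "dissipation L m P u q t \<omega> =
     (\<Sum>e\<in>faces m. LINT s:{0..t}|lborel. \<Sum>\<l>\<in>L. LINT x:e|hausdorff (CARD('n) - 1).
        \<bar>ntrace P \<l> e x\<bar> *
          (eta_q P \<l> e * (face_jump m (u s \<omega>) e x)\<^sup>2
           + eta_u P \<l> e * (face_jump m (q \<l> s \<omega>) e x)\<^sup>2))"

end

theory Submission
  imports Defs
begin

text \<open>On each element the coefficients of \<open>u\<^sub>h\<close> in an \<open>L\<^sup>2\<close>-orthonormal basis are Ito processes with
  bounded drift and integrands up to the hitting time \<open>\<tau>\<^sub>n\<close>.  Summing the Ito energy balance of their
  squares over basis and elements gives, by Parseval, the balance for \<open>\<parallel>u\<^sub>h\<parallel>\<^sup>2\<close>, whose right-hand side is the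
  time integral of twice the form \<open>b\<close> tested with \<open>u\<^sub>h\<close> plus \<open>\<parallel>q\<^sub>h\<parallel>\<^sup>2\<close>.  Testing the equation for \<open>q\<^sub>h\<close> with
  \<open>q\<^sub>h\<close>, the volume terms add up to the integral of \<open>\<sigma> \<bullet> grad (g(u\<^sub>h) q\<^sub>h)\<close>, which lives on the faces
  since \<open>div \<sigma> = 0\<close>, and the difference quotient in the flux makes all face terms cancel except for
  the penalties, which form the dissipation.  Since only an inequality is wanted, the square of the stochastic integral may be bounded by
  Fatou's lemma, and Ito's formula is replaced by summation by parts along partitions.  Letting
  \<open>n \<rightarrow> \<infinity>\<close> is a second application of Fatou's lemma.\<close>

section \<open>Wiener increments\<close>

text \<open>Stopping bounds only the coefficients of \<open>uh\<close>, whereas the balance also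
  contains \<open>qh\<close>, which solves an implicit equation with a penalty. Its bound is
  therefore an estimate of its own: tested with \<open>qh\<close>, that equation gives |Q|^2 <= c
  |Q|_1 for the coordinates Q in an orthonormal basis, and c depends on the size of
  \<open>uh\<close> alone. The basis of the scheme need not be orthonormal, hence the Gram-Schmidt
  step. The stochastic integral is given only as a limit in probability. Bounding the energy of the
  simple integrands yields moment bounds, with which mean zero and the upper bound for the second
  moment pass to the limit. The coefficients carry meaning only before \<open>\<tau>max\<close>.
  Adaptedness of the stopped ones is therefore recovered through sums over time grids, up to null
  sets, which the usual conditions place in every \<open>F t\<close>.\<close>

locale filtered_prob_space = prob_space M
  for M :: "'w measure" +
  fixes F :: "real \<Rightarrow> 'w measure"
  assumes usual: "usual_filtration M F"
begin

lemma subalg: "0 \<le> t \<Longrightarrow> subalgebra M (F t)"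
  using usual by (auto simp: usual_filtration_def)

lemma space_F: "0 \<le> t \<Longrightarrow> space (F t) = space M"
  using subalg by (auto simp: subalgebra_def)

lemma sets_F: "0 \<le> t \<Longrightarrow> A \<in> sets (F t) \<Longrightarrow> A \<in> sets M"
  using subalg by (auto simp: subalgebra_def)

lemma F_mono: "0 \<le> s \<Longrightarrow> s \<le> t \<Longrightarrow> sets (F s) \<subseteq> sets (F t)"
  using usual by (auto simp: usual_filtration_def)

lemma measurable_F_M: "0 \<le> t \<Longrightarrow> f \<in> measurable (F t) N \<Longrightarrow> f \<in> measurable M N"
  using measurable_from_subalg[OF subalg] .

lemma measurable_F_mono:
  assumes "0 \<le> s" "s \<le> t" "f \<in> measurable (F s) N" shows "f \<in> measurable (F t) N"
proof -
  have "subalgebra (F t) (F s)"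
    using assms F_mono[of s t] space_F by (auto simp: subalgebra_def)
  then show ?thesis using assms(3) by (rule measurable_from_subalg)
qed

lemma wiener_measurable: "wiener_process M F W \<Longrightarrow> 0 \<le> t \<Longrightarrow> W t \<in> borel_measurable (F t)"
  by (auto simp: wiener_process_def)

lemma wiener_measurable': "wiener_process M F W \<Longrightarrow> 0 \<le> t \<Longrightarrow> t \<le> s \<Longrightarrow> W t \<in> borel_measurable (F s)"
  using measurable_F_mono wiener_measurable by blast

lemma wiener_measurable_M: "wiener_process M F W \<Longrightarrow> 0 \<le> t \<Longrightarrow> W t \<in> borel_measurable M"
  using measurable_F_M wiener_measurable by blast

lemma wiener_increment_moments:
  assumes W: "wiener_process M F W" and ab: "0 \<le> a" "a \<le> b"
  shows "integrable M (\<lambda>\<omega>. W b \<omega> - W a \<omega>)" "integrable M (\<lambda>\<omega>. (W b \<omega> - W a \<omega>)\<^sup>2)"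
    "(\<integral>\<omega>. W b \<omega> - W a \<omega> \<partial>M) = 0" "(\<integral>\<omega>. (W b \<omega> - W a \<omega>)\<^sup>2 \<partial>M) = b - a"
proof -
  have "integrable M (\<lambda>\<omega>. W b \<omega> - W a \<omega>) \<and> integrable M (\<lambda>\<omega>. (W b \<omega> - W a \<omega>)\<^sup>2) \<and>
    (\<integral>\<omega>. W b \<omega> - W a \<omega> \<partial>M) = 0 \<and> (\<integral>\<omega>. (W b \<omega> - W a \<omega>)\<^sup>2 \<partial>M) = b - a"
  \<comment> \<open>The normal law of increments is postulated for strictly ordered times only; at
    equal times the increment is zero.\<close>
  proof (cases "a = b")
    case False
    define s where "s = sqrt (b - a)"
    have s: "s > 0" using False ab by (simp add: s_def)
    have D: "distributed M lborel (\<lambda>\<omega>. W b \<omega> - W a \<omega>) (normal_density 0 s)"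
      using W ab False by (auto simp: wiener_process_def s_def)
    have i1: "integrable M (\<lambda>\<omega>. W b \<omega> - W a \<omega>)"
      using distributed_integrable[OF D, of "\<lambda>x. x"] integrable_normal_moment_nz_1[OF s, of 0] by simp
    have i2: "integrable M (\<lambda>\<omega>. (W b \<omega> - W a \<omega>)\<^sup>2)"
      using distributed_integrable[OF D, of "\<lambda>x. x\<^sup>2"] integrable_normal_moment[OF s, of 0 2] by simp
    have e1: "(\<integral>\<omega>. W b \<omega> - W a \<omega> \<partial>M) = 0"
      using normal_distributed_expectation[OF s D] by simp
    have "variance (\<lambda>\<omega>. W b \<omega> - W a \<omega>) = s\<^sup>2" by (rule normal_distributed_variance[OF s D])
    then show ?thesis using i1 i2 e1 False ab by (simp add: s_def)
  qed auto
  then show "integrable M (\<lambda>\<omega>. W b \<omega> - W a \<omega>)" "integrable M (\<lambda>\<omega>. (W b \<omega> - W a \<omega>)\<^sup>2)"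
    "(\<integral>\<omega>. W b \<omega> - W a \<omega> \<partial>M) = 0" "(\<integral>\<omega>. (W b \<omega> - W a \<omega>)\<^sup>2 \<partial>M) = b - a" by auto
qed

text \<open>\<open>wiener_process\<close> speaks of the family of preimages under the increment;
  this is turned into independence of two random variables, to which the product rules for
  expectations apply. At equal times the increment is constant and generates the trivial
  \<sigma>-algebra.\<close>

lemma wiener_indep_past:
  assumes W: "wiener_process M F W" and ab: "0 \<le> a" "a \<le> b"
    and Z: "Z \<in> borel_measurable (F a)"
  shows "indep_var borel Z borel (\<lambda>\<omega>. W b \<omega> - W a \<omega>)"
proof -
  have mW[measurable]: "W a \<in> borel_measurable M" "W b \<in> borel_measurable M"
    using wiener_measurable_M[OF W] ab by auto
  have ZM[measurable]: "Z \<in> borel_measurable M" using measurable_F_M[OF ab(1) Z] .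
  have sub: "sigma_sets (space M) {Z -` A \<inter> space M |A. A \<in> sets borel} \<subseteq> sets (F a)"
  proof -
    have "{Z -` A \<inter> space M |A. A \<in> sets borel} \<subseteq> sets (F a)"
      using measurable_sets[OF Z] space_F[OF ab(1)] by auto
    then show ?thesis using sets.sigma_sets_subset[of _ "F a"] space_F[OF ab(1)] by auto
  qed
  let ?D = "\<lambda>\<omega>. W b \<omega> - W a \<omega>"
  have "indep_set (sets (F a)) (sigma_sets (space M) {?D -` A \<inter> space M |A. A \<in> sets borel})"
  proof (cases "a = b")
    case False
    have ss: "sigma_sets (space M) {?D -` A \<inter> space M |A. A \<in> sets borel} =
       {?D -` A \<inter> space M |A. A \<in> sets borel}"
      using sets.sigma_sets_eq[of "vimage_algebra (space M) ?D borel"]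
      by (simp add: sets_vimage_algebra2)
    show ?thesis unfolding ss using W False ab by (auto simp: wiener_process_def)
  next
    case True
    have e: "{?D -` A \<inter> space M |A. A \<in> sets borel} \<subseteq> {{}, space M}" using True by auto
    have "sigma_sets (space M) {?D -` A \<inter> space M |A. A \<in> sets borel} \<subseteq> {{}, space M}"
      using sigma_algebra.sigma_sets_subset[OF sigma_algebra_trivial e] .
    then show ?thesis unfolding indep_sets2_eq using sets_F[OF ab(1)] sets.sets_into_space
      by (auto simp: prob_space Int_absorb2)
  qed
  then have "indep_set (sigma_sets (space M) {Z -` A \<inter> space M |A. A \<in> sets borel})
     (sigma_sets (space M) {?D -` A \<inter> space M |A. A \<in> sets borel})"
    using sub unfolding indep_sets2_eq by blast
  then show ?thesis unfolding indep_var_eq by simp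
qed

text \<open>Independence makes these products integrable for merely integrable Z. Hence Z may be a
  square, or a bounded factor times earlier increments, as the isometry and the mixed terms
  require.\<close>

lemma wiener_mult_increment:
  assumes W: "wiener_process M F W" and ab: "0 \<le> a" "a \<le> b"
    and Z: "Z \<in> borel_measurable (F a)" "integrable M Z"
  shows "integrable M (\<lambda>\<omega>. Z \<omega> * (W b \<omega> - W a \<omega>))" "(\<integral>\<omega>. Z \<omega> * (W b \<omega> - W a \<omega>) \<partial>M) = 0"
    "integrable M (\<lambda>\<omega>. Z \<omega> * (W b \<omega> - W a \<omega>)\<^sup>2)"
    "(\<integral>\<omega>. Z \<omega> * (W b \<omega> - W a \<omega>)\<^sup>2 \<partial>M) = (\<integral>\<omega>. Z \<omega> \<partial>M) * (b - a)"
proof -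
  note m = wiener_increment_moments[OF W ab]
  note i = wiener_indep_past[OF W ab Z(1)]
  show "integrable M (\<lambda>\<omega>. Z \<omega> * (W b \<omega> - W a \<omega>))" by (rule indep_var_integrable[OF i Z(2) m(1)])
  show "(\<integral>\<omega>. Z \<omega> * (W b \<omega> - W a \<omega>) \<partial>M) = 0"
    using indep_var_lebesgue_integral[OF i Z(2) m(1)] m(3) by simp
  have i2: "indep_var borel Z borel (\<lambda>\<omega>. (W b \<omega> - W a \<omega>)\<^sup>2)"
    using indep_var_compose[OF i, of "\<lambda>x. x" borel "\<lambda>x. x\<^sup>2" borel] by (simp add: comp_def)
  show "integrable M (\<lambda>\<omega>. Z \<omega> * (W b \<omega> - W a \<omega>)\<^sup>2)" by (rule indep_var_integrable[OF i2 Z(2) m(2)])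
  show "(\<integral>\<omega>. Z \<omega> * (W b \<omega> - W a \<omega>)\<^sup>2 \<partial>M) = (\<integral>\<omega>. Z \<omega> \<partial>M) * (b - a)"
    using indep_var_lebesgue_integral[OF i2 Z(2) m(2)] m(4) by simp
qed

lemma integrable_bounded_mult:
  fixes Z f :: "'w \<Rightarrow> real"
  assumes "integrable M f" "Z \<in> borel_measurable M" "\<forall>\<omega>\<in>space M. \<bar>Z \<omega>\<bar> \<le> B"
  shows "integrable M (\<lambda>\<omega>. Z \<omega> * f \<omega>)"
proof (rule Bochner_Integration.integrable_bound[of _ "\<lambda>\<omega>. B * f \<omega>"])
  show "AE \<omega> in M. norm (Z \<omega> * f \<omega>) \<le> norm (B * f \<omega>)"
  proof (rule AE_I2)
    fix \<omega> assume "\<omega> \<in> space M"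
    then have "\<bar>Z \<omega>\<bar> \<le> \<bar>B\<bar>" using assms(3) by force
    then show "norm (Z \<omega> * f \<omega>) \<le> norm (B * f \<omega>)" by (auto simp: abs_mult intro: mult_right_mono)
  qed
qed (use assms in auto)

text \<open>\<open>disj\<close> describes two cells of one time grid. For distinct cells the earlier
  increment is known when the later one starts, so the later one makes the mean vanish.\<close>

lemma wiener_increment_product_eq:
  assumes W: "wiener_process M F W" and ord: "0 \<le> a" "a \<le> b" "0 \<le> c" "c \<le> d"
    and disj: "b \<le> c \<or> d \<le> a \<or> (a = c \<and> b = d)"
  shows "integrable M (\<lambda>\<omega>. (W b \<omega> - W a \<omega>) * (W d \<omega> - W c \<omega>))"
    "(\<integral>\<omega>. (W b \<omega> - W a \<omega>) * (W d \<omega> - W c \<omega>) \<partial>M) = (if a = c \<and> b = d then b - a else 0)"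
proof -
  have *: "integrable M (\<lambda>\<omega>. (W b \<omega> - W a \<omega>) * (W d \<omega> - W c \<omega>)) \<and>
    (\<integral>\<omega>. (W b \<omega> - W a \<omega>) * (W d \<omega> - W c \<omega>) \<partial>M) = 0"
    if "0 \<le> a" "a \<le> b" "0 \<le> c" "c \<le> d" "b \<le> c" for a b c d
  proof -
    have "(\<lambda>\<omega>. W b \<omega> - W a \<omega>) \<in> borel_measurable (F c)"
      using that wiener_measurable'[OF W] by (intro borel_measurable_diff) auto
    with wiener_mult_increment[OF W, of c d] wiener_increment_moments(1)[OF W, of a b] that
    show ?thesis by auto
  qed
  have "integrable M (\<lambda>\<omega>. (W b \<omega> - W a \<omega>) * (W d \<omega> - W c \<omega>)) \<and>
    (\<integral>\<omega>. (W b \<omega> - W a \<omega>) * (W d \<omega> - W c \<omega>) \<partial>M) = (if a = c \<and> b = d then b - a else 0)"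
  proof (cases "a = c \<and> b = d")
    case True
    then show ?thesis using wiener_increment_moments[OF W ord(1,2)] by (simp add: power2_eq_square)
  next
    case False
    with disj have "b \<le> c \<or> d \<le> a" by auto
    then show ?thesis
    proof
      assume "b \<le> c" then show ?thesis using *[of a b c d] ord False by auto
    next
      assume "d \<le> a" then show ?thesis using *[of c d a b] ord False by (auto simp: mult.commute)
    qed
  qed
  then show "integrable M (\<lambda>\<omega>. (W b \<omega> - W a \<omega>) * (W d \<omega> - W c \<omega>))"
    "(\<integral>\<omega>. (W b \<omega> - W a \<omega>) * (W d \<omega> - W c \<omega>) \<partial>M) = (if a = c \<and> b = d then b - a else 0)" by auto
qed

end

section \<open>Several independent Wiener processes\<close>

locale wiener_family = filtered_prob_space M F for M :: "'w measure" and F +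
  fixes L :: "'l set" and W :: "'l \<Rightarrow> real \<Rightarrow> 'w \<Rightarrow> real"
  assumes finL: "finite L" and wieners: "independent_wiener_processes M F L W"
begin

lemma wiener: "\<l> \<in> L \<Longrightarrow> wiener_process M F (W \<l>)"
  using wieners by (auto simp: independent_wiener_processes_def)

text \<open>Independence of whole paths is applied to the product of two increments of each process,
  so that the fourth-order moment becomes a product of two covariances. This is the orthogonality of
  the terms of a realised covariation.\<close>

lemma independent_increments_product:
  assumes l: "\<l> \<in> L" "\<l>' \<in> L" "\<l> \<noteq> \<l>'" and ord: "0 \<le> a" "a \<le> b" "0 \<le> c" "c \<le> d"
    and disj: "b \<le> c \<or> d \<le> a \<or> (a = c \<and> b = d)"
  shows "integrable M (\<lambda>\<omega>. ((W \<l> b \<omega> - W \<l> a \<omega>) * (W \<l> d \<omega> - W \<l> c \<omega>)) *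
            ((W \<l>' b \<omega> - W \<l>' a \<omega>) * (W \<l>' d \<omega> - W \<l>' c \<omega>)))" (is "integrable M ?f")
    "(\<integral>\<omega>. ((W \<l> b \<omega> - W \<l> a \<omega>) * (W \<l> d \<omega> - W \<l> c \<omega>)) *
            ((W \<l>' b \<omega> - W \<l>' a \<omega>) * (W \<l>' d \<omega> - W \<l>' c \<omega>)) \<partial>M) =
     (if a = c \<and> b = d then (b - a)\<^sup>2 else 0)"
proof -
  let ?X = "\<lambda>i \<omega>. (W i b \<omega> - W i a \<omega>) * (W i d \<omega> - W i c \<omega>)"
  let ?Y = "\<lambda>i p. (p b - p a) * (p d - p c) :: real"
  have "indep_vars (\<lambda>i. Pi\<^sub>M {0..} (\<lambda>t. borel)) (\<lambda>i \<omega>. \<lambda>t\<in>{0..}. W i t \<omega>) {\<l>, \<l>'}"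
    using wieners l by (auto simp: independent_wiener_processes_def intro: indep_vars_subset)
  moreover have "?Y i \<in> measurable (Pi\<^sub>M {0..} (\<lambda>t. borel)) borel" for i :: 'l
    using ord by (intro borel_measurable_times borel_measurable_diff measurable_component_singleton) auto
  ultimately have "indep_vars (\<lambda>i. borel) (\<lambda>i x. ?Y i ((\<lambda>i \<omega>. \<lambda>t\<in>{0..}. W i t \<omega>) i x)) {\<l>, \<l>'}"
    by (rule indep_vars_compose2)
  then have ind: "indep_vars (\<lambda>i. borel) ?X {\<l>, \<l>'}"
    using ord by simp
  have int: "integrable M (?X i)" if "i \<in> {\<l>, \<l>'}" for i
    using wiener_increment_product_eq(1)[OF wiener ord disj, of i] that l by auto
  have "(\<integral>\<omega>. (\<Prod>i\<in>{\<l>, \<l>'}. ?X i \<omega>) \<partial>M) = (\<Prod>i\<in>{\<l>, \<l>'}. \<integral>\<omega>. ?X i \<omega> \<partial>M)"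
    by (rule indep_vars_lebesgue_integral[OF _ ind int]) auto
  moreover have "integrable M (\<lambda>\<omega>. \<Prod>i\<in>{\<l>, \<l>'}. ?X i \<omega>)"
    by (rule indep_vars_integrable[OF _ ind int]) auto
  ultimately show "integrable M ?f" "(\<integral>\<omega>. ?f \<omega> \<partial>M) = (if a = c \<and> b = d then (b - a)\<^sup>2 else 0)"
    using l wiener_increment_product_eq(2)[OF wiener ord disj] by (auto simp: power2_eq_square)
qed

end

section \<open>Simple processes\<close>

lemma integrable_mult_of_squares:
  fixes f g :: "'a \<Rightarrow> real"
  assumes "f \<in> borel_measurable M" "g \<in> borel_measurable M"
    "integrable M (\<lambda>x. (f x)\<^sup>2)" "integrable M (\<lambda>x. (g x)\<^sup>2)"
  shows "integrable M (\<lambda>x. f x * g x)"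
proof (rule Bochner_Integration.integrable_bound[of _ "\<lambda>x. (f x)\<^sup>2 + (g x)\<^sup>2"])
  have "\<bar>f x * g x\<bar> \<le> (f x)\<^sup>2 + (g x)\<^sup>2" for x
  proof -
    have "2 * (\<bar>f x\<bar> * \<bar>g x\<bar>) \<le> (f x)\<^sup>2 + (g x)\<^sup>2"
      using sum_squares_bound[of "\<bar>f x\<bar>" "\<bar>g x\<bar>"] by simp
    moreover have "0 \<le> \<bar>f x\<bar> * \<bar>g x\<bar>" by simp
    ultimately show ?thesis unfolding abs_mult by linarith
  qed
  then show "AE x in M. norm (f x * g x) \<le> norm ((f x)\<^sup>2 + (g x)\<^sup>2)" by auto
qed (use assms in auto)

context filtered_prob_space
begin

lemma simple_process_le:
  assumes "simple_process M F N p \<xi>" "i \<le> j" "j \<le> N"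
  shows "p i \<le> p j"
  using assms(2,3)
proof (induction j rule: dec_induct)
  case (step n)
  then have "p n \<le> p (Suc n)" using assms(1) by (auto simp: simple_process_def)
  then show ?case using step by simp
qed simp

lemma simple_process_nonneg:
  assumes "simple_process M F N p \<xi>" "i \<le> N"
  shows "0 \<le> p i"
  using simple_process_le[OF assms(1), of 0 i] assms by (auto simp: simple_process_def)

lemma bounded_mult_increment:
  assumes W: "wiener_process M F W" and ab: "0 \<le> a" "a \<le> b"
    and Z: "Z \<in> borel_measurable (F a)" and B: "\<forall>\<omega>\<in>space M. \<bar>Z \<omega>\<bar> \<le> B"
  shows "integrable M (\<lambda>\<omega>. Z \<omega> * (W b \<omega> - W a \<omega>))" "(\<integral>\<omega>. Z \<omega> * (W b \<omega> - W a \<omega>) \<partial>M) = 0"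
    "integrable M (\<lambda>\<omega>. Z \<omega> * (W b \<omega> - W a \<omega>)\<^sup>2)"
    "(\<integral>\<omega>. Z \<omega> * (W b \<omega> - W a \<omega>)\<^sup>2 \<partial>M) = (\<integral>\<omega>. Z \<omega> \<partial>M) * (b - a)"
proof -
  have "integrable M Z"
    using B measurable_F_M[OF ab(1) Z] by (intro integrable_const_bound[of _ B]) auto
  from wiener_mult_increment[OF W ab Z this]
  show "integrable M (\<lambda>\<omega>. Z \<omega> * (W b \<omega> - W a \<omega>))" "(\<integral>\<omega>. Z \<omega> * (W b \<omega> - W a \<omega>) \<partial>M) = 0"
    "integrable M (\<lambda>\<omega>. Z \<omega> * (W b \<omega> - W a \<omega>)\<^sup>2)"
    "(\<integral>\<omega>. Z \<omega> * (W b \<omega> - W a \<omega>)\<^sup>2 \<partial>M) = (\<integral>\<omega>. Z \<omega> \<partial>M) * (b - a)" by auto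
qed

lemma simple_integral_measurable:
  assumes W: "wiener_process M F W" and S: "simple_process M F N p \<xi>" and t: "0 \<le> t"
  shows "simple_integral W N p \<xi> t \<in> borel_measurable M"
proof -
  have "(\<lambda>\<omega>. \<xi> i \<omega> * (W (min t (p (Suc i))) \<omega> - W (min t (p i)) \<omega>)) \<in> borel_measurable M"
    if i: "i < N" for i
  proof -
    have p: "0 \<le> p i" "0 \<le> p (Suc i)" using simple_process_nonneg[OF S] i by auto
    have "\<xi> i \<in> borel_measurable M"
      using S i measurable_F_M[OF p(1)] by (auto simp: simple_process_def)
    then show ?thesis using p t by (intro borel_measurable_times borel_measurable_diff wiener_measurable_M[OF W]) auto
  qed
  then show ?thesis unfolding simple_integral_def by (auto intro!: borel_measurable_sum)
qed

lemma simple_integral_martingale: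
  assumes W: "wiener_process M F W" and S: "simple_process M F N p \<xi>" and st: "0 \<le> s" "s \<le> t"
    and Z: "Z \<in> borel_measurable (F s)" and B: "\<forall>\<omega>\<in>space M. \<bar>Z \<omega>\<bar> \<le> B"
  shows "integrable M (\<lambda>\<omega>. Z \<omega> * (simple_integral W N p \<xi> t \<omega> - simple_integral W N p \<xi> s \<omega>))"
    "(\<integral>\<omega>. Z \<omega> * (simple_integral W N p \<xi> t \<omega> - simple_integral W N p \<xi> s \<omega>) \<partial>M) = 0"
proof -
  \<comment> \<open>Clamping the partition points to [s,t] turns the increment of the integral into
    a sum over cells that start no earlier than s, so that Z is known at the start of each. Points
    beyond t collapse to t.\<close>
  define a where "a i = min t (max s (p i))" for i
  have summand: "integrable M (\<lambda>\<omega>. Z \<omega> * \<xi> i \<omega> * (W (a (Suc i)) \<omega> - W (a i) \<omega>)) \<and>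
     (\<integral>\<omega>. Z \<omega> * \<xi> i \<omega> * (W (a (Suc i)) \<omega> - W (a i) \<omega>) \<partial>M) = 0" if i: "i < N" for i
  proof (cases "p i \<le> t")
    case True
    have p: "0 \<le> p i" "p i \<le> p (Suc i)" using simple_process_nonneg[OF S] i S by (auto simp: simple_process_def)
    have a: "s \<le> a i" "p i \<le> a i" "a i \<le> a (Suc i)" using True p st by (auto simp: a_def)
    obtain C where C: "\<forall>\<omega>\<in>space M. \<bar>\<xi> i \<omega>\<bar> \<le> C" and xm: "\<xi> i \<in> borel_measurable (F (p i))"
      using S i by (auto simp: simple_process_def)
    have [measurable]: "\<xi> i \<in> borel_measurable (F (a i))" "Z \<in> borel_measurable (F (a i))"
      using measurable_F_mono[OF p(1) a(2) xm] measurable_F_mono[OF st(1) a(1) Z] by auto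
    have m: "(\<lambda>\<omega>. Z \<omega> * \<xi> i \<omega>) \<in> borel_measurable (F (a i))" by measurable
    have "\<forall>\<omega>\<in>space M. \<bar>Z \<omega> * \<xi> i \<omega>\<bar> \<le> B * C"
    proof
      fix \<omega> assume "\<omega> \<in> space M"
      then have "\<bar>Z \<omega>\<bar> \<le> B" "\<bar>\<xi> i \<omega>\<bar> \<le> C" using B C by auto
      then show "\<bar>Z \<omega> * \<xi> i \<omega>\<bar> \<le> B * C" unfolding abs_mult by (intro mult_mono) auto
    qed
    from bounded_mult_increment[OF W _ a(3) m this] a st show ?thesis by auto
  next
    case False
    moreover have "p i \<le> p (Suc i)" using S i by (auto simp: simple_process_def)
    ultimately have "a i = t" "a (Suc i) = t" by (auto simp: a_def)
    then show ?thesis by simp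
  qed
  have split: "W (min t q) \<omega> - W (min s q) \<omega> = W (min t (max s q)) \<omega> - W s \<omega>" for q \<omega>
    using st by (cases "q \<le> s") (auto simp: min_def max_def)
  have eq: "Z \<omega> * (simple_integral W N p \<xi> t \<omega> - simple_integral W N p \<xi> s \<omega>) =
    (\<Sum>i<N. Z \<omega> * \<xi> i \<omega> * (W (a (Suc i)) \<omega> - W (a i) \<omega>))" for \<omega>
  proof -
    have "(W (min t (p (Suc i))) \<omega> - W (min t (p i)) \<omega>) - (W (min s (p (Suc i))) \<omega> - W (min s (p i)) \<omega>)
       = W (a (Suc i)) \<omega> - W (a i) \<omega>" for i
      unfolding a_def using split[of "p i" \<omega>] split[of "p (Suc i)" \<omega>] by linarith
    then show ?thesis
      unfolding simple_integral_def sum_subtractf[symmetric] sum_distrib_left right_diff_distrib[symmetric]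
      by (simp add: mult.assoc)
  qed
  show "integrable M (\<lambda>\<omega>. Z \<omega> * (simple_integral W N p \<xi> t \<omega> - simple_integral W N p \<xi> s \<omega>))"
    unfolding eq using summand by auto
  show "(\<integral>\<omega>. Z \<omega> * (simple_integral W N p \<xi> t \<omega> - simple_integral W N p \<xi> s \<omega>) \<partial>M) = 0"
    unfolding eq using summand by (subst Bochner_Integration.integral_sum) auto
qed

lemma simple_integral_isometry:
  assumes W: "wiener_process M F W" and S: "simple_process M F N p \<xi>" and t: "0 \<le> t"
  shows "integrable M (\<lambda>\<omega>. (simple_integral W N p \<xi> t \<omega>)\<^sup>2)"
    "integrable M (\<lambda>\<omega>. \<Sum>i<N. (\<xi> i \<omega>)\<^sup>2 * (min t (p (Suc i)) - min t (p i)))"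
    "(\<integral>\<omega>. (simple_integral W N p \<xi> t \<omega>)\<^sup>2 \<partial>M) =
     (\<integral>\<omega>. (\<Sum>i<N. (\<xi> i \<omega>)\<^sup>2 * (min t (p (Suc i)) - min t (p i))) \<partial>M)"
proof -
  define d where "d i \<omega> = W (min t (p (Suc i))) \<omega> - W (min t (p i)) \<omega>" for i \<omega>
  define \<delta> where "\<delta> i = min t (p (Suc i)) - min t (p i)" for i
  have pn: "0 \<le> p i" if "i \<le> N" for i using simple_process_nonneg[OF S that] .
  have xi: "\<xi> i \<in> borel_measurable (F (p i))" "\<exists>C. \<forall>\<omega>\<in>space M. \<bar>\<xi> i \<omega>\<bar> \<le> C" if "i < N" for i
    using S that by (auto simp: simple_process_def)
  have pS: "p i \<le> p (Suc i)" if "i < N" for i using S that by (auto simp: simple_process_def)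
  have xi2: "integrable M (\<lambda>\<omega>. (\<xi> i \<omega>)\<^sup>2)" if i: "i < N" for i
  proof -
    obtain C where C: "\<forall>\<omega>\<in>space M. \<bar>\<xi> i \<omega>\<bar> \<le> C" using xi(2)[OF i] by auto
    have "(\<xi> i \<omega>)\<^sup>2 \<le> C\<^sup>2" if "\<omega> \<in> space M" for \<omega>
      using C that by (metis abs_ge_zero abs_le_square_iff abs_of_nonneg order_trans)
    then show ?thesis using measurable_F_M[OF pn xi(1)] i
      by (intro integrable_const_bound[of _ "C\<^sup>2"]) auto
  qed
  have diag: "integrable M (\<lambda>\<omega>. (\<xi> i \<omega> * d i \<omega>)\<^sup>2) \<and>
     (\<integral>\<omega>. (\<xi> i \<omega> * d i \<omega>)\<^sup>2 \<partial>M) = (\<integral>\<omega>. (\<xi> i \<omega>)\<^sup>2 * \<delta> i \<partial>M)" if i: "i < N" for i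
  proof (cases "p i \<le> t")
    case True
    have [measurable]: "\<xi> i \<in> borel_measurable (F (p i))" using xi i by auto
    have "(\<lambda>\<omega>. (\<xi> i \<omega>)\<^sup>2) \<in> borel_measurable (F (p i))" by measurable
    from wiener_mult_increment(3,4)[OF W pn _ this xi2, of "min t (p (Suc i))"]
    show ?thesis using i True pS[OF i] by (auto simp: d_def \<delta>_def power_mult_distrib min_absorb2)
  next
    case False
    then show ?thesis using pS[OF i] by (auto simp: d_def \<delta>_def min_def)
  qed
  \<comment> \<open>The increment over cell j is independent of the other three factors, all of
    which are known at \<open>p j\<close>. When \<open>p j\<close> lies beyond t, truncation makes
    that increment zero.\<close>
  have off: "integrable M (\<lambda>\<omega>. (\<xi> i \<omega> * d i \<omega>) * (\<xi> j \<omega> * d j \<omega>)) \<and>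
     (\<integral>\<omega>. (\<xi> i \<omega> * d i \<omega>) * (\<xi> j \<omega> * d j \<omega>) \<partial>M) = 0" if ij: "i < j" "j < N" for i j
  proof (cases "p j \<le> t")
    case True
    have i: "i < N" using ij by auto
    have le: "p (Suc i) \<le> p j" using simple_process_le[OF S] ij by auto
    have "p i \<le> p j" using le pS[OF i] by auto
    have d: "d i \<in> borel_measurable (F (p j))" unfolding d_def
      using le pS[OF i] True pn ij i t
      by (intro borel_measurable_diff wiener_measurable'[OF W]) auto
    have [measurable]: "\<xi> i \<in> borel_measurable (F (p j))" "\<xi> j \<in> borel_measurable (F (p j))"
      using measurable_F_mono[OF pn \<open>p i \<le> p j\<close> xi(1)] i xi ij by auto
    have m: "(\<lambda>\<omega>. \<xi> j \<omega> * (\<xi> i \<omega> * d i \<omega>)) \<in> borel_measurable (F (p j))" using d by measurable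
    have di: "integrable M (d i)" unfolding d_def
      using wiener_increment_moments(1)[OF W, of "min t (p i)" "min t (p (Suc i))"] pn i t pS[OF i] by auto
    obtain C where C: "\<forall>\<omega>\<in>space M. \<bar>\<xi> i \<omega>\<bar> \<le> C" using xi(2)[OF i] by auto
    obtain C' where C': "\<forall>\<omega>\<in>space M. \<bar>\<xi> j \<omega>\<bar> \<le> C'" using xi(2)[OF ij(2)] by auto
    have "integrable M (\<lambda>\<omega>. \<xi> j \<omega> * (\<xi> i \<omega> * d i \<omega>))"
      using C C' di measurable_F_M[OF pn xi(1)] i ij
      by (intro integrable_bounded_mult) auto
    from wiener_mult_increment(1,2)[OF W pn _ m this, of "min t (p (Suc j))"]
    show ?thesis using ij True pS[of j] by (simp add: d_def[of j] min_absorb2 mult_ac)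
  next
    case False
    then have "d j \<omega> = 0" for \<omega> using pS[of j] ij by (auto simp: d_def min_def)
    then show ?thesis by simp
  qed
  have all: "integrable M (\<lambda>\<omega>. (\<xi> i \<omega> * d i \<omega>) * (\<xi> j \<omega> * d j \<omega>)) \<and>
     (\<integral>\<omega>. (\<xi> i \<omega> * d i \<omega>) * (\<xi> j \<omega> * d j \<omega>) \<partial>M) = (if i = j then \<integral>\<omega>. (\<xi> i \<omega>)\<^sup>2 * \<delta> i \<partial>M else 0)"
    if "i < N" "j < N" for i j
    using diag[of i] off[of i j] off[of j i] that
    by (cases i j rule: linorder_cases) (auto simp: power2_eq_square mult_ac)
  have eq: "(simple_integral W N p \<xi> t \<omega>)\<^sup>2 = (\<Sum>i<N. \<Sum>j<N. (\<xi> i \<omega> * d i \<omega>) * (\<xi> j \<omega> * d j \<omega>))" for \<omega>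
    unfolding simple_integral_def d_def power2_eq_square sum_product ..
  show "integrable M (\<lambda>\<omega>. (simple_integral W N p \<xi> t \<omega>)\<^sup>2)"
    unfolding eq using all by (intro Bochner_Integration.integrable_sum) auto
  show i2: "integrable M (\<lambda>\<omega>. \<Sum>i<N. (\<xi> i \<omega>)\<^sup>2 * (min t (p (Suc i)) - min t (p i)))"
    using xi2 by (intro Bochner_Integration.integrable_sum integrable_mult_left) auto
  have "(\<integral>\<omega>. (simple_integral W N p \<xi> t \<omega>)\<^sup>2 \<partial>M) = (\<Sum>i<N. \<Sum>j<N. if i = j then \<integral>\<omega>. (\<xi> i \<omega>)\<^sup>2 * \<delta> i \<partial>M else 0)"
    unfolding eq using all
    by (subst Bochner_Integration.integral_sum) (auto intro!: sum.cong Bochner_Integration.integral_sum)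
  also have "\<dots> = (\<Sum>i<N. \<integral>\<omega>. (\<xi> i \<omega>)\<^sup>2 * \<delta> i \<partial>M)" by simp
  also have "\<dots> = (\<integral>\<omega>. (\<Sum>i<N. (\<xi> i \<omega>)\<^sup>2 * \<delta> i) \<partial>M)"
    using xi2 by (subst Bochner_Integration.integral_sum) auto
  finally show "(\<integral>\<omega>. (simple_integral W N p \<xi> t \<omega>)\<^sup>2 \<partial>M) =
     (\<integral>\<omega>. (\<Sum>i<N. (\<xi> i \<omega>)\<^sup>2 * (min t (p (Suc i)) - min t (p i))) \<partial>M)" unfolding \<delta>_def .
qed

end

section \<open>Orthogonality of integrals with respect to different Wiener processes\<close>

context wiener_family
begin

text \<open>Each \<open>W \<l>\<close> is a Wiener process for \<open>F\<close> and the \<open>W \<l>\<close> are mutually independent, but the joint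
  increments are not assumed to be independent of the past.  The product of two increments is
  therefore refined along a uniform partition: the mixed terms vanish one process at a time, and the
  diagonal ones form a realised covariation, which is small in \<open>L\<^sup>2\<close>.\<close>

lemma cross_increment_same_interval:
  assumes l: "\<l> \<in> L" "\<l>' \<in> L" "\<l> \<noteq> \<l>'" and ab: "0 \<le> a" "a \<le> b"
    and Y: "Y \<in> borel_measurable (F a)" and B: "\<forall>\<omega>\<in>space M. \<bar>Y \<omega>\<bar> \<le> B"
  shows "(\<integral>\<omega>. Y \<omega> * ((W \<l> b \<omega> - W \<l> a \<omega>) * (W \<l>' b \<omega> - W \<l>' a \<omega>)) \<partial>M) = 0" (is "?c = 0")
proof -
  note W = wiener[OF l(1)] and W' = wiener[OF l(2)]
  have YM: "Y \<in> borel_measurable M" using measurable_F_M[OF ab(1) Y] .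
  \<comment> \<open>On a uniform grid with n cells of length h the diagonal terms are orthogonal,
    with second moment n h^2 = (b - a)^2 / n. The left side is free of n, so letting n grow gives
    zero.\<close>
  have bound: "?c\<^sup>2 \<le> B\<^sup>2 * ((b - a)\<^sup>2 / real n)" if n: "n > 0" for n :: nat
  proof -
    define h where "h = (b - a) / real n"
    define t where "t k = a + real k * h" for k
    have h: "0 \<le> h" using ab n by (simp add: h_def)
    have t0: "t 0 = a" and tn: "t n = b" using n by (simp_all add: t_def h_def)
    have tS: "t k \<le> t (Suc k)" "t (Suc k) - t k = h" for k using h by (auto simp: t_def algebra_simps)
    have tm: "t j \<le> t k" if "j \<le> k" for j k using that h by (auto simp: t_def intro: mult_right_mono)
    have ta: "a \<le> t k" "0 \<le> t k" for k using tm[of 0 k] t0 ab by auto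
    define u where "u k \<omega> = W \<l> (t k) \<omega> - W \<l> a \<omega>" for k \<omega>
    define v where "v k \<omega> = W \<l>' (t k) \<omega> - W \<l>' a \<omega>" for k \<omega>
    define du where "du k \<omega> = W \<l> (t (Suc k)) \<omega> - W \<l> (t k) \<omega>" for k \<omega>
    define dv where "dv k \<omega> = W \<l>' (t (Suc k)) \<omega> - W \<l>' (t k) \<omega>" for k \<omega>
    \<comment> \<open>Discrete product rule: besides the diagonal terms, only past values of one
      process times future increments of the other occur.\<close>
    have split: "u n \<omega> * v n \<omega> = (\<Sum>k<n. du k \<omega> * dv k \<omega>) + (\<Sum>k<n. u k \<omega> * dv k \<omega>) + (\<Sum>k<n. v k \<omega> * du k \<omega>)" for \<omega>
    proof -
      have "u n \<omega> * v n \<omega> = (\<Sum>k<n. u (Suc k) \<omega> * v (Suc k) \<omega> - u k \<omega> * v k \<omega>)"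
        using sum_lessThan_telescope[of "\<lambda>k. u k \<omega> * v k \<omega>" n] by (simp add: u_def[of 0] t0)
      also have "\<dots> = (\<Sum>k<n. du k \<omega> * dv k \<omega> + u k \<omega> * dv k \<omega> + v k \<omega> * du k \<omega>)"
        by (intro sum.cong) (auto simp: u_def v_def du_def dv_def algebra_simps)
      finally show ?thesis by (simp add: sum.distrib)
    qed
    have uint: "integrable M (\<lambda>\<omega>. Y \<omega> * u k \<omega>)" "integrable M (\<lambda>\<omega>. Y \<omega> * v k \<omega>)" for k
      unfolding u_def v_def
      using wiener_increment_moments(1)[OF W ab(1) ta(1)] wiener_increment_moments(1)[OF W' ab(1) ta(1)] YM B
      by (auto intro!: integrable_bounded_mult)
    have Ym[measurable]: "Y \<in> borel_measurable (F (t k))" for k using measurable_F_mono[OF ab(1) ta(1) Y] .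
    have um: "u k \<in> borel_measurable (F (t k))" "v k \<in> borel_measurable (F (t k))" for k
      unfolding u_def v_def using wiener_measurable'[OF W] wiener_measurable'[OF W'] ta ab
      by (auto intro!: borel_measurable_diff)
    have z1: "integrable M (\<lambda>\<omega>. (Y \<omega> * u k \<omega>) * dv k \<omega>)" "(\<integral>\<omega>. (Y \<omega> * u k \<omega>) * dv k \<omega> \<partial>M) = 0" for k
      unfolding dv_def using wiener_mult_increment(1,2)[OF W' ta(2) tS(1) _ uint(1)] um by auto
    have z2: "integrable M (\<lambda>\<omega>. (Y \<omega> * v k \<omega>) * du k \<omega>)" "(\<integral>\<omega>. (Y \<omega> * v k \<omega>) * du k \<omega> \<partial>M) = 0" for k
      unfolding du_def using wiener_mult_increment(1,2)[OF W ta(2) tS(1) _ uint(2)] um by auto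
    define Q where "Q \<omega> = (\<Sum>k<n. du k \<omega> * dv k \<omega>)" for \<omega>
    have disj: "t (Suc j) \<le> t k \<or> t (Suc k) \<le> t j \<or> (t j = t k \<and> t (Suc j) = t (Suc k))" for j k
      using tm by (metis Suc_leI linorder_neqE_nat)
    have pp: "integrable M (\<lambda>\<omega>. (du j \<omega> * dv j \<omega>) * (du k \<omega> * dv k \<omega>))"
       "(\<integral>\<omega>. (du j \<omega> * dv j \<omega>) * (du k \<omega> * dv k \<omega>) \<partial>M) = (if j = k then h\<^sup>2 else 0)" for j k
    proof -
      note I = independent_increments_product[OF l ta(2) tS(1) ta(2) tS(1) disj[of j k]]
      have e: "(\<lambda>\<omega>. (du j \<omega> * dv j \<omega>) * (du k \<omega> * dv k \<omega>)) = (\<lambda>\<omega>. (du j \<omega> * du k \<omega>) * (dv j \<omega> * dv k \<omega>))"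
        by (auto simp: mult_ac)
      \<comment> \<open>When h = 0, distinct indices share a grid point; the expectation and its
        claimed value are then both zero.\<close>
      have "t j = t k \<longleftrightarrow> j = k \<or> h = 0" for j k by (auto simp: t_def)
      then show "integrable M (\<lambda>\<omega>. (du j \<omega> * dv j \<omega>) * (du k \<omega> * dv k \<omega>))"
       "(\<integral>\<omega>. (du j \<omega> * dv j \<omega>) * (du k \<omega> * dv k \<omega>) \<partial>M) = (if j = k then h\<^sup>2 else 0)"
        using I tS(2) unfolding e unfolding du_def dv_def by auto
    qed
    have Q2: "(Q \<omega>)\<^sup>2 = (\<Sum>j<n. \<Sum>k<n. (du j \<omega> * dv j \<omega>) * (du k \<omega> * dv k \<omega>))" for \<omega>
      unfolding Q_def power2_eq_square sum_product ..
    have Q2i: "integrable M (\<lambda>\<omega>. (Q \<omega>)\<^sup>2)" unfolding Q2 using pp by auto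
    have "(\<integral>\<omega>. (Q \<omega>)\<^sup>2 \<partial>M) = (\<Sum>j<n. \<Sum>k<n. if j = k then h\<^sup>2 else 0)"
      unfolding Q2 using pp by (subst Bochner_Integration.integral_sum) (auto intro!: sum.cong)
    also have "\<dots> = (b - a)\<^sup>2 / real n" using n by (simp add: h_def power2_eq_square field_simps)
    finally have EQ: "(\<integral>\<omega>. (Q \<omega>)\<^sup>2 \<partial>M) = (b - a)\<^sup>2 / real n" .
    have dm: "du k \<in> borel_measurable M" "dv k \<in> borel_measurable M" for k
      unfolding du_def dv_def using wiener_measurable_M[OF W] wiener_measurable_M[OF W'] ta
      by (auto intro!: borel_measurable_diff)
    have Qm: "Q \<in> borel_measurable M" unfolding Q_def using dm by auto
    have Qi: "integrable M Q" using square_integrable_imp_integrable[OF Qm Q2i] .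
    have YQ: "integrable M (\<lambda>\<omega>. Y \<omega> * Q \<omega>)" by (rule integrable_bounded_mult[OF Qi YM B])
    have "Y \<omega> * ((W \<l> b \<omega> - W \<l> a \<omega>) * (W \<l>' b \<omega> - W \<l>' a \<omega>)) =
      Y \<omega> * Q \<omega> + (\<Sum>k<n. (Y \<omega> * u k \<omega>) * dv k \<omega>) + (\<Sum>k<n. (Y \<omega> * v k \<omega>) * du k \<omega>)" for \<omega>
      using split[of \<omega>] by (simp add: u_def v_def tn Q_def algebra_simps sum_distrib_left)
    then have "?c = (\<integral>\<omega>. Y \<omega> * Q \<omega> \<partial>M)"
      using YQ z1 z2 by (simp add: Bochner_Integration.integral_sum)
    moreover have "\<bar>\<integral>\<omega>. Y \<omega> * Q \<omega> \<partial>M\<bar> \<le> (\<integral>\<omega>. B * \<bar>Q \<omega>\<bar> \<partial>M)"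
    proof -
      have "\<bar>\<integral>\<omega>. Y \<omega> * Q \<omega> \<partial>M\<bar> \<le> (\<integral>\<omega>. \<bar>Y \<omega> * Q \<omega>\<bar> \<partial>M)" by (rule integral_abs_bound)
      also have "\<dots> \<le> (\<integral>\<omega>. B * \<bar>Q \<omega>\<bar> \<partial>M)"
        using integrable_abs[OF YQ] Qi B
        by (intro integral_mono) (auto simp: abs_mult[symmetric], auto simp: abs_mult intro: mult_right_mono)
      finally show ?thesis .
    qed
    ultimately have "\<bar>?c\<bar> \<le> B * (\<integral>\<omega>. \<bar>Q \<omega>\<bar> \<partial>M)" by simp
    then have "?c\<^sup>2 \<le> (B * (\<integral>\<omega>. \<bar>Q \<omega>\<bar> \<partial>M))\<^sup>2" by (meson abs_ge_self abs_le_square_iff order_trans)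
    also have "(B * (\<integral>\<omega>. \<bar>Q \<omega>\<bar> \<partial>M))\<^sup>2 \<le> B\<^sup>2 * ((b - a)\<^sup>2 / real n)"
    proof -
      \<comment> \<open>Nonnegativity of the variance of |Q| serves as the Cauchy-Schwarz
        inequality.\<close>
      have "(\<integral>\<omega>. \<bar>Q \<omega>\<bar> \<partial>M)\<^sup>2 \<le> (\<integral>\<omega>. \<bar>Q \<omega>\<bar>\<^sup>2 \<partial>M)"
        using variance_eq[of "\<lambda>\<omega>. \<bar>Q \<omega>\<bar>"] variance_positive[of "\<lambda>\<omega>. \<bar>Q \<omega>\<bar>"] Qi Q2i by simp
      then have "(\<integral>\<omega>. \<bar>Q \<omega>\<bar> \<partial>M)\<^sup>2 \<le> (b - a)\<^sup>2 / real n" using EQ by simp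
      then show ?thesis unfolding power_mult_distrib by (rule mult_left_mono) simp
    qed
    finally show ?thesis .
  qed
  have "(\<lambda>n. B\<^sup>2 * ((b - a)\<^sup>2 / real n)) \<longlonglongrightarrow> B\<^sup>2 * 0"
    by (intro tendsto_mult tendsto_const lim_const_over_n)
  then have "?c\<^sup>2 \<le> 0"
    using bound by (intro LIMSEQ_le_const[of _ 0]) (auto intro!: exI[of _ 1])
  then show ?thesis by simp
qed

text \<open>The two intervals are cut at the later start and at the earlier end. Pieces that do not
  overlap vanish, because one increment lies in the future of all other factors; the common piece is
  \<open>cross_increment_same_interval\<close>.\<close>

lemma cross_increment:
  assumes l: "\<l> \<in> L" "\<l>' \<in> L" "\<l> \<noteq> \<l>'" and ord: "0 \<le> a" "a \<le> b" "0 \<le> c" "c \<le> d"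
    and \<xi>: "\<xi> \<in> borel_measurable (F a)" "\<forall>\<omega>\<in>space M. \<bar>\<xi> \<omega>\<bar> \<le> B"
    and \<zeta>: "\<zeta> \<in> borel_measurable (F c)" "\<forall>\<omega>\<in>space M. \<bar>\<zeta> \<omega>\<bar> \<le> B'"
  shows "integrable M (\<lambda>\<omega>. (\<xi> \<omega> * (W \<l> b \<omega> - W \<l> a \<omega>)) * (\<zeta> \<omega> * (W \<l>' d \<omega> - W \<l>' c \<omega>)))"
    "(\<integral>\<omega>. (\<xi> \<omega> * (W \<l> b \<omega> - W \<l> a \<omega>)) * (\<zeta> \<omega> * (W \<l>' d \<omega> - W \<l>' c \<omega>)) \<partial>M) = 0"
proof -
  \<comment> \<open>The two processes play symmetric roles, so the first interval may be assumed to
    start first. Both coefficients then merge into one factor known at c.\<close>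
  have *: "(\<integral>\<omega>. (\<xi> \<omega> * (W \<l> b \<omega> - W \<l> a \<omega>)) * (\<zeta> \<omega> * (W \<l>' d \<omega> - W \<l>' c \<omega>)) \<partial>M) = 0
     \<and> integrable M (\<lambda>\<omega>. (\<xi> \<omega> * (W \<l> b \<omega> - W \<l> a \<omega>)) * (\<zeta> \<omega> * (W \<l>' d \<omega> - W \<l>' c \<omega>)))"
    if l: "\<l> \<in> L" "\<l>' \<in> L" "\<l> \<noteq> \<l>'" and ord: "0 \<le> a" "a \<le> b" "0 \<le> c" "c \<le> d" and ac: "a \<le> c"
      and \<xi>: "\<xi> \<in> borel_measurable (F a)" "\<forall>\<omega>\<in>space M. \<bar>\<xi> \<omega>\<bar> \<le> B"
      and \<zeta>: "\<zeta> \<in> borel_measurable (F c)" "\<forall>\<omega>\<in>space M. \<bar>\<zeta> \<omega>\<bar> \<le> B'"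
    for \<l> \<l>' a b c d \<xi> \<zeta> B B'
  proof -
    note W = wiener[OF l(1)] and W' = wiener[OF l(2)]
    have xc: "\<xi> \<in> borel_measurable (F c)" using measurable_F_mono[OF ord(1) ac \<xi>(1)] .
    define Y where "Y = (\<lambda>\<omega>. \<xi> \<omega> * \<zeta> \<omega>)"
    have Y: "Y \<in> borel_measurable (F c)" unfolding Y_def using xc \<zeta>(1) by measurable
    have YB: "\<forall>\<omega>\<in>space M. \<bar>Y \<omega>\<bar> \<le> B * B'" unfolding Y_def
    proof
      fix \<omega> assume w: "\<omega> \<in> space M"
      then have "0 \<le> B" using \<xi>(2) abs_ge_zero order_trans by blast
      with w show "\<bar>\<xi> \<omega> * \<zeta> \<omega>\<bar> \<le> B * B'" using \<xi>(2) \<zeta>(2) unfolding abs_mult by (intro mult_mono) auto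
    qed
    have YM: "Y \<in> borel_measurable M" using measurable_F_M[OF ord(3) Y] .
    \<comment> \<open>For a <= c this is min b c, the end of the part of the first interval that
      precedes c.\<close>
    define m where "m = min b (max a c)"
    have mm: "a \<le> m" "m \<le> c" "m \<le> b" using ord ac by (auto simp: m_def)
    have bb: "(m = b \<and> b \<le> c) \<or> (m = c \<and> c \<le> b)" using ac ord by (auto simp: m_def)
    have inc: "integrable M (\<lambda>\<omega>. W \<l> m \<omega> - W \<l> a \<omega>)"
      using wiener_increment_moments(1)[OF W ord(1) mm(1)] .
    have Z: "(\<lambda>\<omega>. Y \<omega> * (W \<l> m \<omega> - W \<l> a \<omega>)) \<in> borel_measurable (F c)"
      using Y wiener_measurable'[OF W, of m c] wiener_measurable'[OF W, of a c] mm ord ac by auto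
    have Zi: "integrable M (\<lambda>\<omega>. Y \<omega> * (W \<l> m \<omega> - W \<l> a \<omega>))" by (rule integrable_bounded_mult[OF inc YM YB])
    have 1: "integrable M (\<lambda>\<omega>. Y \<omega> * (W \<l> m \<omega> - W \<l> a \<omega>) * (W \<l>' d \<omega> - W \<l>' c \<omega>))"
       "(\<integral>\<omega>. Y \<omega> * (W \<l> m \<omega> - W \<l> a \<omega>) * (W \<l>' d \<omega> - W \<l>' c \<omega>) \<partial>M) = 0"
      using wiener_mult_increment(1,2)[OF W' ord(3,4) Z Zi] by auto
    have 2: "integrable M (\<lambda>\<omega>. Y \<omega> * ((W \<l> b \<omega> - W \<l> m \<omega>) * (W \<l>' d \<omega> - W \<l>' c \<omega>))) \<and>
       (\<integral>\<omega>. Y \<omega> * ((W \<l> b \<omega> - W \<l> m \<omega>) * (W \<l>' d \<omega> - W \<l>' c \<omega>)) \<partial>M) = 0"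
    proof (cases "m = b")
      case False
      then have mc: "m = c" "c \<le> b" using bb by auto
      have i: "integrable M (\<lambda>\<omega>. Y \<omega> * ((W \<l> q \<omega> - W \<l> c \<omega>) * (W \<l>' r \<omega> - W \<l>' c \<omega>)))"
        if "c \<le> q" "c \<le> r" for q r
        using wiener_increment_moments[OF W ord(3) that(1)] wiener_increment_moments[OF W' ord(3) that(2)]
        by (intro integrable_bounded_mult[OF _ YM YB] integrable_mult_of_squares) auto
      define n where "n = min b d"
      have n: "c \<le> n" "0 \<le> n" using mc ord by (auto simp: n_def)
      have Yn: "Y \<in> borel_measurable (F n)" using measurable_F_mono[OF ord(3) n(1) Y] .
      have base: "(\<integral>\<omega>. Y \<omega> * ((W \<l> n \<omega> - W \<l> c \<omega>) * (W \<l>' n \<omega> - W \<l>' c \<omega>)) \<partial>M) = 0"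
        by (rule cross_increment_same_interval[OF l ord(3) n(1) Y YB])
      consider "n = b" "b \<le> d" | "n = d" "d \<le> b" unfolding n_def by linarith
      then have "(\<integral>\<omega>. Y \<omega> * ((W \<l> b \<omega> - W \<l> c \<omega>) * (W \<l>' d \<omega> - W \<l>' c \<omega>)) \<partial>M) = 0"
      proof cases
        case 1
        have inc: "integrable M (\<lambda>\<omega>. W \<l> n \<omega> - W \<l> c \<omega>)"
          using wiener_increment_moments(1)[OF W ord(3) n(1)] .
        have Z: "(\<lambda>\<omega>. Y \<omega> * (W \<l> n \<omega> - W \<l> c \<omega>)) \<in> borel_measurable (F n)"
          using Yn wiener_measurable'[OF W, of n n] wiener_measurable'[OF W, of c n] n ord by auto
        note z = wiener_mult_increment(1,2)[OF W' n(2) _ Z integrable_bounded_mult[OF inc YM YB], of d]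
        have "(\<lambda>\<omega>. Y \<omega> * ((W \<l> b \<omega> - W \<l> c \<omega>) * (W \<l>' d \<omega> - W \<l>' c \<omega>))) =
          (\<lambda>\<omega>. Y \<omega> * ((W \<l> n \<omega> - W \<l> c \<omega>) * (W \<l>' n \<omega> - W \<l>' c \<omega>)) +
             Y \<omega> * (W \<l> n \<omega> - W \<l> c \<omega>) * (W \<l>' d \<omega> - W \<l>' n \<omega>))"
          using 1 by (auto simp: algebra_simps)
        then show ?thesis using z base i[OF n(1) n(1)] 1 by simp
      next
        case 2
        have inc: "integrable M (\<lambda>\<omega>. W \<l>' n \<omega> - W \<l>' c \<omega>)"
          using wiener_increment_moments(1)[OF W' ord(3) n(1)] .
        have Z: "(\<lambda>\<omega>. Y \<omega> * (W \<l>' n \<omega> - W \<l>' c \<omega>)) \<in> borel_measurable (F n)"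
          using Yn wiener_measurable'[OF W', of n n] wiener_measurable'[OF W', of c n] n ord by auto
        note z = wiener_mult_increment(1,2)[OF W n(2) _ Z integrable_bounded_mult[OF inc YM YB], of b]
        have "(\<lambda>\<omega>. Y \<omega> * ((W \<l> b \<omega> - W \<l> c \<omega>) * (W \<l>' d \<omega> - W \<l>' c \<omega>))) =
          (\<lambda>\<omega>. Y \<omega> * ((W \<l> n \<omega> - W \<l> c \<omega>) * (W \<l>' n \<omega> - W \<l>' c \<omega>)) +
             Y \<omega> * (W \<l>' n \<omega> - W \<l>' c \<omega>) * (W \<l> b \<omega> - W \<l> n \<omega>))"
          using 2 by (auto simp: algebra_simps)
        then show ?thesis using z base i[OF n(1) n(1)] 2 by simp
      qed
      then show ?thesis using i[of b d] mc ord by auto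
    qed auto
    have "(\<lambda>\<omega>. (\<xi> \<omega> * (W \<l> b \<omega> - W \<l> a \<omega>)) * (\<zeta> \<omega> * (W \<l>' d \<omega> - W \<l>' c \<omega>))) =
      (\<lambda>\<omega>. Y \<omega> * (W \<l> m \<omega> - W \<l> a \<omega>) * (W \<l>' d \<omega> - W \<l>' c \<omega>) +
         Y \<omega> * ((W \<l> b \<omega> - W \<l> m \<omega>) * (W \<l>' d \<omega> - W \<l>' c \<omega>)))"
      by (auto simp: Y_def algebra_simps)
    then show ?thesis using 1 2 by simp
  qed
  show "integrable M (\<lambda>\<omega>. (\<xi> \<omega> * (W \<l> b \<omega> - W \<l> a \<omega>)) * (\<zeta> \<omega> * (W \<l>' d \<omega> - W \<l>' c \<omega>)))"
    "(\<integral>\<omega>. (\<xi> \<omega> * (W \<l> b \<omega> - W \<l> a \<omega>)) * (\<zeta> \<omega> * (W \<l>' d \<omega> - W \<l>' c \<omega>)) \<partial>M) = 0"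
    using *[OF l ord _ \<xi> \<zeta>] *[OF l(2,1) l(3)[symmetric] ord(3,4,1,2) _ \<zeta> \<xi>]
    by (cases "a \<le> c"; simp add: mult.commute)+
qed

lemma simple_integral_cross:
  assumes l: "\<l> \<in> L" "\<l>' \<in> L" "\<l> \<noteq> \<l>'" and t: "0 \<le> t"
    and S: "simple_process M F N p \<xi>" and S': "simple_process M F N' p' \<xi>'"
  shows "integrable M (\<lambda>\<omega>. simple_integral (W \<l>) N p \<xi> t \<omega> * simple_integral (W \<l>') N' p' \<xi>' t \<omega>)"
    "(\<integral>\<omega>. simple_integral (W \<l>) N p \<xi> t \<omega> * simple_integral (W \<l>') N' p' \<xi>' t \<omega> \<partial>M) = 0"
proof -
  let ?d = "\<lambda>\<l> p i \<omega>. W \<l> (min t (p (Suc i))) \<omega> - W \<l> (min t (p i)) \<omega>"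
  have eq: "simple_integral (W \<l>) N p \<xi> t \<omega> * simple_integral (W \<l>') N' p' \<xi>' t \<omega> =
     (\<Sum>i<N. \<Sum>j<N'. (\<xi> i \<omega> * ?d \<l> p i \<omega>) * (\<xi>' j \<omega> * ?d \<l>' p' j \<omega>))" for \<omega>
    unfolding simple_integral_def sum_product ..
  have *: "integrable M (\<lambda>\<omega>. (\<xi> i \<omega> * ?d \<l> p i \<omega>) * (\<xi>' j \<omega> * ?d \<l>' p' j \<omega>)) \<and>
    (\<integral>\<omega>. (\<xi> i \<omega> * ?d \<l> p i \<omega>) * (\<xi>' j \<omega> * ?d \<l>' p' j \<omega>) \<partial>M) = 0" if ij: "i < N" "j < N'" for i j
  proof (cases "p i \<le> t \<and> p' j \<le> t")
    case True
    have x: "0 \<le> p i" "p i \<le> p (Suc i)" "\<xi> i \<in> borel_measurable (F (p i))" "\<exists>C. \<forall>\<omega>\<in>space M. \<bar>\<xi> i \<omega>\<bar> \<le> C"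
      using simple_process_nonneg[OF S] S ij by (auto simp: simple_process_def)
    have x': "0 \<le> p' j" "p' j \<le> p' (Suc j)" "\<xi>' j \<in> borel_measurable (F (p' j))" "\<exists>C. \<forall>\<omega>\<in>space M. \<bar>\<xi>' j \<omega>\<bar> \<le> C"
      using simple_process_nonneg[OF S'] S' ij by (auto simp: simple_process_def)
    obtain C C' where "\<forall>\<omega>\<in>space M. \<bar>\<xi> i \<omega>\<bar> \<le> C" "\<forall>\<omega>\<in>space M. \<bar>\<xi>' j \<omega>\<bar> \<le> C'" using x(4) x'(4) by auto
    from cross_increment[OF l _ _ _ _ x(3) this(1) x'(3) this(2), of "min t (p (Suc i))" "min t (p' (Suc j))"]
    show ?thesis using True x x' by (simp add: min_absorb2)
  next
    case False
    moreover have "p i \<le> p (Suc i)" "p' j \<le> p' (Suc j)"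
      using S S' ij by (auto simp: simple_process_def)
    ultimately have "(\<forall>\<omega>. ?d \<l> p i \<omega> = 0) \<or> (\<forall>\<omega>. ?d \<l>' p' j \<omega> = 0)"
      by (auto simp: min_def)
    then show ?thesis by auto
  qed
  show "integrable M (\<lambda>\<omega>. simple_integral (W \<l>) N p \<xi> t \<omega> * simple_integral (W \<l>') N' p' \<xi>' t \<omega>)"
    unfolding eq using * by (intro Bochner_Integration.integrable_sum) auto
  show "(\<integral>\<omega>. simple_integral (W \<l>) N p \<xi> t \<omega> * simple_integral (W \<l>') N' p' \<xi>' t \<omega> \<partial>M) = 0"
    unfolding eq using *
    by (subst Bochner_Integration.integral_sum) (auto intro!: Bochner_Integration.integrable_sum sum.neutral simp: Bochner_Integration.integral_sum)
qed

end

section \<open>Integrals of bounded integrands\<close>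

lemma set_integral_finite_sum:
  fixes f :: "'i \<Rightarrow> 'a \<Rightarrow> real"
  assumes "\<And>i. i \<in> I \<Longrightarrow> set_integrable M A (f i)"
  shows "set_integrable M A (\<lambda>x. \<Sum>i\<in>I. f i x)" "(LINT x:A|M. (\<Sum>i\<in>I. f i x)) = (\<Sum>i\<in>I. LINT x:A|M. f i x)"
  using assms by (simp_all add: set_integrable_def set_lebesgue_integral_def sum_distrib_left
      Bochner_Integration.integral_sum)

text \<open>The k-th index is chosen so that an error above 2^-k has probability below 2^-k; these
  are summable and Borel-Cantelli applies. Abstract events are used so that several kinds of error
  can share one subsequence.\<close>

lemma (in prob_space) AE_eventually_notin_subsequence:
  fixes A :: "nat \<Rightarrow> real \<Rightarrow> 'a set"
  assumes ev: "\<And>j \<epsilon>. \<epsilon> > 0 \<Longrightarrow> A j \<epsilon> \<in> events" and lim: "\<And>\<epsilon>. \<epsilon> > 0 \<Longrightarrow> (\<lambda>j. prob (A j \<epsilon>)) \<longlonglongrightarrow> 0"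
  shows "\<exists>r. AE \<omega> in M. eventually (\<lambda>k. \<omega> \<notin> A (r k) ((1/2)^k)) sequentially"
proof -
  have "\<exists>j. prob (A j ((1/2)^k)) < (1/2)^k" for k :: nat
    using order_tendstoD(2)[OF lim[of "(1/2)^k"], of "(1/2)^k"] by (auto simp: eventually_sequentially)
  then obtain r where r: "\<And>k. prob (A (r k) ((1/2)^k)) < (1/2)^k" by metis
  have "AE \<omega> in M. eventually (\<lambda>k. \<omega> \<in> space M - A (r k) ((1/2)^k)) sequentially"
  proof (rule borel_cantelli_AE1)
    show "A (r k) ((1/2)^k) \<in> sets M" for k using ev by simp
    show "emeasure M (A (r k) ((1/2)^k)) < \<infinity>" for k by (simp add: emeasure_eq_measure)
    show "summable (\<lambda>k. measure M (A (r k) ((1/2)^k)))"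
      by (rule summable_comparison_test'[of "\<lambda>k. (1/2)^k"]) (use r in \<open>auto simp: less_imp_le summable_geometric\<close>)
  qed
  then have "AE \<omega> in M. eventually (\<lambda>k. \<omega> \<notin> A (r k) ((1/2)^k)) sequentially"
    by (rule AE_mp) (auto elim!: eventually_mono)
  then show ?thesis by blast
qed

text \<open>By continuity a strict excess persists near the time where it occurs, hence at a
  rational time, and a countable union suffices. S > 0 provides rational times in [0,S] next to both
  end points.\<close>

lemma sets_ex_continuous_gt:
  fixes f :: "real \<Rightarrow> 'a \<Rightarrow> real"
  assumes S: "0 < S" and m: "\<And>t. t \<in> {0..S} \<Longrightarrow> f t \<in> borel_measurable M"
    and c: "\<And>\<omega>. \<omega> \<in> space M \<Longrightarrow> continuous_on {0..S} (\<lambda>t. f t \<omega>)"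
  shows "{\<omega>\<in>space M. \<exists>t\<in>{0..S}. \<epsilon> < f t \<omega>} \<in> sets M"
proof -
  have "{\<omega>\<in>space M. \<exists>t\<in>{0..S}. \<epsilon> < f t \<omega>} = (\<Union>q\<in>{q\<in>\<rat>. 0 \<le> q \<and> q \<le> S}. {\<omega>\<in>space M. \<epsilon> < f q \<omega>})"
    (is "?L = ?R")
  proof (intro set_eqI iffI)
    fix \<omega> assume "\<omega> \<in> ?L"
    then obtain t where t: "0 \<le> t" "t \<le> S" "\<epsilon> < f t \<omega>" and w: "\<omega> \<in> space M" by auto
    have "((\<lambda>s. f s \<omega>) \<longlongrightarrow> f t \<omega>) (at t within {0..S})"
      using c[OF w] t by (simp add: continuous_on_def)
    then have "eventually (\<lambda>s. \<epsilon> < f s \<omega>) (at t within {0..S})" using t by (simp add: order_tendstoD)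
    then obtain d where d: "d > 0" "\<And>s. s \<in> {0..S} \<Longrightarrow> s \<noteq> t \<Longrightarrow> dist s t < d \<Longrightarrow> \<epsilon> < f s \<omega>"
      unfolding eventually_at by blast
    have "max 0 (t - d) < min S (t + d)" using d t S by auto
    from Rats_dense_in_real[OF this] obtain q where q: "q \<in> \<rat>" "max 0 (t - d) < q" "q < min S (t + d)"
      by blast
    then have "\<epsilon> < f q \<omega>" using d(2)[of q] t by (cases "q = t") (auto simp: dist_real_def abs_if)
    then show "\<omega> \<in> ?R" using q w by auto
  qed auto
  moreover have "countable {q\<in>\<rat>. 0 \<le> q \<and> q \<le> S}"
    using countable_rat by (rule countable_subset[rotated]) auto
  moreover have "{\<omega>\<in>space M. \<epsilon> < f q \<omega>} \<in> sets M" if "q \<in> {q\<in>\<rat>. 0 \<le> q \<and> q \<le> S}" for q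
  proof -
    have [measurable]: "f q \<in> borel_measurable M" using m[of q] that by auto
    show ?thesis by measurable
  qed
  ultimately show ?thesis by (simp only:) (rule sets.countable_UN'')
qed

lemma set_lebesgue_integral_indicator_Ioc:
  fixes a b t :: real
  assumes "0 \<le> a" "a \<le> b"
  shows "set_integrable lborel {0..t} (indicator {a<..b} :: real \<Rightarrow> real)"
    "(LINT s:{0..t}|lborel. indicator {a<..b} s) = (min t b - min t a :: real)"
proof -
  have e: "indicator {0..t} s *\<^sub>R indicator {a<..b} s = (indicator {min t a<..min t b} s :: real)" for s
    using assms by (auto simp: indicator_def)
  show "set_integrable lborel {0..t} (indicator {a<..b} :: real \<Rightarrow> real)"
    unfolding set_integrable_def e by (intro integrable_real_indicator) (use assms in \<open>auto simp: min_def\<close>)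
  show "(LINT s:{0..t}|lborel. indicator {a<..b} s) = (min t b - min t a :: real)"
    unfolding set_lebesgue_integral_def e using assms by auto
qed

context filtered_prob_space
begin

lemma simple_process_measurable:
  "simple_process M F N p \<xi> \<Longrightarrow> i < N \<Longrightarrow> \<xi> i \<in> borel_measurable (F (p i))"
  by (auto simp: simple_process_def)

lemma simple_val_sq:
  assumes S: "simple_process M F N p \<xi>"
  shows "(simple_val N p \<xi> s \<omega>)\<^sup>2 = (\<Sum>i<N. indicator {p i<..p (Suc i)} s * (\<xi> i \<omega>)\<^sup>2)"
proof -
  have dis: "indicator {p i<..p (Suc i)} s * \<xi> i \<omega> * (indicator {p j<..p (Suc j)} s * \<xi> j \<omega>) = 0"
    if "i < j" "j < N" for i j
    using simple_process_le[OF S, of "Suc i" j] that by (auto simp: indicator_def)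
  have e: "simple_val N p \<xi> s \<omega> = (\<Sum>i<N. indicator {p i<..p (Suc i)} s * \<xi> i \<omega>)"
    unfolding simple_val_def by (intro sum.cong) (auto simp: indicator_def)
  have "(simple_val N p \<xi> s \<omega>)\<^sup>2 = (\<Sum>i<N. \<Sum>j<N. indicator {p i<..p (Suc i)} s * \<xi> i \<omega> * (indicator {p j<..p (Suc j)} s * \<xi> j \<omega>))"
    unfolding e power2_eq_square sum_product ..
  also have "\<dots> = (\<Sum>i<N. \<Sum>j<N. if i = j then indicator {p i<..p (Suc i)} s * (\<xi> i \<omega>)\<^sup>2 else 0)"
  proof (intro sum.cong refl)
    fix i j assume "i \<in> {..<N}" "j \<in> {..<N}"
    then show "indicator {p i<..p (Suc i)} s * \<xi> i \<omega> * (indicator {p j<..p (Suc j)} s * \<xi> j \<omega>) =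
      (if i = j then indicator {p i<..p (Suc i)} s * (\<xi> i \<omega>)\<^sup>2 else 0)"
      using dis[of i j] dis[of j i]
      by (cases i j rule: linorder_cases) (auto simp: indicator_def power2_eq_square)
  qed
  finally show ?thesis by simp
qed

lemma simple_val_sq_integral:
  assumes S: "simple_process M F N p \<xi>"
  shows "set_integrable lborel {0..t} (\<lambda>s. (simple_val N p \<xi> s \<omega>)\<^sup>2)"
    "(LINT s:{0..t}|lborel. (simple_val N p \<xi> s \<omega>)\<^sup>2) = (\<Sum>i<N. (\<xi> i \<omega>)\<^sup>2 * (min t (p (Suc i)) - min t (p i)))"
proof -
  have p: "0 \<le> p i" "p i \<le> p (Suc i)" if "i < N" for i
    using simple_process_nonneg[OF S] S that by (auto simp: simple_process_def)
  have e: "(\<lambda>s. (simple_val N p \<xi> s \<omega>)\<^sup>2) = (\<lambda>s. \<Sum>i<N. indicator {p i<..p (Suc i)} s * (\<xi> i \<omega>)\<^sup>2)"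
    using simple_val_sq[OF S] by blast
  have i: "set_integrable lborel {0..t} (\<lambda>s. indicator {p i<..p (Suc i)} s * (\<xi> i \<omega>)\<^sup>2)" if "i < N" for i
    using set_lebesgue_integral_indicator_Ioc(1)[OF p[OF that], of t]
    by (intro set_integrable_mult_left) auto
  show "set_integrable lborel {0..t} (\<lambda>s. (simple_val N p \<xi> s \<omega>)\<^sup>2)"
    unfolding e using i by (intro set_integral_finite_sum) auto
  show "(LINT s:{0..t}|lborel. (simple_val N p \<xi> s \<omega>)\<^sup>2) = (\<Sum>i<N. (\<xi> i \<omega>)\<^sup>2 * (min t (p (Suc i)) - min t (p i)))"
    unfolding e using i set_lebesgue_integral_indicator_Ioc(2)[OF p, of _ t]
    by (subst set_integral_finite_sum) (auto intro!: sum.cong)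
qed

lemma simple_val_measurable:
  assumes S: "simple_process M F N p \<xi>"
  shows "(\<lambda>(\<omega>, s). simple_val N p \<xi> s \<omega>) \<in> borel_measurable (M \<Otimes>\<^sub>M lborel)"
proof -
  have [measurable]: "\<xi> i \<in> borel_measurable M" if "i \<in> {..<N}" for i
    using measurable_F_M[OF simple_process_nonneg[OF S] simple_process_measurable[OF S]] that by auto
  show ?thesis unfolding simple_val_def by measurable
qed

text \<open>Progressive measurability at the single time S suffices for joint measurability once the
  process is extended by zero outside [0,S]. This is the form from which time integrals inherit
  measurability in \<omega>.\<close>

lemma progressive_measurable:
  assumes "progressive F S H" "0 \<le> S"
  shows "(\<lambda>(\<omega>, s). if s \<in> {0..S} then H s \<omega> else 0) \<in> borel_measurable (M \<Otimes>\<^sub>M lborel)" (is "?f \<in> _")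
proof (rule measurable_piecewise_restrict[of "{space M \<times> {0..S}, space M \<times> (- {0..S})}"])
  fix \<Omega> assume \<Omega>: "\<Omega> \<in> {space M \<times> {0..S}, space M \<times> (- {0..S})}"
  then show "\<Omega> \<inter> space (M \<Otimes>\<^sub>M lborel) \<in> sets (M \<Otimes>\<^sub>M lborel)"
    by (auto simp: space_pair_measure intro!: sets.Int)
  let ?R = "restrict_space (M \<Otimes>\<^sub>M lborel) \<Omega>"
  show "?f \<in> borel_measurable ?R"
  proof (cases "\<Omega> = space M \<times> {0..S}")
    case True
    have a: "(\<lambda>x. snd x) \<in> measurable ?R (restrict_space borel {0..S})"
      using True by (intro measurable_restrict_space2 measurable_restrict_space1) (auto simp: space_restrict_space)
    have "(\<lambda>x. x) \<in> measurable M (F S)"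
      using subalg[OF assms(2)] by (auto simp: measurable_def subalgebra_def)
    then have b: "(\<lambda>x. fst x) \<in> measurable ?R (F S)"
      by (intro measurable_restrict_space1 measurable_compose[OF measurable_fst])
    have "(\<lambda>(s, \<omega>). H s \<omega>) \<in> borel_measurable (restrict_space borel {0..S} \<Otimes>\<^sub>M F S)"
      using assms by (auto simp: progressive_def)
    from measurable_compose[OF measurable_Pair[OF a b] this]
    have "(\<lambda>x. H (snd x) (fst x)) \<in> borel_measurable ?R" by simp
    then show ?thesis
      by (rule measurable_cong[THEN iffD1, rotated]) (use True in \<open>auto simp: space_restrict_space\<close>)
  next
    case False
    then have "\<Omega> = space M \<times> (- {0..S})" using \<Omega> by auto
    then have "(\<lambda>x. 0::real) \<in> borel_measurable ?R" "\<And>x. x \<in> space ?R \<Longrightarrow> 0 = ?f x"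
      by (auto simp: space_restrict_space split: prod.split)
    then show ?thesis by (rule measurable_cong[THEN iffD1, rotated]) auto
  qed
qed (auto simp: space_pair_measure)

text \<open>The approximating simple processes converge in probability only.  Switching them off once their
  energy exceeds K bounds all their second moments, and does not affect the limit because the
  integrand is bounded.\<close>

definition truncate_simple :: "real \<Rightarrow> real \<Rightarrow> (nat \<Rightarrow> real) \<Rightarrow> (nat \<Rightarrow> 'w \<Rightarrow> real) \<Rightarrow> nat \<Rightarrow> 'w \<Rightarrow> real" where
  "truncate_simple S K p \<xi> i \<omega> =
     (if (\<Sum>k\<le>i. (\<xi> k \<omega>)\<^sup>2 * (min S (p (Suc k)) - min S (p k))) \<le> K then \<xi> i \<omega> else 0)"

lemma truncate_simple_process:
  assumes S: "simple_process M F N p \<xi>"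
  shows "simple_process M F N p (truncate_simple S K p \<xi>)"
  unfolding simple_process_def
proof (intro conjI allI impI)
  show "0 \<le> p 0" using S by (auto simp: simple_process_def)
  fix i assume i: "i < N"
  show "p i \<le> p (Suc i)" using S i by (auto simp: simple_process_def)
  obtain C where C: "\<forall>\<omega>\<in>space M. \<bar>\<xi> i \<omega>\<bar> \<le> C" using S i by (auto simp: simple_process_def)
  then have "\<forall>\<omega>\<in>space M. \<bar>truncate_simple S K p \<xi> i \<omega>\<bar> \<le> \<bar>C\<bar>" by (force simp: truncate_simple_def)
  then show "\<exists>B. \<forall>\<omega>\<in>space M. \<bar>truncate_simple S K p \<xi> i \<omega>\<bar> \<le> B" ..
  have m: "\<xi> k \<in> borel_measurable (F (p i))" if "k \<le> i" for k
    using measurable_F_mono[OF simple_process_nonneg[OF S] simple_process_le[OF S that] simple_process_measurable[OF S]]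
      that i by simp
  \<comment> \<open>The energy compared with K includes cell i, which ends only at
    \<open>p (Suc i)\<close>. Its value is nevertheless known at \<open>p i\<close>, since
    \<open>\<xi> i\<close> is known there and cell lengths are deterministic; so the switch acts
    before the bound is exceeded and remains adapted.\<close>
  have "(\<lambda>\<omega>. \<Sum>k\<le>i. (\<xi> k \<omega>)\<^sup>2 * (min S (p (Suc k)) - min S (p k))) \<in> borel_measurable (F (p i))"
    using m by (intro borel_measurable_sum borel_measurable_times borel_measurable_power) auto
  then show "truncate_simple S K p \<xi> i \<in> borel_measurable (F (p i))"
    unfolding truncate_simple_def using m[of i] by measurable
qed

lemma truncate_simple_le:
  assumes S: "simple_process M F N p \<xi>" and K: "0 \<le> K"
  shows "(\<Sum>i<N. (truncate_simple S K p \<xi> i \<omega>)\<^sup>2 * (min S (p (Suc i)) - min S (p i))) \<le> K"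
proof -
  let ?d = "\<lambda>i. min S (p (Suc i)) - min S (p i)"
  have d: "0 \<le> ?d i" if "i < N" for i using S that by (auto simp: simple_process_def min_def)
  have le: "(\<Sum>i<n. (truncate_simple S K p \<xi> i \<omega>)\<^sup>2 * ?d i) \<le> (\<Sum>i<n. (\<xi> i \<omega>)\<^sup>2 * ?d i)" if "n \<le> N" for n
    using d that by (intro sum_mono mult_right_mono) (auto simp: truncate_simple_def)
  have "(\<Sum>i<n. (truncate_simple S K p \<xi> i \<omega>)\<^sup>2 * ?d i) \<le> K" if "n \<le> N" for n
    using that
  proof (induction n)
    case (Suc n)
    show ?case
    \<comment> \<open>As long as the original energy is at most K it dominates the truncated one.
      Once it exceeds K the new term is zero, and the induction hypothesis suffices.\<close>
    proof (cases "(\<Sum>k\<le>n. (\<xi> k \<omega>)\<^sup>2 * ?d k) \<le> K")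
      case True
      then show ?thesis using le[OF Suc.prems] by (simp add: lessThan_Suc_atMost)
    next
      case False
      then have "truncate_simple S K p \<xi> n \<omega> = 0" by (simp add: truncate_simple_def)
      then show ?thesis using Suc by simp
    qed
  qed (use K in simp)
  then show ?thesis by simp
qed

lemma truncate_simple_eq:
  assumes S: "simple_process M F N p \<xi>"
    and K: "(\<Sum>i<N. (\<xi> i \<omega>)\<^sup>2 * (min S (p (Suc i)) - min S (p i))) \<le> K" and i: "i < N"
  shows "truncate_simple S K p \<xi> i \<omega> = \<xi> i \<omega>"
proof -
  let ?d = "\<lambda>i. min S (p (Suc i)) - min S (p i)"
  have d: "0 \<le> ?d i" if "i < N" for i using S that by (auto simp: simple_process_def min_def)
  have "(\<Sum>k\<le>i. (\<xi> k \<omega>)\<^sup>2 * ?d k) \<le> (\<Sum>k<N. (\<xi> k \<omega>)\<^sup>2 * ?d k)"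
    using i d by (intro sum_mono2) auto
  then show ?thesis using K by (simp add: truncate_simple_def)
qed

lemma wiener_continuous:
  "wiener_process M F W \<Longrightarrow> \<omega> \<in> space M \<Longrightarrow> continuous_on {0..} (\<lambda>t. W t \<omega>)"
  by (auto simp: wiener_process_def)

text \<open>Upgrades approximation in probability to almost sure convergence along a subsequence.
  The energy bound K holds for every path and every k, so that the approximating integrals have
  uniformly bounded second moments.\<close>

lemma ito_approximation:
  assumes W: "wiener_process M F W" and S: "0 < S" and ito: "has_ito_integral M F W S H I"
    and C: "AE \<omega> in M. \<forall>s\<in>{0..S}. \<bar>H s \<omega>\<bar> \<le> C"
  obtains N p \<xi> K where "\<And>k. simple_process M F (N k) (p k) (\<xi> k)" "0 \<le> K"
    "\<And>k \<omega>. (\<Sum>i<N k. (\<xi> k i \<omega>)\<^sup>2 * (min S (p k (Suc i)) - min S (p k i))) \<le> K"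
    "AE \<omega> in M. (\<lambda>k. LINT s:{0..S}|lborel. (simple_val (N k) (p k) (\<xi> k) s \<omega> - H s \<omega>)\<^sup>2) \<longlonglongrightarrow> 0"
    "AE \<omega> in M. \<forall>t\<in>{0..S}. (\<lambda>k. simple_integral W (N k) (p k) (\<xi> k) t \<omega>) \<longlonglongrightarrow> I t \<omega>"
proof -
  from ito have prog: "progressive F S H" and cI: "continuous_adapted M F S I"
    unfolding has_ito_integral_def by blast+
  from ito obtain N p \<xi> where sp': "\<forall>j. simple_process M F (N j) (p j) (\<xi> j)"
    and l1': "\<forall>\<epsilon>>0. (\<lambda>j. measure M {\<omega>\<in>space M. ennreal \<epsilon> <
            (\<integral>\<^sup>+ s\<in>{0..S}. ennreal ((simple_val (N j) (p j) (\<xi> j) s \<omega> - H s \<omega>)\<^sup>2) \<partial>lborel)})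
          \<longlonglongrightarrow> 0"
    and l2': "\<forall>\<epsilon>>0. (\<lambda>j. measure M {\<omega>\<in>space M. \<exists>t\<in>{0..S}.
            \<epsilon> < \<bar>simple_integral W (N j) (p j) (\<xi> j) t \<omega> - I t \<omega>\<bar>}) \<longlonglongrightarrow> 0"
    unfolding has_ito_integral_def by blast
  note sp = sp'[rule_format] and l1 = l1'[rule_format] and l2 = l2'[rule_format]
  define d where "d j \<omega> = (\<integral>\<^sup>+ s\<in>{0..S}. ennreal ((simple_val (N j) (p j) (\<xi> j) s \<omega> - H s \<omega>)\<^sup>2) \<partial>lborel)" for j \<omega>
  define H' where "H' \<omega> s = (if s \<in> {0..S} then H s \<omega> else 0)" for \<omega> s
  have H'm[measurable]: "case_prod H' \<in> borel_measurable (M \<Otimes>\<^sub>M lborel)"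
    using progressive_measurable[OF prog] S by (simp add: H'_def case_prod_beta')
  have svm[measurable]: "(\<lambda>(\<omega>, s). simple_val (N j) (p j) (\<xi> j) s \<omega>) \<in> borel_measurable (M \<Otimes>\<^sub>M lborel)" for j
    using simple_val_measurable[OF sp] .
  have dm[measurable]: "d j \<in> borel_measurable M" for j
  proof -
    have "(\<lambda>(\<omega>, s). ennreal (((\<lambda>(\<omega>, s). simple_val (N j) (p j) (\<xi> j) s \<omega>) (\<omega>, s) - case_prod H' (\<omega>, s))\<^sup>2) * indicator {0..S} s)
       \<in> borel_measurable (M \<Otimes>\<^sub>M lborel)" by measurable
    then have "(\<lambda>\<omega>. \<integral>\<^sup>+ s. ennreal ((simple_val (N j) (p j) (\<xi> j) s \<omega> - H' \<omega> s)\<^sup>2) * indicator {0..S} s \<partial>lborel) \<in> borel_measurable M"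
      by (intro lborel.borel_measurable_nn_integral) simp
    moreover have "d j = (\<lambda>\<omega>. \<integral>\<^sup>+ s. ennreal ((simple_val (N j) (p j) (\<xi> j) s \<omega> - H' \<omega> s)\<^sup>2) * indicator {0..S} s \<partial>lborel)"
      unfolding d_def H'_def by (intro ext nn_integral_cong) (auto simp: indicator_def)
    ultimately show ?thesis by simp
  qed
  define B where "B j \<epsilon> = {\<omega>\<in>space M. \<exists>t\<in>{0..S}. \<epsilon> < \<bar>simple_integral W (N j) (p j) (\<xi> j) t \<omega> - I t \<omega>\<bar>}" for j \<epsilon>
  have Bm: "B j \<epsilon> \<in> sets M" for j \<epsilon>
    unfolding B_def
  proof (rule sets_ex_continuous_gt[OF S, where f = "\<lambda>t \<omega>. \<bar>simple_integral W (N j) (p j) (\<xi> j) t \<omega> - I t \<omega>\<bar>"])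
    fix t assume t: "t \<in> {0..S}"
    have "I t \<in> borel_measurable M" using cI t by (intro measurable_F_M[of t]) (auto simp: continuous_adapted_def)
    then show "(\<lambda>\<omega>. \<bar>simple_integral W (N j) (p j) (\<xi> j) t \<omega> - I t \<omega>\<bar>) \<in> borel_measurable M"
      using simple_integral_measurable[OF W sp, of t j] t by auto
  next
    fix \<omega> assume w: "\<omega> \<in> space M"
    have "continuous_on {0..S} (\<lambda>t. W (min t q) \<omega>)" if "0 \<le> q" for q
      using that by (intro continuous_on_compose2[OF wiener_continuous[OF W w]] continuous_intros) auto
    then have "continuous_on {0..S} (\<lambda>t. simple_integral W (N j) (p j) (\<xi> j) t \<omega>)"
      unfolding simple_integral_def using simple_process_nonneg[OF sp]
      by (intro continuous_intros) auto
    then show "continuous_on {0..S} (\<lambda>t. \<bar>simple_integral W (N j) (p j) (\<xi> j) t \<omega> - I t \<omega>\<bar>)"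
      using cI w by (intro continuous_intros) (auto simp: continuous_adapted_def)
  qed
  \<comment> \<open>The union lets one subsequence control the error of the integrand and the
    uniform error of the integrals together.\<close>
  define A where "A j \<epsilon> = {\<omega>\<in>space M. ennreal \<epsilon> < d j \<omega>} \<union> B j \<epsilon>" for j \<epsilon>
  have Am: "A j \<epsilon> \<in> sets M" for j \<epsilon> unfolding A_def using Bm by measurable
  have "(\<lambda>j. prob (A j \<epsilon>)) \<longlonglongrightarrow> 0" if e: "\<epsilon> > 0" for \<epsilon>
  proof (rule tendsto_sandwich[OF _ _ tendsto_const])
    show "(\<lambda>j. measure M {\<omega>\<in>space M. ennreal \<epsilon> < d j \<omega>} + measure M (B j \<epsilon>)) \<longlonglongrightarrow> 0"
      using tendsto_add[OF l1[OF e] l2[OF e]] by (simp add: d_def B_def)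
    show "eventually (\<lambda>j. prob (A j \<epsilon>) \<le> measure M {\<omega>\<in>space M. ennreal \<epsilon> < d j \<omega>} + measure M (B j \<epsilon>)) sequentially"
      unfolding A_def using Bm by (intro always_eventually allI measure_Un_le) auto
  qed auto
  then have "\<exists>r. AE \<omega> in M. eventually (\<lambda>k. \<omega> \<notin> A (r k) ((1/2)^k)) sequentially"
    by (intro AE_eventually_notin_subsequence Am)
  then obtain r where
    r: "AE \<omega> in M. eventually (\<lambda>k. \<omega> \<notin> A (r k) ((1/2)^k)) sequentially" by blast
  \<comment> \<open>Off the exceptional event the error of the integrand is at most 1, and H^2
    integrates to at most C^2 S. By x^2 <= 2 (x - h)^2 + 2 h^2 the energy of the approximants is
    then at most K, so on almost every path the truncation eventually changes nothing.\<close>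
  define K where "K = 2 + 2 * (C\<^sup>2 * S)"
  have K: "0 \<le> K" unfolding K_def using S by simp
  define \<xi>' where "\<xi>' k = truncate_simple S K (p (r k)) (\<xi> (r k))" for k
  have AE: "AE \<omega> in M. (\<lambda>k. LINT s:{0..S}|lborel. (simple_val (N (r k)) (p (r k)) (\<xi>' k) s \<omega> - H s \<omega>)\<^sup>2) \<longlonglongrightarrow> 0 \<and>
     (\<forall>t\<in>{0..S}. (\<lambda>k. simple_integral W (N (r k)) (p (r k)) (\<xi>' k) t \<omega>) \<longlonglongrightarrow> I t \<omega>)"
    using r C AE_space
  proof eventually_elim
    case (elim \<omega>)
    define h where "h = H' \<omega>"
    have hm[measurable]: "h \<in> borel_measurable lborel"
      unfolding h_def using measurable_compose[OF measurable_Pair1'[OF elim(3)] H'm] by simp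
    have hH: "h s = H s \<omega>" if "s \<in> {0..S}" for s using that by (simp add: h_def H'_def)
    have bd: "(h s)\<^sup>2 \<le> C\<^sup>2" if "s \<in> {0..S}" for s
    proof -
      have "\<bar>h s\<bar> \<le> C" using elim(2) that hH by auto
      then show ?thesis by (meson abs_le_square_iff abs_ge_self order_trans)
    qed
    have h2: "set_integrable lborel {0..S} (\<lambda>s. (h s)\<^sup>2)"
      unfolding set_integrable_def
    proof (rule Bochner_Integration.integrable_bound)
      show "integrable lborel (\<lambda>s. indicator {0..S} s * C\<^sup>2)"
        using S by (intro integrable_mult_left integrable_real_indicator) auto
      show "AE s in lborel. norm (indicator {0..S} s *\<^sub>R (h s)\<^sup>2) \<le> norm (indicator {0..S} s * C\<^sup>2)"
        using bd by (auto simp: indicator_def)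
    qed auto
    have h2le: "(LINT s:{0..S}|lborel. (h s)\<^sup>2) \<le> C\<^sup>2 * S"
    proof -
      have "set_integrable lborel {0..S} (\<lambda>_. C\<^sup>2)"
        unfolding set_integrable_def real_scaleR_def using S by (intro integrable_mult_left integrable_real_indicator) auto
      from set_integral_mono[OF h2 this] have "(LINT s:{0..S}|lborel. (h s)\<^sup>2) \<le> (LINT s:{0..S}|lborel. C\<^sup>2)"
        using bd by auto
      also have "\<dots> = C\<^sup>2 * S" using S by (simp add: set_lebesgue_integral_def)
      finally show ?thesis .
    qed
    define sv where "sv j s = simple_val (N j) (p j) (\<xi> j) s \<omega>" for j s
    have svm'[measurable]: "sv j \<in> borel_measurable lborel" for j
      unfolding sv_def using measurable_compose[OF measurable_Pair1'[OF elim(3)] svm] by simp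
    have sv2: "set_integrable lborel {0..S} (\<lambda>s. (sv j s)\<^sup>2)" for j
      unfolding sv_def by (rule simple_val_sq_integral[OF sp])
    have diff2: "set_integrable lborel {0..S} (\<lambda>s. (sv j s - h s)\<^sup>2)" for j
    proof -
      have "set_integrable lborel {0..S} (\<lambda>s. 2 * (sv j s)\<^sup>2 + 2 * (h s)\<^sup>2)"
        using sv2 h2 by (intro set_integral_add) auto
      then show ?thesis
        unfolding set_integrable_def
      proof (rule Bochner_Integration.integrable_bound)
        have "(sv j s - h s)\<^sup>2 \<le> 2 * (sv j s)\<^sup>2 + 2 * (h s)\<^sup>2" for s
          using zero_le_power2[of "sv j s + h s"] by (simp add: power2_eq_square algebra_simps)
        then show "AE s in lborel. norm (indicator {0..S} s *\<^sub>R (sv j s - h s)\<^sup>2)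
           \<le> norm (indicator {0..S} s *\<^sub>R (2 * (sv j s)\<^sup>2 + 2 * (h s)\<^sup>2))"
          by (auto simp: indicator_def)
      qed measurable
    qed
    have dle: "(LINT s:{0..S}|lborel. (sv (r k) s - h s)\<^sup>2) \<le> (1/2)^k" if k: "\<omega> \<notin> A (r k) ((1/2)^k)" for k
    proof -
      have "d (r k) \<omega> = (\<integral>\<^sup>+ s. ennreal (indicator {0..S} s *\<^sub>R (sv (r k) s - h s)\<^sup>2) \<partial>lborel)"
        unfolding d_def sv_def using hH by (intro nn_integral_cong) (auto simp: indicator_def)
      also have "\<dots> = ennreal (LINT s:{0..S}|lborel. (sv (r k) s - h s)\<^sup>2)"
        unfolding set_lebesgue_integral_def using diff2
        by (intro nn_integral_eq_integral) (auto simp: set_integrable_def)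
      finally show ?thesis using k elim(3) by (auto simp: A_def not_less)
    qed
    have eq: "\<xi>' k i \<omega> = \<xi> (r k) i \<omega>" if k: "\<omega> \<notin> A (r k) ((1/2)^k)" and i: "i < N (r k)" for k i
    proof -
      have "(\<Sum>i<N (r k). (\<xi> (r k) i \<omega>)\<^sup>2 * (min S (p (r k) (Suc i)) - min S (p (r k) i)))
        = (LINT s:{0..S}|lborel. (sv (r k) s)\<^sup>2)"
        unfolding sv_def by (rule simple_val_sq_integral(2)[OF sp, symmetric])
      also have "\<dots> \<le> (LINT s:{0..S}|lborel. 2 * (sv (r k) s - h s)\<^sup>2 + 2 * (h s)\<^sup>2)"
      proof (rule set_integral_mono[OF sv2])
        show "set_integrable lborel {0..S} (\<lambda>s. 2 * (sv (r k) s - h s)\<^sup>2 + 2 * (h s)\<^sup>2)"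
          using diff2 h2 by (intro set_integral_add) auto
        show "(sv (r k) s)\<^sup>2 \<le> 2 * (sv (r k) s - h s)\<^sup>2 + 2 * (h s)\<^sup>2" for s
          using zero_le_power2[of "sv (r k) s - 2 * h s"] by (simp add: power2_eq_square algebra_simps)
      qed
      also have "\<dots> = 2 * (LINT s:{0..S}|lborel. (sv (r k) s - h s)\<^sup>2) + 2 * (LINT s:{0..S}|lborel. (h s)\<^sup>2)"
        using diff2 h2 by (subst set_integral_add(2)) auto
      also have "\<dots> \<le> 2 * (1/2)^k + 2 * (C\<^sup>2 * S)" using dle[OF k] h2le by simp
      also have "\<dots> \<le> K" unfolding K_def by (simp add: power_le_one)
      finally show ?thesis unfolding \<xi>'_def using i by (intro truncate_simple_eq[OF sp]) auto
    qed
    have ev: "eventually (\<lambda>k. (LINT s:{0..S}|lborel. (simple_val (N (r k)) (p (r k)) (\<xi>' k) s \<omega> - H s \<omega>)\<^sup>2) \<le> (1/2)^k \<and>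
        (\<forall>t\<in>{0..S}. \<bar>simple_integral W (N (r k)) (p (r k)) (\<xi>' k) t \<omega> - I t \<omega>\<bar> \<le> (1/2)^k)) sequentially"
      using elim(1)
    proof eventually_elim
      case (elim k)
      have "simple_val (N (r k)) (p (r k)) (\<xi>' k) s \<omega> = sv (r k) s" for s
        unfolding sv_def simple_val_def using eq[OF elim] by (intro sum.cong) auto
      moreover have "simple_integral W (N (r k)) (p (r k)) (\<xi>' k) t \<omega> = simple_integral W (N (r k)) (p (r k)) (\<xi> (r k)) t \<omega>" for t
        unfolding simple_integral_def using eq[OF elim] by (intro sum.cong) auto
      moreover have "(LINT s:{0..S}|lborel. (sv (r k) s - H s \<omega>)\<^sup>2) = (LINT s:{0..S}|lborel. (sv (r k) s - h s)\<^sup>2)"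
        using hH by (intro set_lebesgue_integral_cong) auto
      ultimately show ?case using dle[OF elim] elim \<open>\<omega> \<in> space M\<close> by (auto simp: A_def B_def not_less)
    qed
    have pw: "(\<lambda>k. (1/2::real)^k) \<longlonglongrightarrow> 0" by (rule LIMSEQ_realpow_zero) auto
    show ?case
    proof (intro conjI ballI)
      show "(\<lambda>k. LINT s:{0..S}|lborel. (simple_val (N (r k)) (p (r k)) (\<xi>' k) s \<omega> - H s \<omega>)\<^sup>2) \<longlonglongrightarrow> 0"
      proof (rule tendsto_sandwich[OF _ _ tendsto_const pw])
        show "eventually (\<lambda>k. 0 \<le> (LINT s:{0..S}|lborel. (simple_val (N (r k)) (p (r k)) (\<xi>' k) s \<omega> - H s \<omega>)\<^sup>2)) sequentially"
          by (intro always_eventually allI) (simp add: set_lebesgue_integral_def)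
        show "eventually (\<lambda>k. (LINT s:{0..S}|lborel. (simple_val (N (r k)) (p (r k)) (\<xi>' k) s \<omega> - H s \<omega>)\<^sup>2) \<le> (1/2)^k) sequentially"
          using ev by (auto elim: eventually_mono)
      qed
      fix t assume t: "t \<in> {0..S}"
      have "(\<lambda>k. simple_integral W (N (r k)) (p (r k)) (\<xi>' k) t \<omega> - I t \<omega>) \<longlonglongrightarrow> 0"
        by (rule Lim_null_comparison[OF _ pw]) (use ev t in \<open>auto elim: eventually_mono\<close>)
      then show "(\<lambda>k. simple_integral W (N (r k)) (p (r k)) (\<xi>' k) t \<omega>) \<longlonglongrightarrow> I t \<omega>"
        by (rule LIM_zero_cancel)
    qed
  qed
  show ?thesis
  proof (rule that[of "\<lambda>k. N (r k)" "\<lambda>k. p (r k)" \<xi>' K])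
    show "simple_process M F (N (r k)) (p (r k)) (\<xi>' k)" for k
      unfolding \<xi>'_def by (rule truncate_simple_process[OF sp])
    show "(\<Sum>i<N (r k). (\<xi>' k i \<omega>)\<^sup>2 * (min S (p (r k) (Suc i)) - min S (p (r k) i))) \<le> K" for k \<omega>
      unfolding \<xi>'_def by (rule truncate_simple_le[OF sp K])
  qed (use AE K in \<open>simp_all add: AE_conj_iff\<close>)
qed

end

section \<open>Null sets, limits in mean square and the martingale property\<close>

context filtered_prob_space
begin

lemma complete: "complete_measure M"
  using usual by (auto simp: usual_filtration_def)

lemma null_subset:
  assumes "AE \<omega> in M. P \<omega>"
  shows "A \<subseteq> {\<omega>\<in>space M. \<not> P \<omega>} \<Longrightarrow> A \<in> null_sets M"
  using assms complete complete_measure.AE_iff_null_sets complete_measure.complete2 by blast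

text \<open>Completeness puts all subsets of an exceptional set among the null sets, and these
  belong to G. A modification on a null set therefore keeps measurability, not only for M but for
  every \<open>F r\<close>.\<close>

lemma borel_measurable_AE_eq:
  fixes f g :: "'w \<Rightarrow> real"
  assumes G: "space G = space M" "null_sets M \<subseteq> sets G" and g: "g \<in> borel_measurable G"
    and eq: "AE \<omega> in M. f \<omega> = g \<omega>"
  shows "f \<in> borel_measurable G"
proof (rule measurableI)
  fix A :: "real set" assume A: "A \<in> sets borel"
  let ?N = "{\<omega>\<in>space M. \<not> f \<omega> = g \<omega>}"
  have N: "B \<in> sets G" if "B \<subseteq> ?N" for B using null_subset[OF eq that] G by auto
  have "f -` A \<inter> space G = ((g -` A \<inter> space G) - ?N) \<union> (f -` A \<inter> ?N)" using G by auto
  also have "\<dots> \<in> sets G" using N[of ?N] N[of "f -` A \<inter> ?N"] measurable_sets[OF g A] by auto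
  finally show "f -` A \<inter> space G \<in> sets G" .
qed simp

lemma borel_measurable_M_AE_eq:
  fixes f g :: "'w \<Rightarrow> real"
  shows "g \<in> borel_measurable M \<Longrightarrow> AE \<omega> in M. f \<omega> = g \<omega> \<Longrightarrow> f \<in> borel_measurable M"
  by (rule borel_measurable_AE_eq[of M]) auto

lemma borel_measurable_F_AE_eq:
  fixes f g :: "'w \<Rightarrow> real"
  assumes "0 \<le> r" "g \<in> borel_measurable (F r)" "AE \<omega> in M. f \<omega> = g \<omega>"
  shows "f \<in> borel_measurable (F r)"
proof (rule borel_measurable_AE_eq[OF _ _ assms(2,3)])
  show "null_sets M \<subseteq> sets (F r)" using usual F_mono[of 0 r] assms(1) unfolding usual_filtration_def by blast
qed (use space_F assms in auto)

lemma borel_measurable_AE_LIMSEQ: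
  fixes f :: "'w \<Rightarrow> real"
  assumes G: "space G = space M" "null_sets M \<subseteq> sets G"
    and f: "\<And>k. fk k \<in> borel_measurable G" and l: "AE \<omega> in M. (\<lambda>k. fk k \<omega>) \<longlonglongrightarrow> f \<omega>"
  shows "f \<in> borel_measurable G"
proof (rule borel_measurable_AE_eq[OF G])
  show "(\<lambda>\<omega>. lim (\<lambda>k. fk k \<omega>)) \<in> borel_measurable G" using f by (rule borel_measurable_lim_metric)
  show "AE \<omega> in M. f \<omega> = lim (\<lambda>k. fk k \<omega>)" using l by eventually_elim (simp add: limI)
qed

text \<open>Lower semicontinuity of the second moment under almost sure convergence. The bounds may
  depend on j, so that only their limit enters: this is how an approximation error disappears from
  an energy bound.\<close>

lemma Fatou_square:
  fixes Y :: "'w \<Rightarrow> real"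
  assumes m: "\<And>j. Yj j \<in> borel_measurable M" and i: "\<And>j. integrable M (\<lambda>\<omega>. (Yj j \<omega>)\<^sup>2)"
    and le: "\<And>j. (\<integral>\<omega>. (Yj j \<omega>)\<^sup>2 \<partial>M) \<le> c j" and c: "c \<longlonglongrightarrow> c0"
    and lim: "AE \<omega> in M. (\<lambda>j. Yj j \<omega>) \<longlonglongrightarrow> Y \<omega>"
  shows "Y \<in> borel_measurable M" "integrable M (\<lambda>\<omega>. (Y \<omega>)\<^sup>2)" "(\<integral>\<omega>. (Y \<omega>)\<^sup>2 \<partial>M) \<le> c0"
proof -
  show Y[measurable]: "Y \<in> borel_measurable M"
    by (rule borel_measurable_AE_LIMSEQ[OF _ _ m lim]) auto
  note m[measurable]
  have c0: "0 \<le> c0"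
  proof (rule LIMSEQ_le_const[OF c])
    have "0 \<le> c j" for j using order_trans[OF Bochner_Integration.integral_nonneg le[of j]] by simp
    then show "\<exists>N. \<forall>n\<ge>N. 0 \<le> c n" by blast
  qed
  have "(\<integral>\<^sup>+\<omega>. ennreal ((Y \<omega>)\<^sup>2) \<partial>M) = (\<integral>\<^sup>+\<omega>. liminf (\<lambda>j. ennreal ((Yj j \<omega>)\<^sup>2)) \<partial>M)"
  proof (rule nn_integral_cong_AE)
    show "AE \<omega> in M. ennreal ((Y \<omega>)\<^sup>2) = liminf (\<lambda>j. ennreal ((Yj j \<omega>)\<^sup>2))"
      using lim
    proof eventually_elim
      case (elim \<omega>)
      have "(\<lambda>j. ennreal ((Yj j \<omega>)\<^sup>2)) \<longlonglongrightarrow> ennreal ((Y \<omega>)\<^sup>2)"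
        by (intro tendsto_ennrealI tendsto_power elim)
      from lim_imp_Liminf[OF _ this] show ?case by simp
    qed
  qed
  also have "\<dots> \<le> liminf (\<lambda>j. \<integral>\<^sup>+\<omega>. ennreal ((Yj j \<omega>)\<^sup>2) \<partial>M)"
    by (rule nn_integral_liminf) auto
  also have "\<dots> \<le> liminf (\<lambda>j. ennreal (c j))"
    using le i by (intro Liminf_mono always_eventually allI) (simp add: nn_integral_eq_integral ennreal_leI)
  also have "\<dots> = ennreal c0"
    using c by (intro lim_imp_Liminf tendsto_ennrealI) auto
  finally have fin: "(\<integral>\<^sup>+\<omega>. ennreal ((Y \<omega>)\<^sup>2) \<partial>M) \<le> ennreal c0" .
  show int: "integrable M (\<lambda>\<omega>. (Y \<omega>)\<^sup>2)"
    using fin by (intro integrableI_bounded) (auto simp: le_less_trans)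
  show "(\<integral>\<omega>. (Y \<omega>)\<^sup>2 \<partial>M) \<le> c0"
    using fin nn_integral_eq_integral[OF int] c0 by simp
qed

text \<open>A uniform bound on second moments gives uniform integrability, and with it almost sure
  convergence becomes convergence in mean.\<close>

lemma L2_bounded_expectation_tendsto:
  fixes Y :: "'w \<Rightarrow> real"
  assumes m: "\<And>j. Yj j \<in> borel_measurable M" and i: "\<And>j. integrable M (\<lambda>\<omega>. (Yj j \<omega>)\<^sup>2)"
    and le: "\<And>j. (\<integral>\<omega>. (Yj j \<omega>)\<^sup>2 \<partial>M) \<le> K"
    and lim: "AE \<omega> in M. (\<lambda>j. Yj j \<omega>) \<longlonglongrightarrow> Y \<omega>"
    and Z: "Z \<in> borel_measurable M" "\<forall>\<omega>\<in>space M. \<bar>Z \<omega>\<bar> \<le> B"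
  shows "(\<lambda>j. \<integral>\<omega>. Z \<omega> * Yj j \<omega> \<partial>M) \<longlonglongrightarrow> (\<integral>\<omega>. Z \<omega> * Y \<omega> \<partial>M)"
proof -
  note F = Fatou_square[OF m i le tendsto_const lim]
  note [measurable] = m F(1) Z(1)
  obtain \<omega>0 where "\<omega>0 \<in> space M" using not_empty by blast
  then have B: "0 \<le> B" using Z(2) by force
  have Yi: "integrable M Y" "integrable M (Yj j)" for j
    using square_integrable_imp_integrable F i m by blast+
  define D where "D j \<omega> = Yj j \<omega> - Y \<omega>" for j \<omega>
  have D[measurable]: "D j \<in> borel_measurable M" for j unfolding D_def by measurable
  have Di: "integrable M (D j)" for j unfolding D_def using Yi by auto
  have D2: "integrable M (\<lambda>\<omega>. (D j \<omega>)\<^sup>2)" "(\<integral>\<omega>. (D j \<omega>)\<^sup>2 \<partial>M) \<le> 4 * K" for j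
  proof -
    have p: "(D j \<omega>)\<^sup>2 \<le> 2 * (Yj j \<omega>)\<^sup>2 + 2 * (Y \<omega>)\<^sup>2" for \<omega>
      unfolding D_def using zero_le_power2[of "Yj j \<omega> + Y \<omega>"] by (simp add: power2_eq_square algebra_simps)
    show int: "integrable M (\<lambda>\<omega>. (D j \<omega>)\<^sup>2)"
      by (rule Bochner_Integration.integrable_bound[of _ "\<lambda>\<omega>. 2 * (Yj j \<omega>)\<^sup>2 + 2 * (Y \<omega>)\<^sup>2"]) (use i F p in auto)
    have "(\<integral>\<omega>. (D j \<omega>)\<^sup>2 \<partial>M) \<le> (\<integral>\<omega>. 2 * (Yj j \<omega>)\<^sup>2 + 2 * (Y \<omega>)\<^sup>2 \<partial>M)"
      using int i F p by (intro integral_mono) auto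
    also have "\<dots> \<le> 4 * K" using i F le[of j] by simp
    finally show "(\<integral>\<omega>. (D j \<omega>)\<^sup>2 \<partial>M) \<le> 4 * K" .
  qed
  have K: "0 \<le> K" using order_trans[OF Bochner_Integration.integral_nonneg D2(2)[of 0]] by simp
  have D0: "(\<lambda>j. \<integral>\<omega>. \<bar>D j \<omega>\<bar> \<partial>M) \<longlonglongrightarrow> 0"
  proof (rule LIMSEQ_I)
    fix \<epsilon> :: real assume \<epsilon>: "0 < \<epsilon>"
    \<comment> \<open>Truncation level. By (x - y)^2 <= 2 x^2 + 2 y^2 the difference has second
      moment at most 4 K, so the part above R costs at most 4 (K + 1) / R = \<epsilon> / 2. Taking K
      + 1 keeps R positive when K = 0.\<close>
    define R where "R = 8 * (K + 1) / \<epsilon>"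
    have R: "0 < R" using K \<epsilon> by (simp add: R_def)
    have "(\<lambda>j. \<integral>\<omega>. min \<bar>D j \<omega>\<bar> R \<partial>M) \<longlonglongrightarrow> (\<integral>\<omega>. 0 \<partial>M)"
    proof (rule integral_dominated_convergence[where w="\<lambda>_. R"])
      show "AE \<omega> in M. (\<lambda>j. min \<bar>D j \<omega>\<bar> R) \<longlonglongrightarrow> 0"
        using lim
      proof eventually_elim
        case (elim \<omega>)
        have "(\<lambda>j. min \<bar>D j \<omega>\<bar> R) \<longlonglongrightarrow> min \<bar>Y \<omega> - Y \<omega>\<bar> R"
          unfolding D_def by (intro tendsto_min tendsto_const tendsto_rabs tendsto_diff elim)
        then show ?case using R by simp
      qed
    qed (use R in auto)
    then have "eventually (\<lambda>j. (\<integral>\<omega>. min \<bar>D j \<omega>\<bar> R \<partial>M) < \<epsilon> / 2) sequentially"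
      using \<epsilon> by (intro order_tendstoD) auto
    then obtain n where n: "\<And>j. j \<ge> n \<Longrightarrow> (\<integral>\<omega>. min \<bar>D j \<omega>\<bar> R \<partial>M) < \<epsilon> / 2"
      by (auto simp: eventually_sequentially)
    have "norm ((\<integral>\<omega>. \<bar>D j \<omega>\<bar> \<partial>M) - 0) < \<epsilon>" if "j \<ge> n" for j
    proof -
      have p: "\<bar>x\<bar> \<le> min \<bar>x\<bar> R + x\<^sup>2 / R" for x :: real
      proof (cases "\<bar>x\<bar> \<le> R")
        case False
        then have "R * \<bar>x\<bar> \<le> \<bar>x\<bar> * \<bar>x\<bar>" by (intro mult_right_mono) auto
        then have "\<bar>x\<bar> \<le> x\<^sup>2 / R" using R by (simp add: field_simps power2_eq_square)
        then show ?thesis using R by simp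
      qed (use R in simp)
      have mi: "integrable M (\<lambda>\<omega>. min \<bar>D j \<omega>\<bar> R)"
        by (rule integrable_const_bound[of _ R]) (use R in auto)
      have "(\<integral>\<omega>. \<bar>D j \<omega>\<bar> \<partial>M) \<le> (\<integral>\<omega>. min \<bar>D j \<omega>\<bar> R + (D j \<omega>)\<^sup>2 / R \<partial>M)"
        using Di D2 mi p by (intro integral_mono) auto
      also have "\<dots> = (\<integral>\<omega>. min \<bar>D j \<omega>\<bar> R \<partial>M) + (\<integral>\<omega>. (D j \<omega>)\<^sup>2 \<partial>M) / R"
        using mi D2 by simp
      also have "\<dots> < \<epsilon> / 2 + 4 * (K + 1) / R"
        using n[OF that] D2(2)[of j] R by (intro add_less_le_mono divide_right_mono) auto
      also have "4 * (K + 1) / R = \<epsilon> / 2" using K \<epsilon> by (simp add: R_def field_simps)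
      finally show ?thesis by simp
    qed
    then show "\<exists>n. \<forall>j\<ge>n. norm ((\<integral>\<omega>. \<bar>D j \<omega>\<bar> \<partial>M) - 0) < \<epsilon>" by blast
  qed
  have "(\<lambda>j. (\<integral>\<omega>. Z \<omega> * Yj j \<omega> \<partial>M) - (\<integral>\<omega>. Z \<omega> * Y \<omega> \<partial>M)) \<longlonglongrightarrow> 0"
  proof (rule Lim_null_comparison)
    show "(\<lambda>j. B * (\<integral>\<omega>. \<bar>D j \<omega>\<bar> \<partial>M)) \<longlonglongrightarrow> 0" using tendsto_mult_right_zero[OF D0] by simp
    have "norm ((\<integral>\<omega>. Z \<omega> * Yj j \<omega> \<partial>M) - (\<integral>\<omega>. Z \<omega> * Y \<omega> \<partial>M)) \<le> B * (\<integral>\<omega>. \<bar>D j \<omega>\<bar> \<partial>M)" for j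
    proof -
      have "(\<integral>\<omega>. Z \<omega> * Yj j \<omega> \<partial>M) - (\<integral>\<omega>. Z \<omega> * Y \<omega> \<partial>M) = (\<integral>\<omega>. Z \<omega> * D j \<omega> \<partial>M)"
        unfolding D_def right_diff_distrib using integrable_bounded_mult[OF _ Z] Yi by simp
      also have "\<bar>\<dots>\<bar> \<le> (\<integral>\<omega>. \<bar>Z \<omega> * D j \<omega>\<bar> \<partial>M)" by (rule integral_abs_bound)
      also have "\<dots> \<le> (\<integral>\<omega>. B * \<bar>D j \<omega>\<bar> \<partial>M)"
      proof (rule integral_mono)
        show "integrable M (\<lambda>\<omega>. \<bar>Z \<omega> * D j \<omega>\<bar>)" using integrable_bounded_mult[OF Di Z] by (rule integrable_abs)
      qed (use Di Z B in \<open>auto simp: abs_mult intro!: mult_right_mono\<close>)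
      finally show ?thesis by simp
    qed
    then show "eventually (\<lambda>j. norm ((\<integral>\<omega>. Z \<omega> * Yj j \<omega> \<partial>M) - (\<integral>\<omega>. Z \<omega> * Y \<omega> \<partial>M)) \<le> B * (\<integral>\<omega>. \<bar>D j \<omega>\<bar> \<partial>M)) sequentially"
      by simp
  qed
  then show ?thesis by (rule LIM_zero_cancel)
qed

lemma simple_integral_L2_le:
  assumes W: "wiener_process M F W" and S: "simple_process M F N p \<xi>" and t: "0 \<le> t" "t \<le> S"
    and K: "\<And>\<omega>. (\<Sum>i<N. (\<xi> i \<omega>)\<^sup>2 * (min S (p (Suc i)) - min S (p i))) \<le> K"
  shows "(\<integral>\<omega>. (simple_integral W N p \<xi> t \<omega>)\<^sup>2 \<partial>M) \<le> K"
proof -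
  have le: "(\<Sum>i<N. (\<xi> i \<omega>)\<^sup>2 * (min t (p (Suc i)) - min t (p i))) \<le> K" for \<omega>
  proof -
    have "(\<Sum>i<N. (\<xi> i \<omega>)\<^sup>2 * (min t (p (Suc i)) - min t (p i))) \<le> (\<Sum>i<N. (\<xi> i \<omega>)\<^sup>2 * (min S (p (Suc i)) - min S (p i)))"
    proof (intro sum_mono mult_left_mono)
      fix i assume "i \<in> {..<N}"
      then have "p i \<le> p (Suc i)" using S by (auto simp: simple_process_def)
      then show "min t (p (Suc i)) - min t (p i) \<le> min S (p (Suc i)) - min S (p i)" using t by linarith
    qed auto
    then show ?thesis using K[of \<omega>] by linarith
  qed
  have "(\<integral>\<omega>. (\<Sum>i<N. (\<xi> i \<omega>)\<^sup>2 * (min t (p (Suc i)) - min t (p i))) \<partial>M) \<le> (\<integral>\<omega>. K \<partial>M)"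
    using simple_integral_isometry(2)[OF W S t(1)] le by (intro integral_mono) auto
  then show ?thesis using simple_integral_isometry(3)[OF W S t(1)] by (simp add: prob_space)
qed

text \<open>Increments of simple integrals are orthogonal to the past, and this survives the limit
  because the second moments stay bounded. The energy of H itself does not enter, only its almost
  sure bound C.\<close>

lemma ito_integral_martingale:
  assumes W: "wiener_process M F W" and S: "0 < S" and ito: "has_ito_integral M F W S H I"
    and C: "AE \<omega> in M. \<forall>s\<in>{0..S}. \<bar>H s \<omega>\<bar> \<le> C"
    and st: "0 \<le> s" "s \<le> t" "t \<le> S"
  shows "I t \<in> borel_measurable M" "integrable M (\<lambda>\<omega>. (I t \<omega>)\<^sup>2)"
    "Z \<in> borel_measurable (F s) \<Longrightarrow> AE \<omega> in M. \<bar>Z \<omega>\<bar> \<le> B \<Longrightarrow> (\<integral>\<omega>. Z \<omega> * (I t \<omega> - I s \<omega>) \<partial>M) = 0"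
proof -
  obtain N p \<xi> K where sp: "\<And>k. simple_process M F (N k) (p k) (\<xi> k)" and "0 \<le> K"
    and K: "\<And>k \<omega>. (\<Sum>i<N k. (\<xi> k i \<omega>)\<^sup>2 * (min S (p k (Suc i)) - min S (p k i))) \<le> K"
    and "AE \<omega> in M. (\<lambda>k. LINT s:{0..S}|lborel. (simple_val (N k) (p k) (\<xi> k) s \<omega> - H s \<omega>)\<^sup>2) \<longlonglongrightarrow> 0"
    and lim: "AE \<omega> in M. \<forall>t\<in>{0..S}. (\<lambda>k. simple_integral W (N k) (p k) (\<xi> k) t \<omega>) \<longlonglongrightarrow> I t \<omega>"
    by (rule ito_approximation[OF W S ito C]) blast
  let ?Y = "\<lambda>t k. simple_integral W (N k) (p k) (\<xi> k) t"
  have m: "?Y t k \<in> borel_measurable M" if "0 \<le> t" for t k by (rule simple_integral_measurable[OF W sp that])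
  have i: "integrable M (\<lambda>\<omega>. (?Y t k \<omega>)\<^sup>2)" if "0 \<le> t" for t k by (rule simple_integral_isometry(1)[OF W sp that])
  have le: "(\<integral>\<omega>. (?Y t k \<omega>)\<^sup>2 \<partial>M) \<le> K" if "0 \<le> t" "t \<le> S" for t k
    by (rule simple_integral_L2_le[OF W sp that K])
  have l: "AE \<omega> in M. (\<lambda>k. ?Y t k \<omega>) \<longlonglongrightarrow> I t \<omega>" if "0 \<le> t" "t \<le> S" for t
    using lim by eventually_elim (use that in auto)
  have t: "0 \<le> t" "s \<le> S" using st by auto
  show It: "I t \<in> borel_measurable M" "integrable M (\<lambda>\<omega>. (I t \<omega>)\<^sup>2)"
    using Fatou_square[OF m[OF t(1)] i[OF t(1)] le[OF t(1) st(3)] tendsto_const l[OF t(1) st(3)]] by auto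
  have Is: "I s \<in> borel_measurable M" "integrable M (\<lambda>\<omega>. (I s \<omega>)\<^sup>2)"
    using Fatou_square[OF m[OF st(1)] i[OF st(1)] le[OF st(1) t(2)] tendsto_const l[OF st(1) t(2)]] by auto
  assume Z: "Z \<in> borel_measurable (F s)" "AE \<omega> in M. \<bar>Z \<omega>\<bar> \<le> B"
  \<comment> \<open>Z is bounded only almost surely, whereas the statements on simple integrals ask
    for a bound on the whole space. Clamping keeps measurability in \<open>F s\<close> and changes Z
    on a null set only.\<close>
  define Z' where "Z' \<omega> = max (- \<bar>B\<bar>) (min \<bar>B\<bar> (Z \<omega>))" for \<omega>
  have Z': "Z' \<in> borel_measurable (F s)" "\<forall>\<omega>\<in>space M. \<bar>Z' \<omega>\<bar> \<le> \<bar>B\<bar>"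
    unfolding Z'_def using Z(1) by (measurable, auto)
  have Z'M: "Z' \<in> borel_measurable M" using measurable_F_M[OF st(1) Z'(1)] .
  have eq: "AE \<omega> in M. Z \<omega> = Z' \<omega>"
    using Z(2) by eventually_elim (auto simp: Z'_def max_def min_def)
  have c: "(\<lambda>k. (\<integral>\<omega>. Z' \<omega> * ?Y t k \<omega> \<partial>M) - (\<integral>\<omega>. Z' \<omega> * ?Y s k \<omega> \<partial>M)) \<longlonglongrightarrow>
     (\<integral>\<omega>. Z' \<omega> * I t \<omega> \<partial>M) - (\<integral>\<omega>. Z' \<omega> * I s \<omega> \<partial>M)"
    by (intro tendsto_diff L2_bounded_expectation_tendsto[OF m i le l Z'M Z'(2)] st t)
  have Yi: "integrable M (?Y t k)" "integrable M (?Y s k)" for k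
    using square_integrable_imp_integrable m i st t by blast+
  have "(\<integral>\<omega>. Z' \<omega> * ?Y t k \<omega> \<partial>M) - (\<integral>\<omega>. Z' \<omega> * ?Y s k \<omega> \<partial>M) = 0" for k
    using simple_integral_martingale(2)[OF W sp st(1,2) Z'] integrable_bounded_mult[OF Yi(1) Z'M Z'(2)]
      integrable_bounded_mult[OF Yi(2) Z'M Z'(2)]
    by (simp add: right_diff_distrib)
  then have "(\<integral>\<omega>. Z' \<omega> * I t \<omega> \<partial>M) - (\<integral>\<omega>. Z' \<omega> * I s \<omega> \<partial>M) = 0"
    using c by (simp add: LIMSEQ_const_iff)
  then have "(\<integral>\<omega>. Z' \<omega> * (I t \<omega> - I s \<omega>) \<partial>M) = 0"
    using integrable_bounded_mult[OF square_integrable_imp_integrable[OF It] Z'M Z'(2)]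
      integrable_bounded_mult[OF square_integrable_imp_integrable[OF Is] Z'M Z'(2)]
    by (simp add: right_diff_distrib)
  moreover have "(\<integral>\<omega>. Z \<omega> * (I t \<omega> - I s \<omega>) \<partial>M) = (\<integral>\<omega>. Z' \<omega> * (I t \<omega> - I s \<omega>) \<partial>M)"
    using It(1) Is(1) Z'M measurable_F_M[OF st(1) Z(1)] eq
    by (intro integral_cong_AE) (auto elim: eventually_mono)
  ultimately show "(\<integral>\<omega>. Z \<omega> * (I t \<omega> - I s \<omega>) \<partial>M) = 0" by simp
qed

lemma progressive_bounded_square:
  assumes prog: "progressive F S H" and S: "0 \<le> S"
    and C: "AE \<omega> in M. \<forall>s\<in>{0..S}. \<bar>H s \<omega>\<bar> \<le> C" and t: "0 \<le> t" "t \<le> S"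
  shows "AE \<omega> in M. set_integrable lborel {0..t} (\<lambda>s. (H s \<omega>)\<^sup>2)"
    "integrable M (\<lambda>\<omega>. LINT s:{0..t}|lborel. (H s \<omega>)\<^sup>2)"
proof -
  define H' where "H' \<omega> s = (if s \<in> {0..S} then H s \<omega> else 0)" for \<omega> s
  have H'm[measurable]: "case_prod H' \<in> borel_measurable (M \<Otimes>\<^sub>M lborel)"
    using progressive_measurable[OF prog] S by (simp add: H'_def case_prod_beta')
  have eq: "(LINT s:{0..t}|lborel. (H s \<omega>)\<^sup>2) = (LINT s|lborel. indicator {0..t} s *\<^sub>R (H' \<omega> s)\<^sup>2)" for \<omega>
    unfolding set_lebesgue_integral_def using t
    by (intro Bochner_Integration.integral_cong) (auto simp: H'_def indicator_def)
  have "(\<lambda>(\<omega>, s). indicator {0..t} s *\<^sub>R (case_prod H' (\<omega>, s))\<^sup>2) \<in> borel_measurable (M \<Otimes>\<^sub>M lborel)" by measurable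
  then have "(\<lambda>\<omega>. LINT s|lborel. indicator {0..t} s *\<^sub>R (H' \<omega> s)\<^sup>2) \<in> borel_measurable M"
    by (intro lborel.borel_measurable_lebesgue_integral) simp
  then have m: "(\<lambda>\<omega>. LINT s:{0..t}|lborel. (H s \<omega>)\<^sup>2) \<in> borel_measurable M" unfolding eq .
  have *: "AE \<omega> in M. set_integrable lborel {0..t} (\<lambda>s. (H s \<omega>)\<^sup>2) \<and>
     \<bar>LINT s:{0..t}|lborel. (H s \<omega>)\<^sup>2\<bar> \<le> C\<^sup>2 * t"
    using C AE_space
  proof eventually_elim
    case (elim \<omega>)
    have hm[measurable]: "H' \<omega> \<in> borel_measurable lborel"
      using measurable_compose[OF measurable_Pair1'[OF elim(2)] H'm] by simp
    have bd: "(H s \<omega>)\<^sup>2 \<le> C\<^sup>2" if "s \<in> {0..t}" for s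
    proof -
      have "\<bar>H s \<omega>\<bar> \<le> C" using elim(1) that t by auto
      then show ?thesis by (meson abs_le_square_iff abs_ge_self order_trans)
    qed
    have cs: "set_integrable lborel {0..t} (\<lambda>_. C\<^sup>2)"
      unfolding set_integrable_def real_scaleR_def using t by (intro integrable_mult_left integrable_real_indicator) auto
    have i: "set_integrable lborel {0..t} (\<lambda>s. (H s \<omega>)\<^sup>2)"
      unfolding set_integrable_def
    proof (rule Bochner_Integration.integrable_bound[OF cs[unfolded set_integrable_def]])
      have e: "(\<lambda>s. indicator {0..t} s *\<^sub>R (H s \<omega>)\<^sup>2) = (\<lambda>s. indicator {0..t} s *\<^sub>R (H' \<omega> s)\<^sup>2)"
        using t by (auto simp: H'_def indicator_def)
      show "(\<lambda>s. indicator {0..t} s *\<^sub>R (H s \<omega>)\<^sup>2) \<in> borel_measurable lborel" unfolding e by measurable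
    qed (use bd in \<open>auto simp: indicator_def\<close>)
    have "0 \<le> (LINT s:{0..t}|lborel. (H s \<omega>)\<^sup>2)" by (simp add: set_lebesgue_integral_def)
    moreover have "(LINT s:{0..t}|lborel. (H s \<omega>)\<^sup>2) \<le> (LINT s:{0..t}|lborel. C\<^sup>2)"
      using set_integral_mono[OF i cs] bd by auto
    moreover have "\<dots> = C\<^sup>2 * t" using t by (simp add: set_lebesgue_integral_def)
    ultimately show ?case using i by auto
  qed
  show "AE \<omega> in M. set_integrable lborel {0..t} (\<lambda>s. (H s \<omega>)\<^sup>2)" using * by eventually_elim auto
  show "integrable M (\<lambda>\<omega>. LINT s:{0..t}|lborel. (H s \<omega>)\<^sup>2)"
    using * m by (intro integrable_const_bound[of _ "C\<^sup>2 * t"]) (auto elim: eventually_mono)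
qed

end

section \<open>Energy inequality for Ito processes\<close>

lemma set_integral_Ioc_diff:
  fixes f :: "real \<Rightarrow> real"
  assumes "set_integrable lborel {0..r'} f" "0 \<le> r" "r \<le> r'"
  shows "set_integrable lborel {r<..r'} f"
    "(LINT s:{0..r'}|lborel. f s) - (LINT s:{0..r}|lborel. f s) = (LINT s:{r<..r'}|lborel. f s)"
proof -
  show i: "set_integrable lborel {r<..r'} f"
    using assms by (intro set_integrable_subset[OF assms(1)]) auto
  have i2: "set_integrable lborel {0..r} f"
    using assms by (intro set_integrable_subset[OF assms(1)]) auto
  have "{0..r'} = {0..r} \<union> {r<..r'}" using assms by auto
  then have "(LINT s:{0..r'}|lborel. f s) = (LINT s:{0..r}|lborel. f s) + (LINT s:{r<..r'}|lborel. f s)"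
    using set_integral_Un[OF ivl_disj_int_two(8)[of 0 r r'] i2 i] by simp
  then show "(LINT s:{0..r'}|lborel. f s) - (LINT s:{0..r}|lborel. f s) = (LINT s:{r<..r'}|lborel. f s)" by simp
qed

lemma abs_set_integral_Ioc_le:
  fixes f :: "real \<Rightarrow> real"
  assumes i: "set_integrable lborel {r<..r'} f" and b: "\<And>s. s \<in> {r<..r'} \<Longrightarrow> \<bar>f s\<bar> \<le> B" and r: "r \<le> r'"
  shows "\<bar>LINT s:{r<..r'}|lborel. f s\<bar> \<le> B * (r' - r)"
proof -
  have c: "set_integrable lborel {r<..r'} (\<lambda>_. B)"
    unfolding set_integrable_def real_scaleR_def using r by (intro integrable_mult_left integrable_real_indicator) auto
  have "\<bar>LINT s:{r<..r'}|lborel. f s\<bar> \<le> (LINT s:{r<..r'}|lborel. \<bar>f s\<bar>)"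
    unfolding set_lebesgue_integral_def using integral_abs_bound[of lborel "\<lambda>s. indicator {r<..r'} s *\<^sub>R f s"]
    by (simp add: abs_mult)
  also have "\<dots> \<le> (LINT s:{r<..r'}|lborel. B)"
    using b by (intro set_integral_mono set_integrable_abs i c) auto
  also have "\<dots> = B * (r' - r)" using r by (simp add: set_lebesgue_integral_def)
  finally show ?thesis .
qed

text \<open>The integrand \<open>g\<close> is evaluated at both end points of a partition interval, as needed for
  the products in the discrete integration by parts below.\<close>

lemma Riemann_Stieltjes_tendsto:
  fixes a f :: "real \<Rightarrow> real" and g :: "real \<Rightarrow> real \<Rightarrow> real"
  assumes t: "0 \<le> t" and a: "set_integrable lborel {0..t} a" "\<And>s. s \<in> {0..t} \<Longrightarrow> \<bar>a s\<bar> \<le> C"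
    and af: "set_integrable lborel {0..t} (\<lambda>s. a s * f s)"
    and A: "\<And>r. r \<in> {0..t} \<Longrightarrow> A r = (LINT s:{0..r}|lborel. a s)"
    and g: "\<And>\<epsilon>. 0 < \<epsilon> \<Longrightarrow> \<exists>\<delta>>0. \<forall>r s r'. 0 \<le> r \<and> r \<le> s \<and> s \<le> r' \<and> r' \<le> t \<and> r' - r < \<delta> \<longrightarrow> \<bar>g r r' - f s\<bar> \<le> \<epsilon>"
  shows "(\<lambda>m. \<Sum>k<Suc m. (A (real (Suc k) * t / real (Suc m)) - A (real k * t / real (Suc m))) *
            g (real k * t / real (Suc m)) (real (Suc k) * t / real (Suc m)))
     \<longlonglongrightarrow> (LINT s:{0..t}|lborel. a s * f s)"
proof (rule LIMSEQ_I)
  fix e :: real assume e: "0 < e"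
  have C: "0 \<le> C" using a(2)[of 0] t by force
  \<comment> \<open>The total error will be C \<epsilon> t, hence at most e / 2; the added ones
    avoid a zero denominator.\<close>
  define \<epsilon> where "\<epsilon> = e / (2 * (C + 1) * (t + 1))"
  have \<epsilon>: "0 < \<epsilon>" using e C t by (simp add: \<epsilon>_def)
  from g[OF \<epsilon>] obtain \<delta> where \<delta>: "\<delta> > 0"
    and g': "\<And>r s r'. 0 \<le> r \<Longrightarrow> r \<le> s \<Longrightarrow> s \<le> r' \<Longrightarrow> r' \<le> t \<Longrightarrow> r' - r < \<delta> \<Longrightarrow> \<bar>g r r' - f s\<bar> \<le> \<epsilon>" by blast
  obtain n where n: "t / \<delta> < real n" using reals_Archimedean2 by blast
  define B where "B r = (LINT s:{0..r}|lborel. a s * f s)" for r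
  show "\<exists>n. \<forall>m\<ge>n. norm ((\<Sum>k<Suc m. (A (real (Suc k) * t / real (Suc m)) - A (real k * t / real (Suc m))) *
            g (real k * t / real (Suc m)) (real (Suc k) * t / real (Suc m)))
            - (LINT s:{0..t}|lborel. a s * f s)) < e"
  proof (intro exI allI impI)
    fix m assume m: "n \<le> m"
    define h where "h = t / real (Suc m)"
    have h: "0 \<le> h" "h < \<delta>"
    proof -
      have "t / \<delta> < real (Suc m)" using n m by linarith
      then show "h < \<delta>" using \<delta> by (simp add: h_def field_simps)
    qed (use t in \<open>simp add: h_def\<close>)
    define u where "u k = real k * t / real (Suc m)" for k
    have u1: "u (Suc k) - u k = h" for k
      unfolding u_def h_def diff_divide_distrib[symmetric] by (simp add: algebra_simps)
    have u: "u (Suc k) - u k = h" "0 \<le> u k" "u k \<le> u (Suc k)" for k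
      using u1[of k] t h by (simp, simp add: u_def, linarith)
    have ut: "u k \<le> t" if "k \<le> Suc m" for k
    proof -
      have "real k * t \<le> real (Suc m) * t" using that t by (intro mult_right_mono) auto
      then show ?thesis by (simp add: u_def field_simps)
    qed
    have u0: "u 0 = 0" and um: "u (Suc m) = t" by (simp_all add: u_def)
    have B0: "B 0 = 0"
    proof -
      have "B 0 = (a 0 * f 0) * measure lborel {0::real}" unfolding B_def by (simp add: set_integral_at_point)
      then show ?thesis by simp
    qed
    have tel: "B t = (\<Sum>k<Suc m. B (u (Suc k)) - B (u k))"
      using sum_lessThan_telescope[of "\<lambda>k. B (u k)" "Suc m"] B0 by (simp add: u0 um)
    have step: "\<bar>(A (u (Suc k)) - A (u k)) * g (u k) (u (Suc k)) - (B (u (Suc k)) - B (u k))\<bar> \<le> C * \<epsilon> * h"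
      if k: "k < Suc m" for k
    proof -
      have ia: "set_integrable lborel {0..u (Suc k)} a" "set_integrable lborel {0..u (Suc k)} (\<lambda>s. a s * f s)"
        using ut[of "Suc k"] k u(2)[of "Suc k"] by (auto intro: set_integrable_subset[OF a(1)] set_integrable_subset[OF af])
      have d1: "A (u (Suc k)) - A (u k) = (LINT s:{u k<..u (Suc k)}|lborel. a s)"
        using set_integral_Ioc_diff(2)[OF ia(1) u(2) u(3)] A[of "u k"] A[of "u (Suc k)"] ut[of k] ut[of "Suc k"] u k by auto
      have d2: "B (u (Suc k)) - B (u k) = (LINT s:{u k<..u (Suc k)}|lborel. a s * f s)"
        unfolding B_def by (rule set_integral_Ioc_diff(2)[OF ia(2) u(2) u(3)])
      have i1: "set_integrable lborel {u k<..u (Suc k)} (\<lambda>s. a s * g (u k) (u (Suc k)))"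
        using set_integral_Ioc_diff(1)[OF ia(1) u(2) u(3)] by simp
      have i2: "set_integrable lborel {u k<..u (Suc k)} (\<lambda>s. a s * f s)"
        using set_integral_Ioc_diff(1)[OF ia(2) u(2) u(3)] .
      have "(A (u (Suc k)) - A (u k)) * g (u k) (u (Suc k)) - (B (u (Suc k)) - B (u k)) =
         (LINT s:{u k<..u (Suc k)}|lborel. a s * g (u k) (u (Suc k)) - a s * f s)"
        unfolding d1 d2 using i1 i2 by simp
      also have "\<bar>\<dots>\<bar> \<le> C * \<epsilon> * (u (Suc k) - u k)"
      proof (rule abs_set_integral_Ioc_le)
        fix s assume s: "s \<in> {u k<..u (Suc k)}"
        have "\<bar>a s\<bar> \<le> C" using a(2)[of s] s u(2)[of k] ut[of "Suc k"] k by auto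
        moreover have "\<bar>g (u k) (u (Suc k)) - f s\<bar> \<le> \<epsilon>"
          using s u ut[of "Suc k"] k h by (intro g') auto
        ultimately have "\<bar>a s * (g (u k) (u (Suc k)) - f s)\<bar> \<le> C * \<epsilon>"
          unfolding abs_mult using C by (intro mult_mono) auto
        then show "\<bar>a s * g (u k) (u (Suc k)) - a s * f s\<bar> \<le> C * \<epsilon>" by (simp add: right_diff_distrib)
      qed (use i1 i2 u in auto)
      finally show ?thesis using u by simp
    qed
    have "\<bar>(\<Sum>k<Suc m. (A (u (Suc k)) - A (u k)) * g (u k) (u (Suc k))) - B t\<bar> \<le> (\<Sum>k<Suc m. C * \<epsilon> * h)"
      unfolding tel sum_subtractf[symmetric]
      by (rule order_trans[OF sum_abs]) (use step in \<open>intro sum_mono; auto\<close>)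
    also have "\<dots> = C * \<epsilon> * t" by (simp add: h_def field_simps)
    also have "\<dots> < e"
    proof -
      have "C * t \<le> (C + 1) * (t + 1)" using C t by (simp add: algebra_simps)
      then have "C * t * \<epsilon> \<le> (C + 1) * (t + 1) * \<epsilon>" using \<epsilon> by (intro mult_right_mono) auto
      also have "\<dots> = e / 2"
      proof -
        have "(C + 1) * (t + 1) \<noteq> 0" using C t by (metis add_nonneg_pos less_numeral_extra(1) mult_pos_pos order_less_irrefl)
        then show ?thesis unfolding \<epsilon>_def by (simp add: field_simps)
      qed
      finally show ?thesis using e by (simp add: mult_ac)
    qed
    finally show "norm ((\<Sum>k<Suc m. (A (real (Suc k) * t / real (Suc m)) - A (real k * t / real (Suc m))) *
            g (real k * t / real (Suc m)) (real (Suc k) * t / real (Suc m)))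
            - (LINT s:{0..t}|lborel. a s * f s)) < e"
      unfolding B_def u_def by simp
  qed
qed

section \<open>Second moment of a sum of stochastic integrals\<close>

context wiener_family
begin

text \<open>For simple integrands the cross terms between different \<l> have mean zero, so the
  second moment is the sum of the energies. A weighted Young inequality compares these with the
  energies of \<open>H \<l>\<close>; the error tends to zero in mean, Fatou's lemma gives the bound
  with factor 1 + \<epsilon>, and \<epsilon> is sent to zero at the end.\<close>

lemma ito_sum_isometry_le:
  assumes S: "0 < S" and ito: "\<And>\<l>. \<l> \<in> L \<Longrightarrow> has_ito_integral M F (W \<l>) S (H \<l>) (I \<l>)"
    and C: "\<And>\<l>. \<l> \<in> L \<Longrightarrow> AE \<omega> in M. \<forall>s\<in>{0..S}. \<bar>H \<l> s \<omega>\<bar> \<le> C" and t: "0 \<le> t" "t \<le> S"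
  shows "integrable M (\<lambda>\<omega>. (\<Sum>\<l>\<in>L. I \<l> t \<omega>)\<^sup>2)"
    "(\<integral>\<omega>. (\<Sum>\<l>\<in>L. I \<l> t \<omega>)\<^sup>2 \<partial>M) \<le> (\<Sum>\<l>\<in>L. \<integral>\<omega>. (LINT s:{0..t}|lborel. (H \<l> s \<omega>)\<^sup>2) \<partial>M)"
proof -
  \<comment> \<open>Collects what \<open>ito_approximation\<close> yields, so that one choice
    produces approximants for all \<l> at once, indexed by the same k.\<close>
  define Q where "Q \<l> N p \<xi> K \<longleftrightarrow> (\<forall>k. simple_process M F (N k) (p k) (\<xi> k)) \<and> 0 \<le> K \<and>
    (\<forall>k \<omega>. (\<Sum>i<N k. (\<xi> k i \<omega>)\<^sup>2 * (min S (p k (Suc i)) - min S (p k i))) \<le> K) \<and>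
    (AE \<omega> in M. (\<lambda>k. LINT s:{0..S}|lborel. (simple_val (N k) (p k) (\<xi> k) s \<omega> - H \<l> s \<omega>)\<^sup>2) \<longlonglongrightarrow> 0) \<and>
    (AE \<omega> in M. \<forall>t\<in>{0..S}. (\<lambda>k. simple_integral (W \<l>) (N k) (p k) (\<xi> k) t \<omega>) \<longlonglongrightarrow> I \<l> t \<omega>)"
    for \<l> and N :: "nat \<Rightarrow> nat" and p :: "nat \<Rightarrow> nat \<Rightarrow> real" and \<xi> :: "nat \<Rightarrow> nat \<Rightarrow> 'w \<Rightarrow> real" and K
  have "\<forall>\<l>\<in>L. \<exists>x. Q \<l> (fst x) (fst (snd x)) (fst (snd (snd x))) (snd (snd (snd x)))"
  proof
    fix \<l> assume l: "\<l> \<in> L"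
    obtain N p \<xi> K where "Q \<l> N p \<xi> K"
      unfolding Q_def by (rule ito_approximation[OF wiener[OF l] S ito[OF l] C[OF l]]) blast
    then show "\<exists>x. Q \<l> (fst x) (fst (snd x)) (fst (snd (snd x))) (snd (snd (snd x)))"
      by (intro exI[of _ "(N, p, \<xi>, K)"]) simp
  qed
  then obtain x where x: "\<And>\<l>. \<l> \<in> L \<Longrightarrow> Q \<l> (fst (x \<l>)) (fst (snd (x \<l>))) (fst (snd (snd (x \<l>)))) (snd (snd (snd (x \<l>))))"
    by metis
  define N where "N \<l> = fst (x \<l>)" for \<l>
  define p where "p \<l> = fst (snd (x \<l>))" for \<l>
  define \<xi> where "\<xi> \<l> = fst (snd (snd (x \<l>)))" for \<l>
  define K where "K \<l> = snd (snd (snd (x \<l>)))" for \<l>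
  have sp: "simple_process M F (N \<l> k) (p \<l> k) (\<xi> \<l> k)" if "\<l> \<in> L" for \<l> k
    using x[OF that] by (auto simp: Q_def N_def p_def \<xi>_def)
  have K: "(\<Sum>i<N \<l> k. (\<xi> \<l> k i \<omega>)\<^sup>2 * (min S (p \<l> k (Suc i)) - min S (p \<l> k i))) \<le> K \<l>" if "\<l> \<in> L" for \<l> k \<omega>
    using x[OF that] by (auto simp: Q_def N_def p_def \<xi>_def K_def)
  define e where "e \<l> k \<omega> = (LINT s:{0..S}|lborel. (simple_val (N \<l> k) (p \<l> k) (\<xi> \<l> k) s \<omega> - H \<l> s \<omega>)\<^sup>2)" for \<l> k \<omega>
  have e0: "AE \<omega> in M. (\<lambda>k. e \<l> k \<omega>) \<longlonglongrightarrow> 0" if "\<l> \<in> L" for \<l>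
    using x[OF that] by (auto simp: Q_def N_def p_def \<xi>_def e_def)
  define Y where "Y k \<omega> = (\<Sum>\<l>\<in>L. simple_integral (W \<l>) (N \<l> k) (p \<l> k) (\<xi> \<l> k) t \<omega>)" for k \<omega>
  have Ylim: "AE \<omega> in M. (\<lambda>k. Y k \<omega>) \<longlonglongrightarrow> (\<Sum>\<l>\<in>L. I \<l> t \<omega>)"
  proof -
    have "AE \<omega> in M. \<forall>\<l>\<in>L. (\<lambda>k. simple_integral (W \<l>) (N \<l> k) (p \<l> k) (\<xi> \<l> k) t \<omega>) \<longlonglongrightarrow> I \<l> t \<omega>"
    proof (rule AE_finite_allI[OF finL])
      fix \<l> assume "\<l> \<in> L"
      from x[OF this] have "AE \<omega> in M. \<forall>t\<in>{0..S}. (\<lambda>k. simple_integral (W \<l>) (N \<l> k) (p \<l> k) (\<xi> \<l> k) t \<omega>) \<longlonglongrightarrow> I \<l> t \<omega>"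
        by (auto simp: Q_def N_def p_def \<xi>_def)
      then show "AE \<omega> in M. (\<lambda>k. simple_integral (W \<l>) (N \<l> k) (p \<l> k) (\<xi> \<l> k) t \<omega>) \<longlonglongrightarrow> I \<l> t \<omega>"
        by eventually_elim (use t in auto)
    qed
    then show ?thesis unfolding Y_def by eventually_elim (auto intro!: tendsto_sum)
  qed
  have Ym: "Y k \<in> borel_measurable M" for k
    unfolding Y_def using simple_integral_measurable[OF wiener sp t(1)] by auto
  define q where "q \<l> k \<omega> = (\<Sum>i<N \<l> k. (\<xi> \<l> k i \<omega>)\<^sup>2 * (min t (p \<l> k (Suc i)) - min t (p \<l> k i)))" for \<l> k \<omega>
  have qi: "integrable M (q \<l> k)" if "\<l> \<in> L" for \<l> k
    unfolding q_def by (rule simple_integral_isometry(2)[OF wiener[OF that] sp[OF that] t(1)])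
  have Y2: "integrable M (\<lambda>\<omega>. (Y k \<omega>)\<^sup>2) \<and> (\<integral>\<omega>. (Y k \<omega>)\<^sup>2 \<partial>M) = (\<Sum>\<l>\<in>L. \<integral>\<omega>. q \<l> k \<omega> \<partial>M)" for k
  proof -
    let ?s = "\<lambda>\<l>. simple_integral (W \<l>) (N \<l> k) (p \<l> k) (\<xi> \<l> k) t"
    have pr: "integrable M (\<lambda>\<omega>. ?s \<l> \<omega> * ?s \<l>' \<omega>) \<and> (\<integral>\<omega>. ?s \<l> \<omega> * ?s \<l>' \<omega> \<partial>M) = (if \<l> = \<l>' then \<integral>\<omega>. q \<l> k \<omega> \<partial>M else 0)"
      if l: "\<l> \<in> L" "\<l>' \<in> L" for \<l> \<l>'
    proof (cases "\<l> = \<l>'")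
      case True
      then show ?thesis using simple_integral_isometry(1,3)[OF wiener[OF l(1)] sp[OF l(1)] t(1), of k]
        unfolding q_def power2_eq_square[of "simple_integral _ _ _ _ _ _"] by simp
    next
      case False
      then show ?thesis using simple_integral_cross[OF l False t(1) sp[OF l(1)] sp[OF l(2)]] by auto
    qed
    have eq: "(Y k \<omega>)\<^sup>2 = (\<Sum>\<l>\<in>L. \<Sum>\<l>'\<in>L. ?s \<l> \<omega> * ?s \<l>' \<omega>)" for \<omega>
      unfolding Y_def power2_eq_square sum_product ..
    have "(\<integral>\<omega>. (Y k \<omega>)\<^sup>2 \<partial>M) = (\<Sum>\<l>\<in>L. \<Sum>\<l>'\<in>L. if \<l> = \<l>' then \<integral>\<omega>. q \<l> k \<omega> \<partial>M else 0)"
      unfolding eq using pr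
      by (subst Bochner_Integration.integral_sum) (auto intro!: sum.cong Bochner_Integration.integral_sum)
    moreover have "integrable M (\<lambda>\<omega>. (Y k \<omega>)\<^sup>2)" unfolding eq using pr by auto
    ultimately show ?thesis using finL by simp
  qed
  define V where "V \<l> = (\<integral>\<omega>. (LINT s:{0..t}|lborel. (H \<l> s \<omega>)\<^sup>2) \<partial>M)" for \<l>
  \<comment> \<open>The bound on \<open>e\<close>, which is uniform in k, supplies the dominating
    constant for its convergence to zero in mean.\<close>
  have path: "AE \<omega> in M. \<forall>k. 0 \<le> e \<l> k \<omega> \<and> e \<l> k \<omega> \<le> 2 * K \<l> + 2 * (C\<^sup>2 * S) \<and>
      (\<forall>\<epsilon>>0. q \<l> k \<omega> \<le> (1 + \<epsilon>) * (LINT s:{0..t}|lborel. (H \<l> s \<omega>)\<^sup>2) + (1 + 1 / \<epsilon>) * e \<l> k \<omega>)"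
    (is "AE \<omega> in M. ?path \<omega>") and em: "e \<l> k \<in> borel_measurable M" if l: "\<l> \<in> L" for \<l> k
  proof -
    have prog: "progressive F S (H \<l>)" using ito[OF l] by (simp add: has_ito_integral_def)
    define H' where "H' \<omega> s = (if s \<in> {0..S} then H \<l> s \<omega> else 0)" for \<omega> s
    have H'm[measurable]: "case_prod H' \<in> borel_measurable (M \<Otimes>\<^sub>M lborel)"
      using progressive_measurable[OF prog] S by (simp add: H'_def case_prod_beta')
    have svm[measurable]: "(\<lambda>(\<omega>, s). simple_val (N \<l> k) (p \<l> k) (\<xi> \<l> k) s \<omega>) \<in> borel_measurable (M \<Otimes>\<^sub>M lborel)" for k
      using simple_val_measurable[OF sp[OF l]] .
    have "(\<lambda>(\<omega>, s). indicator {0..S} s *\<^sub>R ((\<lambda>(\<omega>, s). simple_val (N \<l> k) (p \<l> k) (\<xi> \<l> k) s \<omega>) (\<omega>, s) - case_prod H' (\<omega>, s))\<^sup>2)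
       \<in> borel_measurable (M \<Otimes>\<^sub>M lborel)" by measurable
    then have "(\<lambda>\<omega>. LINT s|lborel. indicator {0..S} s *\<^sub>R (simple_val (N \<l> k) (p \<l> k) (\<xi> \<l> k) s \<omega> - H' \<omega> s)\<^sup>2) \<in> borel_measurable M"
      by (intro lborel.borel_measurable_lebesgue_integral) simp
    moreover have "e \<l> k = (\<lambda>\<omega>. LINT s|lborel. indicator {0..S} s *\<^sub>R (simple_val (N \<l> k) (p \<l> k) (\<xi> \<l> k) s \<omega> - H' \<omega> s)\<^sup>2)"
      unfolding e_def set_lebesgue_integral_def
      by (intro ext Bochner_Integration.integral_cong) (auto simp: H'_def indicator_def)
    ultimately show "e \<l> k \<in> borel_measurable M" by simp
    show "AE \<omega> in M. ?path \<omega>"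
      using progressive_bounded_square(1)[OF prog less_imp_le[OF S] C[OF l] less_imp_le[OF S] order_refl] C[OF l] AE_space
    proof eventually_elim
      case (elim \<omega>)
      have h2: "set_integrable lborel {0..S} (\<lambda>s. (H \<l> s \<omega>)\<^sup>2)" using elim S by auto
      have hm[measurable]: "H' \<omega> \<in> borel_measurable lborel"
        using measurable_compose[OF measurable_Pair1'[OF elim(3)] H'm] by simp
      let ?sv = "\<lambda>k s. simple_val (N \<l> k) (p \<l> k) (\<xi> \<l> k) s \<omega>"
      have svm'[measurable]: "?sv k \<in> borel_measurable lborel" for k
        using measurable_compose[OF measurable_Pair1'[OF elim(3)] svm] by simp
      have sv2: "set_integrable lborel {0..r} (\<lambda>s. (?sv k s)\<^sup>2)" for k r
        by (rule simple_val_sq_integral[OF sp[OF l]])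
      have pw: "(x - y)\<^sup>2 \<le> 2 * x\<^sup>2 + 2 * y\<^sup>2" for x y :: real
        using zero_le_power2[of "x + y"] by (simp add: power2_eq_square algebra_simps)
      have sum2: "set_integrable lborel {0..S} (\<lambda>s. 2 * (?sv k s)\<^sup>2 + 2 * (H \<l> s \<omega>)\<^sup>2)" for k
        using sv2 h2 by (intro set_integral_add) auto
      have d2: "set_integrable lborel {0..S} (\<lambda>s. (?sv k s - H \<l> s \<omega>)\<^sup>2)" for k
        unfolding set_integrable_def
      proof (rule Bochner_Integration.integrable_bound[OF sum2[of k, unfolded set_integrable_def]])
        have "(\<lambda>s. indicator {0..S} s *\<^sub>R (?sv k s - H \<l> s \<omega>)\<^sup>2) = (\<lambda>s. indicator {0..S} s *\<^sub>R (?sv k s - H' \<omega> s)\<^sup>2)"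
          by (auto simp: H'_def indicator_def)
        then show "(\<lambda>s. indicator {0..S} s *\<^sub>R (?sv k s - H \<l> s \<omega>)\<^sup>2) \<in> borel_measurable lborel" by simp
      qed (use pw in \<open>auto simp: indicator_def\<close>)
      have H2le: "(LINT s:{0..S}|lborel. (H \<l> s \<omega>)\<^sup>2) \<le> C\<^sup>2 * S"
      proof -
        have cs: "set_integrable lborel {0..S} (\<lambda>_. C\<^sup>2)"
          unfolding set_integrable_def real_scaleR_def using S by (intro integrable_mult_left integrable_real_indicator) auto
        have "(H \<l> s \<omega>)\<^sup>2 \<le> C\<^sup>2" if "s \<in> {0..S}" for s
          using elim(2) that by (metis abs_ge_self abs_le_square_iff order_trans)
        then have "(LINT s:{0..S}|lborel. (H \<l> s \<omega>)\<^sup>2) \<le> (LINT s:{0..S}|lborel. C\<^sup>2)"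
          by (intro set_integral_mono h2 cs) auto
        also have "\<dots> = C\<^sup>2 * S" using S by (simp add: set_lebesgue_integral_def)
        finally show ?thesis .
      qed
      show ?case
      proof (intro allI conjI impI)
        fix k
        show "0 \<le> e \<l> k \<omega>" by (simp add: e_def set_lebesgue_integral_def)
        have "e \<l> k \<omega> \<le> (LINT s:{0..S}|lborel. 2 * (?sv k s)\<^sup>2 + 2 * (H \<l> s \<omega>)\<^sup>2)"
          unfolding e_def using pw by (intro set_integral_mono d2 sum2) auto
        also have "\<dots> = 2 * (LINT s:{0..S}|lborel. (?sv k s)\<^sup>2) + 2 * (LINT s:{0..S}|lborel. (H \<l> s \<omega>)\<^sup>2)"
          using sv2 h2 by (subst set_integral_add(2)) auto
        also have "\<dots> \<le> 2 * K \<l> + 2 * (C\<^sup>2 * S)"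
          using simple_val_sq_integral(2)[OF sp[OF l, of k], of S \<omega>] K[OF l, of k \<omega>] H2le by linarith
        finally show "e \<l> k \<omega> \<le> 2 * K \<l> + 2 * (C\<^sup>2 * S)" .
        fix \<epsilon> :: real assume \<epsilon>: "0 < \<epsilon>"
        \<comment> \<open>Young's inequality with weight \<epsilon> on the mixed term of x = y + (x
          - y). The loss on y^2 can be made arbitrarily small, unlike with the factor 2 used
          elsewhere, and this is what gives the isometry constant 1.\<close>
        have y: "x\<^sup>2 \<le> (1 + \<epsilon>) * y\<^sup>2 + (1 + 1 / \<epsilon>) * (x - y)\<^sup>2" for x y :: real
        proof -
          have "0 \<le> (\<epsilon> * y - (x - y))\<^sup>2 / \<epsilon>" using \<epsilon> by simp
          also have "\<dots> = (1 + \<epsilon>) * y\<^sup>2 + (1 + 1 / \<epsilon>) * (x - y)\<^sup>2 - x\<^sup>2"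
            using \<epsilon> by (simp add: power2_eq_square field_simps)
          finally show ?thesis by simp
        qed
        have h2t: "set_integrable lborel {0..t} (\<lambda>s. (H \<l> s \<omega>)\<^sup>2)"
          using t by (intro set_integrable_subset[OF h2]) auto
        have d2t: "set_integrable lborel {0..t} (\<lambda>s. (?sv k s - H \<l> s \<omega>)\<^sup>2)"
          using t by (intro set_integrable_subset[OF d2]) auto
        have "q \<l> k \<omega> = (LINT s:{0..t}|lborel. (?sv k s)\<^sup>2)"
          unfolding q_def by (rule simple_val_sq_integral(2)[OF sp[OF l], symmetric])
        also have "\<dots> \<le> (LINT s:{0..t}|lborel. (1 + \<epsilon>) * (H \<l> s \<omega>)\<^sup>2 + (1 + 1 / \<epsilon>) * (?sv k s - H \<l> s \<omega>)\<^sup>2)"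
          using h2t d2t y by (intro set_integral_mono sv2 set_integral_add) auto
        also have "\<dots> = (1 + \<epsilon>) * (LINT s:{0..t}|lborel. (H \<l> s \<omega>)\<^sup>2) + (1 + 1 / \<epsilon>) * (LINT s:{0..t}|lborel. (?sv k s - H \<l> s \<omega>)\<^sup>2)"
          using h2t d2t by (subst set_integral_add(2)) auto
        also have "\<dots> \<le> (1 + \<epsilon>) * (LINT s:{0..t}|lborel. (H \<l> s \<omega>)\<^sup>2) + (1 + 1 / \<epsilon>) * e \<l> k \<omega>"
        proof -
          have "(LINT s:{0..t}|lborel. (?sv k s - H \<l> s \<omega>)\<^sup>2) \<le> e \<l> k \<omega>"
            unfolding e_def set_lebesgue_integral_def
            using d2[of k] d2t t by (intro integral_mono) (auto simp: set_integrable_def indicator_def)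
          then show ?thesis using \<epsilon> by (intro add_left_mono mult_left_mono) auto
        qed
        finally show "q \<l> k \<omega> \<le> (1 + \<epsilon>) * (LINT s:{0..t}|lborel. (H \<l> s \<omega>)\<^sup>2) + (1 + 1 / \<epsilon>) * e \<l> k \<omega>" .
      qed
    qed
  qed
  have ei: "integrable M (e \<l> k)" if l: "\<l> \<in> L" for \<l> k
    using path[OF l] em[OF l] by (intro integrable_const_bound[of _ "2 * K \<l> + 2 * (C\<^sup>2 * S)"]) (auto elim: eventually_mono)
  have elim: "(\<lambda>k. \<integral>\<omega>. e \<l> k \<omega> \<partial>M) \<longlonglongrightarrow> 0" if l: "\<l> \<in> L" for \<l>
  proof -
    have "(\<lambda>k. \<integral>\<omega>. e \<l> k \<omega> \<partial>M) \<longlonglongrightarrow> (\<integral>\<omega>. 0 \<partial>M)"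
    proof (rule integral_dominated_convergence[where w="\<lambda>_. 2 * K \<l> + 2 * (C\<^sup>2 * S)"])
      show "AE \<omega> in M. norm (e \<l> k \<omega>) \<le> 2 * K \<l> + 2 * (C\<^sup>2 * S)" for k
        using path[OF l] by eventually_elim auto
    qed (use em[OF l] e0[OF l] in auto)
    then show ?thesis by simp
  qed
  have Vi: "integrable M (\<lambda>\<omega>. LINT s:{0..t}|lborel. (H \<l> s \<omega>)\<^sup>2)" if l: "\<l> \<in> L" for \<l>
    using ito[OF l] S by (intro progressive_bounded_square(2)[OF _ _ C[OF l] t]) (auto simp: has_ito_integral_def)
  have main: "integrable M (\<lambda>\<omega>. (\<Sum>\<l>\<in>L. I \<l> t \<omega>)\<^sup>2) \<and> (\<integral>\<omega>. (\<Sum>\<l>\<in>L. I \<l> t \<omega>)\<^sup>2 \<partial>M) \<le> (1 + \<epsilon>) * (\<Sum>\<l>\<in>L. V \<l>)"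
    if \<epsilon>: "0 < \<epsilon>" for \<epsilon>
  proof -
    define c where "c k = (\<Sum>\<l>\<in>L. (1 + \<epsilon>) * V \<l> + (1 + 1 / \<epsilon>) * (\<integral>\<omega>. e \<l> k \<omega> \<partial>M))" for k
    have "(\<integral>\<omega>. (Y k \<omega>)\<^sup>2 \<partial>M) \<le> c k" for k
    proof -
      have "(\<integral>\<omega>. q \<l> k \<omega> \<partial>M) \<le> (1 + \<epsilon>) * V \<l> + (1 + 1 / \<epsilon>) * (\<integral>\<omega>. e \<l> k \<omega> \<partial>M)" if l: "\<l> \<in> L" for \<l>
      proof -
        have "(\<integral>\<omega>. q \<l> k \<omega> \<partial>M) \<le> (\<integral>\<omega>. (1 + \<epsilon>) * (LINT s:{0..t}|lborel. (H \<l> s \<omega>)\<^sup>2) + (1 + 1 / \<epsilon>) * e \<l> k \<omega> \<partial>M)"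
          using path[OF l] \<epsilon> qi[OF l] Vi[OF l] ei[OF l] by (intro integral_mono_AE) (auto elim: eventually_mono)
        then show ?thesis unfolding V_def using Vi[OF l] ei[OF l] by simp
      qed
      then show ?thesis using Y2[of k] unfolding c_def by (simp add: sum_mono)
    qed
    moreover have "c \<longlonglongrightarrow> (\<Sum>\<l>\<in>L. (1 + \<epsilon>) * V \<l> + (1 + 1 / \<epsilon>) * 0)"
      unfolding c_def by (intro tendsto_sum tendsto_add tendsto_mult tendsto_const elim)
    then have "c \<longlonglongrightarrow> (1 + \<epsilon>) * (\<Sum>\<l>\<in>L. V \<l>)" by (simp add: sum_distrib_left)
    ultimately show ?thesis using Fatou_square(2,3)[OF Ym _ _ _ Ylim] Y2 by blast
  qed
  show "integrable M (\<lambda>\<omega>. (\<Sum>\<l>\<in>L. I \<l> t \<omega>)\<^sup>2)" using main[of 1] by simp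
  have "((\<lambda>\<epsilon>. (1 + \<epsilon>) * (\<Sum>\<l>\<in>L. V \<l>)) \<longlongrightarrow> (1 + 0) * (\<Sum>\<l>\<in>L. V \<l>)) (at_right 0)"
    by (intro tendsto_intros)
  then have "(\<integral>\<omega>. (\<Sum>\<l>\<in>L. I \<l> t \<omega>)\<^sup>2 \<partial>M) \<le> (1 + 0) * (\<Sum>\<l>\<in>L. V \<l>)"
    by (rule tendsto_lowerbound) (use main in \<open>auto simp: eventually_at_right_less eventually_at_filter\<close>)
  then show "(\<integral>\<omega>. (\<Sum>\<l>\<in>L. I \<l> t \<omega>)\<^sup>2 \<partial>M) \<le> (\<Sum>\<l>\<in>L. \<integral>\<omega>. (LINT s:{0..t}|lborel. (H \<l> s \<omega>)\<^sup>2) \<partial>M)"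
    by (simp add: V_def)
qed

end

context wiener_family
begin

text \<open>With \<open>A\<close> the drift and \<open>J\<close> the martingale part of \<open>X = X 0 + A - J\<close>, expand the square.  The terms
  that contain \<open>A\<close> telescope along a partition into \<open>R\<close>, which tends to the integral of \<open>2 X a\<close>, and
  increments of \<open>J\<close> multiplied by past values of \<open>A\<close>, which have mean zero.  Only an upper bound
  for \<open>E J\<^sup>2\<close> is needed, and this is what Fatou's lemma provides.\<close>

lemma ito_energy_le:
  assumes S: "0 < S" and ito: "\<And>\<l>. \<l> \<in> L \<Longrightarrow> has_ito_integral M F (W \<l>) S (H \<l>) (I \<l>)"
    and H: "\<And>\<l>. \<l> \<in> L \<Longrightarrow> AE \<omega> in M. \<forall>s\<in>{0..S}. \<bar>H \<l> s \<omega>\<bar> \<le> C"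
    and a: "AE \<omega> in M. set_integrable lborel {0..S} (\<lambda>s. a s \<omega>)" "AE \<omega> in M. \<forall>s\<in>{0..S}. \<bar>a s \<omega>\<bar> \<le> C"
    and Xm: "\<And>r. r \<in> {0..S} \<Longrightarrow> X r \<in> borel_measurable (F r)" and Xb: "AE \<omega> in M. \<forall>r\<in>{0..S}. \<bar>X r \<omega>\<bar> \<le> C"
    and eq: "AE \<omega> in M. \<forall>r\<in>{0..S}. X r \<omega> = X 0 \<omega> + (LINT s:{0..r}|lborel. a s \<omega>) - (\<Sum>\<l>\<in>L. I \<l> r \<omega>)"
    and t: "0 \<le> t" "t \<le> S"
  shows "integrable M (\<lambda>\<omega>. (X t \<omega>)\<^sup>2)"
    "AE \<omega> in M. set_integrable lborel {0..t} (\<lambda>s. 2 * X s \<omega> * a s \<omega>)"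
    "integrable M (\<lambda>\<omega>. LINT s:{0..t}|lborel. 2 * X s \<omega> * a s \<omega>)"
    "(\<integral>\<omega>. (X t \<omega>)\<^sup>2 \<partial>M) \<le> (\<integral>\<omega>. (X 0 \<omega>)\<^sup>2 \<partial>M) + (\<integral>\<omega>. (LINT s:{0..t}|lborel. 2 * X s \<omega> * a s \<omega>) \<partial>M)
       + (\<Sum>\<l>\<in>L. \<integral>\<omega>. (LINT s:{0..t}|lborel. (H \<l> s \<omega>)\<^sup>2) \<partial>M)"
proof -
  define J where "J r \<omega> = (\<Sum>\<l>\<in>L. I \<l> r \<omega>)" for r \<omega>
  \<comment> \<open>The drift part is defined algebraically and not as a time integral, so that it
    is adapted by construction; \<open>path\<close> identifies it with the integral of a almost
    surely.\<close>
  define A where "A r \<omega> = X r \<omega> - X 0 \<omega> + J r \<omega>" for r \<omega>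
  have C: "0 \<le> C"
  proof -
    have "AE \<omega> in M. 0 \<le> C" using Xb by eventually_elim (use S in force)
    then show ?thesis by (simp add: AE_const)
  qed
  have IF: "I \<l> r \<in> borel_measurable (F r)" if "\<l> \<in> L" "r \<in> {0..S}" for \<l> r
    using ito[OF that(1)] that(2) by (auto simp: has_ito_integral_def continuous_adapted_def)
  have JF: "J r \<in> borel_measurable (F r)" if "r \<in> {0..S}" for r
    unfolding J_def using IF that by auto
  have AF: "A r \<in> borel_measurable (F r)" if "r \<in> {0..S}" for r
    unfolding A_def using JF[OF that] Xm[OF that] measurable_F_mono[OF _ _ Xm[of 0], of r] that by auto
  have XM: "X r \<in> borel_measurable M" and AM: "A r \<in> borel_measurable M" and JM: "J r \<in> borel_measurable M"
    if "r \<in> {0..S}" for r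
    using that measurable_F_M[OF _ Xm[OF that]] measurable_F_M[OF _ AF[OF that]] measurable_F_M[OF _ JF[OF that]] by auto
  have path: "AE \<omega> in M. (\<forall>r\<in>{0..S}. A r \<omega> = (LINT s:{0..r}|lborel. a s \<omega>) \<and> \<bar>A r \<omega>\<bar> \<le> C * S \<and> \<bar>J r \<omega>\<bar> \<le> C * S + 2 * C) \<and>
      A 0 \<omega> = 0 \<and> J 0 \<omega> = 0 \<and> continuous_on {0..S} (\<lambda>r. X r \<omega>) \<and> continuous_on {0..S} (\<lambda>r. J r \<omega>) \<and>
      (\<forall>r r'. 0 \<le> r \<and> r \<le> r' \<and> r' \<le> S \<longrightarrow> \<bar>A r' \<omega> - A r \<omega>\<bar> \<le> C * (r' - r))"
    using a Xb eq AE_space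
  proof eventually_elim
    case (elim \<omega>)
    have Aeq: "A r \<omega> = (LINT s:{0..r}|lborel. a s \<omega>)" if "r \<in> {0..S}" for r
      unfolding A_def J_def elim(4)[rule_format, OF that] by simp
    have z: "(LINT s:{0..0}|lborel. a s \<omega>) = 0"
    proof -
      have "AE s in lborel. indicator {0..0::real} s *\<^sub>R a s \<omega> = 0"
        using AE_lborel_singleton[of "0::real"] by (rule AE_mp) (simp add: indicator_def)
      then show ?thesis unfolding set_lebesgue_integral_def by (rule integral_eq_zero_AE)
    qed
    have A0: "A 0 \<omega> = 0" using Aeq[of 0] z S by simp
    then have J0: "J 0 \<omega> = 0" by (simp add: A_def)
    have lip: "\<bar>A r' \<omega> - A r \<omega>\<bar> \<le> C * (r' - r)" if "0 \<le> r" "r \<le> r'" "r' \<le> S" for r r'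
    proof -
      have i: "set_integrable lborel {0..r'} (\<lambda>s. a s \<omega>)" using that by (intro set_integrable_subset[OF elim(1)]) auto
      note d = set_integral_Ioc_diff[OF i that(1,2)]
      have "A r' \<omega> - A r \<omega> = (LINT s:{r<..r'}|lborel. a s \<omega>)" using d(2) Aeq that by auto
      moreover have "\<bar>LINT s:{r<..r'}|lborel. a s \<omega>\<bar> \<le> C * (r' - r)"
        by (rule abs_set_integral_Ioc_le[OF d(1)]) (use elim(2) that in auto)
      ultimately show ?thesis by simp
    qed
    have Ab: "\<bar>A r \<omega>\<bar> \<le> C * S" if "r \<in> {0..S}" for r
    proof -
      have "0 \<le> r" "r \<le> S" using that by auto
      from lip[OF order_refl this] have "\<bar>A r \<omega>\<bar> \<le> C * r" by (simp only: A0 diff_zero)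
      also have "\<dots> \<le> C * S" using that C by (intro mult_left_mono) auto
      finally show ?thesis .
    qed
    have Jb: "\<bar>J r \<omega>\<bar> \<le> C * S + 2 * C" if "r \<in> {0..S}" for r
    proof -
      have "\<bar>X r \<omega>\<bar> \<le> C" "\<bar>X 0 \<omega>\<bar> \<le> C" using elim(3) that S by auto
      then show ?thesis using Ab[OF that] unfolding A_def by linarith
    qed
    have cJ: "continuous_on {0..S} (\<lambda>r. J r \<omega>)"
      unfolding J_def using ito elim(5) by (intro continuous_intros) (auto simp: has_ito_integral_def continuous_adapted_def)
    have "C-lipschitz_on {0..S} (\<lambda>r. A r \<omega>)"
    proof (rule lipschitz_onI[OF _ C])
      fix x y assume "x \<in> {0..S}" "y \<in> {0..S}"
      then show "dist (A x \<omega>) (A y \<omega>) \<le> C * dist x y"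
        using lip[of x y] lip[of y x] by (cases "x \<le> y") (auto simp: dist_real_def)
    qed
    then have cA: "continuous_on {0..S} (\<lambda>r. A r \<omega>)" by (rule lipschitz_on_continuous_on)
    have "continuous_on {0..S} (\<lambda>r. X 0 \<omega> + A r \<omega> - J r \<omega>)" using cA cJ by (intro continuous_intros)
    then have cX: "continuous_on {0..S} (\<lambda>r. X r \<omega>)" by (simp add: A_def)
    show ?case
      by (intro conjI ballI allI impI Aeq Ab Jb A0 J0 cJ cX lip) auto
  qed
  define u where "u m k = real k * t / real (Suc m)" for m k
  have u: "u m k \<in> {0..S}" "u m k \<le> u m (Suc k)" if "k \<le> Suc m" for m k
  proof -
    have "real k * t \<le> real (Suc m) * t" using that t by (intro mult_right_mono) auto
    then have "u m k \<le> t" by (simp add: u_def field_simps)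
    then show "u m k \<in> {0..S}" using t by (auto simp: u_def)
    show "u m k \<le> u m (Suc k)" unfolding u_def using t by (intro divide_right_mono mult_right_mono) auto
  qed
  have u0: "u m 0 = 0" and um: "u m (Suc m) = t" for m by (simp_all add: u_def)
  \<comment> \<open>With X = X 0 + A - J the second factor equals 2 X 0 + A(right) + A(left) - 2
    J(right). It tends to 2 X as the mesh shrinks, and with J taken at the right end the telescoping
    leaves exactly A(left) times a future increment of J.\<close>
  define R where "R m \<omega> = (\<Sum>k<Suc m. (A (u m (Suc k)) \<omega> - A (u m k) \<omega>) *
      (X (u m (Suc k)) \<omega> + X (u m k) \<omega> + J (u m k) \<omega> - J (u m (Suc k)) \<omega>))" for m \<omega>
  have Rm: "R m \<in> borel_measurable M" for m
    unfolding R_def using XM AM JM u by (intro borel_measurable_sum borel_measurable_times borel_measurable_diff borel_measurable_add) auto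
  \<comment> \<open>C t bounds the total variation of A on [0,t]. The last factor bounds two values
    of X, each by C, and two values of J, each by C S + 2 C because J = A - X + X 0.\<close>
  define BR where "BR = C * t * (2 * C + 2 * (C * S + 2 * C))"
  have Rb: "AE \<omega> in M. \<bar>R m \<omega>\<bar> \<le> BR" for m
    using path Xb
  proof eventually_elim
    case (elim \<omega>)
    have "\<bar>R m \<omega>\<bar> \<le> (\<Sum>k<Suc m. C * (u m (Suc k) - u m k) * (2 * C + 2 * (C * S + 2 * C)))"
      unfolding R_def
    proof (rule order_trans[OF sum_abs], rule sum_mono)
      fix k assume k: "k \<in> {..<Suc m}"
      have "\<bar>A (u m (Suc k)) \<omega> - A (u m k) \<omega>\<bar> \<le> C * (u m (Suc k) - u m k)"
        using elim(1) u[of k m] u[of "Suc k" m] k by auto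
      moreover have "\<bar>X (u m (Suc k)) \<omega> + X (u m k) \<omega> + J (u m k) \<omega> - J (u m (Suc k)) \<omega>\<bar> \<le> 2 * C + 2 * (C * S + 2 * C)"
      proof -
        have "\<bar>X (u m (Suc k)) \<omega>\<bar> \<le> C" "\<bar>X (u m k) \<omega>\<bar> \<le> C" "\<bar>J (u m k) \<omega>\<bar> \<le> C * S + 2 * C" "\<bar>J (u m (Suc k)) \<omega>\<bar> \<le> C * S + 2 * C"
          using elim u[of k m] u[of "Suc k" m] k by auto
        moreover have "\<bar>x + y + z - w\<bar> \<le> 2 * b + 2 * c" if "\<bar>x\<bar> \<le> b" "\<bar>y\<bar> \<le> b" "\<bar>z\<bar> \<le> c" "\<bar>w\<bar> \<le> c" for x y z w b c :: real
          using that by linarith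
        ultimately show ?thesis by blast
      qed
      ultimately show "\<bar>(A (u m (Suc k)) \<omega> - A (u m k) \<omega>) * (X (u m (Suc k)) \<omega> + X (u m k) \<omega> + J (u m k) \<omega> - J (u m (Suc k)) \<omega>)\<bar>
        \<le> C * (u m (Suc k) - u m k) * (2 * C + 2 * (C * S + 2 * C))"
        unfolding abs_mult using C u(2)[of k m] k by (intro mult_mono) auto
    qed
    also have "\<dots> = C * (\<Sum>k<Suc m. u m (Suc k) - u m k) * (2 * C + 2 * (C * S + 2 * C))"
      by (simp only: sum_distrib_right sum_distrib_left)
    also have "(\<Sum>k<Suc m. u m (Suc k) - u m k) = t"
      using sum_lessThan_telescope[of "u m" "Suc m"] by (simp add: u0 um)
    finally show ?case by (simp add: BR_def)
  qed
  define Dr where "Dr \<omega> = (LINT s:{0..t}|lborel. 2 * X s \<omega> * a s \<omega>)" for \<omega>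
  have conv: "AE \<omega> in M. set_integrable lborel {0..t} (\<lambda>s. 2 * X s \<omega> * a s \<omega>) \<and> (\<lambda>m. R m \<omega>) \<longlonglongrightarrow> Dr \<omega>"
    using path Xb a
  proof eventually_elim
    case (elim \<omega>)
    have cX: "continuous_on {0..t} (\<lambda>r. X r \<omega>)" and cJ: "continuous_on {0..t} (\<lambda>r. J r \<omega>)"
      using elim(1) t by (auto intro: continuous_on_subset)
    have ia: "set_integrable lborel {0..t} (\<lambda>s. a s \<omega>)" using t by (intro set_integrable_subset[OF elim(3)]) auto
    have ix: "set_integrable lborel {0..t} (\<lambda>s. a s \<omega> * (2 * X s \<omega>))"
      unfolding set_integrable_def
    proof (rule Bochner_Integration.integrable_bound[of _ "\<lambda>s. 2 * C * (indicator {0..t} s *\<^sub>R a s \<omega>)"])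
      show "integrable lborel (\<lambda>s. 2 * C * (indicator {0..t} s *\<^sub>R a s \<omega>))"
        using ia unfolding set_integrable_def by simp
      have [measurable]: "(\<lambda>s. indicator {0..t} s *\<^sub>R a s \<omega>) \<in> borel_measurable lborel"
        using ia unfolding set_integrable_def by auto
      have [measurable]: "(\<lambda>s. indicator {0..t} s *\<^sub>R X s \<omega>) \<in> borel_measurable lborel"
        using borel_measurable_continuous_on_indicator[OF _ cX] by simp
      have "(\<lambda>s. indicator {0..t} s *\<^sub>R (a s \<omega> * (2 * X s \<omega>))) = (\<lambda>s. (indicator {0..t} s *\<^sub>R a s \<omega>) * (2 * (indicator {0..t} s *\<^sub>R X s \<omega>)))"
        by (auto simp: indicator_def)
      moreover have "\<dots> \<in> borel_measurable lborel" by measurable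
      ultimately show "(\<lambda>s. indicator {0..t} s *\<^sub>R (a s \<omega> * (2 * X s \<omega>))) \<in> borel_measurable lborel" by metis
      have "\<bar>a s \<omega> * (2 * X s \<omega>)\<bar> \<le> 2 * C * \<bar>a s \<omega>\<bar>" if "s \<in> {0..t}" for s
      proof -
        have "\<bar>X s \<omega>\<bar> \<le> C" using elim(2) that t by auto
        then have "\<bar>a s \<omega>\<bar> * \<bar>X s \<omega>\<bar> \<le> \<bar>a s \<omega>\<bar> * C" by (intro mult_left_mono) auto
        then show ?thesis by (simp add: abs_mult mult_ac)
      qed
      then show "AE s in lborel. norm (indicator {0..t} s *\<^sub>R (a s \<omega> * (2 * X s \<omega>))) \<le> norm (2 * C * (indicator {0..t} s *\<^sub>R a s \<omega>))"
        using C by (auto simp: indicator_def abs_mult)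
    qed
    have "(\<lambda>m. \<Sum>k<Suc m. (A (real (Suc k) * t / real (Suc m)) \<omega> - A (real k * t / real (Suc m)) \<omega>) *
            (\<lambda>r r'. X r' \<omega> + X r \<omega> + J r \<omega> - J r' \<omega>) (real k * t / real (Suc m)) (real (Suc k) * t / real (Suc m)))
     \<longlonglongrightarrow> (LINT s:{0..t}|lborel. a s \<omega> * (2 * X s \<omega>))"
    proof (rule Riemann_Stieltjes_tendsto[OF t(1) ia _ ix])
      show "\<bar>a s \<omega>\<bar> \<le> C" if "s \<in> {0..t}" for s using elim(4) that t by auto
      show "A r \<omega> = (LINT s:{0..r}|lborel. a s \<omega>)" if "r \<in> {0..t}" for r using elim(1) that t by auto
      fix \<epsilon> :: real assume \<epsilon>: "0 < \<epsilon>"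
      have "uniformly_continuous_on {0..t} (\<lambda>r. X r \<omega>)" "uniformly_continuous_on {0..t} (\<lambda>r. J r \<omega>)"
        using cX cJ by (auto intro: compact_uniformly_continuous)
      then obtain d1 d2 where d: "d1 > 0" "d2 > 0"
        and d1: "\<And>x y. x \<in> {0..t} \<Longrightarrow> y \<in> {0..t} \<Longrightarrow> dist y x < d1 \<Longrightarrow> dist (X y \<omega>) (X x \<omega>) < \<epsilon> / 3"
        and d2: "\<And>x y. x \<in> {0..t} \<Longrightarrow> y \<in> {0..t} \<Longrightarrow> dist y x < d2 \<Longrightarrow> dist (J y \<omega>) (J x \<omega>) < \<epsilon> / 3"
        using \<epsilon> unfolding uniformly_continuous_on_def by (metis zero_less_divide_iff zero_less_numeral)
      \<comment> \<open>The two values of X differ from \<open>X s\<close> by at most a third of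
        \<epsilon> each, and the increment of J takes the last third.\<close>
      show "\<exists>\<delta>>0. \<forall>r s r'. 0 \<le> r \<and> r \<le> s \<and> s \<le> r' \<and> r' \<le> t \<and> r' - r < \<delta> \<longrightarrow>
         \<bar>(X r' \<omega> + X r \<omega> + J r \<omega> - J r' \<omega>) - 2 * X s \<omega>\<bar> \<le> \<epsilon>"
      proof (intro exI[of _ "min d1 d2"] conjI allI impI)
        fix r s r' assume *: "0 \<le> r \<and> r \<le> s \<and> s \<le> r' \<and> r' \<le> t \<and> r' - r < min d1 d2"
        have "dist (X r' \<omega>) (X s \<omega>) < \<epsilon> / 3" "dist (X r \<omega>) (X s \<omega>) < \<epsilon> / 3" "dist (J r \<omega>) (J r' \<omega>) < \<epsilon> / 3"
          using * by (intro d1 d2; simp add: dist_real_def)+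
        then show "\<bar>(X r' \<omega> + X r \<omega> + J r \<omega> - J r' \<omega>) - 2 * X s \<omega>\<bar> \<le> \<epsilon>"
          unfolding dist_real_def by linarith
      qed (use d in auto)
    qed
    then have "(\<lambda>m. R m \<omega>) \<longlonglongrightarrow> (LINT s:{0..t}|lborel. a s \<omega> * (2 * X s \<omega>))" by (simp add: R_def u_def)
    moreover have "(\<lambda>s. a s \<omega> * (2 * X s \<omega>)) = (\<lambda>s. 2 * X s \<omega> * a s \<omega>)" by auto
    ultimately show ?case using ix by (simp add: Dr_def)
  qed
  show "AE \<omega> in M. set_integrable lborel {0..t} (\<lambda>s. 2 * X s \<omega> * a s \<omega>)" using conv by eventually_elim simp
  have convR: "AE \<omega> in M. (\<lambda>m. R m \<omega>) \<longlonglongrightarrow> Dr \<omega>" using conv by eventually_elim simp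
  have Drm: "Dr \<in> borel_measurable M" by (rule borel_measurable_AE_LIMSEQ[OF _ _ Rm convR]) auto
  note dct = integral_dominated_convergence[where w="\<lambda>_. BR" and s=R and f=Dr and M=M, OF Drm Rm _ convR]
    integrable_dominated_convergence[where w="\<lambda>_. BR" and s=R and f=Dr and M=M, OF Drm Rm _ convR]
  have Dri: "integrable M Dr" and Rlim: "(\<lambda>m. \<integral>\<omega>. R m \<omega> \<partial>M) \<longlonglongrightarrow> (\<integral>\<omega>. Dr \<omega> \<partial>M)"
    using dct Rb by auto
  show "integrable M (\<lambda>\<omega>. LINT s:{0..t}|lborel. 2 * X s \<omega> * a s \<omega>)" using Dri unfolding Dr_def .
  have Ri: "integrable M (R m)" for m using Rb Rm by (intro integrable_const_bound[of _ BR]) auto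
  have bi: "integrable M (\<lambda>\<omega>. f \<omega> * g \<omega>)" if "f \<in> borel_measurable M" "g \<in> borel_measurable M"
    "AE \<omega> in M. \<bar>f \<omega>\<bar> \<le> c" "AE \<omega> in M. \<bar>g \<omega>\<bar> \<le> c'" for f g :: "'w \<Rightarrow> real" and c c'
  proof (rule integrable_const_bound[of _ "c * c'"])
    show "AE \<omega> in M. norm (f \<omega> * g \<omega>) \<le> c * c'"
      using that(3,4)
    proof eventually_elim
      case (elim \<omega>)
      then show ?case unfolding real_norm_def abs_mult by (intro mult_mono order_trans[OF abs_ge_zero]) auto
    qed
  qed (use that in auto)
  have Xbr: "AE \<omega> in M. \<bar>X r \<omega>\<bar> \<le> C" if "r \<in> {0..S}" for r using Xb by eventually_elim (use that in auto)
  have Abr: "AE \<omega> in M. \<bar>A r \<omega>\<bar> \<le> C * S" if "r \<in> {0..S}" for r using path by eventually_elim (use that in blast)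
  have Jbr: "AE \<omega> in M. \<bar>J r \<omega>\<bar> \<le> C * S + 2 * C" if "r \<in> {0..S}" for r using path by eventually_elim (use that in blast)
  have tS: "t \<in> {0..S}" "0 \<in> {0..S}" using t by auto
  show "integrable M (\<lambda>\<omega>. (X t \<omega>)\<^sup>2)"
    unfolding power2_eq_square by (rule bi[OF XM XM Xbr Xbr]) (use tS in auto)
  have X02: "integrable M (\<lambda>\<omega>. (X 0 \<omega>)\<^sup>2)"
    unfolding power2_eq_square by (rule bi[OF XM XM Xbr Xbr]) (use tS in auto)
  have J2: "integrable M (\<lambda>\<omega>. (J t \<omega>)\<^sup>2)"
    unfolding power2_eq_square by (rule bi[OF JM JM Jbr Jbr]) (use tS in auto)
  have mart: "integrable M (\<lambda>\<omega>. Z \<omega> * (J r' \<omega> - J r \<omega>))" "(\<integral>\<omega>. Z \<omega> * (J r' \<omega> - J r \<omega>) \<partial>M) = 0"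
    if Z: "Z \<in> borel_measurable (F r)" "AE \<omega> in M. \<bar>Z \<omega>\<bar> \<le> c" and r: "0 \<le> r" "r \<le> r'" "r' \<le> S" for Z r r' c
  proof -
    have ZM: "Z \<in> borel_measurable M" using measurable_F_M[OF r(1) Z(1)] .
    have Ii: "integrable M (\<lambda>\<omega>. Z \<omega> * (I \<l> r' \<omega> - I \<l> r \<omega>)) \<and> (\<integral>\<omega>. Z \<omega> * (I \<l> r' \<omega> - I \<l> r \<omega>) \<partial>M) = 0" if l: "\<l> \<in> L" for \<l>
    proof
      note im = ito_integral_martingale[OF wiener[OF l] S ito[OF l] H[OF l]]
      have i1: "integrable M (I \<l> r')" using im(1,2)[OF r] by (rule square_integrable_imp_integrable)
      have i2: "integrable M (I \<l> r)"
        using im(1,2)[OF r(1) order_refl order_trans[OF r(2,3)]] by (rule square_integrable_imp_integrable)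
      show "integrable M (\<lambda>\<omega>. Z \<omega> * (I \<l> r' \<omega> - I \<l> r \<omega>))"
      proof (rule Bochner_Integration.integrable_bound[of _ "\<lambda>\<omega>. c * (I \<l> r' \<omega> - I \<l> r \<omega>)"])
        show "AE \<omega> in M. norm (Z \<omega> * (I \<l> r' \<omega> - I \<l> r \<omega>)) \<le> norm (c * (I \<l> r' \<omega> - I \<l> r \<omega>))"
          using Z(2) by eventually_elim (auto simp: abs_mult intro!: mult_right_mono)
      qed (use i1 i2 ZM in auto)
      show "(\<integral>\<omega>. Z \<omega> * (I \<l> r' \<omega> - I \<l> r \<omega>) \<partial>M) = 0" by (rule im(3)[OF r Z])
    qed
    have e: "Z \<omega> * (J r' \<omega> - J r \<omega>) = (\<Sum>\<l>\<in>L. Z \<omega> * (I \<l> r' \<omega> - I \<l> r \<omega>))" for \<omega>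
      unfolding J_def sum_subtractf[symmetric] sum_distrib_left ..
    show "integrable M (\<lambda>\<omega>. Z \<omega> * (J r' \<omega> - J r \<omega>))" unfolding e using Ii by auto
    show "(\<integral>\<omega>. Z \<omega> * (J r' \<omega> - J r \<omega>) \<partial>M) = 0"
      unfolding e using Ii by (subst Bochner_Integration.integral_sum) auto
  qed
  \<comment> \<open>An exact identity on every grid. Both mixed terms have mean zero, since
    \<open>X 0\<close> and \<open>A (u m k)\<close> are known before the increments of J that they
    multiply.\<close>
  have id: "(\<integral>\<omega>. (X t \<omega>)\<^sup>2 \<partial>M) = (\<integral>\<omega>. (X 0 \<omega>)\<^sup>2 \<partial>M) + (\<integral>\<omega>. (J t \<omega>)\<^sup>2 \<partial>M) + (\<integral>\<omega>. R m \<omega> \<partial>M)" for m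
  proof -
    note m0 = mart[OF Xm[OF tS(2)] Xbr[OF tS(2)] _ t(1,2)]
    have mk: "integrable M (\<lambda>\<omega>. A (u m k) \<omega> * (J (u m (Suc k)) \<omega> - J (u m k) \<omega>))"
       "(\<integral>\<omega>. A (u m k) \<omega> * (J (u m (Suc k)) \<omega> - J (u m k) \<omega>) \<partial>M) = 0" if k: "k < Suc m" for k
    proof -
      have "k \<le> Suc m" "Suc k \<le> Suc m" using k by auto
      note uk = u(1)[OF this(1)] u(1)[OF this(2)] u(2)[OF this(1)]
      show "integrable M (\<lambda>\<omega>. A (u m k) \<omega> * (J (u m (Suc k)) \<omega> - J (u m k) \<omega>))"
        by (rule mart(1)[OF AF[OF uk(1)] Abr[OF uk(1)] _ uk(3)]) (use uk in auto)
      show "(\<integral>\<omega>. A (u m k) \<omega> * (J (u m (Suc k)) \<omega> - J (u m k) \<omega>) \<partial>M) = 0"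
        by (rule mart(2)[OF AF[OF uk(1)] Abr[OF uk(1)] _ uk(3)]) (use uk in auto)
    qed
    have "AE \<omega> in M. (X t \<omega>)\<^sup>2 = (X 0 \<omega>)\<^sup>2 + (J t \<omega>)\<^sup>2 + R m \<omega> - 2 * (X 0 \<omega> * (J t \<omega> - J 0 \<omega>))
         - 2 * (\<Sum>k<Suc m. A (u m k) \<omega> * (J (u m (Suc k)) \<omega> - J (u m k) \<omega>))"
      using path
    proof eventually_elim
      case (elim \<omega>)
      let ?A = "\<lambda>k. A (u m k) \<omega>" and ?J = "\<lambda>k. J (u m k) \<omega>" and ?x = "X 0 \<omega>"
      have A0: "A 0 \<omega> = 0" and J0: "J 0 \<omega> = 0" using elim by blast+
      have X: "X r \<omega> = ?x + A r \<omega> - J r \<omega>" for r by (simp add: A_def)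
      have "R m \<omega> - 2 * (\<Sum>k<Suc m. ?A k * (?J (Suc k) - ?J k)) =
        (\<Sum>k<Suc m. ((?A (Suc k))\<^sup>2 + 2 * ?x * ?A (Suc k) - 2 * ?A (Suc k) * ?J (Suc k)) - ((?A k)\<^sup>2 + 2 * ?x * ?A k - 2 * ?A k * ?J k))"
        unfolding R_def sum_distrib_left sum_subtractf[symmetric] X[of "u m _"]
        by (intro sum.cong refl) algebra
      also have "\<dots> = ((?A (Suc m))\<^sup>2 + 2 * ?x * ?A (Suc m) - 2 * ?A (Suc m) * ?J (Suc m)) - ((?A 0)\<^sup>2 + 2 * ?x * ?A 0 - 2 * ?A 0 * ?J 0)"
        by (rule sum_lessThan_telescope)
      also have "\<dots> = (A t \<omega>)\<^sup>2 + 2 * ?x * A t \<omega> - 2 * A t \<omega> * J t \<omega>"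
        unfolding u0 um A0 by simp
      finally have 1: "R m \<omega> - 2 * (\<Sum>k<Suc m. ?A k * (?J (Suc k) - ?J k)) = (A t \<omega>)\<^sup>2 + 2 * ?x * A t \<omega> - 2 * A t \<omega> * J t \<omega>" .
      have 2: "(X t \<omega>)\<^sup>2 = ?x\<^sup>2 + (J t \<omega>)\<^sup>2 - 2 * (?x * (J t \<omega> - 0)) + ((A t \<omega>)\<^sup>2 + 2 * ?x * A t \<omega> - 2 * A t \<omega> * J t \<omega>)"
        unfolding X[of t] by algebra
      show ?case unfolding J0 2 1[symmetric] by simp
    qed
    then have "(\<integral>\<omega>. (X t \<omega>)\<^sup>2 \<partial>M) = (\<integral>\<omega>. (X 0 \<omega>)\<^sup>2 + (J t \<omega>)\<^sup>2 + R m \<omega> - 2 * (X 0 \<omega> * (J t \<omega> - J 0 \<omega>))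
         - 2 * (\<Sum>k<Suc m. A (u m k) \<omega> * (J (u m (Suc k)) \<omega> - J (u m k) \<omega>)) \<partial>M)"
      using XM JM AM Rm tS u
      by (intro integral_cong_AE) (auto intro!: borel_measurable_sum borel_measurable_times borel_measurable_diff)
    also have "\<dots> = (\<integral>\<omega>. (X 0 \<omega>)\<^sup>2 \<partial>M) + (\<integral>\<omega>. (J t \<omega>)\<^sup>2 \<partial>M) + (\<integral>\<omega>. R m \<omega> \<partial>M)"
    proof -
      have si: "integrable M (\<lambda>\<omega>. \<Sum>k<Suc m. A (u m k) \<omega> * (J (u m (Suc k)) \<omega> - J (u m k) \<omega>))"
        using mk by (intro Bochner_Integration.integrable_sum) auto
      have s0: "(\<integral>\<omega>. (\<Sum>k<Suc m. A (u m k) \<omega> * (J (u m (Suc k)) \<omega> - J (u m k) \<omega>)) \<partial>M) = 0"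
        using mk by (subst Bochner_Integration.integral_sum) auto
      have x0: "integrable M (\<lambda>\<omega>. X 0 \<omega> * (J t \<omega> - J 0 \<omega>))" "(\<integral>\<omega>. X 0 \<omega> * (J t \<omega> - J 0 \<omega>) \<partial>M) = 0"
        using m0 by auto
      show ?thesis
        using X02 J2 Ri[of m] x0 si s0 by (simp del: sum.lessThan_Suc)
    qed
    finally show ?thesis .
  qed
  \<comment> \<open>By the identity above the mean of \<open>R m\<close> is the same for all m, so
    its limit is still an equality. The inequality enters only afterwards, through the second moment
    of J.\<close>
  have "(\<integral>\<omega>. (X t \<omega>)\<^sup>2 \<partial>M) - (\<integral>\<omega>. (X 0 \<omega>)\<^sup>2 \<partial>M) - (\<integral>\<omega>. (J t \<omega>)\<^sup>2 \<partial>M) = (\<integral>\<omega>. Dr \<omega> \<partial>M)"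
  proof (rule LIMSEQ_unique[OF _ Rlim])
    have "(\<lambda>m. \<integral>\<omega>. R m \<omega> \<partial>M) = (\<lambda>m. (\<integral>\<omega>. (X t \<omega>)\<^sup>2 \<partial>M) - (\<integral>\<omega>. (X 0 \<omega>)\<^sup>2 \<partial>M) - (\<integral>\<omega>. (J t \<omega>)\<^sup>2 \<partial>M))"
      using id by (auto simp: algebra_simps)
    then show "(\<lambda>m. \<integral>\<omega>. R m \<omega> \<partial>M) \<longlonglongrightarrow> (\<integral>\<omega>. (X t \<omega>)\<^sup>2 \<partial>M) - (\<integral>\<omega>. (X 0 \<omega>)\<^sup>2 \<partial>M) - (\<integral>\<omega>. (J t \<omega>)\<^sup>2 \<partial>M)"
      by simp
  qed
  moreover have "(\<integral>\<omega>. (J t \<omega>)\<^sup>2 \<partial>M) \<le> (\<Sum>\<l>\<in>L. \<integral>\<omega>. (LINT s:{0..t}|lborel. (H \<l> s \<omega>)\<^sup>2) \<partial>M)"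
    unfolding J_def by (rule ito_sum_isometry_le(2)[OF S ito H t])
  ultimately show "(\<integral>\<omega>. (X t \<omega>)\<^sup>2 \<partial>M) \<le> (\<integral>\<omega>. (X 0 \<omega>)\<^sup>2 \<partial>M) + (\<integral>\<omega>. (LINT s:{0..t}|lborel. 2 * X s \<omega> * a s \<omega>) \<partial>M)
       + (\<Sum>\<l>\<in>L. \<integral>\<omega>. (LINT s:{0..t}|lborel. (H \<l> s \<omega>)\<^sup>2) \<partial>M)"
    unfolding Dr_def by linarith
qed

end

section \<open>Polynomials\<close>

lemma C1I:
  assumes "\<And>x. (f has_derivative f' x) (at x)" "\<And>b. b \<in> Basis \<Longrightarrow> continuous_on UNIV (\<lambda>x. f' x b)"
  shows "C_k 1 f"
proof -
  have "frechet_derivative f (at x) = f' x" for x using frechet_derivative_at[OF assms(1)] by metis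
  then show ?thesis using assms by (auto simp: differentiable_def)
qed

lemma C1_D:
  assumes "C_k 1 f"
  shows "(f has_derivative frechet_derivative f (at x)) (at x)"
    "b \<in> Basis \<Longrightarrow> continuous_on UNIV (\<lambda>x. frechet_derivative f (at x) b)"
    "continuous_on UNIV f"
proof -
  show d: "(f has_derivative frechet_derivative f (at x)) (at x)" for x
    using assms by (simp add: frechet_derivative_works)
  show "b \<in> Basis \<Longrightarrow> continuous_on UNIV (\<lambda>x. frechet_derivative f (at x) b)" using assms by simp
  show "continuous_on UNIV f"
    using has_derivative_continuous[OF d] by (simp add: continuous_on_eq_continuous_at)
qed

lemma C1_const: "C_k 1 (\<lambda>x::'a::euclidean_space. c)"
  by (rule C1I[of _ "\<lambda>x h. 0"]) auto

lemma C1_nth: "C_k 1 (\<lambda>x::real^'n::finite. x $ i)"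
proof (rule C1I[of _ "\<lambda>x h. h $ i"])
  show "((\<lambda>x::real^'n. x $ i) has_derivative (\<lambda>h. h $ i)) (at x)" for x
    by (rule bounded_linear_imp_has_derivative) (rule bounded_linear_vec_nth)
qed auto

lemma C1_add:
  assumes "C_k 1 f" "C_k 1 g" shows "C_k 1 (\<lambda>x. f x + g x)"
  by (rule C1I, rule has_derivative_add[OF C1_D(1)[OF assms(1)] C1_D(1)[OF assms(2)]])
    (intro continuous_intros C1_D(2)[OF assms(1)] C1_D(2)[OF assms(2)])

lemma C1_mult:
  assumes "C_k 1 f" "C_k 1 g" shows "C_k 1 (\<lambda>x. f x * g x)"
  by (rule C1I, rule has_derivative_mult[OF C1_D(1)[OF assms(1)] C1_D(1)[OF assms(2)]])
    (intro continuous_intros C1_D(2,3)[OF assms(1)] C1_D(2,3)[OF assms(2)])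

lemma C1_sum: "(\<And>i. i \<in> I \<Longrightarrow> C_k 1 (f i)) \<Longrightarrow> C_k 1 (\<lambda>x. \<Sum>i\<in>I. f i x)"
proof (induction I rule: infinite_finite_induct)
  case (insert i I)
  then show ?case by (subst sum.insert) (auto intro!: C1_add simp del: C_k.simps One_nat_def)
qed (auto intro!: C1_const simp del: C_k.simps One_nat_def)

lemma C1_prod: "(\<And>i. i \<in> I \<Longrightarrow> C_k 1 (f i)) \<Longrightarrow> C_k 1 (\<lambda>x. \<Prod>i\<in>I. f i x)"
proof (induction I rule: infinite_finite_induct)
  case (insert i I)
  then show ?case by (subst prod.insert) (auto intro!: C1_mult simp del: C_k.simps One_nat_def)
qed (auto intro!: C1_const simp del: C_k.simps One_nat_def)

lemma C1_power: "C_k 1 f \<Longrightarrow> C_k 1 (\<lambda>x. f x ^ n)"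
  by (induction n) (auto intro!: C1_mult C1_const simp del: C_k.simps One_nat_def)

lemma polys_C1: "p \<in> polys k \<Longrightarrow> C_k 1 p"
  unfolding polys_def
  by (auto intro!: C1_sum C1_mult C1_prod C1_power C1_nth C1_const simp del: C_k.simps One_nat_def)

lemma polys_continuous: "p \<in> polys k \<Longrightarrow> continuous_on S p"
  using C1_D(3)[OF polys_C1] continuous_on_subset by blast

lemma polys_zero: "(\<lambda>x. 0) \<in> polys k"
  unfolding polys_def by (auto intro!: exI[of _ "\<lambda>_. 0"])

lemma polys_lincomb:
  assumes "p \<in> polys k" "q \<in> polys k" shows "(\<lambda>x. a * p x + b * q x) \<in> polys k"
proof -
  let ?I = "{\<alpha>::'a \<Rightarrow> nat. (\<Sum>i\<in>UNIV. \<alpha> i) \<le> k}"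
  obtain c d where "p = (\<lambda>x. \<Sum>\<alpha>\<in>?I. c \<alpha> * (\<Prod>i\<in>UNIV. (x $ i) ^ \<alpha> i))" "q = (\<lambda>x. \<Sum>\<alpha>\<in>?I. d \<alpha> * (\<Prod>i\<in>UNIV. (x $ i) ^ \<alpha> i))"
    using assms unfolding polys_def by auto
  then have "(\<lambda>x. a * p x + b * q x) = (\<lambda>x. \<Sum>\<alpha>\<in>?I. (a * c \<alpha> + b * d \<alpha>) * (\<Prod>i\<in>UNIV. (x $ i) ^ \<alpha> i))"
    by (simp add: sum_distrib_left sum.distrib algebra_simps)
  then show ?thesis unfolding polys_def by (auto intro!: exI[of _ "\<lambda>\<alpha>. a * c \<alpha> + b * d \<alpha>"])
qed

lemma has_derivative_grad:
  fixes f :: "real^'n::finite \<Rightarrow> real"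
  assumes "f differentiable (at x)"
  shows "(f has_derivative (\<lambda>h. grad f x \<bullet> h)) (at x)"
proof -
  let ?D = "frechet_derivative f (at x)"
  have d: "(f has_derivative ?D) (at x)" using assms by (simp add: frechet_derivative_works)
  then have l: "linear ?D" by (rule has_derivative_linear)
  have "?D h = grad f x \<bullet> h" for h
  proof -
    have "?D h = ?D (\<Sum>i\<in>UNIV. (h $ i) *\<^sub>R axis i 1)"
      by (metis (no_types, lifting) basis_expansion scalar_mult_eq_scaleR sum.cong)
    also have "\<dots> = (\<Sum>i\<in>UNIV. (h $ i) * ?D (axis i 1))"
      using l by (simp add: linear_sum linear_cmul)
    also have "\<dots> = grad f x \<bullet> h" by (simp add: grad_def inner_vec_def mult.commute)
    finally show ?thesis .
  qed
  then have "?D = (\<lambda>h. grad f x \<bullet> h)" by auto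
  then show ?thesis using d by simp
qed

lemma grad_unique:
  fixes f :: "real^'n::finite \<Rightarrow> real"
  assumes "(f has_derivative (\<lambda>h. v \<bullet> h)) (at x)"
  shows "grad f x = v"
proof -
  have "frechet_derivative f (at x) = (\<lambda>h. v \<bullet> h)" using frechet_derivative_at[OF assms] by simp
  then show ?thesis by (simp add: grad_def vec_eq_iff inner_axis)
qed

lemma continuous_on_grad:
  fixes f :: "real^'n::finite \<Rightarrow> real"
  assumes "C_k 1 f" shows "continuous_on S (grad f)"
proof -
  have "continuous_on UNIV (\<lambda>x. \<chi> i. frechet_derivative f (at x) (axis i 1))"
    by (intro continuous_on_vec_lambda C1_D(2)[OF assms]) (auto simp: axis_in_Basis_iff)
  then show ?thesis unfolding grad_def[abs_def] by (rule continuous_on_subset) auto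
qed

lemma grad_sum:
  fixes p :: "'i \<Rightarrow> real^'n::finite \<Rightarrow> real"
  assumes "\<And>i. i \<in> I \<Longrightarrow> C_k 1 (p i)"
  shows "grad (\<lambda>x. \<Sum>i\<in>I. c i * p i x) x = (\<Sum>i\<in>I. c i *\<^sub>R grad (p i) x)"
proof (rule grad_unique)
  have "\<And>i. i \<in> I \<Longrightarrow> (p i has_derivative (\<lambda>h. grad (p i) x \<bullet> h)) (at x)"
    using assms by (auto intro!: has_derivative_grad)
  then show "((\<lambda>x. \<Sum>i\<in>I. c i * p i x) has_derivative (\<lambda>h. (\<Sum>i\<in>I. c i *\<^sub>R grad (p i) x) \<bullet> h)) (at x)"
    by (auto intro!: derivative_eq_intros simp: inner_sum_left)
qed

text \<open>\<open>C_k\<close> is phrased through Frechet derivatives in basis directions. On the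
  reals the only basis vector is 1, which identifies them with \<open>deriv\<close>.\<close>

lemma C2_real_D:
  fixes g :: "real \<Rightarrow> real"
  assumes "C_k 2 g"
  shows "(g has_real_derivative deriv g x) (at x)" "continuous_on S (deriv g)" "continuous_on S g"
proof -
  have 2: "(2::nat) = Suc 1" by simp
  have g1: "g differentiable (at x)" "C_k 1 (\<lambda>x. frechet_derivative g (at x) 1)" for x
    using assms unfolding 2 C_k.simps by auto
  have d: "(g has_real_derivative frechet_derivative g (at x) 1) (at x)" for x
  proof -
    have *: "(g has_derivative frechet_derivative g (at x)) (at x)"
      using g1 by (simp add: frechet_derivative_works)
    then have l: "linear (frechet_derivative g (at x))" by (rule has_derivative_linear)
    have "frechet_derivative g (at x) = (\<lambda>h. frechet_derivative g (at x) 1 * h)"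
    proof
      show "frechet_derivative g (at x) h = frechet_derivative g (at x) 1 * h" for h
        using linear_cmul[OF l, of h 1] by (simp add: mult.commute)
    qed
    with * show ?thesis unfolding has_field_derivative_def by simp
  qed
  have e: "deriv g x = frechet_derivative g (at x) 1" for x using d DERIV_imp_deriv by blast
  show "(g has_real_derivative deriv g x) (at x)" for x using d e by simp
  show "continuous_on S (deriv g)" unfolding e[abs_def]
    using C1_D(3)[OF g1(2)] by (rule continuous_on_subset) auto
  show "continuous_on S g" by (rule DERIV_continuous_on, rule has_field_derivative_at_within, rule d)
qed

text \<open>The product g(u) q is the function tested in Green's formula, and the two terms of its
  gradient are the volume terms of the two discrete equations.\<close>

lemma C1_comp_mult:
  fixes p q :: "real^'n::finite \<Rightarrow> real"
  assumes g: "C_k 2 g" and p: "C_k 1 p" and q: "C_k 1 q"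
  shows "C_k 1 (\<lambda>x. g (p x) * q x)"
    "grad (\<lambda>x. g (p x) * q x) x = (deriv g (p x) * q x) *\<^sub>R grad p x + g (p x) *\<^sub>R grad q x"
proof -
  have dp: "(p has_derivative (\<lambda>h. grad p x \<bullet> h)) (at x)" "(q has_derivative (\<lambda>h. grad q x \<bullet> h)) (at x)" for x
    using p q by (auto intro!: has_derivative_grad)
  have dg: "(g has_derivative (\<lambda>h. deriv g (p x) * h)) (at (p x))" for x
    using C2_real_D(1)[OF g] by (simp add: has_field_derivative_def)
  have D: "((\<lambda>x. g (p x) * q x) has_derivative (\<lambda>h. ((deriv g (p x) * q x) *\<^sub>R grad p x + g (p x) *\<^sub>R grad q x) \<bullet> h)) (at x)" for x
    using has_derivative_mult[OF has_derivative_compose[OF dp(1) dg] dp(2), of x]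
    by (simp add: inner_add_left algebra_simps)
  show "grad (\<lambda>x. g (p x) * q x) x = (deriv g (p x) * q x) *\<^sub>R grad p x + g (p x) *\<^sub>R grad q x"
    by (rule grad_unique[OF D])
  show "C_k 1 (\<lambda>x. g (p x) * q x)"
  proof (rule C1I[OF D])
    fix b :: "real^'n"
    have "continuous_on UNIV (\<lambda>x. deriv g (p x))"
      by (rule continuous_on_compose2[OF C2_real_D(2)[OF g, of UNIV] C1_D(3)[OF p]]) simp
    moreover have "continuous_on UNIV (\<lambda>x. g (p x))"
      by (rule continuous_on_compose2[OF C2_real_D(3)[OF g, of UNIV] C1_D(3)[OF p]]) simp
    ultimately show "continuous_on UNIV (\<lambda>x. ((deriv g (p x) * q x) *\<^sub>R grad p x + g (p x) *\<^sub>R grad q x) \<bullet> b)"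
      using C1_D(3)[OF q] continuous_on_grad[OF p] continuous_on_grad[OF q] by (intro continuous_intros)
  qed
qed

section \<open>Definiteness of the L2 product on polynomials, and orthonormalisation\<close>

lemma polys_line:
  assumes "p \<in> polys k"
  shows "\<exists>P. \<forall>t. p (x + t *\<^sub>R v) = poly P t"
proof -
  obtain c where "p = (\<lambda>x. \<Sum>\<alpha> | (\<Sum>i\<in>UNIV. \<alpha> i) \<le> k. c \<alpha> * (\<Prod>i\<in>UNIV. (x $ i) ^ \<alpha> i))"
    using assms unfolding polys_def by auto
  then have "p (x + t *\<^sub>R v) = poly (\<Sum>\<alpha> | (\<Sum>i\<in>UNIV. \<alpha> i) \<le> k. [:c \<alpha>:] * (\<Prod>i\<in>UNIV. [:x $ i, v $ i:] ^ \<alpha> i)) t" for t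
    by (simp add: poly_sum poly_prod poly_power)
  then show ?thesis by blast
qed

text \<open>On the line from a point of U to an arbitrary y the polynomial is univariate and
  vanishes on an open, hence infinite, set of parameters.\<close>

lemma polys_eq_0:
  assumes p: "p \<in> polys k" and U: "open U" "U \<noteq> {}" "\<And>x. x \<in> U \<Longrightarrow> p x = 0"
  shows "p = (\<lambda>x. 0)"
proof
  fix y
  obtain x where x: "x \<in> U" using U by blast
  obtain P where P: "\<And>t. p (x + t *\<^sub>R (y - x)) = poly P t" using polys_line[OF p] by blast
  have "P = 0"
  proof (rule ccontr)
    assume "P \<noteq> 0"
    then have fin: "finite {t. poly P t = 0}" by (rule poly_roots_finite)
    have o: "open ((\<lambda>t. x + t *\<^sub>R (y - x)) -` U)"
      using U(1) by (intro open_vimage continuous_intros)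
    have "0 \<in> (\<lambda>t. x + t *\<^sub>R (y - x)) -` U" using x by simp
    then have "infinite ((\<lambda>t. x + t *\<^sub>R (y - x)) -` U)" using infinite_openin[of UNIV] o
      by (metis finite_imp_not_open empty_iff)
    moreover have "(\<lambda>t. x + t *\<^sub>R (y - x)) -` U \<subseteq> {t. poly P t = 0}" using U(3) P by fastforce
    ultimately show False using fin finite_subset by blast
  qed
  then show "p y = 0" using P[of 1] by simp
qed

lemma set_integrable_continuous_compact:
  fixes f :: "'a::euclidean_space \<Rightarrow> 'b::euclidean_space"
  assumes "compact K" "continuous_on K f" shows "set_integrable lborel K f"
  using borel_integrable_compact[OF assms] by (simp add: set_integrable_def)

text \<open>A zero integral gives p = 0 almost everywhere on K. Inside the interior the set where p
  is nonzero is open and null, hence empty. This is the definiteness required for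
  orthonormalisation.\<close>

lemma polys_L2_definite:
  fixes K :: "(real^'n::finite) set"
  assumes p: "p \<in> polys k" and K: "compact K" "interior K \<noteq> {}" and 0: "(LINT x:K|lborel. p x * p x) = 0"
  shows "p = (\<lambda>x. 0)"
proof (rule polys_eq_0[OF p, of "interior K"])
  have i: "integrable lborel (\<lambda>x. indicator K x *\<^sub>R (p x * p x))"
    using set_integrable_continuous_compact[OF K(1), of "\<lambda>x. p x * p x"] polys_continuous[OF p]
    by (auto simp: set_integrable_def intro!: continuous_intros)
  have "AE x in lborel. indicator K x *\<^sub>R (p x * p x) = (0::real)"
    using 0 integral_nonneg_eq_0_iff_AE[OF i] by (simp add: set_lebesgue_integral_def)
  then have ae: "AE x in lborel. x \<notin> interior K \<inter> {x. p x \<noteq> 0}"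
    by eventually_elim (use interior_subset in \<open>auto simp: indicator_def split: if_splits\<close>)
  have o: "open (interior K \<inter> {x. p x \<noteq> 0})"
    using polys_continuous[OF p] by (intro open_Int open_interior open_Collect_neq continuous_intros)
  have "interior K \<inter> {x. p x \<noteq> 0} \<in> null_sets lborel"
    using ae o by (subst AE_iff_null_sets) auto
  then have "negligible (interior K \<inter> {x. p x \<noteq> 0})"
    by (simp add: negligible_iff_null_sets null_sets_completionI)
  then have "interior K \<inter> {x. p x \<noteq> 0} = {}" using open_not_negligible[OF o] by blast
  then show "p x = 0" if "x \<in> interior K" for x using that by auto
qed (use K in auto)

text \<open>A member of \<phi> that is already spanned leaves the residual zero and is skipped, so r
  can be smaller than n + 1 and \<phi> need only span V. Definiteness is demanded as equality of
  functions, not almost everywhere, so the resulting expansion holds at every point.\<close>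

lemma gram_schmidt:
  fixes B :: "('a \<Rightarrow> real) \<Rightarrow> ('a \<Rightarrow> real) \<Rightarrow> real" and \<phi> :: "nat \<Rightarrow> 'a \<Rightarrow> real"
  assumes zero: "(\<lambda>x. 0) \<in> V"
    and lin: "\<And>p q a b. p \<in> V \<Longrightarrow> q \<in> V \<Longrightarrow> (\<lambda>x. a * p x + b * q x) \<in> V"
    and bil: "\<And>p q r a b. p \<in> V \<Longrightarrow> q \<in> V \<Longrightarrow> r \<in> V \<Longrightarrow> B (\<lambda>x. a * p x + b * q x) r = a * B p r + b * B q r"
    and sym: "\<And>p q. B p q = B q p" and pos: "\<And>p. p \<in> V \<Longrightarrow> 0 \<le> B p p"
    and dfn: "\<And>p. p \<in> V \<Longrightarrow> B p p = 0 \<Longrightarrow> p = (\<lambda>x. 0)"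
    and \<phi>: "\<And>j. j \<le> n \<Longrightarrow> \<phi> j \<in> V" and span: "\<And>p. p \<in> V \<Longrightarrow> \<exists>c. p = (\<lambda>x. \<Sum>j\<le>n. c j * \<phi> j x)"
  obtains r :: nat and e where "\<And>i. i < r \<Longrightarrow> e i \<in> V"
    "\<And>i j. i < r \<Longrightarrow> j < r \<Longrightarrow> B (e i) (e j) = (if i = j then 1 else 0)"
    "\<And>p. p \<in> V \<Longrightarrow> p = (\<lambda>x. \<Sum>i<r. B p (e i) * e i x)"
proof -
  have B0: "B (\<lambda>x. 0) q = 0" if "q \<in> V" for q using bil[OF zero zero that, of 0 0] by simp
  have sumV: "(\<lambda>x. \<Sum>i\<in>I. c i * f i x) \<in> V \<and> (\<forall>q\<in>V. B (\<lambda>x. \<Sum>i\<in>I. c i * f i x) q = (\<Sum>i\<in>I. c i * B (f i) q))"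
    if "finite I" "\<And>i. i \<in> I \<Longrightarrow> f i \<in> V" for I :: "nat set" and c and f :: "nat \<Rightarrow> 'a \<Rightarrow> real"
    using that
  proof (induction I)
    case empty
    then show ?case using zero B0 by auto
  next
    case (insert i I)
    then have IH: "(\<lambda>x. \<Sum>i\<in>I. c i * f i x) \<in> V" "\<forall>q\<in>V. B (\<lambda>x. \<Sum>i\<in>I. c i * f i x) q = (\<Sum>i\<in>I. c i * B (f i) q)"
      and fi: "f i \<in> V" by auto
    have e: "(\<lambda>x. \<Sum>i\<in>insert i I. c i * f i x) = (\<lambda>x. c i * f i x + 1 * (\<Sum>i\<in>I. c i * f i x))"
      using insert by auto
    show ?case unfolding e using lin[OF fi IH(1), of "c i" 1] bil[OF fi IH(1), of _ "c i" 1] IH(2) insert by auto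
  qed
  have main: "\<exists>(r::nat) e. (\<forall>i<r. e i \<in> V) \<and> (\<forall>i<r. \<forall>j<r. B (e i) (e j) = (if i = j then 1 else 0)) \<and>
     (\<forall>j<m. \<phi> j = (\<lambda>x. \<Sum>i<r. B (\<phi> j) (e i) * e i x))" if "m \<le> Suc n" for m
    using that
  proof (induction m)
    case 0
    show ?case by (intro exI[of _ 0]) auto
  next
    case (Suc m)
    then obtain r :: nat and e where e: "\<forall>i<r. e i \<in> V" "\<forall>i<r. \<forall>j<r. B (e i) (e j) = (if i = j then 1 else 0)"
      and sp: "\<forall>j<m. \<phi> j = (\<lambda>x. \<Sum>i<r. B (\<phi> j) (e i) * e i x)" by auto
    have fm: "\<phi> m \<in> V" using \<phi> Suc by auto
    define s where "s = (\<lambda>x. \<Sum>i<r. B (\<phi> m) (e i) * e i x)"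
    have s: "s \<in> V" "\<And>q. q \<in> V \<Longrightarrow> B s q = (\<Sum>i<r. B (\<phi> m) (e i) * B (e i) q)"
      using sumV[of "{..<r}" e "\<lambda>i. B (\<phi> m) (e i)"] e unfolding s_def by auto
    \<comment> \<open>The residual after projection, written as a combination of two functions so
      that \<open>lin\<close> and \<open>bil\<close> apply to it as they stand.\<close>
    define w where "w = (\<lambda>x. 1 * \<phi> m x + (-1) * s x)"
    have w: "w \<in> V" unfolding w_def by (rule lin[OF fm s(1)])
    have wq: "B w q = B (\<phi> m) q - B s q" if "q \<in> V" for q
      unfolding w_def using bil[OF fm s(1) that, of 1 "-1"] by simp
    have wo: "B w (e j) = 0" if j: "j < r" for j
    proof -
      have "B s (e j) = (\<Sum>i<r. B (\<phi> m) (e i) * (if i = j then 1 else 0))"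
        using s(2)[of "e j"] e j by (auto intro!: sum.cong)
      also have "\<dots> = B (\<phi> m) (e j)" using j by (simp add: if_distrib[where f = "\<lambda>z. _ * z"] cong: if_cong)
      finally show ?thesis using wq[of "e j"] e j by simp
    qed
    show ?case
    proof (cases "B w w = 0")
      case True
      then have "w = (\<lambda>x. 0)" using dfn w by blast
      then have "\<phi> m = s" unfolding w_def by (auto simp: fun_eq_iff)
      then show ?thesis using e sp unfolding s_def by (intro exI[of _ r] exI[of _ e]) (auto simp: less_Suc_eq)
    next
      case False
      then have ww: "0 < B w w" using pos[OF w] by simp
      define c where "c = 1 / sqrt (B w w)"
      define f where "f = (\<lambda>x. c * w x + 0 * w x)"
      have f: "f \<in> V" unfolding f_def by (rule lin[OF w w])
      have fq: "B f q = c * B w q" if "q \<in> V" for q unfolding f_def using bil[OF w w that, of c 0] by simp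
      have cc: "c * c * B w w = 1" using ww by (simp add: c_def)
      have ff: "B f f = 1" using fq[OF f] fq[OF w] sym[of w f] cc by simp
      have fe: "B f (e j) = 0" if "j < r" for j using fq[of "e j"] wo that e by simp
      define e' where "e' i = (if i = r then f else e i)" for i
      have "\<phi> j = (\<lambda>x. \<Sum>i<Suc r. B (\<phi> j) (e' i) * e' i x)" if j: "j < Suc m" for j
      proof (cases "j = m")
        case True
        have sf: "B s f = 0" using s(2)[OF f] fe sym by (simp add: sum.neutral)
        have "B (\<phi> m) f = B w f" using wq[OF f] sf by simp
        also have "\<dots> = c * B w w" using fq[OF w] sym by metis
        finally have "B (\<phi> m) f * f x = w x" for x using cc by (simp add: f_def mult_ac)
        then have "\<phi> m x = (\<Sum>i<Suc r. B (\<phi> m) (e' i) * e' i x)" for x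
          by (simp add: e'_def w_def s_def)
        then show ?thesis using True by auto
      next
        case False
        then have jm: "j < m" using j by auto
        have "B (\<phi> j) f = (\<Sum>i<r. B (\<phi> j) (e i) * B (e i) f)"
          using sumV[of "{..<r}" e "\<lambda>i. B (\<phi> j) (e i)"] e f sp jm by auto
        then have "B (\<phi> j) f = 0" using fe sym by (simp add: sum.neutral)
        then have "(\<lambda>x. \<Sum>i<Suc r. B (\<phi> j) (e' i) * e' i x) = (\<lambda>x. \<Sum>i<r. B (\<phi> j) (e i) * e i x)"
          by (simp add: e'_def)
        then show ?thesis using sp jm by metis
      qed
      then show ?thesis using e f ff fe sym
        by (intro exI[of _ "Suc r"] exI[of _ e']) (auto simp: e'_def less_Suc_eq)
    qed
  qed
  obtain r :: nat and e where e: "\<forall>i<r. e i \<in> V" "\<forall>i<r. \<forall>j<r. B (e i) (e j) = (if i = j then 1 else 0)"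
    and sp: "\<forall>j<Suc n. \<phi> j = (\<lambda>x. \<Sum>i<r. B (\<phi> j) (e i) * e i x)" using main[of "Suc n"] by auto
  have rep: "p = (\<lambda>x. \<Sum>i<r. B p (e i) * e i x)" if p: "p \<in> V" for p
  proof
    fix x
    obtain c where c: "p = (\<lambda>x. \<Sum>j\<le>n. c j * \<phi> j x)" using span p by blast
    have Bp: "B p (e i) = (\<Sum>j\<le>n. c j * B (\<phi> j) (e i))" if "i < r" for i
      using sumV[of "{..n}" \<phi> c] \<phi> e that c by auto
    have "p x = (\<Sum>j\<le>n. c j * (\<Sum>i<r. B (\<phi> j) (e i) * e i x))"
      unfolding c using sp by (intro sum.cong refl) (metis atMost_iff le_imp_less_Suc)
    also have "\<dots> = (\<Sum>i<r. B p (e i) * e i x)"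
      unfolding sum_distrib_left using Bp
      by (subst sum.swap) (auto intro!: sum.cong simp: sum_distrib_right mult.assoc)
    finally show "p x = (\<Sum>i<r. B p (e i) * e i x)" .
  qed
  show ?thesis
  proof (rule that[of r e])
    show "e i \<in> V" if "i < r" for i using e that by blast
    show "B (e i) (e j) = (if i = j then 1 else 0)" if "i < r" "j < r" for i j using e that by blast
  qed (rule rep)
qed

section \<open>Faces of the mesh\<close>

lemma space_hausdorff [simp]: "space (hausdorff s :: 'a::metric_space measure) = UNIV"
  unfolding hausdorff_def by (subst space_measure_of) auto

lemma sets_hausdorff [simp, measurable_cong]: "sets (hausdorff s :: 'a::metric_space measure) = sets borel"
  unfolding hausdorff_def using sets.sigma_sets_eq[of "borel :: 'a measure"] by (subst sets_measure_of) auto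

text \<open>Covers in the definition are sequences, so a finite one is padded with empty sets, whose
  gauge is zero even in dimension 0.\<close>

lemma hausdorff_pre_finite_cover:
  assumes G: "finite G" and cov: "A \<subseteq> (\<Union>z\<in>G. C z)" and \<delta>: "0 \<le> \<delta>"
    and C: "\<And>z. z \<in> G \<Longrightarrow> bounded (C z) \<and> diameter (C z) \<le> \<delta>"
  shows "hausdorff_pre s \<delta> A \<le> (\<Sum>z\<in>G. hausdorff_gauge s (C z))"
proof -
  obtain h where h: "bij_betw h {..<card G} G" using ex_bij_betw_nat_finite[OF G] by (auto simp: lessThan_atLeast0)
  define E where "E k = (if k < card G then C (h k) else {})" for k
  have "hausdorff_pre s \<delta> A \<le> (\<Sum>k. hausdorff_gauge s (E k))"
  proof (rule hausdorff_pre_le)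
    show "A \<subseteq> (\<Union>k. E k)"
    proof
      fix x assume "x \<in> A"
      then obtain z where z: "z \<in> G" "x \<in> C z" using cov by auto
      then have "z \<in> h ` {..<card G}" using h by (simp add: bij_betw_def)
      then obtain k where "k < card G" "h k = z" by auto
      then have "x \<in> E k" using z by (simp add: E_def)
      then show "x \<in> (\<Union>k. E k)" by blast
    qed
    show "bounded (E k) \<and> diameter (E k) \<le> \<delta>" for k
      using C h \<delta> by (cases "k < card G") (auto simp: E_def bij_betw_def)
  qed
  also have "\<dots> = (\<Sum>k<card G. hausdorff_gauge s (E k))"
    by (rule suminf_finite) (auto simp: E_def hausdorff_gauge_def)
  also have "\<dots> = (\<Sum>k<card G. hausdorff_gauge s (C (h k)))" by (simp add: E_def)
  also have "\<dots> = (\<Sum>z\<in>G. hausdorff_gauge s (C z))" by (rule sum.reindex_bij_betw[OF h])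
  finally show ?thesis .
qed

text \<open>On a hyperplane whose normal has a nonzero i-th component, coordinate i is a linear
  function of the others. The sum in the constant is its Lipschitz bound; the cardinality accounts
  for the remaining coordinates.\<close>

lemma hyperplane_coordinate_dist:
  fixes x y n :: "real^'n::finite"
  assumes n: "n $ i \<noteq> 0" "n \<bullet> (x - y) = 0" and h: "\<And>j. j \<noteq> i \<Longrightarrow> \<bar>x $ j - y $ j\<bar> \<le> h" "0 \<le> h"
  shows "dist x y \<le> (real CARD('n) + (\<Sum>j\<in>UNIV. \<bar>n $ j / n $ i\<bar>)) * h"
proof -
  let ?c = "\<Sum>j\<in>UNIV. \<bar>n $ j / n $ i\<bar>"
  have "n $ i * (x $ i - y $ i) = - (\<Sum>j\<in>UNIV - {i}. n $ j * (x $ j - y $ j))"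
    using n(2) by (simp add: inner_vec_def sum.remove[of UNIV i])
  then have "x $ i - y $ i = - (\<Sum>j\<in>UNIV - {i}. n $ j * (x $ j - y $ j)) / n $ i"
    using n(1) by (simp add: field_simps)
  also have "\<dots> = - (\<Sum>j\<in>UNIV - {i}. n $ j / n $ i * (x $ j - y $ j))"
    by (simp add: sum_divide_distrib)
  finally have eq: "x $ i - y $ i = - (\<Sum>j\<in>UNIV - {i}. n $ j / n $ i * (x $ j - y $ j))" .
  have "\<bar>x $ i - y $ i\<bar> \<le> (\<Sum>j\<in>UNIV - {i}. \<bar>n $ j / n $ i\<bar> * \<bar>x $ j - y $ j\<bar>)"
    unfolding eq abs_minus_cancel abs_mult[symmetric] by (rule sum_abs)
  also have "\<dots> \<le> (\<Sum>j\<in>UNIV - {i}. \<bar>n $ j / n $ i\<bar> * h)"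
    using h by (intro sum_mono mult_left_mono) auto
  also have "\<dots> \<le> (\<Sum>j\<in>UNIV. \<bar>n $ j / n $ i\<bar> * h)"
    using h by (intro sum_mono2) auto
  finally have xi: "\<bar>x $ i - y $ i\<bar> \<le> ?c * h" by (simp add: sum_distrib_right)
  have "dist x y \<le> (\<Sum>j\<in>UNIV. \<bar>(x - y) $ j\<bar>)" unfolding dist_norm by (rule norm_le_l1_cart)
  also have "\<dots> = \<bar>x $ i - y $ i\<bar> + (\<Sum>j\<in>UNIV - {i}. \<bar>x $ j - y $ j\<bar>)"
    by (simp add: sum.remove[of UNIV i])
  also have "\<dots> \<le> ?c * h + (\<Sum>j\<in>UNIV - {i}. h)"
    using xi h by (intro add_mono sum_mono) auto
  also have "\<dots> \<le> ?c * h + real CARD('n) * h"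
    using h by (auto intro!: mult_right_mono simp: card_Diff_singleton)
  finally show ?thesis by (simp add: algebra_simps)
qed

text \<open>The set is a graph over d - 1 coordinates. Slicing each of these into about M pieces
  gives (M + 1)^(d - 1) cells of diameter at most \<kappa> / M, and the exponent d - 1 of the gauge
  makes the total independent of M, hence of \<delta>.\<close>

lemma hausdorff_outer_hyperplane_finite:
  fixes A :: "(real^'n::finite) set"
  assumes bd: "bounded A" and n: "n \<noteq> 0" "\<forall>x\<in>A. \<forall>y\<in>A. n \<bullet> (x - y) = 0"
  shows "hausdorff_outer (CARD('n) - 1) A < top"
proof -
  let ?s = "CARD('n) - 1"
  obtain i where i: "n $ i \<noteq> 0" using n(1) by (auto simp: vec_eq_iff)
  obtain R where R: "R > 0" "\<forall>x\<in>A. norm x \<le> R" using bd bounded_pos by blast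
  define \<kappa> where "\<kappa> = (real CARD('n) + (\<Sum>j\<in>UNIV. \<bar>n $ j / n $ i\<bar>)) * (2 * R)"
  have \<kappa>: "0 \<le> \<kappa>" unfolding \<kappa>_def using R by (intro mult_nonneg_nonneg add_nonneg_nonneg sum_nonneg) auto
  have "hausdorff_pre ?s \<delta> A \<le> ennreal (unit_ball_vol (real ?s) * \<kappa> ^ ?s)" if \<delta>: "0 < \<delta>" for \<delta>
  proof -
    obtain M0 :: nat where M0: "\<kappa> / \<delta> < real M0" using reals_Archimedean2 by blast
    define M where "M = Suc M0"
    have M: "0 < real M" "\<kappa> / real M \<le> \<delta>"
    proof -
      have "\<kappa> / \<delta> \<le> real M" using M0 by (simp add: M_def)
      then show "\<kappa> / real M \<le> \<delta>" using \<delta> by (simp add: M_def field_simps)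
    qed (simp add: M_def)
    define num where "num x j = nat \<lfloor>(x $ j + R) * real M / (2 * R)\<rfloor>" for x :: "real^'n" and j
    \<comment> \<open>Cell indices. Coordinate i is determined by the others and gets the dummy
      index 0; the value M occurs as an index when a coordinate equals R.\<close>
    define G where "G = (\<Pi>\<^sub>E j\<in>UNIV. if j = i then {0} else {..M})"
    define C where "C z = {x\<in>A. \<forall>j. j \<noteq> i \<longrightarrow> num x j = z j}" for z
    have finG: "finite G" unfolding G_def by (intro finite_PiE) auto
    have cardG: "card G = (M + 1) ^ ?s"
    proof -
      have "card G = (\<Prod>j\<in>UNIV. card (if j = i then {0::nat} else {..M}))" unfolding G_def by (simp add: card_PiE)
      also have "\<dots> = card {0::nat} * (\<Prod>j\<in>UNIV - {i}. card (if j = i then {0::nat} else {..M}))"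
        by (subst prod.remove[of UNIV i]) auto
      also have "(\<Prod>j\<in>UNIV - {i}. card (if j = i then {0::nat} else {..M})) = (\<Prod>j\<in>UNIV - {i}. M + 1)"
        by (intro prod.cong) auto
      finally show ?thesis by (simp add: card_Diff_singleton)
    qed
    have scaled: "0 \<le> (x $ j + R) * real M / (2 * R)" "(x $ j + R) * real M / (2 * R) \<le> real M" if "x \<in> A" for x j
    proof -
      have "\<bar>x $ j\<bar> \<le> R" using R(2) that component_le_norm_cart[of x j] by force
      then have b: "0 \<le> x $ j + R" "x $ j + R \<le> 2 * R" by linarith+
      show "0 \<le> (x $ j + R) * real M / (2 * R)" using b R M by simp
      have "(x $ j + R) * real M \<le> 2 * R * real M" using b M by (intro mult_right_mono) auto
      then show "(x $ j + R) * real M / (2 * R) \<le> real M" using R by (simp add: field_simps)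
    qed
    have cov: "A \<subseteq> (\<Union>z\<in>G. C z)"
    proof
      fix x assume x: "x \<in> A"
      define z where "z = (\<lambda>j. if j = i then 0 else num x j)"
      have "num x j \<le> M" for j
        unfolding num_def using scaled(2)[OF x, of j] by linarith
      then have "z \<in> G" by (auto simp: G_def z_def)
      moreover have "x \<in> C z" using x by (simp add: C_def z_def)
      ultimately show "x \<in> (\<Union>z\<in>G. C z)" by blast
    qed
    have Cd: "diameter (C z) \<le> \<kappa> / real M" for z
    proof (rule diameter_le)
      show "C z \<noteq> {} \<or> 0 \<le> \<kappa> / real M" using \<kappa> M by auto
      fix x y assume xy: "x \<in> C z" "y \<in> C z"
      then have A: "x \<in> A" "y \<in> A" by (auto simp: C_def)
      have h: "\<bar>x $ j - y $ j\<bar> \<le> 2 * R / real M" if "j \<noteq> i" for j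
      proof -
        have "num x j = num y j" using xy that by (simp add: C_def)
        then have "\<lfloor>(x $ j + R) * real M / (2 * R)\<rfloor> = \<lfloor>(y $ j + R) * real M / (2 * R)\<rfloor>"
          unfolding num_def using scaled(1)[OF A(1), of j] scaled(1)[OF A(2), of j]
          by (simp add: nat_eq_iff2)
        then have "\<bar>(x $ j + R) * real M / (2 * R) - (y $ j + R) * real M / (2 * R)\<bar> \<le> 1" by linarith
        also have "(x $ j + R) * real M / (2 * R) - (y $ j + R) * real M / (2 * R) = (x $ j - y $ j) * (real M / (2 * R))"
          unfolding diff_divide_distrib[symmetric] times_divide_eq_right by (simp add: algebra_simps)
        finally have "\<bar>x $ j - y $ j\<bar> * (real M / (2 * R)) \<le> 1" using R M by (simp add: abs_mult)
        then show ?thesis using R M by (simp add: field_simps)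
      qed
      have "dist x y \<le> (real CARD('n) + (\<Sum>j\<in>UNIV. \<bar>n $ j / n $ i\<bar>)) * (2 * R / real M)"
        using n(2) A R M by (intro hyperplane_coordinate_dist[OF i _ h]) auto
      then show "norm (x - y) \<le> \<kappa> / real M" by (simp add: \<kappa>_def dist_norm)
    qed
    have Cb: "bounded (C z)" for z using bd by (rule bounded_subset) (auto simp: C_def)
    have "hausdorff_pre ?s \<delta> A \<le> (\<Sum>z\<in>G. hausdorff_gauge ?s (C z))"
      using Cd M Cb \<delta> by (intro hausdorff_pre_finite_cover[OF finG cov]) (auto intro: order_trans)
    also have "\<dots> \<le> (\<Sum>z\<in>G. ennreal (unit_ball_vol (real ?s) * (\<kappa> / real M / 2) ^ ?s))"
    proof (rule sum_mono)
      fix z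
      show "hausdorff_gauge ?s (C z) \<le> ennreal (unit_ball_vol (real ?s) * (\<kappa> / real M / 2) ^ ?s)"
        unfolding hausdorff_gauge_def using Cd[of z] diameter_ge_0[OF Cb, of z]
        by (auto intro!: ennreal_leI mult_left_mono power_mono divide_right_mono unit_ball_vol_nonneg)
    qed
    also have "\<dots> = ennreal (real ((M + 1) ^ ?s) * (unit_ball_vol (real ?s) * (\<kappa> / real M / 2) ^ ?s))"
      using \<kappa> M by (simp add: cardG ennreal_mult' ennreal_of_nat_eq_real_of_nat)
    also have "\<dots> \<le> ennreal (unit_ball_vol (real ?s) * \<kappa> ^ ?s)"
    proof (rule ennreal_leI)
      \<comment> \<open>The gauge contains half the diameter, and this factor absorbs M + 1 <= 2
        M.\<close>
      have "(real (M + 1) * (\<kappa> / real M / 2)) \<le> \<kappa>"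
      proof -
        have "real (M + 1) \<le> 2 * real M" by (simp add: M_def)
        then have "real (M + 1) * \<kappa> \<le> 2 * real M * \<kappa>" using \<kappa> by (rule mult_right_mono)
        then show ?thesis using M by (simp add: field_simps)
      qed
      then have "(real (M + 1) * (\<kappa> / real M / 2)) ^ ?s \<le> \<kappa> ^ ?s" using \<kappa> M by (intro power_mono) auto
      then have "unit_ball_vol (real ?s) * (real (M + 1) * (\<kappa> / real M / 2)) ^ ?s \<le> unit_ball_vol (real ?s) * \<kappa> ^ ?s"
        by (intro mult_left_mono) auto
      then show "real ((M + 1) ^ ?s) * (unit_ball_vol (real ?s) * (\<kappa> / real M / 2) ^ ?s) \<le> unit_ball_vol (real ?s) * \<kappa> ^ ?s"
        by (simp only: of_nat_power power_mult_distrib mult_ac)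
    qed
    finally show ?thesis .
  qed
  then have "hausdorff_outer ?s A \<le> ennreal (unit_ball_vol (real ?s) * \<kappa> ^ ?s)"
    unfolding hausdorff_outer_def by (intro SUP_least) auto
  then show ?thesis by (simp add: le_less_trans)
qed

text \<open>The directions of a facet span d - 1 dimensions, so their orthogonal complement is a
  line; both normals lie on it and have length 1.\<close>

lemma unit_normal_unique:
  fixes e :: "(real^'n::finite) set"
  assumes dim: "aff_dim e = int CARD('n) - 1" and n: "unit_normal e n" "unit_normal e n'"
  shows "n' = n \<or> n' = - n"
proof -
  have "e \<noteq> {}" using dim by auto
  then obtain a where a: "a \<in> e" by blast
  let ?S = "(+) (- a) ` e"
  have "int (dim ?S) = int CARD('n) - 1" using aff_dim_eq_dim[of a e] hull_inc[OF a] dim by auto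
  then have dS: "CARD('n) \<le> dim ?S + 1" by linarith
  have nn: "norm n = 1" "norm n' = 1" using n by (auto simp: unit_normal_def)
  have sub: "?S \<subseteq> {y\<in>UNIV. \<forall>x\<in>span {n, n'}. orthogonal x y}"
  proof (intro subsetI CollectI conjI UNIV_I ballI)
    fix w y assume "w \<in> ?S" and y: "y \<in> span {n, n'}"
    then obtain x where x: "x \<in> e" "w = - a + x" by auto
    have o: "orthogonal (- a + x) z" if "z \<in> {n, n'}" for z
    proof -
      have "z \<bullet> (x - a) = 0" using that n a x(1) unfolding unit_normal_def by blast
      moreover have "- a + x = x - a" by simp
      ultimately show ?thesis unfolding orthogonal_def by (metis inner_commute)
    qed
    have "orthogonal (- a + x) y" using y o by (rule orthogonal_to_span)
    then show "orthogonal y w" using x by (simp add: orthogonal_commute)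
  qed
  have "dim {y\<in>UNIV. \<forall>x\<in>span {n, n'}. orthogonal x y} + dim (span {n, n'}) = dim (UNIV :: (real^'n) set)"
    by (rule dim_subspace_orthogonal_to_vectors) auto
  moreover have "dim ?S \<le> dim {y\<in>UNIV. \<forall>x\<in>span {n, n'}. orthogonal x y}" using sub by (rule dim_subset)
  ultimately have d1: "dim {n, n'} \<le> 1" using dS by simp
  have n0: "n \<noteq> 0" "n' \<noteq> 0" using nn by auto
  have "n' \<in> span {n}"
  proof (rule ccontr)
    assume c: "n' \<notin> span {n}"
    then have "independent {n', n}" using n0 by (simp add: independent_insert)
    moreover have "n' \<noteq> n" using c span_base by blast
    ultimately have "dim {n', n} = 2" using dim_eq_card_independent by fastforce
    then show False using d1 by (simp add: insert_commute)
  qed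
  then obtain c where c: "n' = c *\<^sub>R n" by (auto simp: span_singleton)
  then have "\<bar>c\<bar> = 1" using nn by simp
  then have "c = 1 \<or> c = -1" by linarith
  then show ?thesis using c by auto
qed

section \<open>Compactness, normals and adjacency in the mesh\<close>

locale mesh_domain =
  fixes D :: "(real^'n::finite) set" and m :: "'n mesh"
  assumes domain: "polyhedral_domain D" and conforming: "conforming_mesh D m"
begin

abbreviation surface :: "(real^'n) measure" where "surface \<equiv> hausdorff (CARD('n) - 1)"

lemma conforming_facts:
  "finite (elems m)" "finite (faces m)" "\<forall>K\<in>elems m. polyhedral K" "closure D = \<Union>(elems m)"
  "\<forall>K\<in>elems m. \<forall>K'\<in>elems m. K \<noteq> K' \<longrightarrow> interior K \<inter> interior K' = {}"
  "\<forall>e\<in>faces m. polytope e \<and> aff_dim e = int CARD('n) - 1 \<and> unit_normal e (fnormal m e)"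
  "\<forall>K\<in>elems m. frontier K = \<Union>(faces_of m K)"
  "\<forall>K\<in>elems m. \<forall>e\<in>faces_of m K. \<exists>n. is_outward_normal K e n"
  "\<forall>e\<in>faces m. card (adjacent m e) = (if e \<subseteq> frontier D then 1 else 2)"
  using conforming unfolding conforming_mesh_def by - (elim conjE, assumption)+

lemmas finite_elems = conforming_facts(1) and finite_faces = conforming_facts(2)
  and elem_polyhedral = conforming_facts(3)[rule_format]

lemma faces_of_D: "e \<in> faces_of m K \<Longrightarrow> e \<in> faces m" "e \<in> faces_of m K \<Longrightarrow> e \<subseteq> frontier K"
  by (auto simp: faces_of_def)

lemma finite_faces_of: "finite (faces_of m K)"
  using finite_faces by (auto simp: faces_of_def)

lemma elem_compact: "K \<in> elems m \<Longrightarrow> compact K"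
  and elem_interior: "K \<in> elems m \<Longrightarrow> interior K \<noteq> {}"
proof -
  assume "K \<in> elems m"
  from elem_polyhedral[OF this] obtain P where P: "finite P" "P \<noteq> {}" "\<forall>p\<in>P. polytope p \<and> interior p \<noteq> {}" "K = \<Union>P"
    unfolding polyhedral_def by blast
  show "compact K" unfolding P(4) using P(1,3) by (intro compact_Union) (auto intro: polytope_imp_compact)
  obtain p where p: "p \<in> P" using P(2) by blast
  then have "interior p \<subseteq> interior K" using P(4) by (intro interior_mono) auto
  then show "interior K \<noteq> {}" using P(3) p by auto
qed

lemma elem_closed: "K \<in> elems m \<Longrightarrow> closed K"
  using elem_compact compact_imp_closed by blast

lemma face_sub_elem: "K \<in> elems m \<Longrightarrow> e \<in> faces_of m K \<Longrightarrow> e \<subseteq> K"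
  using elem_closed frontier_subset_closed faces_of_D by blast

lemma face_props:
  assumes "e \<in> faces m"
  shows "compact e" "e \<in> sets borel" "rel_interior e \<noteq> {}" "negligible e" "emeasure surface e < top"
    "unit_normal e (fnormal m e)" "aff_dim e = int CARD('n) - 1"
proof -
  have p: "polytope e" "aff_dim e = int CARD('n) - 1" "unit_normal e (fnormal m e)"
    using conforming_facts(6) assms by blast+
  show "aff_dim e = int CARD('n) - 1" "unit_normal e (fnormal m e)" by fact+
  show c: "compact e" using p by (simp add: polytope_imp_compact)
  then show b: "e \<in> sets borel" by (simp add: compact_imp_closed)
  have ne: "e \<noteq> {}" using p(2) by auto
  then show "rel_interior e \<noteq> {}" using p(1) by (simp add: rel_interior_eq_empty polytope_imp_convex)
  have n0: "fnormal m e \<noteq> 0" using p(3) by (auto simp: unit_normal_def)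
  obtain a where a: "a \<in> e" using ne by blast
  have "e \<subseteq> {x. fnormal m e \<bullet> x = fnormal m e \<bullet> a}"
  proof
    fix x assume "x \<in> e"
    then have "fnormal m e \<bullet> (x - a) = 0" using p(3) a unfolding unit_normal_def by blast
    then show "x \<in> {x. fnormal m e \<bullet> x = fnormal m e \<bullet> a}" by (simp add: inner_diff_right)
  qed
  then show "negligible e" using negligible_hyperplane[of "fnormal m e"] n0 negligible_subset by blast
  have "hausdorff_outer (CARD('n) - 1) e < top"
    by (rule hausdorff_outer_hyperplane_finite[OF compact_imp_bounded[OF c] n0]) (use p(3) in \<open>unfold unit_normal_def, blast\<close>)
  then show "emeasure surface e < top" using emeasure_hausdorff[OF b] by simp
qed

lemma frontier_null: "K \<in> elems m \<Longrightarrow> frontier K \<in> null_sets lborel"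
proof -
  assume K: "K \<in> elems m"
  have "frontier K = \<Union>(faces_of m K)" using conforming_facts(7) K by blast
  then have "negligible (frontier K)"
    using finite_faces_of face_props(4) faces_of_D(1) by (auto intro!: negligible_Union)
  then show "frontier K \<in> null_sets lborel"
    by (simp add: negligible_iff_null_sets null_sets_completion_iff)
qed

text \<open>Two unit normals differ at most by sign. If both signs were outward, the same small step
  from a relative interior point would lead into K and out of K. So the description in
  \<open>outward_normal\<close> is justified.\<close>

lemma outward_normal_sign:
  assumes K: "K \<in> elems m" and e: "e \<in> faces_of m K"
  shows "is_outward_normal K e (outward_normal K e)"
    "outward_normal K e = fnormal m e \<or> outward_normal K e = - fnormal m e"
proof -
  obtain n where n: "is_outward_normal K e n" using conforming_facts(8) K e by blast
  note fp = face_props[OF faces_of_D(1)[OF e]]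
  have "n' = n" if n': "is_outward_normal K e n'" for n'
  proof (rule ccontr)
    assume "n' \<noteq> n"
    then have neg: "n' = - n" using unit_normal_unique[OF fp(7)] n n' unfolding is_outward_normal_def by blast
    obtain x where x: "x \<in> rel_interior e" using fp(3) by blast
    obtain a where a: "a > 0" "\<forall>s. 0 < s \<and> s < a \<longrightarrow> x - s *\<^sub>R n \<in> interior K \<and> x + s *\<^sub>R n \<notin> K"
      using n x unfolding is_outward_normal_def by blast
    obtain b where b: "b > 0" "\<forall>s. 0 < s \<and> s < b \<longrightarrow> x - s *\<^sub>R n' \<in> interior K \<and> x + s *\<^sub>R n' \<notin> K"
      using n' x unfolding is_outward_normal_def by blast
    define s where "s = min a b / 2"
    have "0 < s" "s < a" "s < b" using a b by (auto simp: s_def)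
    then have "x - s *\<^sub>R n \<in> interior K" "x + s *\<^sub>R n' \<notin> K" using a b by auto
    then show False using neg interior_subset by auto
  qed
  then have eq: "outward_normal K e = n" unfolding outward_normal_def using n by (rule the_equality[of "is_outward_normal K e", rotated])
  show "is_outward_normal K e (outward_normal K e)" unfolding eq by (rule n)
  have "unit_normal e n" using n unfolding is_outward_normal_def by (elim conjE)
  then show "outward_normal K e = fnormal m e \<or> outward_normal K e = - fnormal m e"
    unfolding eq by (rule unit_normal_unique[OF fp(7,6)])
qed

text \<open>If the outward normals of the two elements agreed, a short inward step from a relative
  interior point of the face would lie in both interiors, which are disjoint.\<close>

lemma outward_normal_opposite:
  assumes K: "K \<in> elems m" "e \<in> faces_of m K" and K': "K' \<in> elems m" "e \<in> faces_of m K'" and ne: "K \<noteq> K'"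
  shows "outward_normal K' e = - outward_normal K e"
proof (rule ccontr)
  assume c: "outward_normal K' e \<noteq> - outward_normal K e"
  note fp = face_props[OF faces_of_D(1)[OF K(2)]]
  let ?n = "outward_normal K e"
  have eq: "outward_normal K' e = ?n"
    using c outward_normal_sign(2)[OF K] outward_normal_sign(2)[OF K'] by auto
  obtain x where x: "x \<in> rel_interior e" using fp(3) by blast
  obtain a where a: "a > 0" "\<forall>s. 0 < s \<and> s < a \<longrightarrow> x - s *\<^sub>R ?n \<in> interior K \<and> x + s *\<^sub>R ?n \<notin> K"
    using outward_normal_sign(1)[OF K] x unfolding is_outward_normal_def by blast
  obtain b where b: "b > 0" "\<forall>s. 0 < s \<and> s < b \<longrightarrow> x - s *\<^sub>R ?n \<in> interior K' \<and> x + s *\<^sub>R ?n \<notin> K'"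
    using outward_normal_sign(1)[OF K'] x unfolding is_outward_normal_def eq by blast
  define s where "s = min a b / 2"
  have "0 < s" "s < a" "s < b" using a b by (auto simp: s_def)
  then have "x - s *\<^sub>R ?n \<in> interior K \<inter> interior K'" using a b by auto
  moreover have "interior K \<inter> interior K' = {}" using conforming_facts(5) K K' ne by blast
  ultimately show False by blast
qed

lemma adjacent_iff: "K \<in> adjacent m e \<and> e \<in> faces m \<longleftrightarrow> K \<in> elems m \<and> e \<in> faces_of m K"
  by (auto simp: adjacent_def faces_of_def)

lemma sum_elems_faces:
  "(\<Sum>K\<in>elems m. \<Sum>e\<in>faces_of m K. f K e) = (\<Sum>e\<in>faces m. \<Sum>K\<in>adjacent m e. f K e)"
  unfolding faces_of_def adjacent_def by (rule sum.swap_restrict[OF finite_elems finite_faces])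

text \<open>All later face arguments go through these two cases, which remove the description
  operators in \<open>neighbour\<close> and \<open>face_jump\<close>. In the interior case K is the
  element for which the fixed normal is outward; this fixes the sign of the jump.\<close>

lemma face_cases:
  assumes e: "e \<in> faces m"
  obtains (boundary) K where "e \<subseteq> frontier D" "K \<in> elems m" "e \<in> faces_of m K" "adjacent m e = {K}"
      "neighbour m K e = K" "\<And>v x. face_jump m v e x = 0"
  | (interior) K K' where "K \<in> elems m" "e \<in> faces_of m K" "K' \<in> elems m" "e \<in> faces_of m K'" "K \<noteq> K'"
      "adjacent m e = {K, K'}" "neighbour m K e = K'" "neighbour m K' e = K"
      "outward_normal K e = fnormal m e" "outward_normal K' e = - fnormal m e"
      "\<And>v x. face_jump m v e x = v K' x - v K x"
proof (cases "e \<subseteq> frontier D")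
  case True
  then have "card (adjacent m e) = 1" using conforming_facts(9) e by simp
  then obtain K where K: "adjacent m e = {K}" by (auto simp: card_1_singleton_iff)
  then have "K \<in> elems m" "e \<in> faces_of m K" using adjacent_iff[of K e] e by auto
  moreover have "neighbour m K e = K" using K by (simp add: neighbour_def)
  moreover have "face_jump m v e x = 0" for v x using K by (simp add: face_jump_def)
  ultimately show ?thesis using boundary True K by blast
next
  case False
  then have card: "card (adjacent m e) = 2" using conforming_facts(9) e by simp
  then obtain A B where AB: "adjacent m e = {A, B}" "A \<noteq> B" by (auto simp: card_2_iff)
  then have A: "A \<in> elems m" "e \<in> faces_of m A" and B: "B \<in> elems m" "e \<in> faces_of m B"
    using adjacent_iff[of _ e] e by auto
  have opp: "outward_normal B e = - outward_normal A e" by (rule outward_normal_opposite[OF A B AB(2)])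
  obtain K K' where K: "K \<in> elems m" "e \<in> faces_of m K" and K': "K' \<in> elems m" "e \<in> faces_of m K'"
    and ne: "K \<noteq> K'" and adj: "adjacent m e = {K, K'}"
    and n: "outward_normal K e = fnormal m e" "outward_normal K' e = - fnormal m e"
  proof (cases "outward_normal A e = fnormal m e")
    case True
    then show ?thesis using that[of A B] A B AB opp by simp
  next
    case False
    then have "outward_normal A e = - fnormal m e" using outward_normal_sign(2)[OF A] by auto
    then show ?thesis using that[of B A] A B AB opp by (simp add: insert_commute)
  qed
  have "neighbour m K e = K'" "neighbour m K' e = K"
    unfolding neighbour_def adj using ne by (auto intro!: the_equality)
  moreover have "face_jump m v e x = v K' x - v K x" for v x
  proof -
    have "fnormal m e \<noteq> 0" using face_props(6)[OF e] by (auto simp: unit_normal_def)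
    then have nn: "fnormal m e \<noteq> - fnormal m e"
      by (metis add.inverse_neutral eq_neg_iff_add_eq_0 scaleR_2 scaleR_eq_0_iff zero_neq_numeral)
    have "(THE K. K \<in> adjacent m e \<and> outward_normal K e = - fnormal m e) = K'"
      unfolding adj using n nn by (intro the_equality) auto
    moreover have "(THE K. K \<in> adjacent m e \<and> outward_normal K e = fnormal m e) = K"
      unfolding adj using n nn by (intro the_equality) auto
    ultimately show ?thesis using card by (simp add: face_jump_def)
  qed
  ultimately show ?thesis using interior[OF K K' ne adj _ _ n] by blast
qed

lemma sgn_normal:
  assumes "e \<in> faces m" shows "fnormal m e \<bullet> fnormal m e = 1"
  using face_props(6)[OF assms] by (simp add: unit_normal_def dot_square_norm)

end

section \<open>Discrete energy identity\<close>

lemma diff_quot_sym: "diff_quot g a b = diff_quot g b a"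
proof (cases "a = b")
  case False
  then have "(g b - g a) / (b - a) = (g a - g b) / (a - b)" by (simp add: field_simps)
  then show ?thesis using False by (simp add: diff_quot_def)
qed simp

lemma diff_quot_mult: "(b - a) * diff_quot g a b = g b - g a"
  by (simp add: diff_quot_def)

lemma diff_quot_bounded:
  assumes g: "C_k 2 g" and G: "\<And>z. \<bar>z\<bar> \<le> U \<Longrightarrow> \<bar>deriv g z\<bar> \<le> G" and ab: "\<bar>a\<bar> \<le> U" "\<bar>b\<bar> \<le> U"
  shows "\<bar>diff_quot g a b\<bar> \<le> G"
proof -
  have *: "\<bar>diff_quot g a b\<bar> \<le> G" if ab: "a < b" "\<bar>a\<bar> \<le> U" "\<bar>b\<bar> \<le> U" for a b
  proof -
    obtain z where z: "a < z" "z < b" "g b - g a = (b - a) * deriv g z"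
      using MVT2[OF ab(1), of g "deriv g"] C2_real_D(1)[OF g] by blast
    then have "diff_quot g a b = deriv g z" using ab by (simp add: diff_quot_def)
    moreover have "\<bar>z\<bar> \<le> U" using z ab by (auto simp: abs_le_iff)
    ultimately show ?thesis using G by simp
  qed
  consider "a < b" | "b < a" | "a = b" by linarith
  then show ?thesis
  proof cases
    case 1 then show ?thesis using * ab by blast
  next
    case 2 then show ?thesis using * ab diff_quot_sym[of g a b] by metis
  next
    case 3 then show ?thesis using G[OF ab(1)] by (simp add: diff_quot_def)
  qed
qed

text \<open>Here \<gamma> is the normal trace seen from the first element, a and b are the traces of
  u, p and q those of the auxiliary variable. The hypothesis on dq turns the central terms into the
  product rule jump(g q) = jump(g) mean(q) + mean(g) jump(q), which cancels the traces from Green's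
  formula. The sign factors make both penalties proportional to |\<gamma>|.\<close>

lemma face_flux_cancellation:
  fixes \<gamma> a b p q ga gb dq x y :: real
  assumes "(b - a) * dq = gb - ga"
  shows "(a * (\<gamma> * (dq * ((p + q) / 2) + y * sgn \<gamma> * (b - a))) + p * (\<gamma> * ((ga + gb) / 2 + x * sgn \<gamma> * (q - p))) - \<gamma> * (ga * p))
       + (b * (- \<gamma> * (dq * ((q + p) / 2) + y * sgn (- \<gamma>) * (a - b))) + q * (- \<gamma> * ((gb + ga) / 2 + x * sgn (- \<gamma>) * (p - q))) - (- \<gamma>) * (gb * q))
     = - (\<bar>\<gamma>\<bar> * (y * (b - a)\<^sup>2 + x * (q - p)\<^sup>2))"
proof -
  have s: "sgn (- \<gamma>) = - sgn \<gamma>" by (simp add: sgn_minus)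
  have ab: "\<bar>\<gamma>\<bar> = \<gamma> * sgn \<gamma>" by (simp add: abs_sgn)
  have gb: "gb = ga + (b - a) * dq" using assms by simp
  show ?thesis unfolding s gb ab by (simp add: field_simps power2_eq_square)
qed

text \<open>The penalty of \<open>flux_g\<close> alone, tested with the auxiliary variable from both
  sides: it sums to minus |\<gamma>| x times the squared jump.\<close>

lemma face_flux_stability:
  fixes \<gamma> p q x :: real
  assumes "0 \<le> x"
  shows "p * (\<gamma> * (x * sgn \<gamma> * (q - p))) + q * (- \<gamma> * (x * sgn (- \<gamma>) * (p - q))) \<le> 0"
proof -
  have s: "sgn (- \<gamma>) = - sgn \<gamma>" by (simp add: sgn_minus)
  have ab: "\<bar>\<gamma>\<bar> = \<gamma> * sgn \<gamma>" by (simp add: abs_sgn)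
  have "p * (\<gamma> * (x * sgn \<gamma> * (q - p))) + q * (- \<gamma> * (x * sgn (- \<gamma>) * (p - q))) = - (\<bar>\<gamma>\<bar> * x * (q - p)\<^sup>2)"
    unfolding s ab by (simp add: algebra_simps power2_eq_square)
  also have "\<dots> \<le> 0" using assms by simp
  finally show ?thesis .
qed

section \<open>Integrability and bounds of volume and face terms\<close>

locale ldg_mesh = mesh_domain D m for D :: "(real^'n::finite) set" and m +
  fixes L :: "'l set" and P :: "('l, 'n) scheme" and k :: nat
  assumes structural: "structural_assumption L m P"
    and eta_nonneg: "\<forall>\<l>\<in>L. \<forall>e\<in>faces m. eta_u P \<l> e \<ge> 0 \<and> eta_q P \<l> e \<ge> 0"
begin

lemma structural_D:
  assumes "\<l> \<in> L"
  shows "square_integrable (sigma P \<l>)" "has_normal_trace m (sigma P \<l>) (ntrace P \<l>)" "C_k 2 (gfun P \<l>)"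
  using structural assms unfolding structural_assumption_def by blast+

lemma sigma_measurable: "\<l> \<in> L \<Longrightarrow> sigma P \<l> \<in> borel_measurable borel"
  using structural_D(1) by (auto simp: square_integrable_def)

lemma ntrace_measurable: "\<l> \<in> L \<Longrightarrow> e \<in> faces m \<Longrightarrow> ntrace P \<l> e \<in> borel_measurable borel"
  using structural_D(2) unfolding has_normal_trace_def by blast

lemma ntrace_square: "\<l> \<in> L \<Longrightarrow> e \<in> faces m \<Longrightarrow> set_integrable surface e (\<lambda>x. (ntrace P \<l> e x)\<^sup>2)"
  using structural_D(2) unfolding has_normal_trace_def by blast

lemma green:
  assumes "\<l> \<in> L" "K \<in> elems m" "C_k 1 v"
  shows "(LINT x:K|lborel. sigma P \<l> x \<bullet> grad v x) =
     (\<Sum>e\<in>faces_of m K. LINT x:e|surface. sigma_n m P \<l> K e x * v x)"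
  using structural_D(2)[OF assms(1)] assms(2,3) unfolding has_normal_trace_def sigma_n_def by blast

lemma elem_sets: "K \<in> elems m \<Longrightarrow> K \<in> sets borel"
  using elem_closed by simp

text \<open>On a bounded element square integrability implies integrability, through z <= 1 +
  z^2.\<close>

lemma sigma_norm_integrable:
  assumes l: "\<l> \<in> L" and K: "K \<in> elems m"
  shows "set_integrable lborel K (\<lambda>x. norm (sigma P \<l> x))"
  unfolding set_integrable_def
proof (rule Bochner_Integration.integrable_bound[of _ "\<lambda>x. indicator K x + (norm (sigma P \<l> x))\<^sup>2"])
  have "emeasure lborel K < top" using emeasure_compact_finite[OF elem_compact[OF K]] by simp
  then show "integrable lborel (\<lambda>x. indicator K x + (norm (sigma P \<l> x))\<^sup>2)"
    using structural_D(1)[OF l] elem_sets[OF K]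
    by (intro Bochner_Integration.integrable_add integrable_real_indicator) (auto simp: square_integrable_def)
  have "z \<le> 1 + z\<^sup>2" for z :: real
  proof -
    have "2 * z \<le> z\<^sup>2 + 1" using zero_le_power2[of "z - 1"] unfolding power2_diff by simp
    then show ?thesis using zero_le_power2[of z] by linarith
  qed
  then show "AE x in lborel. norm (indicator K x *\<^sub>R norm (sigma P \<l> x)) \<le> norm (indicator K x + (norm (sigma P \<l> x))\<^sup>2)"
    by (auto simp: indicator_def)
  show "(\<lambda>x. indicator K x *\<^sub>R norm (sigma P \<l> x)) \<in> borel_measurable lborel"
    using sigma_measurable[OF l] elem_sets[OF K] by measurable
qed

lemma volume_integrable:
  assumes l: "\<l> \<in> L" and K: "K \<in> elems m" and v: "v \<in> borel_measurable borel" and b: "\<And>x. x \<in> K \<Longrightarrow> norm (v x) \<le> B"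
  shows "set_integrable lborel K (\<lambda>x. v x \<bullet> sigma P \<l> x)"
    "\<bar>LINT x:K|lborel. v x \<bullet> sigma P \<l> x\<bar> \<le> B * (LINT x:K|lborel. norm (sigma P \<l> x))"
proof -
  note si = sigma_norm_integrable[OF l K]
  have le: "\<bar>v x \<bullet> sigma P \<l> x\<bar> \<le> B * norm (sigma P \<l> x)" if "x \<in> K" for x
    using Cauchy_Schwarz_ineq2[of "v x" "sigma P \<l> x"] mult_right_mono[OF b[OF that], of "norm (sigma P \<l> x)"] by simp
  have si': "set_integrable lborel K (\<lambda>x. B * norm (sigma P \<l> x))" using si by simp
  show i: "set_integrable lborel K (\<lambda>x. v x \<bullet> sigma P \<l> x)"
    unfolding set_integrable_def
  proof (rule Bochner_Integration.integrable_bound[OF si'[unfolded set_integrable_def]])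
    show "AE x in lborel. norm (indicator K x *\<^sub>R (v x \<bullet> sigma P \<l> x)) \<le> norm (indicator K x *\<^sub>R (B * norm (sigma P \<l> x)))"
      using le by (auto simp: indicator_def intro: order_trans[OF _ abs_ge_self])
    show "(\<lambda>x. indicator K x *\<^sub>R (v x \<bullet> sigma P \<l> x)) \<in> borel_measurable lborel"
      using v sigma_measurable[OF l] elem_sets[OF K] by measurable
  qed
  have "\<bar>LINT x:K|lborel. v x \<bullet> sigma P \<l> x\<bar> \<le> (LINT x:K|lborel. \<bar>v x \<bullet> sigma P \<l> x\<bar>)"
    using integral_abs_bound[of lborel "\<lambda>x. indicator K x *\<^sub>R (v x \<bullet> sigma P \<l> x)"]
    unfolding set_lebesgue_integral_def by (simp add: abs_mult)
  also have "\<dots> \<le> (LINT x:K|lborel. B * norm (sigma P \<l> x))"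
    using le by (intro set_integral_mono set_integrable_abs i si') auto
  finally show "\<bar>LINT x:K|lborel. v x \<bullet> sigma P \<l> x\<bar> \<le> B * (LINT x:K|lborel. norm (sigma P \<l> x))" by simp
qed

lemma ntrace_integrable:
  assumes l: "\<l> \<in> L" and e: "e \<in> faces m"
  shows "set_integrable surface e (\<lambda>x. \<bar>ntrace P \<l> e x\<bar>)"
  unfolding set_integrable_def
proof (rule Bochner_Integration.integrable_bound[of _ "\<lambda>x. indicator e x + indicator e x *\<^sub>R (ntrace P \<l> e x)\<^sup>2"])
  show "integrable surface (\<lambda>x. indicator e x + indicator e x *\<^sub>R (ntrace P \<l> e x)\<^sup>2)"
    using ntrace_square[OF l e] face_props(2,5)[OF e] unfolding set_integrable_def
    by (intro Bochner_Integration.integrable_add integrable_real_indicator) auto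
  have "\<bar>z\<bar> \<le> 1 + z\<^sup>2" for z :: real
  proof -
    have "2 * \<bar>z\<bar> \<le> z\<^sup>2 + 1" using zero_le_power2[of "\<bar>z\<bar> - 1"] unfolding power2_diff by simp
    then show ?thesis using zero_le_power2[of z] by linarith
  qed
  then show "AE x in surface. norm (indicator e x *\<^sub>R \<bar>ntrace P \<l> e x\<bar>) \<le> norm (indicator e x + indicator e x *\<^sub>R (ntrace P \<l> e x)\<^sup>2)"
    by (auto simp: indicator_def)
  have "(\<lambda>x. indicator e x *\<^sub>R \<bar>ntrace P \<l> e x\<bar>) \<in> borel_measurable borel"
    using ntrace_measurable[OF l e] face_props(2)[OF e] by measurable
  then show "(\<lambda>x. indicator e x *\<^sub>R \<bar>ntrace P \<l> e x\<bar>) \<in> borel_measurable surface" by simp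
qed

text \<open>Normal traces are square integrable but possibly unbounded, so face integrands are
  dominated by multiples of |\<open>ntrace\<close>| rather than by constants.\<close>

lemma face_integrable:
  assumes l: "\<l> \<in> L" and e: "e \<in> faces m" and v: "v \<in> borel_measurable borel"
    and b: "\<And>x. x \<in> e \<Longrightarrow> \<bar>v x\<bar> \<le> B * \<bar>ntrace P \<l> e x\<bar>"
  shows "set_integrable surface e v" "\<bar>LINT x:e|surface. v x\<bar> \<le> B * (LINT x:e|surface. \<bar>ntrace P \<l> e x\<bar>)"
proof -
  have si': "set_integrable surface e (\<lambda>x. B * \<bar>ntrace P \<l> e x\<bar>)" using ntrace_integrable[OF l e] by simp
  show i: "set_integrable surface e v"
    unfolding set_integrable_def
  proof (rule Bochner_Integration.integrable_bound[OF si'[unfolded set_integrable_def]])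
    show "AE x in surface. norm (indicator e x *\<^sub>R v x) \<le> norm (indicator e x *\<^sub>R (B * \<bar>ntrace P \<l> e x\<bar>))"
      using b by (auto simp: indicator_def intro: order_trans[OF _ abs_ge_self])
    have "(\<lambda>x. indicator e x *\<^sub>R v x) \<in> borel_measurable borel"
      using v face_props(2)[OF e] by measurable
    then show "(\<lambda>x. indicator e x *\<^sub>R v x) \<in> borel_measurable surface" by simp
  qed
  have "\<bar>LINT x:e|surface. v x\<bar> \<le> (LINT x:e|surface. \<bar>v x\<bar>)"
    using integral_abs_bound[of surface "\<lambda>x. indicator e x *\<^sub>R v x"]
    unfolding set_lebesgue_integral_def by (simp add: abs_mult)
  also have "\<dots> \<le> (LINT x:e|surface. B * \<bar>ntrace P \<l> e x\<bar>)"
    using b by (intro set_integral_mono set_integrable_abs i si') auto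
  finally show "\<bar>LINT x:e|surface. v x\<bar> \<le> B * (LINT x:e|surface. \<bar>ntrace P \<l> e x\<bar>)" by simp
qed

lemma abs_sigma_n:
  assumes K: "K \<in> elems m" "e \<in> faces_of m K"
  shows "\<bar>sigma_n m P \<l> K e x\<bar> = \<bar>ntrace P \<l> e x\<bar>"
  using outward_normal_sign(2)[OF K] sgn_normal[OF faces_of_D(1)[OF K(2)]]
  by (auto simp: sigma_n_def)

lemma sigma_n_measurable:
  "\<l> \<in> L \<Longrightarrow> e \<in> faces m \<Longrightarrow> sigma_n m P \<l> K e \<in> borel_measurable borel"
  unfolding sigma_n_def[abs_def] using ntrace_measurable by (intro borel_measurable_times) auto

lemma bounded_on_elems:
  fixes f :: "(real^'n) set \<Rightarrow> real^'n \<Rightarrow> 'b::real_normed_vector"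
  assumes "\<And>K. K \<in> elems m \<Longrightarrow> continuous_on UNIV (f K)"
  obtains B where "0 < B" "\<And>K x. K \<in> elems m \<Longrightarrow> x \<in> K \<Longrightarrow> norm (f K x) \<le> B"
proof -
  have "compact (f K ` K)" if "K \<in> elems m" for K
    using assms[OF that] elem_compact[OF that] by (intro compact_continuous_image) (auto intro: continuous_on_subset)
  then have "bounded (\<Union>K\<in>elems m. f K ` K)"
    using finite_elems by (intro bounded_UN) (auto intro: compact_imp_bounded)
  then obtain B where "0 < B" "\<forall>y\<in>(\<Union>K\<in>elems m. f K ` K). norm y \<le> B" by (auto simp: bounded_pos)
  then show ?thesis using that by blast
qed

lemma neighbour_elem:
  assumes K: "K \<in> elems m" "e \<in> faces_of m K"
  shows "neighbour m K e \<in> elems m" "e \<subseteq> neighbour m K e"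
proof -
  have adj: "K \<in> adjacent m e" using K adjacent_iff[of K e] by blast
  have "neighbour m K e \<in> elems m \<and> e \<in> faces_of m (neighbour m K e)"
  proof (cases rule: face_cases[OF faces_of_D(1)[OF K(2)], case_names boundary interior])
    case (boundary K')
    then have "K = K'" using adj by auto
    then show ?thesis using boundary by auto
  next
    case (interior A B)
    then have "K = A \<or> K = B" using adj by auto
    then show ?thesis using interior by auto
  qed
  then show "neighbour m K e \<in> elems m" "e \<subseteq> neighbour m K e" using face_sub_elem by auto
qed

lemma g_bounded:
  assumes "finite L"
  obtains G where "0 < G" "\<And>\<l> z. \<l> \<in> L \<Longrightarrow> \<bar>z\<bar> \<le> U \<Longrightarrow> \<bar>gfun P \<l> z\<bar> \<le> G \<and> \<bar>deriv (gfun P \<l>) z\<bar> \<le> G"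
proof -
  have "compact ((\<lambda>z. (gfun P \<l> z, deriv (gfun P \<l>) z)) ` {-U..U})" if "\<l> \<in> L" for \<l>
    using C2_real_D(2,3)[OF structural_D(3)[OF that]] by (intro compact_continuous_image continuous_intros) auto
  then have "bounded (\<Union>\<l>\<in>L. (\<lambda>z. (gfun P \<l> z, deriv (gfun P \<l>) z)) ` {-U..U})"
    using assms by (intro bounded_UN) (auto intro: compact_imp_bounded)
  then obtain G where G: "0 < G" "\<forall>y\<in>(\<Union>\<l>\<in>L. (\<lambda>z. (gfun P \<l> z, deriv (gfun P \<l>) z)) ` {-U..U}). norm y \<le> G"
    by (auto simp: bounded_pos)
  show ?thesis
  proof (rule that[OF G(1)])
    fix \<l> z assume "\<l> \<in> L" "\<bar>z\<bar> \<le> U"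
    then have "norm (gfun P \<l> z, deriv (gfun P \<l>) z) \<le> G" using G(2) by (auto simp: abs_le_iff)
    then show "\<bar>gfun P \<l> z\<bar> \<le> G \<and> \<bar>deriv (gfun P \<l>) z\<bar> \<le> G"
      using norm_fst_le[of "gfun P \<l> z" "deriv (gfun P \<l>) z"] norm_snd_le[of "deriv (gfun P \<l>) z" "gfun P \<l> z"]
      by simp
  qed
qed

lemma g_measurable:
  assumes "\<l> \<in> L"
  shows "gfun P \<l> \<in> borel_measurable borel" "deriv (gfun P \<l>) \<in> borel_measurable borel"
  using C2_real_D(2,3)[OF structural_D(3)[OF assms], of UNIV] by (auto intro: borel_measurable_continuous_onI)

lemma diff_quot_measurable [measurable (raw)]:
  assumes l: "\<l> \<in> L" and f: "f \<in> borel_measurable A" "h \<in> borel_measurable A"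
  shows "(\<lambda>x. diff_quot (gfun P \<l>) (f x) (h x)) \<in> borel_measurable A"
proof -
  note [measurable] = f g_measurable[OF l]
  show ?thesis unfolding diff_quot_def by measurable
qed

text \<open>The mean value theorem bounds \<open>diff_quot\<close> by the bound G for g', also when
  the jump of u is small. The terms 2 U and 2 Q come from the jumps in the penalties.\<close>

lemma flux_bounds:
  assumes l: "\<l> \<in> L" and K: "K \<in> elems m" "e \<in> faces_of m K" and x: "x \<in> e"
    and G: "\<And>z. \<bar>z\<bar> \<le> U \<Longrightarrow> \<bar>gfun P \<l> z\<bar> \<le> G \<and> \<bar>deriv (gfun P \<l>) z\<bar> \<le> G" "0 \<le> G"
    and u: "\<And>K x. K \<in> elems m \<Longrightarrow> x \<in> K \<Longrightarrow> \<bar>u K x\<bar> \<le> U" and q: "\<And>K x. K \<in> elems m \<Longrightarrow> x \<in> K \<Longrightarrow> \<bar>q K x\<bar> \<le> Q"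
  shows "\<bar>flux_gq m P \<l> u q K e x\<bar> \<le> (G * Q + eta_q P \<l> e * (2 * U)) * \<bar>ntrace P \<l> e x\<bar>"
    "\<bar>flux_g m P \<l> u q K e x\<bar> \<le> (G + eta_u P \<l> e * (2 * Q)) * \<bar>ntrace P \<l> e x\<bar>"
proof -
  let ?K = "neighbour m K e" and ?s = "sigma_n m P \<l> K e x"
  have xK: "x \<in> K" "x \<in> ?K" "?K \<in> elems m" using face_sub_elem[OF K] neighbour_elem[OF K] x by auto
  note uu = u[OF K(1) xK(1)] u[OF xK(3,2)] and qq = q[OF K(1) xK(1)] q[OF xK(3,2)]
  have eta: "0 \<le> eta_q P \<l> e" "0 \<le> eta_u P \<l> e" using eta_nonneg l faces_of_D(1)[OF K(2)] by auto
  have U: "0 \<le> U" "0 \<le> Q" using uu qq by linarith+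
  have dq: "\<bar>diff_quot (gfun P \<l>) (u K x) (u ?K x)\<bar> \<le> G"
    using G(1) by (intro diff_quot_bounded[OF structural_D(3)[OF l] _ uu]) auto
  have s: "\<bar>sgn ?s\<bar> \<le> 1" by (simp add: sgn_if)
  have "\<bar>diff_quot (gfun P \<l>) (u K x) (u ?K x) * ((q K x + q ?K x) / 2)\<bar> \<le> G * Q"
    unfolding abs_mult using dq qq G(2) by (intro mult_mono) auto
  moreover have "\<bar>eta_q P \<l> e * sgn ?s * (u ?K x - u K x)\<bar> \<le> eta_q P \<l> e * 1 * (2 * U)"
    unfolding abs_mult using eta s uu by (intro mult_mono) auto
  ultimately have "\<bar>diff_quot (gfun P \<l>) (u K x) (u ?K x) * ((q K x + q ?K x) / 2) + eta_q P \<l> e * sgn ?s * (u ?K x - u K x)\<bar>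
      \<le> G * Q + eta_q P \<l> e * (2 * U)" by linarith
  then show "\<bar>flux_gq m P \<l> u q K e x\<bar> \<le> (G * Q + eta_q P \<l> e * (2 * U)) * \<bar>ntrace P \<l> e x\<bar>"
    unfolding flux_gq_def Let_def abs_mult[of ?s] abs_sigma_n[OF K]
    by (subst mult.commute) (intro mult_right_mono, auto)
  have "\<bar>(gfun P \<l> (u K x) + gfun P \<l> (u ?K x)) / 2\<bar> \<le> G" using G(1)[OF uu(1)] G(1)[OF uu(2)] by auto
  moreover have "\<bar>eta_u P \<l> e * sgn ?s * (q ?K x - q K x)\<bar> \<le> eta_u P \<l> e * 1 * (2 * Q)"
    unfolding abs_mult using eta s qq by (intro mult_mono) auto
  ultimately have "\<bar>(gfun P \<l> (u K x) + gfun P \<l> (u ?K x)) / 2 + eta_u P \<l> e * sgn ?s * (q ?K x - q K x)\<bar>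
      \<le> G + eta_u P \<l> e * (2 * Q)" by linarith
  then show "\<bar>flux_g m P \<l> u q K e x\<bar> \<le> (G + eta_u P \<l> e * (2 * Q)) * \<bar>ntrace P \<l> e x\<bar>"
    unfolding flux_g_def Let_def abs_mult[of ?s] abs_sigma_n[OF K]
    by (subst mult.commute) (intro mult_right_mono, auto)
qed

text \<open>The parameter z may be a point with u and q fixed, or a pair of time and point. One
  statement thus serves both the integral over a face and the measurability of that integral in
  time.\<close>

lemma flux_measurable:
  assumes l: "\<l> \<in> L" and K: "K \<in> elems m" "e \<in> faces_of m K"
    and u: "\<And>K. K \<in> elems m \<Longrightarrow> (\<lambda>z. u z K (X z)) \<in> borel_measurable A"
    and q: "\<And>K. K \<in> elems m \<Longrightarrow> (\<lambda>z. q z K (X z)) \<in> borel_measurable A" and X: "X \<in> measurable A borel"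
  shows "(\<lambda>z. flux_gq m P \<l> (u z) (q z) K e (X z)) \<in> borel_measurable A"
    "(\<lambda>z. flux_g m P \<l> (u z) (q z) K e (X z)) \<in> borel_measurable A"
proof -
  note [measurable] = u[OF K(1)] u[OF neighbour_elem(1)[OF K]] q[OF K(1)] q[OF neighbour_elem(1)[OF K]]
    g_measurable[OF l] diff_quot_measurable[OF l u[OF K(1)] u[OF neighbour_elem(1)[OF K]]]
  have [measurable]: "(\<lambda>z. sigma_n m P \<l> K e (X z)) \<in> borel_measurable A"
    using measurable_compose[OF X sigma_n_measurable[OF l faces_of_D(1)[OF K(2)]]] .
  show "(\<lambda>z. flux_gq m P \<l> (u z) (q z) K e (X z)) \<in> borel_measurable A"
    unfolding flux_gq_def Let_def by measurable
  show "(\<lambda>z. flux_g m P \<l> (u z) (q z) K e (X z)) \<in> borel_measurable A"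
    unfolding flux_g_def Let_def by measurable
qed

lemma dg_continuous: "v \<in> dg_space m k \<Longrightarrow> K \<in> elems m \<Longrightarrow> continuous_on S (v K)"
  unfolding dg_space_def using polys_continuous by blast

lemma dg_C1: "v \<in> dg_space m k \<Longrightarrow> K \<in> elems m \<Longrightarrow> C_k 1 (v K)"
  unfolding dg_space_def using polys_C1 by blast

lemma dg_measurable: "v \<in> dg_space m k \<Longrightarrow> K \<in> elems m \<Longrightarrow> v K \<in> borel_measurable borel"
  using dg_continuous by (intro borel_measurable_continuous_onI)

lemma dg_bounded:
  assumes "v \<in> dg_space m k"
  obtains B where "0 < B" "\<And>K x. K \<in> elems m \<Longrightarrow> x \<in> K \<Longrightarrow> \<bar>v K x\<bar> \<le> B"
  using bounded_on_elems[of v] dg_continuous[OF assms] unfolding real_norm_def by metis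

lemma continuous_volume_integrable:
  assumes l: "\<l> \<in> L" and K: "K \<in> elems m" and v: "continuous_on UNIV v"
  shows "set_integrable lborel K (\<lambda>x. v x \<bullet> sigma P \<l> x)"
proof -
  have "compact (v ` K)" using v elem_compact[OF K] by (intro compact_continuous_image) (auto intro: continuous_on_subset)
  then obtain B where B: "\<forall>y\<in>v ` K. norm y \<le> B" using compact_imp_bounded bounded_pos by metis
  show ?thesis
    by (rule volume_integrable(1)[OF l K, of _ B]) (use v B in \<open>auto intro: borel_measurable_continuous_onI\<close>)
qed

lemma face_term_integrable:
  assumes fL: "finite L" and l: "\<l> \<in> L" and u: "u \<in> dg_space m k" and q: "q \<in> dg_space m k"
    and K: "K \<in> elems m" "e \<in> faces_of m K" and \<phi>: "continuous_on UNIV \<phi>"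
  shows "set_integrable surface e (\<lambda>x. \<phi> x * flux_gq m P \<l> u q K e x)"
    "set_integrable surface e (\<lambda>x. \<phi> x * flux_g m P \<l> u q K e x)"
    "set_integrable surface e (\<lambda>x. sigma_n m P \<l> K e x * \<phi> x)"
proof -
  have e: "e \<in> faces m" by (rule faces_of_D(1)[OF K(2)])
  obtain U where U: "0 < U" "\<And>K x. K \<in> elems m \<Longrightarrow> x \<in> K \<Longrightarrow> \<bar>u K x\<bar> \<le> U" using dg_bounded[OF u] by metis
  obtain Q where Q: "0 < Q" "\<And>K x. K \<in> elems m \<Longrightarrow> x \<in> K \<Longrightarrow> \<bar>q K x\<bar> \<le> Q" using dg_bounded[OF q] by metis
  obtain G where G: "0 < G" "\<And>\<l> z. \<l> \<in> L \<Longrightarrow> \<bar>z\<bar> \<le> U \<Longrightarrow> \<bar>gfun P \<l> z\<bar> \<le> G \<and> \<bar>deriv (gfun P \<l>) z\<bar> \<le> G"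
    using g_bounded[OF fL, of U] by metis
  obtain B where B: "0 < B" "\<And>K x. K \<in> elems m \<Longrightarrow> x \<in> K \<Longrightarrow> \<bar>\<phi> x\<bar> \<le> B"
    using bounded_on_elems[of "\<lambda>_. \<phi>"] \<phi> unfolding real_norm_def by metis
  have \<phi>B: "\<bar>\<phi> x\<bar> \<le> B" if "x \<in> e" for x using B(2)[OF K(1)] face_sub_elem[OF K] that by auto
  note fb = flux_bounds[OF l K _ G(2)[OF l] less_imp_le[OF G(1)] U(2) Q(2)]
  have m1: "flux_gq m P \<l> u q K e \<in> borel_measurable borel" "flux_g m P \<l> u q K e \<in> borel_measurable borel"
    using flux_measurable[OF l K, of "\<lambda>_. u" "\<lambda>x. x" borel "\<lambda>_. q"] dg_measurable u q by auto
  have \<phi>m: "\<phi> \<in> borel_measurable borel" using \<phi> by (rule borel_measurable_continuous_onI)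
  have sm: "sigma_n m P \<l> K e \<in> borel_measurable borel" by (rule sigma_n_measurable[OF l e])
  show "set_integrable surface e (\<lambda>x. \<phi> x * flux_gq m P \<l> u q K e x)"
  proof (rule face_integrable(1)[OF l e, of _ "B * (G * Q + eta_q P \<l> e * (2 * U))"])
    show "\<bar>\<phi> x * flux_gq m P \<l> u q K e x\<bar> \<le> B * (G * Q + eta_q P \<l> e * (2 * U)) * \<bar>ntrace P \<l> e x\<bar>" if "x \<in> e" for x
      unfolding abs_mult mult.assoc using \<phi>B[OF that] fb(1)[OF that] B(1) by (intro mult_mono) auto
  qed (use m1 \<phi>m in measurable)
  show "set_integrable surface e (\<lambda>x. \<phi> x * flux_g m P \<l> u q K e x)"
  proof (rule face_integrable(1)[OF l e, of _ "B * (G + eta_u P \<l> e * (2 * Q))"])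
    show "\<bar>\<phi> x * flux_g m P \<l> u q K e x\<bar> \<le> B * (G + eta_u P \<l> e * (2 * Q)) * \<bar>ntrace P \<l> e x\<bar>" if "x \<in> e" for x
      unfolding abs_mult mult.assoc using \<phi>B[OF that] fb(2)[OF that] B(1) by (intro mult_mono) auto
  qed (use m1 \<phi>m in measurable)
  show "set_integrable surface e (\<lambda>x. sigma_n m P \<l> K e x * \<phi> x)"
  proof (rule face_integrable(1)[OF l e, of _ B])
    show "\<bar>sigma_n m P \<l> K e x * \<phi> x\<bar> \<le> B * \<bar>ntrace P \<l> e x\<bar>" if "x \<in> e" for x
      unfolding abs_mult abs_sigma_n[OF K] using \<phi>B[OF that] by (subst mult.commute) (intro mult_right_mono, auto)
  qed (use sm \<phi>m in measurable)
qed

end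

lemma set_integral_lincomb:
  fixes f :: "'i \<Rightarrow> 'a \<Rightarrow> real"
  assumes "\<And>i. i \<in> I \<Longrightarrow> set_integrable M A (f i)"
  shows "(LINT x:A|M. (\<Sum>i\<in>I. c i * f i x)) = (\<Sum>i\<in>I. c i * (LINT x:A|M. f i x))"
  using assms set_integral_finite_sum(2)[of I M A "\<lambda>i x. c i * f i x"] by simp

section \<open>Energy balance of the two discrete equations\<close>

context ldg_mesh
begin

text \<open>The first two terms are the numerical fluxes of the two equations; the last one is the
  trace that Green's formula produces from their volume terms.\<close>

definition elem_energy_face :: "'l \<Rightarrow> 'n broken \<Rightarrow> 'n broken \<Rightarrow> (real^'n) set \<Rightarrow> (real^'n) set \<Rightarrow> real^'n \<Rightarrow> real" where
  "elem_energy_face \<l> u q K e x = u K x * flux_gq m P \<l> u q K e x + q K x * flux_g m P \<l> u q K e x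
     - sigma_n m P \<l> K e x * (gfun P \<l> (u K x) * q K x)"

definition face_dissipation :: "'l \<Rightarrow> 'n broken \<Rightarrow> 'n broken \<Rightarrow> (real^'n) set \<Rightarrow> real^'n \<Rightarrow> real" where
  "face_dissipation \<l> u q e x = \<bar>ntrace P \<l> e x\<bar> *
     (eta_q P \<l> e * (face_jump m u e x)\<^sup>2 + eta_u P \<l> e * (face_jump m q e x)\<^sup>2)"

text \<open>The factor 2 stems from differentiating a square and cancels the 1/2 in
  \<open>b_form\<close>. Both volume terms then have weight one and form a single gradient, to which
  Green's formula applies with no divergence term.\<close>

lemma elem_energy:
  assumes fL: "finite L" and l: "\<l> \<in> L" and u: "u \<in> dg_space m k" and q: "q \<in> dg_space m k"
    and qe: "q_equation m P k \<l> u q" and K: "K \<in> elems m"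
  shows "2 * b_form m P \<l> K u q u + (LINT x:K|lborel. (q K x)\<^sup>2)
     = (\<Sum>e\<in>faces_of m K. LINT x:e|surface. elem_energy_face \<l> u q K e x)"
    "\<And>e. e \<in> faces_of m K \<Longrightarrow> set_integrable surface e (elem_energy_face \<l> u q K e)"
proof -
  note g = structural_D(3)[OF l]
  note cu = dg_continuous[OF u K, of UNIV] and cq = dg_continuous[OF q K, of UNIV]
  have cg: "continuous_on UNIV (\<lambda>x. gfun P \<l> (u K x))" "continuous_on UNIV (\<lambda>x. deriv (gfun P \<l>) (u K x))"
    using continuous_on_compose2[OF C2_real_D(3)[OF g, of UNIV] cu] continuous_on_compose2[OF C2_real_D(2)[OF g, of UNIV] cu] by auto
  note cgr = continuous_on_grad[OF dg_C1[OF u K], of UNIV] continuous_on_grad[OF dg_C1[OF q K], of UNIV]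
  have i1: "set_integrable lborel K (\<lambda>x. (grad (u K) x \<bullet> sigma P \<l> x) * deriv (gfun P \<l>) (u K x) * q K x)"
  proof -
    have "continuous_on UNIV (\<lambda>x. (deriv (gfun P \<l>) (u K x) * q K x) *\<^sub>R grad (u K) x)"
      by (intro continuous_intros cg cgr cq)
    from continuous_volume_integrable[OF l K this] show ?thesis by (simp add: mult_ac)
  qed
  have i2: "set_integrable lborel K (\<lambda>x. (grad (q K) x \<bullet> sigma P \<l> x) * gfun P \<l> (u K x))"
  proof -
    have "continuous_on UNIV (\<lambda>x. (gfun P \<l> (u K x)) *\<^sub>R grad (q K) x)"
      by (intro continuous_intros cg cgr)
    from continuous_volume_integrable[OF l K this] show ?thesis by (simp add: mult_ac)
  qed
  note v = C1_comp_mult[OF g dg_C1[OF u K] dg_C1[OF q K]]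
  have gr: "(LINT x:K|lborel. (grad (u K) x \<bullet> sigma P \<l> x) * deriv (gfun P \<l>) (u K x) * q K x)
     + (LINT x:K|lborel. (grad (q K) x \<bullet> sigma P \<l> x) * gfun P \<l> (u K x))
     = (\<Sum>e\<in>faces_of m K. LINT x:e|surface. sigma_n m P \<l> K e x * (gfun P \<l> (u K x) * q K x))"
  proof -
    have "(LINT x:K|lborel. (grad (u K) x \<bullet> sigma P \<l> x) * deriv (gfun P \<l>) (u K x) * q K x)
     + (LINT x:K|lborel. (grad (q K) x \<bullet> sigma P \<l> x) * gfun P \<l> (u K x))
     = (LINT x:K|lborel. sigma P \<l> x \<bullet> grad (\<lambda>x. gfun P \<l> (u K x) * q K x) x)"
      unfolding v(2) set_integral_add(2)[OF i1 i2, symmetric]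
      by (intro set_lebesgue_integral_cong) (use elem_sets[OF K] in \<open>auto simp: inner_add_right inner_commute mult_ac\<close>)
    then show ?thesis using green[OF l K v(1)] by simp
  qed
  have fi: "set_integrable surface e (\<lambda>x. u K x * flux_gq m P \<l> u q K e x)"
    "set_integrable surface e (\<lambda>x. q K x * flux_g m P \<l> u q K e x)"
    "set_integrable surface e (\<lambda>x. sigma_n m P \<l> K e x * (gfun P \<l> (u K x) * q K x))" if e: "e \<in> faces_of m K" for e
  proof -
    show "set_integrable surface e (\<lambda>x. u K x * flux_gq m P \<l> u q K e x)"
      by (rule face_term_integrable(1)[OF fL l u q K e cu])
    show "set_integrable surface e (\<lambda>x. q K x * flux_g m P \<l> u q K e x)"
      by (rule face_term_integrable(2)[OF fL l u q K e cq])
    show "set_integrable surface e (\<lambda>x. sigma_n m P \<l> K e x * (gfun P \<l> (u K x) * q K x))"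
      by (rule face_term_integrable(3)[OF fL l u q K e]) (intro continuous_intros cg cq)
  qed
  show "set_integrable surface e (elem_energy_face \<l> u q K e)" if "e \<in> faces_of m K" for e
    unfolding elem_energy_face_def using fi[OF that] by (intro set_integral_diff(1) set_integral_add(1))
  have qq: "(LINT x:K|lborel. (q K x)\<^sup>2) = - (LINT x:K|lborel. (grad (q K) x \<bullet> sigma P \<l> x) * gfun P \<l> (u K x))
     + (\<Sum>e\<in>faces_of m K. LINT x:e|surface. q K x * flux_g m P \<l> u q K e x)"
    using qe K q unfolding q_equation_def power2_eq_square by blast
  have bb: "2 * b_form m P \<l> K u q u = - (LINT x:K|lborel. (grad (u K) x \<bullet> sigma P \<l> x) * deriv (gfun P \<l>) (u K x) * q K x)
     + (\<Sum>e\<in>faces_of m K. LINT x:e|surface. u K x * flux_gq m P \<l> u q K e x)"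
    unfolding b_form_def by simp
  have "(\<Sum>e\<in>faces_of m K. LINT x:e|surface. elem_energy_face \<l> u q K e x) =
     (\<Sum>e\<in>faces_of m K. LINT x:e|surface. u K x * flux_gq m P \<l> u q K e x)
     + (\<Sum>e\<in>faces_of m K. LINT x:e|surface. q K x * flux_g m P \<l> u q K e x)
     - (\<Sum>e\<in>faces_of m K. LINT x:e|surface. sigma_n m P \<l> K e x * (gfun P \<l> (u K x) * q K x))"
    unfolding sum.distrib[symmetric] sum_subtractf[symmetric] elem_energy_face_def
    using fi by (intro sum.cong refl) (simp add: set_integral_add(2) set_integral_diff(2) set_integral_add(1))
  then show "2 * b_form m P \<l> K u q u + (LINT x:K|lborel. (q K x)\<^sup>2)
     = (\<Sum>e\<in>faces_of m K. LINT x:e|surface. elem_energy_face \<l> u q K e x)"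
    using qq bb gr by linarith
qed

text \<open>The sum over elements and their faces is regrouped by faces. An interior face sees both
  neighbours and reduces to the penalties by \<open>face_flux_cancellation\<close>; a boundary face
  sees one element only.\<close>

lemma energy_identity:
  assumes fL: "finite L" and l: "\<l> \<in> L" and u: "u \<in> dg_space m k" and q: "q \<in> dg_space m k"
    and qe: "q_equation m P k \<l> u q"
    and bd: "\<forall>K\<in>elems m. \<forall>e\<in>faces_of m K. e \<subseteq> frontier D \<longrightarrow>
           (AE x in surface. x \<in> e \<longrightarrow> sigma_n m P \<l> K e x * u K x = 0)"
  shows "(\<Sum>K\<in>elems m. 2 * b_form m P \<l> K u q u + (LINT x:K|lborel. (q K x)\<^sup>2))
     = - (\<Sum>e\<in>faces m. LINT x:e|surface. face_dissipation \<l> u q e x)"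
proof -
  have "(\<Sum>K\<in>elems m. 2 * b_form m P \<l> K u q u + (LINT x:K|lborel. (q K x)\<^sup>2)) =
    (\<Sum>e\<in>faces m. \<Sum>K\<in>adjacent m e. LINT x:e|surface. elem_energy_face \<l> u q K e x)"
    unfolding sum_elems_faces[symmetric] using elem_energy(1)[OF fL l u q qe] by simp
  also have "\<dots> = (\<Sum>e\<in>faces m. - (LINT x:e|surface. face_dissipation \<l> u q e x))"
  proof (rule sum.cong[OF refl])
    fix e assume e: "e \<in> faces m"
    show "(\<Sum>K\<in>adjacent m e. LINT x:e|surface. elem_energy_face \<l> u q K e x) = - (LINT x:e|surface. face_dissipation \<l> u q e x)"
    proof (cases rule: face_cases[OF e, case_names boundary interior])
      case (boundary K)
      \<comment> \<open>On a boundary face K is its own neighbour, so the jumps vanish and the flux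
        of g cancels the Green trace. What is left is (\<sigma> . n) u g'(u) q, a term without sign,
        which \<open>bd\<close> annihilates.\<close>
      have "elem_energy_face \<l> u q K e x = (sigma_n m P \<l> K e x * u K x) * (deriv (gfun P \<l>) (u K x) * q K x)" for x
        using boundary(5) by (simp add: elem_energy_face_def flux_gq_def flux_g_def Let_def diff_quot_def algebra_simps)
      moreover have "AE x in surface. x \<in> e \<longrightarrow> sigma_n m P \<l> K e x * u K x = 0" using bd boundary(1-3) by blast
      ultimately have "AE x in surface. indicator e x *\<^sub>R elem_energy_face \<l> u q K e x = 0"
        by (auto elim!: eventually_mono simp: indicator_def)
      then have "(LINT x:e|surface. elem_energy_face \<l> u q K e x) = 0"
        unfolding set_lebesgue_integral_def by (rule integral_eq_zero_AE)
      moreover have "(LINT x:e|surface. face_dissipation \<l> u q e x) = 0"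
        unfolding face_dissipation_def boundary(6) by simp
      ultimately show ?thesis using boundary(4) by simp
    next
      case (interior K K')
      have sK: "sigma_n m P \<l> K e x = ntrace P \<l> e x" and sK': "sigma_n m P \<l> K' e x = - ntrace P \<l> e x" for x
        using interior(9,10) sgn_normal[OF e] by (simp_all add: sigma_n_def)
      have pt: "elem_energy_face \<l> u q K e x + elem_energy_face \<l> u q K' e x = - face_dissipation \<l> u q e x" for x
        unfolding elem_energy_face_def face_dissipation_def flux_gq_def flux_g_def Let_def interior(7,8,11) sK sK'
          diff_quot_sym[of _ "u K' x" "u K x"]
        by (rule face_flux_cancellation) (rule diff_quot_mult)
      have "(\<Sum>K\<in>adjacent m e. LINT x:e|surface. elem_energy_face \<l> u q K e x) =
        (LINT x:e|surface. elem_energy_face \<l> u q K e x) + (LINT x:e|surface. elem_energy_face \<l> u q K' e x)"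
        using interior(5,6) by simp
      also have "\<dots> = (LINT x:e|surface. elem_energy_face \<l> u q K e x + elem_energy_face \<l> u q K' e x)"
        using elem_energy(2)[OF fL l u q qe interior(1,2)] elem_energy(2)[OF fL l u q qe interior(3,4)]
        by (rule set_integral_add(2)[symmetric])
      also have "\<dots> = - (LINT x:e|surface. face_dissipation \<l> u q e x)"
        unfolding pt set_lebesgue_integral_def by simp
      finally show ?thesis .
    qed
  qed
  finally show ?thesis by (simp add: sum_negf)
qed

text \<open>The equation for \<open>q\<close> is implicit through the penalty term in \<open>flux_g\<close>; tested with \<open>q\<close> itself
  this term has a favourable sign, so \<open>q\<close> is controlled by \<open>u\<close> alone.\<close>

lemma q_energy_le:
  assumes fL: "finite L" and l: "\<l> \<in> L" and u: "u \<in> dg_space m k" and q: "q \<in> dg_space m k"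
    and qe: "q_equation m P k \<l> u q"
  shows "(\<Sum>K\<in>elems m. LINT x:K|lborel. (q K x)\<^sup>2) \<le>
    (\<Sum>K\<in>elems m. - (LINT x:K|lborel. (grad (q K) x \<bullet> sigma P \<l> x) * gfun P \<l> (u K x))
      + (\<Sum>e\<in>faces_of m K. LINT x:e|surface. sigma_n m P \<l> K e x * (((gfun P \<l> (u K x) + gfun P \<l> (u (neighbour m K e) x)) / 2) * q K x)))"
proof -
  let ?A = "\<lambda>K e x. sigma_n m P \<l> K e x * (((gfun P \<l> (u K x) + gfun P \<l> (u (neighbour m K e) x)) / 2) * q K x)"
  \<comment> \<open>The flux of g splits into a part that depends on q only through the test factor,
    \<open>?A\<close>, and the penalty \<open>?B\<close>, which is quadratic in q and is dropped by
    its sign.\<close>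
  let ?B = "\<lambda>K e x. q K x * (sigma_n m P \<l> K e x * (eta_u P \<l> e * sgn (sigma_n m P \<l> K e x) * (q (neighbour m K e) x - q K x)))"
  have cg: "continuous_on UNIV (\<lambda>x. gfun P \<l> (u K x))" if "K \<in> elems m" for K
    using continuous_on_compose2[OF C2_real_D(3)[OF structural_D(3)[OF l], of UNIV] dg_continuous[OF u that, of UNIV]] by auto
  have iA: "set_integrable surface e (?A K e)" if K: "K \<in> elems m" "e \<in> faces_of m K" for K e
    using cg[OF K(1)] cg[OF neighbour_elem(1)[OF K]] dg_continuous[OF q K(1), of UNIV]
    by (intro face_term_integrable(3)[OF fL l u q K]) (intro continuous_intros, auto)
  have iF: "set_integrable surface e (\<lambda>x. q K x * flux_g m P \<l> u q K e x)" if K: "K \<in> elems m" "e \<in> faces_of m K" for K e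
    by (rule face_term_integrable(2)[OF fL l u q K dg_continuous[OF q K(1)]])
  have eqB: "?B K e x = q K x * flux_g m P \<l> u q K e x - ?A K e x" for K e x
    by (simp add: flux_g_def Let_def algebra_simps)
  have iB: "set_integrable surface e (?B K e)" if K: "K \<in> elems m" "e \<in> faces_of m K" for K e
    unfolding eqB by (intro set_integral_diff(1) iF[OF K] iA[OF K])
  have fl: "(LINT x:e|surface. q K x * flux_g m P \<l> u q K e x) = (LINT x:e|surface. ?A K e x) + (LINT x:e|surface. ?B K e x)"
    if K: "K \<in> elems m" "e \<in> faces_of m K" for K e
    unfolding eqB set_integral_diff(2)[OF iF[OF K] iA[OF K]] by simp
  have qq: "(LINT x:K|lborel. (q K x)\<^sup>2) = - (LINT x:K|lborel. (grad (q K) x \<bullet> sigma P \<l> x) * gfun P \<l> (u K x))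
     + (\<Sum>e\<in>faces_of m K. LINT x:e|surface. ?A K e x) + (\<Sum>e\<in>faces_of m K. LINT x:e|surface. ?B K e x)" if K: "K \<in> elems m" for K
  proof -
    have "(LINT x:K|lborel. (q K x)\<^sup>2) = - (LINT x:K|lborel. (grad (q K) x \<bullet> sigma P \<l> x) * gfun P \<l> (u K x))
      + (\<Sum>e\<in>faces_of m K. LINT x:e|surface. q K x * flux_g m P \<l> u q K e x)"
      using qe K q unfolding q_equation_def power2_eq_square by blast
    also have "(\<Sum>e\<in>faces_of m K. LINT x:e|surface. q K x * flux_g m P \<l> u q K e x) =
       (\<Sum>e\<in>faces_of m K. (LINT x:e|surface. ?A K e x) + (LINT x:e|surface. ?B K e x))"
      using fl[OF K] by (intro sum.cong) auto
    finally show ?thesis by (simp add: sum.distrib)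
  qed
  have "(\<Sum>K\<in>elems m. \<Sum>e\<in>faces_of m K. LINT x:e|surface. ?B K e x) = (\<Sum>e\<in>faces m. \<Sum>K\<in>adjacent m e. LINT x:e|surface. ?B K e x)"
    by (rule sum_elems_faces)
  also have "\<dots> \<le> 0"
  proof (rule sum_nonpos)
    fix e assume e: "e \<in> faces m"
    show "(\<Sum>K\<in>adjacent m e. LINT x:e|surface. ?B K e x) \<le> 0"
    proof (cases rule: face_cases[OF e, case_names boundary interior])
      case (boundary K)
      then show ?thesis by simp
    next
      case (interior K K')
      have sK: "sigma_n m P \<l> K e x = ntrace P \<l> e x" and sK': "sigma_n m P \<l> K' e x = - ntrace P \<l> e x" for x
        using interior(9,10) sgn_normal[OF e] by (simp_all add: sigma_n_def)
      have "0 \<le> eta_u P \<l> e" using eta_nonneg l e by blast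
      then have pt: "?B K e x + ?B K' e x \<le> 0" for x
        unfolding interior(7,8) sK sK' by (rule face_flux_stability)
      have "(\<Sum>K\<in>adjacent m e. LINT x:e|surface. ?B K e x) = (LINT x:e|surface. ?B K e x) + (LINT x:e|surface. ?B K' e x)"
        using interior(5,6) by simp
      also have "\<dots> = (LINT x:e|surface. ?B K e x + ?B K' e x)"
        using iB[OF interior(1,2)] iB[OF interior(3,4)] by (rule set_integral_add(2)[symmetric])
      also have "\<dots> \<le> (LINT x:e|surface. 0)"
      proof (rule set_integral_mono)
        show "set_integrable surface e (\<lambda>x. ?B K e x + ?B K' e x)"
          using iB[OF interior(1,2)] iB[OF interior(3,4)] by (rule set_integral_add(1))
      qed (use pt in \<open>auto simp: set_integrable_def\<close>)
      finally show ?thesis by simp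
    qed
  qed
  finally have neg: "(\<Sum>K\<in>elems m. \<Sum>e\<in>faces_of m K. LINT x:e|surface. ?B K e x) \<le> 0" .
  have "(\<Sum>K\<in>elems m. LINT x:K|lborel. (q K x)\<^sup>2) =
    (\<Sum>K\<in>elems m. - (LINT x:K|lborel. (grad (q K) x \<bullet> sigma P \<l> x) * gfun P \<l> (u K x)) + (\<Sum>e\<in>faces_of m K. LINT x:e|surface. ?A K e x))
    + (\<Sum>K\<in>elems m. \<Sum>e\<in>faces_of m K. LINT x:e|surface. ?B K e x)"
    unfolding sum.distrib[symmetric] using qq by (intro sum.cong) auto
  then show ?thesis using neg by linarith
qed

end

text \<open>\<open>eb_expand\<close> is an identity of functions on the whole space. It may
  therefore be differentiated, and evaluated on faces, where an identity almost everywhere in K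
  would say nothing.\<close>

locale ldg_basis = ldg_mesh D m L P k for D :: "(real^'n::finite) set" and m and L :: "'l set" and P and k +
  fixes r :: "(real^'n) set \<Rightarrow> nat" and eb :: "(real^'n) set \<Rightarrow> nat \<Rightarrow> real^'n \<Rightarrow> real"
  assumes finL: "finite L"
    and eb_polys: "\<And>K i. K \<in> elems m \<Longrightarrow> i < r K \<Longrightarrow> eb K i \<in> polys k"
    and eb_orth: "\<And>K i j. K \<in> elems m \<Longrightarrow> i < r K \<Longrightarrow> j < r K \<Longrightarrow>
        (LINT x:K|lborel. eb K i x * eb K j x) = (if i = j then 1 else 0)"
    and eb_expand: "\<And>K p. K \<in> elems m \<Longrightarrow> p \<in> polys k \<Longrightarrow>
        p = (\<lambda>x. \<Sum>i<r K. (LINT x:K|lborel. eb K i x * p x) * eb K i x)"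
begin

definition coord :: "(real^'n) set \<Rightarrow> (real^'n \<Rightarrow> real) \<Rightarrow> nat \<Rightarrow> real" where
  "coord K p i = (LINT x:K|lborel. eb K i x * p x)"

lemma expand: "K \<in> elems m \<Longrightarrow> p \<in> polys k \<Longrightarrow> p x = (\<Sum>i<r K. coord K p i * eb K i x)"
  using fun_cong[OF eb_expand[of K p], of x] unfolding coord_def .

lemma eb_C1: "K \<in> elems m \<Longrightarrow> i < r K \<Longrightarrow> C_k 1 (eb K i)"
  using eb_polys polys_C1 by blast

lemma poly_product_integrable:
  assumes "K \<in> elems m" "p \<in> polys k" "q \<in> polys k" shows "set_integrable lborel K (\<lambda>x. p x * q x)"
  using assms elem_compact polys_continuous
  by (intro set_integrable_continuous_compact continuous_intros) auto

lemma parseval: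
  assumes K: "K \<in> elems m" and p: "p \<in> polys k"
  shows "(LINT x:K|lborel. (p x)\<^sup>2) = (\<Sum>i<r K. (coord K p i)\<^sup>2)"
proof -
  have "(LINT x:K|lborel. (p x)\<^sup>2) = (LINT x:K|lborel. (\<Sum>i<r K. coord K p i * (eb K i x * p x)))"
  proof -
    have "(p x)\<^sup>2 = (\<Sum>i<r K. coord K p i * (eb K i x * p x))" for x
    proof -
      have "p x * p x = (\<Sum>i<r K. coord K p i * eb K i x) * p x"
        by (rule arg_cong[of _ _ "\<lambda>z. z * p x", OF expand[OF K p]])
      then show ?thesis by (simp add: power2_eq_square sum_distrib_right mult.assoc)
    qed
    then show ?thesis by simp
  qed
  also have "\<dots> = (\<Sum>i<r K. coord K p i * coord K p i)"
    using poly_product_integrable[OF K eb_polys[OF K] p]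
    by (subst set_integral_lincomb) (auto simp: coord_def)
  finally show ?thesis by (simp add: power2_eq_square)
qed

text \<open>Linearity in the test function alone. It assembles the drifts of the single coordinates
  into the form tested with u itself, which is what the energy identity concerns.\<close>

lemma b_form_expand:
  assumes l: "\<l> \<in> L" and u: "u \<in> dg_space m k" and q: "q \<in> dg_space m k" and K: "K \<in> elems m"
  shows "b_form m P \<l> K u q u = (\<Sum>i<r K. coord K (u K) i * b_form m P \<l> K u q (\<lambda>_. eb K i))"
proof -
  have uK: "u K \<in> polys k" using u K by (simp add: dg_space_def)
  note g = structural_D(3)[OF l]
  let ?c = "coord K (u K)"
  have gu: "grad (u K) x = (\<Sum>i<r K. ?c i *\<^sub>R grad (eb K i) x)" for x
  proof -
    have "grad (u K) x = grad (\<lambda>x. \<Sum>i<r K. ?c i * eb K i x) x"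
      by (rule arg_cong[of _ _ "\<lambda>f. grad f x"]) (rule ext, rule expand[OF K uK])
    also have "\<dots> = (\<Sum>i<r K. ?c i *\<^sub>R grad (eb K i) x)" by (rule grad_sum) (use eb_C1[OF K] in auto)
    finally show ?thesis .
  qed
  note cu = dg_continuous[OF u K, of UNIV] and cq = dg_continuous[OF q K, of UNIV]
  have cg: "continuous_on UNIV (\<lambda>x. deriv (gfun P \<l>) (u K x))"
    using continuous_on_compose2[OF C2_real_D(2)[OF g, of UNIV] cu] by auto
  let ?V = "\<lambda>i x. (grad (eb K i) x \<bullet> sigma P \<l> x) * deriv (gfun P \<l>) (u K x) * q K x"
  have iV: "set_integrable lborel K (?V i)" if "i < r K" for i
  proof -
    have "continuous_on UNIV (\<lambda>x. (deriv (gfun P \<l>) (u K x) * q K x) *\<^sub>R grad (eb K i) x)"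
      by (intro continuous_intros cg cq continuous_on_grad[OF eb_C1[OF K that]])
    from continuous_volume_integrable[OF l K this] show ?thesis by (simp add: mult_ac)
  qed
  have 1: "(LINT x:K|lborel. (grad (u K) x \<bullet> sigma P \<l> x) * deriv (gfun P \<l>) (u K x) * q K x)
     = (\<Sum>i<r K. ?c i * (LINT x:K|lborel. ?V i x))"
  proof -
    have "(grad (u K) x \<bullet> sigma P \<l> x) * deriv (gfun P \<l>) (u K x) * q K x = (\<Sum>i<r K. ?c i * ?V i x)" for x
      unfolding gu by (simp add: inner_sum_left sum_distrib_right mult.assoc)
    then have "(LINT x:K|lborel. (grad (u K) x \<bullet> sigma P \<l> x) * deriv (gfun P \<l>) (u K x) * q K x) = (LINT x:K|lborel. (\<Sum>i<r K. ?c i * ?V i x))" by simp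
    also have "\<dots> = (\<Sum>i<r K. ?c i * (LINT x:K|lborel. ?V i x))" using iV by (intro set_integral_lincomb) auto
    finally show ?thesis .
  qed
  let ?F = "\<lambda>e i x. eb K i x * flux_gq m P \<l> u q K e x"
  have 2: "(LINT x:e|surface. u K x * flux_gq m P \<l> u q K e x) = (\<Sum>i<r K. ?c i * (LINT x:e|surface. ?F e i x))"
    if e: "e \<in> faces_of m K" for e
  proof -
    have iF: "set_integrable surface e (?F e i)" if "i < r K" for i
      by (rule face_term_integrable(1)[OF finL l u q K e]) (use eb_polys[OF K that] polys_continuous in blast)
    have "u K x * flux_gq m P \<l> u q K e x = (\<Sum>i<r K. ?c i * ?F e i x)" for x
    proof -
      have "u K x * flux_gq m P \<l> u q K e x = (\<Sum>i<r K. ?c i * eb K i x) * flux_gq m P \<l> u q K e x"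
        by (rule arg_cong[of _ _ "\<lambda>z. z * flux_gq m P \<l> u q K e x", OF expand[OF K uK]])
      then show ?thesis by (simp add: sum_distrib_right mult.assoc)
    qed
    then have "(LINT x:e|surface. u K x * flux_gq m P \<l> u q K e x) = (LINT x:e|surface. (\<Sum>i<r K. ?c i * ?F e i x))" by simp
    also have "\<dots> = (\<Sum>i<r K. ?c i * (LINT x:e|surface. ?F e i x))" using iF by (intro set_integral_lincomb) auto
    finally show ?thesis .
  qed
  have 3: "(\<Sum>e\<in>faces_of m K. LINT x:e|surface. u K x * flux_gq m P \<l> u q K e x)
      = (\<Sum>i<r K. ?c i * (\<Sum>e\<in>faces_of m K. LINT x:e|surface. ?F e i x))"
    using 2 by (simp add: sum_distrib_left) (rule sum.swap)
  show ?thesis unfolding b_form_def 1 3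
    by (simp add: sum_distrib_left sum.distrib[symmetric] sum_subtractf[symmetric] sum_negf[symmetric] algebra_simps)
qed

lemma coord_bounded:
  assumes U: "\<And>K x. K \<in> elems m \<Longrightarrow> x \<in> K \<Longrightarrow> \<bar>v K x\<bar> \<le> U" and v: "v \<in> dg_space m k" and K: "K \<in> elems m" and i: "i < r K"
  shows "\<bar>coord K (v K) i\<bar> \<le> U * (LINT x:K|lborel. \<bar>eb K i x\<bar>)"
proof -
  have vK: "v K \<in> polys k" using v K by (simp add: dg_space_def)
  have ie: "set_integrable lborel K (\<lambda>x. \<bar>eb K i x\<bar>)"
    using elem_compact[OF K] polys_continuous[OF eb_polys[OF K i]]
    by (intro set_integrable_continuous_compact continuous_intros) auto
  have "\<bar>coord K (v K) i\<bar> \<le> (LINT x:K|lborel. \<bar>eb K i x * v K x\<bar>)"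
    using integral_abs_bound[of lborel "\<lambda>x. indicator K x *\<^sub>R (eb K i x * v K x)"]
    unfolding coord_def set_lebesgue_integral_def by (simp add: abs_mult)
  also have "\<dots> \<le> (LINT x:K|lborel. U * \<bar>eb K i x\<bar>)"
  proof (rule set_integral_mono)
    show "set_integrable lborel K (\<lambda>x. \<bar>eb K i x * v K x\<bar>)"
      using poly_product_integrable[OF K eb_polys[OF K i] vK] by (rule set_integrable_abs)
    show "\<bar>eb K i x * v K x\<bar> \<le> U * \<bar>eb K i x\<bar>" if "x \<in> K" for x
      unfolding abs_mult using U[OF K that] by (subst mult.commute) (intro mult_right_mono, auto)
  qed (use ie in simp)
  finally show ?thesis by simp
qed

end

section \<open>Boundedness and measurability of the discrete forms\<close>

context ldg_basis
begin

text \<open>The surface measure is not \<sigma>-finite on the whole space, but its restriction to a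
  face is finite, and there integrals depend measurably on a parameter.\<close>

lemma surface_integral_measurable:
  assumes e: "e \<in> faces m" and f: "(\<lambda>(z, x). f z x) \<in> borel_measurable (A \<Otimes>\<^sub>M borel)"
  shows "(\<lambda>z. LINT x:e|surface. f z x :: real) \<in> borel_measurable A"
proof -
  let ?R = "restrict_space surface e"
  have es: "e \<in> sets surface" using face_props(2)[OF e] by simp
  have "emeasure ?R (space ?R) = emeasure surface e"
    using es by (subst emeasure_restrict_space) (auto simp: space_restrict_space)
  then interpret R: finite_measure ?R using face_props(5)[OF e] by (intro finite_measureI) auto
  have "(\<lambda>x. x) \<in> measurable ?R borel" by (intro measurable_restrict_space1) (simp add: measurable_def)
  then have "(\<lambda>p. (fst p, snd p)) \<in> measurable (A \<Otimes>\<^sub>M ?R) (A \<Otimes>\<^sub>M borel)"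
    by (intro measurable_Pair measurable_fst measurable_compose[OF measurable_snd])
  from measurable_compose[OF this f] have "(\<lambda>(z, x). f z x) \<in> borel_measurable (A \<Otimes>\<^sub>M ?R)"
    by (simp add: case_prod_beta')
  then have "(\<lambda>z. LINT x|?R. f z x) \<in> borel_measurable A" by (rule R.borel_measurable_lebesgue_integral)
  then show ?thesis using es by (simp add: integral_restrict_space set_lebesgue_integral_def)
qed

lemma volume_integral_measurable:
  assumes K: "K \<in> elems m" and f: "(\<lambda>(z, x). f z x) \<in> borel_measurable (A \<Otimes>\<^sub>M borel)"
  shows "(\<lambda>z. LINT x:K|lborel. f z x :: real) \<in> borel_measurable A"
proof -
  have "(\<lambda>p. indicator K (snd p) *\<^sub>R (\<lambda>(z, x). f z x) p) \<in> borel_measurable (A \<Otimes>\<^sub>M borel)"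
    using f elem_sets[OF K] by measurable
  then have "(\<lambda>(z, x). indicator K x *\<^sub>R f z x) \<in> borel_measurable (A \<Otimes>\<^sub>M lborel)"
    by (subst measurable_cong_sets[OF sets_pair_measure_cong refl, of A A lborel borel]) (auto simp: case_prod_beta')
  then show ?thesis unfolding set_lebesgue_integral_def by (rule lborel.borel_measurable_lebesgue_integral)
qed

lemma basis_bounded:
  obtains B where "0 < B"
    "\<And>K i x. K \<in> elems m \<Longrightarrow> i < r K \<Longrightarrow> x \<in> K \<Longrightarrow> \<bar>eb K i x\<bar> \<le> B \<and> norm (grad (eb K i) x) \<le> B"
proof -
  let ?f = "\<lambda>p x. (eb (fst p) (snd p) x, grad (eb (fst p) (snd p)) x)"
  let ?I = "Sigma (elems m) (\<lambda>K. {..<r K})"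
  have "compact (?f p ` fst p)" if "p \<in> ?I" for p
    using that elem_compact by (intro compact_continuous_image continuous_intros polys_continuous[OF eb_polys] continuous_on_grad eb_C1) auto
  then have "bounded (\<Union>p\<in>?I. ?f p ` fst p)"
    using finite_elems by (intro bounded_UN) (auto intro: compact_imp_bounded)
  then obtain B where B: "0 < B" "\<forall>y\<in>(\<Union>p\<in>?I. ?f p ` fst p). norm y \<le> B" by (auto simp: bounded_pos)
  show ?thesis
  proof (rule that[OF B(1)])
    fix K i x assume "K \<in> elems m" "i < r K" "x \<in> K"
    then have "(eb K i x, grad (eb K i) x) \<in> (\<Union>p\<in>?I. ?f p ` fst p)" by force
    then have "norm (eb K i x, grad (eb K i) x) \<le> B" using B(2) by blast
    then show "\<bar>eb K i x\<bar> \<le> B \<and> norm (grad (eb K i) x) \<le> B"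
      using norm_fst_le[of "eb K i x" "grad (eb K i) x"] norm_snd_le[of "grad (eb K i) x" "eb K i x"] by simp
  qed
qed

text \<open>This sum and the next one serve as crude common bounds over the finitely many processes,
  elements and faces.\<close>

definition sigma_mass :: real where
  "sigma_mass = (\<Sum>\<l>\<in>L. \<Sum>K\<in>elems m. LINT x:K|lborel. norm (sigma P \<l> x))"

definition trace_mass :: real where
  "trace_mass = (\<Sum>\<l>\<in>L. \<Sum>e\<in>faces m. LINT x:e|surface. \<bar>ntrace P \<l> e x\<bar>)"

lemma sigma_mass:
  assumes "\<l> \<in> L" "K \<in> elems m" shows "0 \<le> (LINT x:K|lborel. norm (sigma P \<l> x))" "(LINT x:K|lborel. norm (sigma P \<l> x)) \<le> sigma_mass"
proof -
  have nn: "0 \<le> (LINT x:K|lborel. norm (sigma P \<l> x))" for \<l> K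
    by (simp add: set_lebesgue_integral_def)
  then show "0 \<le> (LINT x:K|lborel. norm (sigma P \<l> x))" .
  have "(LINT x:K|lborel. norm (sigma P \<l> x)) \<le> (\<Sum>K\<in>elems m. LINT x:K|lborel. norm (sigma P \<l> x))"
    using assms finite_elems nn by (intro member_le_sum) auto
  also have "\<dots> \<le> sigma_mass" unfolding sigma_mass_def
    using assms finL nn by (intro member_le_sum[where f = "\<lambda>\<l>. \<Sum>K\<in>elems m. LINT x:K|lborel. norm (sigma P \<l> x)"] sum_nonneg) auto
  finally show "(LINT x:K|lborel. norm (sigma P \<l> x)) \<le> sigma_mass" .
qed

lemma trace_mass:
  assumes "\<l> \<in> L" shows "0 \<le> (LINT x:e|surface. \<bar>ntrace P \<l> e x\<bar>)"
    "(\<Sum>e\<in>faces m. LINT x:e|surface. \<bar>ntrace P \<l> e x\<bar>) \<le> trace_mass"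
proof -
  have nn: "0 \<le> (LINT x:e|surface. \<bar>ntrace P \<l> e x\<bar>)" for \<l> e
    by (simp add: set_lebesgue_integral_def)
  then show "0 \<le> (LINT x:e|surface. \<bar>ntrace P \<l> e x\<bar>)" .
  show "(\<Sum>e\<in>faces m. LINT x:e|surface. \<bar>ntrace P \<l> e x\<bar>) \<le> trace_mass" unfolding trace_mass_def
    using assms finL nn by (intro member_le_sum[where f = "\<lambda>\<l>. \<Sum>e\<in>faces m. LINT x:e|surface. \<bar>ntrace P \<l> e x\<bar>"] sum_nonneg) auto
qed

lemma faces_sum_bound:
  assumes l: "\<l> \<in> L" and B: "0 \<le> B"
    and f: "\<And>e. e \<in> faces_of m K \<Longrightarrow> \<bar>f e\<bar> \<le> B * (LINT x:e|surface. \<bar>ntrace P \<l> e x\<bar>)"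
  shows "\<bar>\<Sum>e\<in>faces_of m K. f e\<bar> \<le> B * trace_mass"
proof -
  have "\<bar>\<Sum>e\<in>faces_of m K. f e\<bar> \<le> (\<Sum>e\<in>faces_of m K. B * (LINT x:e|surface. \<bar>ntrace P \<l> e x\<bar>))"
    by (rule order_trans[OF sum_abs]) (use f in \<open>intro sum_mono; auto\<close>)
  also have "\<dots> \<le> (\<Sum>e\<in>faces m. B * (LINT x:e|surface. \<bar>ntrace P \<l> e x\<bar>))"
    using B trace_mass(1)[OF l] finite_faces by (intro sum_mono2) (auto simp: faces_of_def)
  also have "\<dots> \<le> B * trace_mass" unfolding sum_distrib_left[symmetric] using trace_mass(2)[OF l] B by (rule mult_left_mono)
  finally show ?thesis .
qed

text \<open>The constant depends on U only. By \<open>q_energy_le\<close> and Parseval, the sum of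
  the squared coordinates of q is at most c times the sum of their absolute values. Young's
  inequality absorbs half of the left side, and a bound on the coordinates bounds q pointwise since
  the basis is bounded on the elements.\<close>

lemma q_coord_bounded:
  obtains C where "\<And>\<l> u q K x. \<l> \<in> L \<Longrightarrow> u \<in> dg_space m k \<Longrightarrow> q \<in> dg_space m k \<Longrightarrow> q_equation m P k \<l> u q \<Longrightarrow>
    (\<And>K x. K \<in> elems m \<Longrightarrow> x \<in> K \<Longrightarrow> \<bar>u K x\<bar> \<le> U) \<Longrightarrow> K \<in> elems m \<Longrightarrow> x \<in> K \<Longrightarrow> \<bar>q K x\<bar> \<le> C"
proof -
  obtain B where B: "0 < B"
    "\<And>K i x. K \<in> elems m \<Longrightarrow> i < r K \<Longrightarrow> x \<in> K \<Longrightarrow> \<bar>eb K i x\<bar> \<le> B \<and> norm (grad (eb K i) x) \<le> B"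
    using basis_bounded by metis
  obtain G where G: "0 < G" "\<And>\<l> z. \<l> \<in> L \<Longrightarrow> \<bar>z\<bar> \<le> U \<Longrightarrow> \<bar>gfun P \<l> z\<bar> \<le> G \<and> \<bar>deriv (gfun P \<l>) z\<bar> \<le> G"
    using g_bounded[OF finL, of U] by metis
  \<comment> \<open>Bounds the factor of each coordinate of q: G bounds g on [-U, U], B the basis
    functions and their gradients, and the masses bound the integrals of |\<sigma>| and of the
    normal traces.\<close>
  define c where "c = G * B * (sigma_mass + trace_mass)"
  define n where "n = (\<Sum>K\<in>elems m. r K)"
  \<comment> \<open>Obtained from Q_i^2 <= n c^2, with n the total number of coordinates, and |x| <=
    1 + x^2.\<close>
  define R where "R = 1 + real n * c\<^sup>2"
  show ?thesis
  proof (rule that[of "real n * (R * B)"])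
    fix \<l> u q K0 x0
    assume l: "\<l> \<in> L" and u: "u \<in> dg_space m k" and q: "q \<in> dg_space m k" and qe: "q_equation m P k \<l> u q"
      and U: "\<And>K x. K \<in> elems m \<Longrightarrow> x \<in> K \<Longrightarrow> \<bar>u K x\<bar> \<le> U" and K0: "K0 \<in> elems m" "x0 \<in> K0"
    have GB: "0 \<le> G * B" using G B by simp
    let ?Q = "\<lambda>K. coord K (q K)"
    have qK: "q K \<in> polys k" if "K \<in> elems m" for K using q that by (simp add: dg_space_def)
    have gm: "(\<lambda>x. gfun P \<l> (u K x)) \<in> borel_measurable borel" if "K \<in> elems m" for K
      using measurable_compose[OF dg_measurable[OF u that] g_measurable(1)[OF l]] .
    have bound: "- (LINT x:K|lborel. (grad (q K) x \<bullet> sigma P \<l> x) * gfun P \<l> (u K x))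
      + (\<Sum>e\<in>faces_of m K. LINT x:e|surface. sigma_n m P \<l> K e x * (((gfun P \<l> (u K x) + gfun P \<l> (u (neighbour m K e) x)) / 2) * q K x))
      \<le> (\<Sum>i<r K. c * \<bar>?Q K i\<bar>)" if K: "K \<in> elems m" for K
    proof -
      let ?V = "\<lambda>i x. (gfun P \<l> (u K x) *\<^sub>R grad (eb K i) x) \<bullet> sigma P \<l> x"
      have V: "set_integrable lborel K (?V i)" "\<bar>LINT x:K|lborel. ?V i x\<bar> \<le> G * B * sigma_mass" if i: "i < r K" for i
      proof -
        have m1: "(\<lambda>x. gfun P \<l> (u K x) *\<^sub>R grad (eb K i) x) \<in> borel_measurable borel"
          using gm[OF K] borel_measurable_continuous_onI[OF continuous_on_grad[OF eb_C1[OF K i]]] by measurable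
        have b: "norm (gfun P \<l> (u K x) *\<^sub>R grad (eb K i) x) \<le> G * B" if "x \<in> K" for x
          unfolding norm_scaleR using G(2)[OF l U[OF K that]] B(2)[OF K i that] G(1) by (intro mult_mono) auto
        show "set_integrable lborel K (?V i)" by (rule volume_integrable(1)[OF l K m1 b])
        have "\<bar>LINT x:K|lborel. ?V i x\<bar> \<le> G * B * (LINT x:K|lborel. norm (sigma P \<l> x))"
          by (rule volume_integrable(2)[OF l K m1 b])
        also have "\<dots> \<le> G * B * sigma_mass" using sigma_mass(2)[OF l K] GB by (rule mult_left_mono)
        finally show "\<bar>LINT x:K|lborel. ?V i x\<bar> \<le> G * B * sigma_mass" .
      qed
      let ?F = "\<lambda>e i x. sigma_n m P \<l> K e x * (((gfun P \<l> (u K x) + gfun P \<l> (u (neighbour m K e) x)) / 2) * eb K i x)"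
      have F: "set_integrable surface e (?F e i)" "\<bar>LINT x:e|surface. ?F e i x\<bar> \<le> G * B * (LINT x:e|surface. \<bar>ntrace P \<l> e x\<bar>)"
        if i: "i < r K" and e: "e \<in> faces_of m K" for i e
      proof -
        note ef = faces_of_D(1)[OF e] and nb = neighbour_elem[OF K e]
        have m1: "?F e i \<in> borel_measurable borel"
          using gm[OF K] gm[OF nb(1)] sigma_n_measurable[OF l ef]
            borel_measurable_continuous_onI[OF polys_continuous[OF eb_polys[OF K i]]] by measurable
        have b: "\<bar>?F e i x\<bar> \<le> G * B * \<bar>ntrace P \<l> e x\<bar>" if x: "x \<in> e" for x
        proof -
          have xK: "x \<in> K" "x \<in> neighbour m K e" using face_sub_elem[OF K e] nb(2) x by auto
          have "\<bar>(gfun P \<l> (u K x) + gfun P \<l> (u (neighbour m K e) x)) / 2\<bar> \<le> G"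
            using G(2)[OF l U[OF K xK(1)]] G(2)[OF l U[OF nb(1) xK(2)]] by auto
          then have "\<bar>((gfun P \<l> (u K x) + gfun P \<l> (u (neighbour m K e) x)) / 2) * eb K i x\<bar> \<le> G * B"
            unfolding abs_mult using B(2)[OF K i xK(1)] G(1) by (intro mult_mono) auto
          then show ?thesis unfolding abs_mult[of "sigma_n _ _ _ _ _ _"] abs_sigma_n[OF K e]
            by (subst mult.commute) (intro mult_right_mono, auto)
        qed
        show "set_integrable surface e (?F e i)" by (rule face_integrable(1)[OF l ef m1 b])
        show "\<bar>LINT x:e|surface. ?F e i x\<bar> \<le> G * B * (LINT x:e|surface. \<bar>ntrace P \<l> e x\<bar>)"
          by (rule face_integrable(2)[OF l ef m1 b])
      qed
      have gq: "grad (q K) x = (\<Sum>i<r K. ?Q K i *\<^sub>R grad (eb K i) x)" for x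
      proof -
        have "grad (q K) x = grad (\<lambda>x. \<Sum>i<r K. ?Q K i * eb K i x) x"
          by (rule arg_cong[of _ _ "\<lambda>f. grad f x"]) (rule ext, rule expand[OF K qK[OF K]])
        also have "\<dots> = (\<Sum>i<r K. ?Q K i *\<^sub>R grad (eb K i) x)" by (rule grad_sum) (use eb_C1[OF K] in auto)
        finally show ?thesis .
      qed
      have v: "(LINT x:K|lborel. (grad (q K) x \<bullet> sigma P \<l> x) * gfun P \<l> (u K x)) = (\<Sum>i<r K. ?Q K i * (LINT x:K|lborel. ?V i x))"
      proof -
        have "(grad (q K) x \<bullet> sigma P \<l> x) * gfun P \<l> (u K x) = (\<Sum>i<r K. ?Q K i * ?V i x)" for x
          unfolding gq by (simp add: inner_sum_left sum_distrib_right sum_distrib_left mult_ac)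
        then show ?thesis using V(1) by (simp only: ) (intro set_integral_lincomb, auto)
      qed
      have f: "(LINT x:e|surface. sigma_n m P \<l> K e x * (((gfun P \<l> (u K x) + gfun P \<l> (u (neighbour m K e) x)) / 2) * q K x))
         = (\<Sum>i<r K. ?Q K i * (LINT x:e|surface. ?F e i x))" if e: "e \<in> faces_of m K" for e
      proof -
        let ?h = "\<lambda>x. sigma_n m P \<l> K e x * ((gfun P \<l> (u K x) + gfun P \<l> (u (neighbour m K e) x)) / 2)"
        have "?h x * q K x = ?h x * (\<Sum>i<r K. ?Q K i * eb K i x)" for x
          by (rule arg_cong[of _ _ "\<lambda>z. ?h x * z", OF expand[OF K qK[OF K]]])
        then have "sigma_n m P \<l> K e x * (((gfun P \<l> (u K x) + gfun P \<l> (u (neighbour m K e) x)) / 2) * q K x) = (\<Sum>i<r K. ?Q K i * ?F e i x)" for x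
          unfolding mult.assoc[symmetric] by (simp add: sum_distrib_left mult_ac)
        then show ?thesis using F(1)[OF _ e] by (simp only: ) (intro set_integral_lincomb, auto)
      qed
      have "- (LINT x:K|lborel. (grad (q K) x \<bullet> sigma P \<l> x) * gfun P \<l> (u K x))
        + (\<Sum>e\<in>faces_of m K. LINT x:e|surface. sigma_n m P \<l> K e x * (((gfun P \<l> (u K x) + gfun P \<l> (u (neighbour m K e) x)) / 2) * q K x))
        = (\<Sum>i<r K. ?Q K i * ((\<Sum>e\<in>faces_of m K. LINT x:e|surface. ?F e i x) - (LINT x:K|lborel. ?V i x)))"
      proof -
        have "(\<Sum>e\<in>faces_of m K. LINT x:e|surface. sigma_n m P \<l> K e x * (((gfun P \<l> (u K x) + gfun P \<l> (u (neighbour m K e) x)) / 2) * q K x))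
          = (\<Sum>e\<in>faces_of m K. \<Sum>i<r K. ?Q K i * (LINT x:e|surface. ?F e i x))" using f by (intro sum.cong) auto
        also have "\<dots> = (\<Sum>i<r K. ?Q K i * (\<Sum>e\<in>faces_of m K. LINT x:e|surface. ?F e i x))"
          unfolding sum_distrib_left by (rule sum.swap)
        finally show ?thesis unfolding v by (simp add: right_diff_distrib sum_subtractf)
      qed
      also have "\<dots> \<le> (\<Sum>i<r K. c * \<bar>?Q K i\<bar>)"
      proof (rule sum_mono)
        fix i assume "i \<in> {..<r K}"
        then have i: "i < r K" by simp
        have "\<bar>\<Sum>e\<in>faces_of m K. LINT x:e|surface. ?F e i x\<bar> \<le> G * B * trace_mass"
          by (rule faces_sum_bound[OF l GB F(2)[OF i]])
        then have "\<bar>(\<Sum>e\<in>faces_of m K. LINT x:e|surface. ?F e i x) - (LINT x:K|lborel. ?V i x)\<bar> \<le> c"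
          using V(2)[OF i] unfolding c_def distrib_left by linarith
        then have "\<bar>?Q K i\<bar> * \<bar>(\<Sum>e\<in>faces_of m K. LINT x:e|surface. ?F e i x) - (LINT x:K|lborel. ?V i x)\<bar> \<le> \<bar>?Q K i\<bar> * c"
          by (rule mult_left_mono) simp
        then show "?Q K i * ((\<Sum>e\<in>faces_of m K. LINT x:e|surface. ?F e i x) - (LINT x:K|lborel. ?V i x)) \<le> c * \<bar>?Q K i\<bar>"
          unfolding abs_mult[symmetric] by (simp only: mult.commute[of c])
      qed
      finally show ?thesis .
    qed
    have "(\<Sum>K\<in>elems m. \<Sum>i<r K. (?Q K i)\<^sup>2) = (\<Sum>K\<in>elems m. LINT x:K|lborel. (q K x)\<^sup>2)"
      using parseval qK by (intro sum.cong) auto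
    also have "\<dots> \<le> (\<Sum>K\<in>elems m. \<Sum>i<r K. c * \<bar>?Q K i\<bar>)"
      by (rule order_trans[OF q_energy_le[OF finL l u q qe]]) (rule sum_mono, rule bound)
    also have "\<dots> \<le> (\<Sum>K\<in>elems m. \<Sum>i<r K. (?Q K i)\<^sup>2 / 2 + c\<^sup>2 / 2)"
    proof (intro sum_mono)
      fix K i
      have "2 * (c * \<bar>?Q K i\<bar>) \<le> c\<^sup>2 + \<bar>?Q K i\<bar>\<^sup>2" using sum_squares_bound[of c "\<bar>?Q K i\<bar>"] by simp
      then show "c * \<bar>?Q K i\<bar> \<le> (?Q K i)\<^sup>2 / 2 + c\<^sup>2 / 2" by simp
    qed
    also have "\<dots> = (\<Sum>K\<in>elems m. \<Sum>i<r K. (?Q K i)\<^sup>2) / 2 + real n * c\<^sup>2 / 2"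
      by (simp add: sum.distrib sum_divide_distrib n_def sum_distrib_right)
    finally have tot: "(\<Sum>K\<in>elems m. \<Sum>i<r K. (?Q K i)\<^sup>2) \<le> real n * c\<^sup>2" by simp
    have Q: "\<bar>?Q K0 i\<bar> \<le> R" if i: "i < r K0" for i
    proof -
      have "(?Q K0 i)\<^sup>2 \<le> (\<Sum>i<r K0. (?Q K0 i)\<^sup>2)"
        using i by (intro member_le_sum) auto
      also have "\<dots> \<le> (\<Sum>K\<in>elems m. \<Sum>i<r K. (?Q K i)\<^sup>2)"
        using K0 finite_elems by (intro member_le_sum[where f = "\<lambda>K. \<Sum>i<r K. (?Q K i)\<^sup>2"] sum_nonneg) auto
      finally have "(?Q K0 i)\<^sup>2 \<le> real n * c\<^sup>2" using tot by linarith
      moreover have "\<bar>?Q K0 i\<bar> \<le> 1 + (?Q K0 i)\<^sup>2"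
      proof -
        have "2 * \<bar>?Q K0 i\<bar> \<le> (?Q K0 i)\<^sup>2 + 1" using zero_le_power2[of "\<bar>?Q K0 i\<bar> - 1"] unfolding power2_diff by simp
        then show ?thesis using zero_le_power2[of "?Q K0 i"] by linarith
      qed
      ultimately show ?thesis unfolding R_def by linarith
    qed
    have R0: "0 \<le> R" unfolding R_def by simp
    have "\<bar>q K0 x0\<bar> = \<bar>\<Sum>i<r K0. ?Q K0 i * eb K0 i x0\<bar>"
      by (rule arg_cong[of _ _ abs, OF expand[OF K0(1) qK[OF K0(1)]]])
    also have "\<dots> \<le> (\<Sum>i<r K0. R * B)"
    proof (rule order_trans[OF sum_abs], rule sum_mono)
      fix i assume "i \<in> {..<r K0}"
      then show "\<bar>?Q K0 i * eb K0 i x0\<bar> \<le> R * B"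
        unfolding abs_mult using Q[of i] B(2)[OF K0(1) _ K0(2), of i] R0 by (intro mult_mono) auto
    qed
    also have "\<dots> \<le> real n * (R * B)"
    proof -
      have "r K0 \<le> n" unfolding n_def using K0(1) finite_elems by (intro member_le_sum) auto
      then show ?thesis using R0 B(1) by (auto intro!: mult_right_mono)
    qed
    finally show "\<bar>q K0 x0\<bar> \<le> real n * (R * B)" .
  qed
qed

lemma b_form_bounded:
  obtains C where "\<And>\<l> u q K i. \<l> \<in> L \<Longrightarrow> u \<in> dg_space m k \<Longrightarrow> q \<in> dg_space m k \<Longrightarrow>
    (\<And>K x. K \<in> elems m \<Longrightarrow> x \<in> K \<Longrightarrow> \<bar>u K x\<bar> \<le> U) \<Longrightarrow> (\<And>K x. K \<in> elems m \<Longrightarrow> x \<in> K \<Longrightarrow> \<bar>q K x\<bar> \<le> Q) \<Longrightarrow>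
    K \<in> elems m \<Longrightarrow> i < r K \<Longrightarrow> \<bar>b_form m P \<l> K u q (\<lambda>_. eb K i)\<bar> \<le> C"
proof -
  obtain B where B: "0 < B"
    "\<And>K i x. K \<in> elems m \<Longrightarrow> i < r K \<Longrightarrow> x \<in> K \<Longrightarrow> \<bar>eb K i x\<bar> \<le> B \<and> norm (grad (eb K i) x) \<le> B"
    using basis_bounded by metis
  obtain G where G: "0 < G" "\<And>\<l> z. \<l> \<in> L \<Longrightarrow> \<bar>z\<bar> \<le> U \<Longrightarrow> \<bar>gfun P \<l> z\<bar> \<le> G \<and> \<bar>deriv (gfun P \<l>) z\<bar> \<le> G"
    using g_bounded[OF finL, of U] by metis
  \<comment> \<open>The penalties are nonnegative, so their sum bounds each of them.\<close>
  define E where "E = (\<Sum>\<l>\<in>L. \<Sum>e\<in>faces m. eta_q P \<l> e)"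
  have E: "0 \<le> E" "\<And>\<l> e. \<l> \<in> L \<Longrightarrow> e \<in> faces m \<Longrightarrow> eta_q P \<l> e \<le> E"
  proof -
    show "0 \<le> E" unfolding E_def using eta_nonneg by (intro sum_nonneg) auto
    fix \<l> e assume le: "\<l> \<in> L" "e \<in> faces m"
    have "eta_q P \<l> e \<le> (\<Sum>e\<in>faces m. eta_q P \<l> e)" using le eta_nonneg finite_faces by (intro member_le_sum) auto
    also have "\<dots> \<le> E" unfolding E_def using le eta_nonneg finL
      by (intro member_le_sum[where f = "\<lambda>\<l>. \<Sum>e\<in>faces m. eta_q P \<l> e"] sum_nonneg) auto
    finally show "eta_q P \<l> e \<le> E" .
  qed
  \<comment> \<open>The parameters Q and U come without a sign; clipping at zero makes the constants
    below nonnegative.\<close>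
  define Q' where "Q' = max 0 Q"
  define U' where "U' = max 0 U"
  define c where "c = B * (G * Q' + E * (2 * U'))"
  show ?thesis
  proof (rule that[of "G * Q' * B * sigma_mass + c * trace_mass"])
    fix \<l> u q K i
    assume l: "\<l> \<in> L" and u: "u \<in> dg_space m k" and q: "q \<in> dg_space m k"
      and U: "\<And>K x. K \<in> elems m \<Longrightarrow> x \<in> K \<Longrightarrow> \<bar>u K x\<bar> \<le> U" and Q: "\<And>K x. K \<in> elems m \<Longrightarrow> x \<in> K \<Longrightarrow> \<bar>q K x\<bar> \<le> Q"
      and K: "K \<in> elems m" and i: "i < r K"
    have Q': "\<bar>q K x\<bar> \<le> Q'" if "K \<in> elems m" "x \<in> K" for K x using Q[OF that] by (simp add: Q'_def)
    have c: "0 \<le> c" "0 \<le> G * Q' * B" unfolding c_def using B(1) G(1) E(1) by (auto simp: Q'_def U'_def)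
    note eC = eb_polys[OF K i]
    let ?v = "\<lambda>x. (deriv (gfun P \<l>) (u K x) * q K x) *\<^sub>R grad (eb K i) x"
    have vm: "?v \<in> borel_measurable borel"
      using measurable_compose[OF dg_measurable[OF u K] g_measurable(2)[OF l]] dg_measurable[OF q K]
        borel_measurable_continuous_onI[OF continuous_on_grad[OF eb_C1[OF K i]]] by measurable
    have vb: "norm (?v x) \<le> G * Q' * B" if "x \<in> K" for x
      unfolding norm_scaleR abs_mult using G(2)[OF l U[OF K that]] Q'[OF K that] B(2)[OF K i that] G(1)
      by (intro mult_mono) (auto simp: Q'_def)
    have "\<bar>LINT x:K|lborel. ?v x \<bullet> sigma P \<l> x\<bar> \<le> G * Q' * B * sigma_mass"
      using volume_integrable(2)[OF l K vm vb] mult_left_mono[OF sigma_mass(2)[OF l K] c(2)] by linarith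
    moreover have "(LINT x:K|lborel. (grad (eb K i) x \<bullet> sigma P \<l> x) * deriv (gfun P \<l>) (u K x) * q K x) = (LINT x:K|lborel. ?v x \<bullet> sigma P \<l> x)"
      by (simp add: mult_ac)
    moreover have "\<bar>\<Sum>e\<in>faces_of m K. LINT x:e|surface. eb K i x * flux_gq m P \<l> u q K e x\<bar> \<le> c * trace_mass"
    proof (rule faces_sum_bound[OF l c(1)])
      fix e assume e: "e \<in> faces_of m K"
      note ef = faces_of_D(1)[OF e]
      have m1: "flux_gq m P \<l> u q K e \<in> borel_measurable borel"
        using flux_measurable(1)[OF l K e, of "\<lambda>_. u" "\<lambda>x. x" borel "\<lambda>_. q"] dg_measurable u q by auto
      show "\<bar>LINT x:e|surface. eb K i x * flux_gq m P \<l> u q K e x\<bar> \<le> c * (LINT x:e|surface. \<bar>ntrace P \<l> e x\<bar>)"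
      proof (rule face_integrable(2)[OF l ef])
        show "(\<lambda>x. eb K i x * flux_gq m P \<l> u q K e x) \<in> borel_measurable borel"
          using m1 borel_measurable_continuous_onI[OF polys_continuous[OF eC]] by measurable
        fix x assume x: "x \<in> e"
        then have xK: "x \<in> K" using face_sub_elem[OF K e] by auto
        have "\<bar>flux_gq m P \<l> u q K e x\<bar> \<le> (G * Q' + eta_q P \<l> e * (2 * U')) * \<bar>ntrace P \<l> e x\<bar>"
        proof (rule flux_bounds(1)[OF l K e x])
          have Ueq: "U' = U" using U[OF K xK] by (simp add: U'_def)
          show "\<bar>gfun P \<l> z\<bar> \<le> G \<and> \<bar>deriv (gfun P \<l>) z\<bar> \<le> G" if "\<bar>z\<bar> \<le> U'" for z
            using G(2)[OF l, of z] that by (simp add: Ueq)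
          show "\<bar>u K x\<bar> \<le> U'" if "K \<in> elems m" "x \<in> K" for K x using U[OF that] by (simp add: U'_def)
        qed (use G Q' in auto)
        also have "\<dots> \<le> (G * Q' + E * (2 * U')) * \<bar>ntrace P \<l> e x\<bar>"
          using E(2)[OF l ef] by (intro mult_right_mono add_left_mono) (auto simp: U'_def)
        finally show "\<bar>eb K i x * flux_gq m P \<l> u q K e x\<bar> \<le> c * \<bar>ntrace P \<l> e x\<bar>"
          unfolding abs_mult c_def mult.assoc using B(2)[OF K i xK] B(1) by (intro mult_mono) auto
      qed
    qed
    moreover have "0 \<le> G * Q' * B * sigma_mass" "0 \<le> c * trace_mass"
      using calculation abs_ge_zero order_trans by blast+
    ultimately show "\<bar>b_form m P \<l> K u q (\<lambda>_. eb K i)\<bar> \<le> G * Q' * B * sigma_mass + c * trace_mass"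
      unfolding b_form_def by (simp only:)
  qed
qed

lemma b_form_measurable:
  assumes l: "\<l> \<in> L" and K: "K \<in> elems m" and i: "i < r K"
    and u: "\<And>K. K \<in> elems m \<Longrightarrow> (\<lambda>(z, x). u z K x) \<in> borel_measurable (A \<Otimes>\<^sub>M borel)"
    and q: "\<And>K. K \<in> elems m \<Longrightarrow> (\<lambda>(z, x). q z K x) \<in> borel_measurable (A \<Otimes>\<^sub>M borel)"
  shows "(\<lambda>z. b_form m P \<l> K (u z) (q z) (\<lambda>_. eb K i)) \<in> borel_measurable A"
proof -
  have sm: "sigma P \<l> \<in> borel_measurable borel" by (rule sigma_measurable[OF l])
  have gm: "grad (eb K i) \<in> borel_measurable borel"
    using continuous_on_grad[OF eb_C1[OF K i]] by (rule borel_measurable_continuous_onI)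
  have em: "eb K i \<in> borel_measurable borel"
    using polys_continuous[OF eb_polys[OF K i]] by (rule borel_measurable_continuous_onI)
  have u': "(\<lambda>p. u (fst p) K (snd p)) \<in> borel_measurable (A \<Otimes>\<^sub>M borel)" if "K \<in> elems m" for K
    using u[OF that] by (simp add: case_prod_beta')
  have q': "(\<lambda>p. q (fst p) K (snd p)) \<in> borel_measurable (A \<Otimes>\<^sub>M borel)" if "K \<in> elems m" for K
    using q[OF that] by (simp add: case_prod_beta')
  have [measurable]: "(\<lambda>p. sigma P \<l> (snd p)) \<in> borel_measurable (A \<Otimes>\<^sub>M borel)"
    "(\<lambda>p. grad (eb K i) (snd p)) \<in> borel_measurable (A \<Otimes>\<^sub>M borel)"
    "(\<lambda>p. eb K i (snd p)) \<in> borel_measurable (A \<Otimes>\<^sub>M borel)"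
    "(\<lambda>p. deriv (gfun P \<l>) (u (fst p) K (snd p))) \<in> borel_measurable (A \<Otimes>\<^sub>M borel)"
    "(\<lambda>p. q (fst p) K (snd p)) \<in> borel_measurable (A \<Otimes>\<^sub>M borel)"
    using measurable_compose[OF measurable_snd sm] measurable_compose[OF measurable_snd gm]
      measurable_compose[OF measurable_snd em] measurable_compose[OF u'[OF K] g_measurable(2)[OF l]] q'[OF K] by auto
  have 1: "(\<lambda>z. LINT x:K|lborel. (grad (eb K i) x \<bullet> sigma P \<l> x) * deriv (gfun P \<l>) (u z K x) * q z K x) \<in> borel_measurable A"
    by (rule volume_integral_measurable[OF K]) (simp add: case_prod_beta')
  have 2: "(\<lambda>z. LINT x:e|surface. eb K i x * flux_gq m P \<l> (u z) (q z) K e x) \<in> borel_measurable A" if e: "e \<in> faces_of m K" for e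
  proof (rule surface_integral_measurable[OF faces_of_D(1)[OF e]])
    have "(\<lambda>p. flux_gq m P \<l> (u (fst p)) (q (fst p)) K e (snd p)) \<in> borel_measurable (A \<Otimes>\<^sub>M borel)"
      by (rule flux_measurable(1)[where u = "\<lambda>p. u (fst p)" and q = "\<lambda>p. q (fst p)" and X = snd, OF l K e u' q' measurable_snd])
    then show "(\<lambda>(z, x). eb K i x * flux_gq m P \<l> (u z) (q z) K e x) \<in> borel_measurable (A \<Otimes>\<^sub>M borel)"
      by (simp add: case_prod_beta')
  qed
  show ?thesis unfolding b_form_def using 1 2 by (intro borel_measurable_add borel_measurable_times borel_measurable_sum) auto
qed

lemma face_jump_bounded:
  assumes e: "e \<in> faces m" and x: "x \<in> e" and v: "\<And>K x. K \<in> elems m \<Longrightarrow> x \<in> K \<Longrightarrow> \<bar>v K x\<bar> \<le> U"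
  shows "\<bar>face_jump m v e x\<bar> \<le> 2 * U"
proof (cases rule: face_cases[OF e, case_names boundary interior])
  case (boundary K)
  have "x \<in> K" using face_sub_elem boundary x by blast
  then have "0 \<le> U" using v[OF boundary(2)] abs_ge_zero order_trans by blast
  then show ?thesis using boundary(6) by simp
next
  case (interior K K')
  have "x \<in> K" "x \<in> K'" using face_sub_elem interior(1-4) x by blast+
  then have "\<bar>v K x\<bar> \<le> U" "\<bar>v K' x\<bar> \<le> U" using v interior(1,3) by auto
  then show ?thesis unfolding interior(11) by linarith
qed

lemma face_jump_measurable:
  assumes e: "e \<in> faces m"
    and v: "\<And>K. K \<in> elems m \<Longrightarrow> (\<lambda>(z, x). v z K x) \<in> borel_measurable (A \<Otimes>\<^sub>M borel)"
  shows "(\<lambda>(z, x). face_jump m (v z) e x) \<in> borel_measurable (A \<Otimes>\<^sub>M borel)"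
proof (cases rule: face_cases[OF e, case_names boundary interior])
  case (boundary K)
  show ?thesis unfolding boundary(6) by simp
next
  case (interior K K')
  show ?thesis unfolding interior(11)
    using v[OF interior(1)] v[OF interior(3)] by (auto simp: case_prod_beta' intro: borel_measurable_diff)
qed

lemma face_dissipation_nonneg: "\<l> \<in> L \<Longrightarrow> e \<in> faces m \<Longrightarrow> 0 \<le> face_dissipation \<l> u q e x"
  unfolding face_dissipation_def using eta_nonneg by (intro mult_nonneg_nonneg add_nonneg_nonneg) auto

lemma face_dissipation_integral:
  assumes l: "\<l> \<in> L" and e: "e \<in> faces m"
    and u: "\<And>K. K \<in> elems m \<Longrightarrow> (\<lambda>(z, x). u z K x) \<in> borel_measurable (A \<Otimes>\<^sub>M borel)"
    and q: "\<And>K. K \<in> elems m \<Longrightarrow> (\<lambda>(z, x). q z K x) \<in> borel_measurable (A \<Otimes>\<^sub>M borel)"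
  shows "(\<lambda>z. LINT x:e|surface. face_dissipation \<l> (u z) (q z) e x) \<in> borel_measurable A"
    "z \<in> space A \<Longrightarrow> (\<And>K x. K \<in> elems m \<Longrightarrow> x \<in> K \<Longrightarrow> \<bar>u z K x\<bar> \<le> U) \<Longrightarrow> (\<And>K x. K \<in> elems m \<Longrightarrow> x \<in> K \<Longrightarrow> \<bar>q z K x\<bar> \<le> Q) \<Longrightarrow>
      \<bar>LINT x:e|surface. face_dissipation \<l> (u z) (q z) e x\<bar> \<le>
        (eta_q P \<l> e * (2 * U)\<^sup>2 + eta_u P \<l> e * (2 * Q)\<^sup>2) * (LINT x:e|surface. \<bar>ntrace P \<l> e x\<bar>)"
proof -
  have nm: "(\<lambda>p. ntrace P \<l> e (snd p)) \<in> borel_measurable (A \<Otimes>\<^sub>M borel)"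
    by (rule measurable_compose[OF measurable_snd ntrace_measurable[OF l e]])
  have ju: "(\<lambda>p. face_jump m (u (fst p)) e (snd p)) \<in> borel_measurable (A \<Otimes>\<^sub>M borel)"
    using face_jump_measurable[OF e u] by (simp add: case_prod_beta')
  have jq: "(\<lambda>p. face_jump m (q (fst p)) e (snd p)) \<in> borel_measurable (A \<Otimes>\<^sub>M borel)"
    using face_jump_measurable[OF e q] by (simp add: case_prod_beta')
  note [measurable] = nm ju jq
  have m: "(\<lambda>(z, x). face_dissipation \<l> (u z) (q z) e x) \<in> borel_measurable (A \<Otimes>\<^sub>M borel)"
    unfolding face_dissipation_def case_prod_beta' by measurable
  then show "(\<lambda>z. LINT x:e|surface. face_dissipation \<l> (u z) (q z) e x) \<in> borel_measurable A"
    by (rule surface_integral_measurable[OF e])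
  assume z: "z \<in> space A" and U: "\<And>K x. K \<in> elems m \<Longrightarrow> x \<in> K \<Longrightarrow> \<bar>u z K x\<bar> \<le> U" and Q: "\<And>K x. K \<in> elems m \<Longrightarrow> x \<in> K \<Longrightarrow> \<bar>q z K x\<bar> \<le> Q"
  show "\<bar>LINT x:e|surface. face_dissipation \<l> (u z) (q z) e x\<bar> \<le>
        (eta_q P \<l> e * (2 * U)\<^sup>2 + eta_u P \<l> e * (2 * Q)\<^sup>2) * (LINT x:e|surface. \<bar>ntrace P \<l> e x\<bar>)"
  proof (rule face_integrable(2)[OF l e])
    show "face_dissipation \<l> (u z) (q z) e \<in> borel_measurable borel"
      using measurable_compose[OF measurable_Pair1'[OF z] m] by simp
    fix x assume x: "x \<in> e"
    have "\<bar>face_jump m (u z) e x\<bar> \<le> \<bar>2 * U\<bar>" "\<bar>face_jump m (q z) e x\<bar> \<le> \<bar>2 * Q\<bar>"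
      by (rule order_trans[OF face_jump_bounded[OF e x U] abs_ge_self], assumption+)
        (rule order_trans[OF face_jump_bounded[OF e x Q] abs_ge_self], assumption+)
    then have "(face_jump m (u z) e x)\<^sup>2 \<le> (2 * U)\<^sup>2" "(face_jump m (q z) e x)\<^sup>2 \<le> (2 * Q)\<^sup>2"
      by (simp_all only: abs_le_square_iff)
    then have "eta_q P \<l> e * (face_jump m (u z) e x)\<^sup>2 + eta_u P \<l> e * (face_jump m (q z) e x)\<^sup>2 \<le>
       eta_q P \<l> e * (2 * U)\<^sup>2 + eta_u P \<l> e * (2 * Q)\<^sup>2"
      using eta_nonneg l e by (intro add_mono mult_left_mono) auto
    then have "\<bar>ntrace P \<l> e x\<bar> * (eta_q P \<l> e * (face_jump m (u z) e x)\<^sup>2 + eta_u P \<l> e * (face_jump m (q z) e x)\<^sup>2) \<le>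
       \<bar>ntrace P \<l> e x\<bar> * (eta_q P \<l> e * (2 * U)\<^sup>2 + eta_u P \<l> e * (2 * Q)\<^sup>2)" by (rule mult_left_mono) simp
    then show "\<bar>face_dissipation \<l> (u z) (q z) e x\<bar> \<le> (eta_q P \<l> e * (2 * U)\<^sup>2 + eta_u P \<l> e * (2 * Q)\<^sup>2) * \<bar>ntrace P \<l> e x\<bar>"
      using face_dissipation_nonneg[OF l e, of "u z" "q z" x] unfolding face_dissipation_def by (simp add: mult.commute)
  qed
qed

end

section \<open>The stopped solution\<close>

lemma coef_expand:
  assumes b: "local_basis m k N \<beta>" and v: "v \<in> dg_space m k" and K: "K \<in> elems m"
  shows "v K x = (\<Sum>j\<le>N. coef_matrix N \<beta> v j K * \<beta> j K x)"
proof -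
  have vK: "v K \<in> polys k" using v K by (simp add: dg_space_def)
  have sp: "\<exists>c. v K = (\<lambda>x. \<Sum>j\<le>N. c j * \<beta> j K x)"
    and ind: "\<And>c. (\<lambda>x. \<Sum>j\<le>N. c j * \<beta> j K x) = (\<lambda>x. 0) \<Longrightarrow> \<forall>j\<le>N. c j = 0"
    using b vK K unfolding local_basis_def by blast+
  obtain c0 where c0: "v K = (\<lambda>x. \<Sum>j\<le>N. c0 j * \<beta> j K x)" using sp by blast
  \<comment> \<open>\<open>coef_matrix\<close> asks for coefficients that vanish beyond N. This
    normalisation makes the description unique, linear independence of the basis settling the
    indices up to N.\<close>
  define c where "c i = (if i \<le> N then c0 i else 0)" for i
  have c: "(\<forall>i>N. c i = 0) \<and> v K = (\<lambda>x. \<Sum>i\<le>N. c i * \<beta> i K x)"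
    unfolding c0 by (simp add: c_def)
  have uniq: "d = c" if d: "(\<forall>i>N. d i = 0) \<and> v K = (\<lambda>x. \<Sum>i\<le>N. d i * \<beta> i K x)" for d
  proof -
    have "(\<lambda>x. \<Sum>j\<le>N. (d j - c j) * \<beta> j K x) = (\<lambda>x. 0)"
    proof
      fix x
      have "(\<Sum>i\<le>N. d i * \<beta> i K x) = (\<Sum>i\<le>N. c i * \<beta> i K x)"
        using fun_cong[OF conjunct2[OF c], of x] fun_cong[OF conjunct2[OF d], of x] by simp
      then show "(\<Sum>j\<le>N. (d j - c j) * \<beta> j K x) = 0" by (simp add: left_diff_distrib sum_subtractf)
    qed
    from ind[OF this] have "d i = c i" if "i \<le> N" for i using that by simp
    then show "d = c" using c d by (metis ext not_le)
  qed
  have "(THE c. (\<forall>i>N. c i = 0) \<and> v K = (\<lambda>x. \<Sum>i\<le>N. c i * \<beta> i K x)) = c"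
    by (rule the_equality[of "\<lambda>c. (\<forall>i>N. c i = 0) \<and> v K = (\<lambda>x. \<Sum>i\<le>N. c i * \<beta> i K x)", OF c uniq])
  then have "coef_matrix N \<beta> v i K = c i" for i unfolding coef_matrix_def by simp
  then show ?thesis using fun_cong[OF conjunct2[OF c], of x] by simp
qed

lemma coef_matrix_cong: "v K = w K \<Longrightarrow> coef_matrix N \<beta> v j K = coef_matrix N \<beta> w j K"
  by (simp add: coef_matrix_def)

lemma frobenius_cong:
  assumes "\<And>K. K \<in> elems m \<Longrightarrow> v K = w K"
  shows "frobenius_norm m N (coef_matrix N \<beta> v) = frobenius_norm m N (coef_matrix N \<beta> w)"
proof -
  have "coef_matrix N \<beta> v j K = coef_matrix N \<beta> w j K" if "K \<in> elems m" for j K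
    using coef_matrix_cong[of v K w, OF assms[OF that]] .
  then show ?thesis unfolding frobenius_norm_def by (simp cong: sum.cong)
qed

lemma coef_le_frobenius:
  assumes "finite (elems m)" "j \<le> N" "K \<in> elems m"
  shows "\<bar>c j K\<bar> \<le> frobenius_norm m N c"
proof -
  have "(c j K)\<^sup>2 \<le> (\<Sum>K\<in>elems m. (c j K)\<^sup>2)" using assms by (intro member_le_sum) auto
  also have "\<dots> \<le> (\<Sum>j\<le>N. \<Sum>K\<in>elems m. (c j K)\<^sup>2)"
    using assms by (intro member_le_sum[where f = "\<lambda>j. \<Sum>K\<in>elems m. (c j K)\<^sup>2"] sum_nonneg) auto
  finally have "sqrt ((c j K)\<^sup>2) \<le> frobenius_norm m N c" unfolding frobenius_norm_def by (rule real_sqrt_le_mono)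
  then show ?thesis by simp
qed

text \<open>The sum is \<open>f\<close> at the last index that precedes the stopping; in this form the stopped process
  is adapted by inspection.\<close>

lemma telescope_stop:
  fixes f :: "nat \<Rightarrow> real"
  assumes "\<And>k. p (Suc k) \<Longrightarrow> p k"
  shows "\<exists>K\<le>n. f 0 + (\<Sum>k<n. (f (Suc k) - f k) * (if p (Suc k) then 1 else 0)) = f K \<and> (K = 0 \<or> p K) \<and> (K < n \<longrightarrow> \<not> p (Suc K))"
proof (induction n)
  case 0
  show ?case by (intro exI[of _ 0]) simp
next
  case (Suc n)
  then obtain K where K: "K \<le> n" "f 0 + (\<Sum>k<n. (f (Suc k) - f k) * (if p (Suc k) then 1 else 0)) = f K" "K = 0 \<or> p K" "K < n \<longrightarrow> \<not> p (Suc K)"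
    by blast
  have anti: "p j \<Longrightarrow> i \<le> j \<Longrightarrow> p i" for i j
    by (induction j) (use assms in \<open>auto simp: le_Suc_eq\<close>)
  show ?case
  proof (cases "p (Suc n)")
    case True
    then have "K = n" using K(1,4) anti[OF True, of "Suc K"] by (cases "K < n") auto
    then show ?thesis using True K(2) by (intro exI[of _ "Suc n"]) auto
  next
    case False
    then show ?thesis using K by (intro exI[of _ K]) (auto simp: less_Suc_eq)
  qed
qed

locale ldg_problem = wiener_family M F L W + ldg_basis D m L P k r eb
  for M :: "'w measure" and F and L :: "'l set" and W
    and D :: "(real^'n::finite) set" and m and P :: "('l, 'n) scheme" and k r eb +
  fixes T :: real and N :: nat and \<beta> :: "nat \<Rightarrow> 'n broken" and uh0 :: "'n broken"
    and \<tau>max :: "'w \<Rightarrow> ereal" and uh :: "real \<Rightarrow> 'w \<Rightarrow> 'n broken" and qh :: "'l \<Rightarrow> real \<Rightarrow> 'w \<Rightarrow> 'n broken"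
  assumes T: "0 < T" and basis: "local_basis m k N \<beta>" and uh0: "uh0 \<in> dg_space m k"
    and solution: "ldg_solution M F L W m P k N \<beta> uh0 \<tau>max uh qh"
    and no_transport: "no_boundary_transport M L T D m P \<tau>max uh"
begin

abbreviation coefs :: "real \<Rightarrow> 'w \<Rightarrow> nat \<Rightarrow> (real^'n) set \<Rightarrow> real" where
  "coefs t \<omega> \<equiv> coef_matrix N \<beta> (uh t \<omega>)"

definition size :: "real \<Rightarrow> 'w \<Rightarrow> real" where
  "size t \<omega> = frobenius_norm m N (coefs t \<omega>)"

text \<open>Collects the almost sure properties of the solution, so that the pathwise arguments
  below refer to one exceptional null set.\<close>

definition good :: "'w \<Rightarrow> bool" where
  "good \<omega> \<longleftrightarrow> \<omega> \<in> space M \<and> 0 < \<tau>max \<omega> \<and>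
     (\<tau>max \<omega> < \<infinity> \<longrightarrow> (\<forall>R. \<exists>t\<ge>0. ereal t < \<tau>max \<omega> \<and> R \<le> size t \<omega>)) \<and>
     (\<forall>K\<in>elems m. uh 0 \<omega> K = uh0 K) \<and>
     (\<forall>t\<ge>0. ereal t < \<tau>max \<omega> \<longrightarrow> (\<forall>\<l>\<in>L. q_equation m P k \<l> (uh t \<omega>) (qh \<l> t \<omega>))) \<and>
     (\<forall>t\<in>{0..T}. ereal t < \<tau>max \<omega> \<longrightarrow>
        (\<forall>\<l>\<in>L. \<forall>K\<in>elems m. \<forall>e\<in>faces_of m K. e \<subseteq> frontier D \<longrightarrow>
           (AE x in surface. x \<in> e \<longrightarrow> sigma_n m P \<l> K e x * uh t \<omega> K x = 0)))"

lemma solution_facts: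
  "\<forall>t\<ge>0. {\<omega>\<in>space M. \<tau>max \<omega> \<le> ereal t} \<in> sets (F t)" "AE \<omega> in M. 0 < \<tau>max \<omega>"
  "AE \<omega> in M. \<tau>max \<omega> < \<infinity> \<longrightarrow> (\<forall>R. \<exists>t\<ge>0. ereal t < \<tau>max \<omega> \<and> R \<le> frobenius_norm m N (coefs t \<omega>))"
  "dg_process M F m k N \<beta> \<tau>max uh" "\<forall>\<l>\<in>L. dg_process M F m k N \<beta> \<tau>max (qh \<l>)"
  "AE \<omega> in M. \<forall>K\<in>elems m. uh 0 \<omega> K = uh0 K"
  "AE \<omega> in M. \<forall>t\<ge>0. ereal t < \<tau>max \<omega> \<longrightarrow> (\<forall>\<l>\<in>L. q_equation m P k \<l> (uh t \<omega>) (qh \<l> t \<omega>))"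
  "\<forall>n::nat. \<forall>K\<in>elems m. \<forall>\<phi>\<in>dg_space m k. \<exists>I.
        (\<forall>\<l>\<in>L. \<forall>S>0. has_ito_integral M F (W \<l>) S
           (\<lambda>s \<omega>. if ereal s \<le> hit_time m N \<beta> \<tau>max uh n \<omega> \<and> ereal s < \<tau>max \<omega>
                  then LINT x:K|lborel. \<phi> K x * qh \<l> s \<omega> K x else 0) (I \<l>)) \<and>
        (AE \<omega> in M. \<forall>t\<ge>0.
           (LINT x:K|lborel. \<phi> K x * uh (stopped_time m N \<beta> \<tau>max uh n t \<omega>) \<omega> K x) =
           (LINT x:K|lborel. \<phi> K x * uh 0 \<omega> K x)
           + (LINT s:{0..stopped_time m N \<beta> \<tau>max uh n t \<omega>}|lborel.
                \<Sum>\<l>\<in>L. b_form m P \<l> K (uh s \<omega>) (qh \<l> s \<omega>) \<phi>)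
           - (\<Sum>\<l>\<in>L. I \<l> t \<omega>))"
  using solution unfolding ldg_solution_def by - (elim conjE, assumption)+

lemma good_space: "good \<omega> \<Longrightarrow> \<omega> \<in> space M" unfolding good_def by (elim conjE)

lemma less_max_mono: "s \<le> t \<Longrightarrow> ereal t < \<tau>max \<omega> \<Longrightarrow> ereal s < \<tau>max \<omega>"
  by (rule le_less_trans[of "ereal s" "ereal t"]) simp_all

lemma AE_good: "AE \<omega> in M. good \<omega>"
  using solution_facts(2,3,6,7) no_transport[unfolded no_boundary_transport_def] AE_space
proof eventually_elim
  case (elim \<omega>)
  show ?case unfolding good_def size_def by (intro conjI elim)
qed

lemma dg_uh: "\<omega> \<in> space M \<Longrightarrow> 0 \<le> t \<Longrightarrow> ereal t < \<tau>max \<omega> \<Longrightarrow> uh t \<omega> \<in> dg_space m k"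
  using solution_facts(4) unfolding dg_process_def by blast

lemma dg_qh: "\<l> \<in> L \<Longrightarrow> \<omega> \<in> space M \<Longrightarrow> 0 \<le> t \<Longrightarrow> ereal t < \<tau>max \<omega> \<Longrightarrow> qh \<l> t \<omega> \<in> dg_space m k"
  using solution_facts(5) unfolding dg_process_def by blast

lemma coefs_continuous:
  "\<omega> \<in> space M \<Longrightarrow> j \<le> N \<Longrightarrow> K \<in> elems m \<Longrightarrow> continuous_on {t. 0 \<le> t \<and> ereal t < \<tau>max \<omega>} (\<lambda>t. coefs t \<omega> j K)"
  using solution_facts(4) unfolding dg_process_def by blast

lemma coefs_qh_continuous:
  "\<l> \<in> L \<Longrightarrow> \<omega> \<in> space M \<Longrightarrow> j \<le> N \<Longrightarrow> K \<in> elems m \<Longrightarrow>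
    continuous_on {t. 0 \<le> t \<and> ereal t < \<tau>max \<omega>} (\<lambda>t. coef_matrix N \<beta> (qh \<l> t \<omega>) j K)"
  using solution_facts(5) unfolding dg_process_def by blast

lemma coefs_adapted:
  "0 \<le> t \<Longrightarrow> j \<le> N \<Longrightarrow> K \<in> elems m \<Longrightarrow> (\<lambda>\<omega>. if ereal t < \<tau>max \<omega> then coefs t \<omega> j K else 0) \<in> borel_measurable (F t)"
  using solution_facts(4) unfolding dg_process_def by blast

lemma size_continuous:
  assumes "\<omega> \<in> space M" "\<And>t. t \<in> A \<Longrightarrow> 0 \<le> t \<and> ereal t < \<tau>max \<omega>"
  shows "continuous_on A (\<lambda>t. size t \<omega>)"
proof -
  have "continuous_on {t. 0 \<le> t \<and> ereal t < \<tau>max \<omega>} (\<lambda>t. size t \<omega>)"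
    unfolding size_def frobenius_norm_def
    by (intro continuous_intros coefs_continuous) (use assms in auto)
  then show ?thesis by (rule continuous_on_subset) (use assms in auto)
qed

end

section \<open>Paths up to a hitting time, and adaptedness of the stopped coefficients\<close>

locale ldg_stopped = ldg_problem M F L W D m P k r eb T N \<beta> uh0 \<tau>max uh qh
  for M :: "'w measure" and F and L :: "'l set" and W
    and D :: "(real^'n::finite) set" and m and P :: "('l, 'n) scheme" and k r eb T N \<beta> uh0 \<tau>max uh qh +
  fixes n :: nat
begin

definition hit :: "'w \<Rightarrow> ereal" where "hit \<omega> = hit_time m N \<beta> \<tau>max uh n \<omega>"

definition \<tau> :: "real \<Rightarrow> 'w \<Rightarrow> real" where "\<tau> t \<omega> = stopped_time m N \<beta> \<tau>max uh n t \<omega>"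

lemma hit_eq: "hit \<omega> = Inf (ereal ` {t. 0 \<le> t \<and> ereal t < \<tau>max \<omega> \<and> real n \<le> size t \<omega>})"
  by (simp add: hit_def hit_time_def size_def)

lemma \<tau>_eq: "\<tau> t \<omega> = real_of_ereal (min (ereal t) (hit \<omega>))"
  by (simp add: \<tau>_def hit_def stopped_time_def)

lemma hit_nonneg: "0 \<le> hit \<omega>"
  unfolding hit_eq by (intro Inf_greatest) auto

lemma hit_le: "0 \<le> t \<Longrightarrow> ereal t < \<tau>max \<omega> \<Longrightarrow> real n \<le> size t \<omega> \<Longrightarrow> hit \<omega> \<le> ereal t"
  unfolding hit_eq by (intro Inf_lower) auto

text \<open>If \<open>\<tau>max\<close> is finite, the coefficients are unbounded before it, so
  level n is reached strictly earlier. Hence on good paths the stopped times remain in the interval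
  where the solution lives.\<close>

lemma hit_less_max:
  assumes "good \<omega>" shows "hit \<omega> < \<tau>max \<omega> \<or> (hit \<omega> = \<infinity> \<and> \<tau>max \<omega> = \<infinity>)"
proof (cases "\<tau>max \<omega> < \<infinity>")
  case True
  then obtain t where t: "0 \<le> t" "ereal t < \<tau>max \<omega>" "real n \<le> size t \<omega>" using assms unfolding good_def by blast
  then show ?thesis using hit_le by (meson le_less_trans)
next
  case False
  then show ?thesis by (cases "hit \<omega>") auto
qed

lemma before_hit:
  assumes "good \<omega>" "0 \<le> s" "ereal s < hit \<omega>"
  shows "ereal s < \<tau>max \<omega>" "size s \<omega> < real n"
proof -
  show 1: "ereal s < \<tau>max \<omega>" using hit_less_max[OF assms(1)] assms(3) by (auto intro: less_trans)
  show "size s \<omega> < real n" using hit_le[OF assms(2) 1] assms(3) by (meson not_le)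
qed

lemma \<tau>_props:
  assumes "good \<omega>" "0 \<le> t"
  shows "ereal (\<tau> t \<omega>) = min (ereal t) (hit \<omega>)" "0 \<le> \<tau> t \<omega>" "\<tau> t \<omega> \<le> t" "ereal (\<tau> t \<omega>) \<le> hit \<omega>" "ereal (\<tau> t \<omega>) < \<tau>max \<omega>"
proof -
  have "\<bar>min (ereal t) (hit \<omega>)\<bar> \<noteq> \<infinity>" using hit_nonneg[of \<omega>] by (cases "hit \<omega>") (auto simp: min_def)
  then show 1: "ereal (\<tau> t \<omega>) = min (ereal t) (hit \<omega>)" unfolding \<tau>_eq by (simp add: ereal_real)
  have "0 \<le> ereal (\<tau> t \<omega>)" unfolding 1 using assms(2) hit_nonneg by simp
  then show "0 \<le> \<tau> t \<omega>" by simp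
  have "ereal (\<tau> t \<omega>) \<le> ereal t" unfolding 1 by simp
  then show "\<tau> t \<omega> \<le> t" by simp
  show h: "ereal (\<tau> t \<omega>) \<le> hit \<omega>" unfolding 1 by simp
  show "ereal (\<tau> t \<omega>) < \<tau>max \<omega>" using hit_less_max[OF assms(1)] h by (auto intro: le_less_trans)
qed

lemma \<tau>_before: "0 \<le> s \<Longrightarrow> ereal s \<le> hit \<omega> \<Longrightarrow> \<tau> s \<omega> = s"
  unfolding \<tau>_eq by (simp add: min_absorb1)

text \<open>If the initial coefficients already exceed n, the hitting time is 0 and only the initial
  value is ever seen; this is why the initial norm enters.\<close>

definition bound :: real where "bound = max (real n) (frobenius_norm m N (coef_matrix N \<beta> uh0))"

lemma size_bound:
  assumes g: "good \<omega>" and s: "0 \<le> s" "ereal s \<le> hit \<omega>" "ereal s < \<tau>max \<omega>"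
  shows "size s \<omega> \<le> bound"
proof (cases "s = 0")
  case True
  have "size 0 \<omega> = frobenius_norm m N (coef_matrix N \<beta> uh0)"
    unfolding size_def by (rule frobenius_cong) (use g in \<open>unfold good_def, blast\<close>)
  then show ?thesis using True by (simp add: bound_def)
next
  case False
  then have s0: "0 < s" using s by simp
  \<comment> \<open>Strictly before the hitting time the size is below n; continuity carries the
    bound to s, which may be the hitting time itself.\<close>
  have "continuous_on (closure {0..<s}) (\<lambda>t. size t \<omega>)"
  proof (rule size_continuous)
    show "\<omega> \<in> space M" by (rule good_space[OF g])
    fix t assume "t \<in> closure {0..<s}"
    then have "0 \<le> t" "t \<le> s" using s0 by auto
    then show "0 \<le> t \<and> ereal t < \<tau>max \<omega>" using s(3) by (auto intro: le_less_trans[of "ereal t" "ereal s"])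
  qed
  then have "size s \<omega> \<le> real n"
  proof (rule continuous_le_on_closure)
    show "s \<in> closure {0..<s}" using s0 by simp
    fix t assume t: "t \<in> {0..<s}"
    then have "ereal t < hit \<omega>" using s(2) by (auto intro: less_le_trans[of _ "ereal s"])
    then show "size t \<omega> \<le> real n" using before_hit(2)[OF g, of t] t by simp
  qed
  then show ?thesis by (simp add: bound_def)
qed

text \<open>Describes the event that level n has not been reached by time a through the path on
  [0,a] and countably many operations. A continuous function attains its maximum there, so staying
  below n means staying below n - 1/(i+1) for some i; the negated existential is the form that
  \<open>sets_ex_continuous_gt\<close> handles.\<close>

lemma after_hit_iff:
  assumes g: "good \<omega>" and a: "0 < a"
  shows "ereal a < hit \<omega> \<longleftrightarrow> ereal a < \<tau>max \<omega> \<and> (\<exists>i::nat. \<not> (\<exists>s\<in>{0..a}. real n - 1 / real (Suc i) < size s \<omega>))"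
proof
  assume h: "ereal a < hit \<omega>"
  have sp: "\<omega> \<in> space M" by (rule good_space[OF g])
  have am: "ereal a < \<tau>max \<omega>" using before_hit(1)[OF g _ h] a by simp
  have c: "continuous_on {0..a} (\<lambda>t. size t \<omega>)"
    by (rule size_continuous[OF sp]) (use less_max_mono[OF _ am] in auto)
  obtain s0 where s0: "s0 \<in> {0..a}" "\<forall>s\<in>{0..a}. size s \<omega> \<le> size s0 \<omega>"
    using continuous_attains_sup[OF _ _ c] a by auto
  have "ereal s0 < hit \<omega>" using s0(1) h by (auto intro: le_less_trans[of _ "ereal a"])
  then have "0 < real n - size s0 \<omega>" using before_hit(2)[OF g, of s0] s0(1) by simp
  then obtain i where "inverse (real (Suc i)) < real n - size s0 \<omega>" using reals_Archimedean by blast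
  then have "\<not> (\<exists>s\<in>{0..a}. real n - 1 / real (Suc i) < size s \<omega>)" using s0(2) by (force simp: inverse_eq_divide)
  then show "ereal a < \<tau>max \<omega> \<and> (\<exists>i::nat. \<not> (\<exists>s\<in>{0..a}. real n - 1 / real (Suc i) < size s \<omega>))" using am by blast
next
  assume "ereal a < \<tau>max \<omega> \<and> (\<exists>i::nat. \<not> (\<exists>s\<in>{0..a}. real n - 1 / real (Suc i) < size s \<omega>))"
  then obtain i :: nat where am: "ereal a < \<tau>max \<omega>" and i': "\<not> (\<exists>s\<in>{0..a}. real n - 1 / real (Suc i) < size s \<omega>)"
    by blast
  have i: "size s \<omega> \<le> real n - 1 / real (Suc i)" if "s \<in> {0..a}" for s
    using i' that not_less by blast
  have sp: "\<omega> \<in> space M" by (rule good_space[OF g])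
  have lt: "size s \<omega> < real n" if "s \<in> {0..a}" for s
  proof -
    have "0 < 1 / real (Suc i)" by simp
    then show ?thesis using i[OF that] by linarith
  qed
  \<comment> \<open>The path lives slightly beyond a, and by continuity it stays below n there,
    which makes the inequality for the hitting time strict.\<close>
  obtain b where b: "a < b" "ereal b < \<tau>max \<omega>"
    using ereal_dense2[OF am] by auto
  have "continuous_on {0..b} (\<lambda>t. size t \<omega>)"
    by (rule size_continuous[OF sp]) (use less_max_mono[OF _ b(2)] in auto)
  then have "((\<lambda>t. size t \<omega>) \<longlongrightarrow> size a \<omega>) (at a within {0..b})"
    using a b by (simp add: continuous_on_def)
  moreover have "size a \<omega> < real n" using lt[of a] a by simp
  ultimately have "eventually (\<lambda>t. size t \<omega> < real n) (at a within {0..b})" by (simp add: order_tendstoD)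
  then obtain d where d: "d > 0" "\<And>t. t \<in> {0..b} \<Longrightarrow> t \<noteq> a \<Longrightarrow> dist t a < d \<Longrightarrow> size t \<omega> < real n"
    unfolding eventually_at by blast
  define c where "c = min b (a + d)"
  have c: "a < c" using b d by (simp add: c_def)
  have "ereal c \<le> hit \<omega>"
    unfolding hit_eq
  proof (rule Inf_greatest)
    fix z assume "z \<in> ereal ` {t. 0 \<le> t \<and> ereal t < \<tau>max \<omega> \<and> real n \<le> size t \<omega>}"
    then obtain t where t: "z = ereal t" "0 \<le> t" "real n \<le> size t \<omega>" by auto
    have "\<not> t < c"
    proof
      assume tc: "t < c"
      show False
      proof (cases "t \<le> a")
        case True
        then show False using lt[of t] t by simp
      next
        case False
        then show False using d(2)[of t] t tc a by (auto simp: c_def dist_real_def)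
      qed
    qed
    then show "ereal c \<le> z" using t by simp
  qed
  then show "ereal a < hit \<omega>" using c by (meson ereal_less_ereal_Ex less_ereal.simps(1) less_le_trans)
qed

text \<open>The coefficients carry information only on paths alive at time a, so measurability is
  shown in the trace of \<open>F a\<close> on that event. The hitting time is characterised on good
  paths only, hence the equality up to a null set.\<close>

lemma hit_event:
  assumes a: "0 < a"
  shows "\<exists>A\<in>sets (F a). AE \<omega> in M. ereal a < hit \<omega> \<longleftrightarrow> \<omega> \<in> A"
proof -
  have a0: "0 \<le> a" using a by simp
  define \<Omega> where "\<Omega> = {\<omega>\<in>space M. ereal a < \<tau>max \<omega>}"
  have \<Omega>: "\<Omega> \<in> sets (F a)"
  proof -
    have "\<Omega> = space (F a) - {\<omega>\<in>space M. \<tau>max \<omega> \<le> ereal a}" using space_F[OF a0] by (auto simp: \<Omega>_def)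
    then show ?thesis using solution_facts(1) a0 by auto
  qed
  let ?R = "restrict_space (F a) \<Omega>"
  have spR: "space ?R = \<Omega>" using \<Omega> sets.sets_into_space by (auto simp: space_restrict_space)
  have E: "{\<omega>\<in>\<Omega>. \<exists>s\<in>{0..a}. c < size s \<omega>} \<in> sets (F a)" for c
  proof -
    have "{\<omega>\<in>space ?R. \<exists>s\<in>{0..a}. c < size s \<omega>} \<in> sets ?R"
    proof (rule sets_ex_continuous_gt[OF a])
      fix t assume t: "t \<in> {0..a}"
      have m1: "(\<lambda>\<omega>. if ereal t < \<tau>max \<omega> then coefs t \<omega> j K else 0) \<in> borel_measurable ?R" if "j \<le> N" "K \<in> elems m" for j K
        using measurable_F_mono[OF _ _ coefs_adapted[OF _ that]] t by (intro measurable_restrict_space1) auto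
      have m2: "(\<lambda>\<omega>. coefs t \<omega> j K) \<in> borel_measurable ?R" if "j \<le> N" "K \<in> elems m" for j K
      proof (rule measurable_cong[THEN iffD1, OF _ m1[OF that]])
        fix \<omega> assume "\<omega> \<in> space ?R"
        then have "ereal a < \<tau>max \<omega>" unfolding spR by (simp add: \<Omega>_def)
        then have "ereal t < \<tau>max \<omega>" using t by (auto intro: le_less_trans[of _ "ereal a"])
        then show "(if ereal t < \<tau>max \<omega> then coefs t \<omega> j K else 0) = coefs t \<omega> j K" by simp
      qed
      show "size t \<in> borel_measurable ?R"
        unfolding size_def[abs_def] frobenius_norm_def
        by (intro borel_measurable_sqrt[THEN measurable_compose[rotated]] borel_measurable_sum borel_measurable_power m2) auto
    next
      fix \<omega> assume "\<omega> \<in> space ?R"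
      then have w: "\<omega> \<in> space M" "ereal a < \<tau>max \<omega>" unfolding spR by (simp_all add: \<Omega>_def)
      show "continuous_on {0..a} (\<lambda>t. size t \<omega>)"
        by (rule size_continuous[OF w(1)]) (use less_max_mono[OF _ w(2)] in auto)
    qed
    then show ?thesis using \<Omega> unfolding spR by (auto simp: sets_restrict_space_iff)
  qed
  let ?A = "\<Union>i::nat. \<Omega> - {\<omega>\<in>\<Omega>. \<exists>s\<in>{0..a}. real n - 1 / real (Suc i) < size s \<omega>}"
  have "?A \<in> sets (F a)" using \<Omega> E by (intro sets.countable_UN) blast
  moreover have "AE \<omega> in M. ereal a < hit \<omega> \<longleftrightarrow> \<omega> \<in> ?A"
    using AE_good
  proof eventually_elim
    case (elim \<omega>)
    have "\<omega> \<in> space M" by (rule good_space[OF elim])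
    then show ?case unfolding after_hit_iff[OF elim a] by (auto simp: \<Omega>_def)
  qed
  ultimately show ?thesis by blast
qed

text \<open>The stopped value is the limit of the values at the last grid time before the stopping.
  Such a value is a telescoping sum whose terms involve the path and the hitting events up to time t
  only, so it is adapted; null sets belong to \<open>F t\<close>.\<close>

lemma stopped_coefs_measurable:
  assumes t: "0 \<le> t" and j: "j \<le> N" and K: "K \<in> elems m"
  shows "(\<lambda>\<omega>. coefs (\<tau> t \<omega>) \<omega> j K) \<in> borel_measurable (F t)"
\<comment> \<open>\<open>hit_event\<close> concerns positive times only. At time 0 the stopped time
  is 0, and the initial coefficients are adapted by assumption.\<close>
proof (cases "t = 0")
  case True
  have "AE \<omega> in M. coefs (\<tau> 0 \<omega>) \<omega> j K = (if ereal 0 < \<tau>max \<omega> then coefs 0 \<omega> j K else 0)"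
    using AE_good
  proof eventually_elim
    case (elim \<omega>)
    have "\<tau> 0 \<omega> = 0" using \<tau>_props[OF elim, of 0] by simp
    then show ?case using elim by (simp add: good_def zero_ereal_def)
  qed
  then have "(\<lambda>\<omega>. coefs (\<tau> 0 \<omega>) \<omega> j K) \<in> borel_measurable (F 0)"
    by (rule borel_measurable_F_AE_eq[OF order_refl coefs_adapted[OF order_refl j K]])
  then show ?thesis unfolding True .
next
  case False
  then have t0: "0 < t" using t by simp
  obtain E where E: "\<And>a. 0 < a \<Longrightarrow> E a \<in> sets (F a)" and Eh: "\<And>a. 0 < a \<Longrightarrow> AE \<omega> in M. ereal a < hit \<omega> \<longleftrightarrow> \<omega> \<in> E a"
    using hit_event by metis
  define u where "u l i = real i * t / real (Suc l)" for l i :: nat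
  have u: "0 \<le> u l i" "u l i \<le> u l (Suc i)" "0 < u l (Suc i)" for l i
    using t0 by (auto simp: u_def intro!: divide_right_mono mult_right_mono)
  have ut: "u l i \<le> t" if "i \<le> Suc l" for l i
  proof -
    have "real i * t \<le> real (Suc l) * t" using that t by (intro mult_right_mono) auto
    then show ?thesis by (simp add: u_def field_simps)
  qed
  \<comment> \<open>The cut at \<open>\<tau>max\<close> is the form in which adaptedness is given;
    on the grid times that matter the path is still alive and c is the coefficient itself.\<close>
  define c where "c s \<omega> = (if ereal s < \<tau>max \<omega> then coefs s \<omega> j K else 0)" for s \<omega>
  have cm: "c s \<in> borel_measurable (F t)" if "0 \<le> s" "s \<le> t" for s
    unfolding c_def[abs_def] by (rule measurable_F_mono[OF that coefs_adapted[OF that(1) j K]])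
  define Z where "Z l \<omega> = c 0 \<omega> + (\<Sum>i<Suc l. (c (u l (Suc i)) \<omega> - c (u l i) \<omega>) * indicator (E (u l (Suc i))) \<omega>)" for l \<omega>
  have Zm: "Z l \<in> borel_measurable (F t)" for l
  proof -
    have "E (u l (Suc i)) \<in> sets (F t)" if "i < Suc l" for i
      using E[OF u(3), of l i] F_mono[OF _ ut[of "Suc i" l]] u(1)[of l "Suc i"] that by auto
    then show ?thesis unfolding Z_def[abs_def] using cm u(1) ut t
      by (intro borel_measurable_add borel_measurable_sum borel_measurable_times borel_measurable_diff borel_measurable_indicator) auto
  qed
  have "AE \<omega> in M. \<forall>l i. ereal (u l (Suc i)) < hit \<omega> \<longleftrightarrow> \<omega> \<in> E (u l (Suc i))"
    unfolding AE_all_countable using Eh[OF u(3)] by blast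
  then have lim: "AE \<omega> in M. (\<lambda>l. Z l \<omega>) \<longlonglongrightarrow> coefs (\<tau> t \<omega>) \<omega> j K"
    using AE_good
  proof eventually_elim
    case (elim \<omega>)
    note g = elim(2)
    let ?h = "\<tau> t \<omega>"
    note tp = \<tau>_props[OF g t]
    \<comment> \<open>The sum \<open>Z l\<close> picks the last grid time not beyond the stopped
      time, so it misses that time by at most one mesh width.\<close>
    have "\<exists>s. 0 \<le> s \<and> s \<le> ?h \<and> ?h - s \<le> t / real (Suc l) \<and> Z l \<omega> = coefs s \<omega> j K" for l
    proof -
      obtain K' where K': "K' \<le> Suc l" "c (u l 0) \<omega> + (\<Sum>i<Suc l. (c (u l (Suc i)) \<omega> - c (u l i) \<omega>) * (if ereal (u l (Suc i)) < hit \<omega> then 1 else 0)) = c (u l K') \<omega>"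
        "K' = 0 \<or> ereal (u l K') < hit \<omega>" "K' < Suc l \<longrightarrow> \<not> ereal (u l (Suc K')) < hit \<omega>"
        using telescope_stop[of "\<lambda>i. ereal (u l i) < hit \<omega>" "Suc l" "\<lambda>i. c (u l i) \<omega>"] u(2)[of l]
        by (auto intro: le_less_trans simp: ereal_less_eq(3)[symmetric] simp del: ereal_less_eq(3))
      have Zc: "Z l \<omega> = c (u l K') \<omega>"
      proof -
        have "indicator (E (u l (Suc i))) \<omega> = (if ereal (u l (Suc i)) < hit \<omega> then 1 else 0 :: real)" for i
          using elim(1)[rule_format, of l i] by (simp add: indicator_def)
        moreover have "u l 0 = 0" by (simp add: u_def)
        ultimately show ?thesis unfolding K'(2)[symmetric] Z_def by (simp only:)
      qed
      have "ereal (u l K') \<le> hit \<omega>" using K'(3) hit_nonneg[of \<omega>] by (auto simp: u_def zero_ereal_def)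
      then have le: "u l K' \<le> ?h" using ut[OF K'(1)] tp(1) by (metis ereal_less_eq(3) min.boundedI)
      have "?h \<le> u l K' + t / real (Suc l)"
      proof (cases "K' < Suc l")
        case True
        then have "hit \<omega> \<le> ereal (u l (Suc K'))" using K'(4) by (simp add: not_less)
        then have "ereal ?h \<le> ereal (u l (Suc K'))" using tp(4) by (rule order_trans[rotated])
        moreover have "u l (Suc K') = u l K' + t / real (Suc l)" by (simp add: u_def add_divide_distrib[symmetric] algebra_simps)
        ultimately show ?thesis by simp
      next
        case False
        then have "u l K' = t" using K'(1) by (simp add: u_def)
        then show ?thesis using tp(3) t by (simp add: add_increasing2)
      qed
      moreover have "ereal (u l K') < \<tau>max \<omega>" using le tp(5) by (auto intro: le_less_trans[of _ "ereal ?h"])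
      ultimately show ?thesis using Zc le u(1)[of l K'] by (intro exI[of _ "u l K'"]) (simp add: c_def)
    qed
    then obtain s where s: "\<And>l. 0 \<le> s l" "\<And>l. s l \<le> ?h" "\<And>l. ?h - s l \<le> t / real (Suc l)" "\<And>l. Z l \<omega> = coefs (s l) \<omega> j K"
      by metis
    have "(\<lambda>l. ?h - s l) \<longlonglongrightarrow> 0"
    proof (rule tendsto_sandwich[OF _ _ tendsto_const])
      show "(\<lambda>l. t / real (Suc l)) \<longlonglongrightarrow> 0" using LIMSEQ_Suc[OF lim_const_over_n[of t]] by simp
    qed (use s in auto)
    then have sl: "s \<longlonglongrightarrow> ?h" using tendsto_diff[OF tendsto_const[of ?h], of "\<lambda>l. ?h - s l" 0] by simp
    have "continuous_on {0..?h} (\<lambda>t. coefs t \<omega> j K)"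
    proof (rule continuous_on_subset[OF coefs_continuous[OF good_space[OF g] j K]])
      show "{0..?h} \<subseteq> {t. 0 \<le> t \<and> ereal t < \<tau>max \<omega>}" using less_max_mono[OF _ tp(5)] by auto
    qed
    then have "(\<lambda>l. coefs (s l) \<omega> j K) \<longlonglongrightarrow> coefs ?h \<omega> j K"
      using s(1,2) tp(2) sl unfolding continuous_on_sequentially comp_def by auto
    then show ?case using s(4) by simp
  qed
  show ?thesis
  proof (rule borel_measurable_AE_LIMSEQ[OF _ _ Zm lim])
    show "space (F t) = space M" using space_F[OF t] .
    show "null_sets M \<subseteq> sets (F t)" using usual F_mono[of 0 t] t unfolding usual_filtration_def by blast
  qed
qed

end

section \<open>Nonnegativity of the dissipation, and Parseval's identity on the domain\<close>

context ldg_basis begin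

lemma dissipation_nonneg: "0 \<le> dissipation L m P uh qh t \<omega>"
  unfolding dissipation_def set_lebesgue_integral_def face_dissipation_def[symmetric]
  by (intro sum_nonneg Bochner_Integration.integral_nonneg scaleR_nonneg_nonneg face_dissipation_nonneg) auto

text \<open>\<open>dg_fun\<close> is built with the interiors of the elements. These are disjoint,
  so the square can be taken element by element, and the frontiers left out are null sets;
  Parseval's identity applies on each element.\<close>

lemma L2_norm_dg:
  assumes v: "v \<in> dg_space m k"
  shows "(L2_norm D (dg_fun m v))\<^sup>2 = (\<Sum>K\<in>elems m. \<Sum>i<r K. (coord K (v K) i)\<^sup>2)"
proof -
  have sub: "interior K \<subseteq> D" if "K \<in> elems m" for K
  proof -
    have "interior K \<subseteq> interior (closure D)" using that conforming_facts(4) by (intro interior_mono) blast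
    then show ?thesis using domain unfolding polyhedral_domain_def by blast
  qed
  have pt: "indicator D x * (dg_fun m v x)\<^sup>2 = (\<Sum>K\<in>elems m. indicator (interior K) x * (v K x)\<^sup>2)" for x
  proof (cases "\<exists>K\<in>elems m. x \<in> interior K")
    case True
    then obtain K where K: "K \<in> elems m" "x \<in> interior K" by blast
    have ind: "indicator (interior K') x = (if K' = K then 1 else 0 :: real)" if "K' \<in> elems m" for K'
    proof (cases "K' = K")
      case False
      then have "interior K' \<inter> interior K = {}" using conforming_facts(5) that K(1) by blast
      then show ?thesis using K(2) False by (auto simp: indicator_def)
    qed (use K in simp)
    have one: "(\<Sum>K'\<in>elems m. indicator (interior K') x * f K') = f K" for f :: "_ \<Rightarrow> real"
    proof -
      have "(\<Sum>K'\<in>elems m. indicator (interior K') x * f K') = (\<Sum>K'\<in>elems m. if K' = K then f K' else 0)"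
        by (intro sum.cong) (auto simp: ind)
      then show ?thesis using K(1) finite_elems by simp
    qed
    have "x \<in> D" using sub[OF K(1)] K(2) by blast
    then show ?thesis unfolding dg_fun_def one by simp
  next
    case False
    then show ?thesis unfolding dg_fun_def by (simp add: indicator_def sum.neutral)
  qed
  have AE: "AE x in lborel. indicator (interior K) x * (v K x)\<^sup>2 = indicator K x * (v K x)\<^sup>2" if "K \<in> elems m" for K
    using AE_not_in[OF frontier_null[OF that]]
  proof eventually_elim
    case (elim x)
    then have "x \<in> interior K \<longleftrightarrow> x \<in> K" using elem_closed[OF that] interior_subset by (auto simp: frontier_def)
    then show ?case by (simp add: indicator_def)
  qed
  have int: "integrable lborel (\<lambda>x. indicator K x * (v K x)\<^sup>2)" if "K \<in> elems m" for K
    using poly_product_integrable[OF that, of "v K" "v K"] v that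
    by (simp add: dg_space_def set_integrable_def power2_eq_square)
  have vm: "(\<lambda>x. (v K x)\<^sup>2) \<in> borel_measurable borel" if "K \<in> elems m" for K
    using dg_measurable[OF v that] by (rule borel_measurable_power)
  have mi: "(\<lambda>x. indicator (interior K) x * (v K x)\<^sup>2) \<in> borel_measurable lborel" if "K \<in> elems m" for K
    using vm[OF that] by (intro borel_measurable_times borel_measurable_indicator) auto
  have int': "integrable lborel (\<lambda>x. indicator (interior K) x * (v K x)\<^sup>2)" if "K \<in> elems m" for K
    using integrable_cong_AE[OF mi[OF that] borel_measurable_integrable[OF int[OF that]] AE[OF that]] int[OF that] by simp
  have eq: "(LINT x|lborel. indicator (interior K) x * (v K x)\<^sup>2) = (\<Sum>i<r K. (coord K (v K) i)\<^sup>2)" if "K \<in> elems m" for K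
  proof -
    have "(LINT x|lborel. indicator (interior K) x * (v K x)\<^sup>2) = (LINT x:K|lborel. (v K x)\<^sup>2)"
      unfolding set_lebesgue_integral_def
      using integral_cong_AE[OF mi[OF that] borel_measurable_integrable[OF int[OF that]] AE[OF that]] by simp
    then show ?thesis using parseval[OF that, of "v K"] v that by (simp add: dg_space_def)
  qed
  have "(LINT x:D|lborel. (dg_fun m v x)\<^sup>2) = (LINT x|lborel. (\<Sum>K\<in>elems m. indicator (interior K) x * (v K x)\<^sup>2))"
    unfolding set_lebesgue_integral_def real_scaleR_def pt ..
  also have "\<dots> = (\<Sum>K\<in>elems m. \<Sum>i<r K. (coord K (v K) i)\<^sup>2)"
    using int' eq by (simp add: Bochner_Integration.integral_sum)
  finally have "(LINT x:D|lborel. (dg_fun m v x)\<^sup>2) = (\<Sum>K\<in>elems m. \<Sum>i<r K. (coord K (v K) i)\<^sup>2)" .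
  moreover have "0 \<le> (\<Sum>K\<in>elems m. \<Sum>i<r K. (coord K (v K) i)\<^sup>2)" by (intro sum_nonneg) auto
  ultimately show ?thesis unfolding L2_norm_def by simp
qed

end

lemma set_integrable_bounded_interval:
  fixes f :: "real \<Rightarrow> real"
  assumes m: "(\<lambda>s. if s \<in> {a..b} then f s else 0) \<in> borel_measurable borel" and C: "\<And>s. s \<in> {a..b} \<Longrightarrow> \<bar>f s\<bar> \<le> C"
  shows "set_integrable lborel {a..b} f"
proof -
  have eq: "indicator {a..b} s *\<^sub>R f s = (if s \<in> {a..b} then f s else 0)" for s by (simp add: indicator_def)
  have "integrable lborel (\<lambda>s. indicator {a..b} s *\<^sub>R max C 0)"
    by (intro integrable_scaleR_left integrable_real_indicator) (auto simp: emeasure_lborel_Icc_eq)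
  then show ?thesis unfolding set_integrable_def
  proof (rule Bochner_Integration.integrable_bound)
    show "(\<lambda>s. indicator {a..b} s *\<^sub>R f s) \<in> borel_measurable lborel" unfolding eq using m by simp
    show "AE s in lborel. norm (indicator {a..b} s *\<^sub>R f s) \<le> norm (indicator {a..b} s *\<^sub>R max C 0)"
      using C by (intro AE_I2) (auto simp: indicator_def intro: max.coboundedI1)
  qed
qed

context ldg_problem begin

text \<open>Outside \<open>J\<close> the path is replaced by \<open>0\<close>, as \<open>coef_matrix\<close> is junk there.\<close>

lemma path_measurable:
  assumes J: "J \<in> sets borel" and v: "\<And>s. s \<in> J \<Longrightarrow> v s \<in> dg_space m k"
    and c: "\<And>j K. j \<le> N \<Longrightarrow> K \<in> elems m \<Longrightarrow> continuous_on J (\<lambda>s. coef_matrix N \<beta> (v s) j K)" and K: "K \<in> elems m"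
  shows "(\<lambda>(s, x). (if s \<in> J then v s else (\<lambda>_ _. 0)) K x) \<in> borel_measurable (borel \<Otimes>\<^sub>M borel)"
proof -
  have eq: "(if s \<in> J then v s else (\<lambda>_ _. 0)) K x = (\<Sum>j\<le>N. (indicator J s *\<^sub>R coef_matrix N \<beta> (v s) j K) * \<beta> j K x)" for s x
    using coef_expand[OF basis v K, of s x] by (simp add: indicator_def)
  have b: "\<beta> j K \<in> borel_measurable borel" if "j \<le> N" for j
  proof -
    have "\<beta> j K \<in> polys k" using basis that K unfolding local_basis_def by blast
    then show ?thesis by (intro borel_measurable_continuous_onI polys_continuous)
  qed
  have cm: "(\<lambda>s. indicator J s *\<^sub>R coef_matrix N \<beta> (v s) j K) \<in> borel_measurable borel" if "j \<le> N" for j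
    by (rule borel_measurable_continuous_on_indicator[OF J c[OF that K]])
  show ?thesis unfolding eq case_prod_beta'
    by (intro borel_measurable_sum borel_measurable_times measurable_compose[OF measurable_fst cm]
        measurable_compose[OF measurable_snd b]) auto
qed

end

section \<open>Uniform bounds and the energy identity along a path\<close>

context ldg_stopped begin

lemma hit_live: "good \<omega> \<Longrightarrow> ereal s \<le> hit \<omega> \<Longrightarrow> ereal s < \<tau>max \<omega>"
  using hit_less_max[of \<omega>] by (auto intro: le_less_trans)

lemma \<tau>_mem_iff:
  assumes "good \<omega>" "0 \<le> t"
  shows "s \<in> {0..\<tau> t \<omega>} \<longleftrightarrow> s \<in> {0..t} \<and> ereal s \<le> hit \<omega>"
proof -
  have "s \<le> \<tau> t \<omega> \<longleftrightarrow> ereal s \<le> min (ereal t) (hit \<omega>)" using \<tau>_props(1)[OF assms] by (metis ereal_less_eq(3))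
  then show ?thesis by auto
qed

lemma path_props:
  assumes g: "good \<omega>" and s: "0 \<le> s" "ereal s \<le> hit \<omega>"
  shows "uh s \<omega> \<in> dg_space m k" "\<And>\<l>. \<l> \<in> L \<Longrightarrow> qh \<l> s \<omega> \<in> dg_space m k"
    "\<And>\<l>. \<l> \<in> L \<Longrightarrow> q_equation m P k \<l> (uh s \<omega>) (qh \<l> s \<omega>)"
proof -
  have live: "ereal s < \<tau>max \<omega>" by (rule hit_live[OF g s(2)])
  show "uh s \<omega> \<in> dg_space m k" by (rule dg_uh[OF good_space[OF g] s(1) live])
  show "qh \<l> s \<omega> \<in> dg_space m k" if "\<l> \<in> L" for \<l> by (rule dg_qh[OF that good_space[OF g] s(1) live])
  show "q_equation m P k \<l> (uh s \<omega>) (qh \<l> s \<omega>)" if "\<l> \<in> L" for \<l>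
    using g s(1) live that unfolding good_def by blast
qed

text \<open>The constants do not depend on path or time. They are obtained in a chain: the stopping
  level bounds the coefficients and hence \<open>uh\<close>, this bounds \<open>qh\<close> by
  \<open>q_coord_bounded\<close>, and both bound the form b by
  \<open>b_form_bounded\<close>.\<close>

lemma bounds:
  obtains U Q C where "0 \<le> U" "0 \<le> Q"
    "\<And>\<omega> s K x. good \<omega> \<Longrightarrow> 0 \<le> s \<Longrightarrow> ereal s \<le> hit \<omega> \<Longrightarrow> K \<in> elems m \<Longrightarrow> x \<in> K \<Longrightarrow> \<bar>uh s \<omega> K x\<bar> \<le> U"
    "\<And>\<omega> s \<l> K x. good \<omega> \<Longrightarrow> 0 \<le> s \<Longrightarrow> ereal s \<le> hit \<omega> \<Longrightarrow> \<l> \<in> L \<Longrightarrow> K \<in> elems m \<Longrightarrow> x \<in> K \<Longrightarrow> \<bar>qh \<l> s \<omega> K x\<bar> \<le> Q"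
    "\<And>\<omega> s \<l> K i. good \<omega> \<Longrightarrow> 0 \<le> s \<Longrightarrow> ereal s \<le> hit \<omega> \<Longrightarrow> \<l> \<in> L \<Longrightarrow> K \<in> elems m \<Longrightarrow> i < r K \<Longrightarrow>
        \<bar>b_form m P \<l> K (uh s \<omega>) (qh \<l> s \<omega>) (\<lambda>_. eb K i)\<bar> \<le> C"
proof -
  have bc: "continuous_on UNIV (\<lambda>x. \<Sum>j\<le>N. \<bar>\<beta> j K x\<bar>)" if "K \<in> elems m" for K
  proof -
    have "continuous_on UNIV (\<beta> j K)" if "j \<le> N" for j
      using basis that \<open>K \<in> elems m\<close> unfolding local_basis_def by (intro polys_continuous) blast
    then show ?thesis by (intro continuous_intros) auto
  qed
  obtain B where B: "0 < B" "\<And>K x. K \<in> elems m \<Longrightarrow> x \<in> K \<Longrightarrow> norm (\<Sum>j\<le>N. \<bar>\<beta> j K x\<bar>) \<le> B"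
    using bounded_on_elems[of "\<lambda>K x. \<Sum>j\<le>N. \<bar>\<beta> j K x\<bar>"] bc by blast
  define U where "U = bound * B"
  have b0: "0 \<le> bound" by (simp add: bound_def)
  have U: "\<bar>uh s \<omega> K x\<bar> \<le> U" if g: "good \<omega>" and s: "0 \<le> s" "ereal s \<le> hit \<omega>" and K: "K \<in> elems m" and x: "x \<in> K" for \<omega> s K x
  proof -
    have "\<bar>uh s \<omega> K x\<bar> \<le> (\<Sum>j\<le>N. \<bar>coefs s \<omega> j K\<bar> * \<bar>\<beta> j K x\<bar>)"
      unfolding coef_expand[OF basis path_props(1)[OF g s] K] abs_mult[symmetric] by (rule sum_abs)
    also have "\<dots> \<le> (\<Sum>j\<le>N. bound * \<bar>\<beta> j K x\<bar>)"
    proof (intro sum_mono mult_right_mono)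
      fix j assume "j \<in> {..N}"
      then have "\<bar>coefs s \<omega> j K\<bar> \<le> size s \<omega>" unfolding size_def using coef_le_frobenius[OF finite_elems _ K] by blast
      then show "\<bar>coefs s \<omega> j K\<bar> \<le> bound" using size_bound[OF g s hit_live[OF g s(2)]] by linarith
    qed simp
    also have "\<dots> = bound * (\<Sum>j\<le>N. \<bar>\<beta> j K x\<bar>)" by (simp add: sum_distrib_left)
    also have "\<dots> \<le> U" unfolding U_def using B(2)[OF K x] b0 by (intro mult_left_mono) auto
    finally show ?thesis .
  qed
  obtain Q where Q: "\<And>\<l> u q K x. \<l> \<in> L \<Longrightarrow> u \<in> dg_space m k \<Longrightarrow> q \<in> dg_space m k \<Longrightarrow> q_equation m P k \<l> u q \<Longrightarrow>
    (\<And>K x. K \<in> elems m \<Longrightarrow> x \<in> K \<Longrightarrow> \<bar>u K x\<bar> \<le> U) \<Longrightarrow> K \<in> elems m \<Longrightarrow> x \<in> K \<Longrightarrow> \<bar>q K x\<bar> \<le> Q"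
    using q_coord_bounded[of U] by metis
  obtain C where C: "\<And>\<l> u q K i. \<l> \<in> L \<Longrightarrow> u \<in> dg_space m k \<Longrightarrow> q \<in> dg_space m k \<Longrightarrow>
    (\<And>K x. K \<in> elems m \<Longrightarrow> x \<in> K \<Longrightarrow> \<bar>u K x\<bar> \<le> U) \<Longrightarrow> (\<And>K x. K \<in> elems m \<Longrightarrow> x \<in> K \<Longrightarrow> \<bar>q K x\<bar> \<le> max Q 0) \<Longrightarrow>
    K \<in> elems m \<Longrightarrow> i < r K \<Longrightarrow> \<bar>b_form m P \<l> K u q (\<lambda>_. eb K i)\<bar> \<le> C"
    using b_form_bounded[of U "max Q 0"] by metis
  have qb: "\<bar>qh \<l> s \<omega> K x\<bar> \<le> max Q 0" if "good \<omega>" "0 \<le> s" "ereal s \<le> hit \<omega>" "\<l> \<in> L" "K \<in> elems m" "x \<in> K" for \<omega> s \<l> K x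
  proof -
    have "\<bar>qh \<l> s \<omega> K x\<bar> \<le> Q"
      by (rule Q[OF that(4) path_props(1)[OF that(1-3)] path_props(2)[OF that(1-4)] path_props(3)[OF that(1-4)] U[OF that(1-3)] that(5,6)])
    then show ?thesis by linarith
  qed
  have "\<bar>b_form m P \<l> K (uh s \<omega>) (qh \<l> s \<omega>) (\<lambda>_. eb K i)\<bar> \<le> C"
    if "good \<omega>" "0 \<le> s" "ereal s \<le> hit \<omega>" "\<l> \<in> L" "K \<in> elems m" "i < r K" for \<omega> s \<l> K i
    by (rule C[OF that(4) path_props(1)[OF that(1-3)] path_props(2)[OF that(1-4)] U[OF that(1-3)] qb[OF that(1-4)] that(5,6)])
  moreover have "0 \<le> U" unfolding U_def using b0 B(1) by simp
  ultimately show thesis using U qb by (intro that[of U "max Q 0" C]) auto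
qed

lemma path_integrable:
  assumes g: "good \<omega>" and c: "ereal c \<le> hit \<omega>" and l: "\<l> \<in> L"
  shows "K \<in> elems m \<Longrightarrow> i < r K \<Longrightarrow> set_integrable lborel {0..c} (\<lambda>s. b_form m P \<l> K (uh s \<omega>) (qh \<l> s \<omega>) (\<lambda>_. eb K i))"
    "K \<in> elems m \<Longrightarrow> i < r K \<Longrightarrow> set_integrable lborel {0..c} (\<lambda>s. coord K (uh s \<omega> K) i * b_form m P \<l> K (uh s \<omega>) (qh \<l> s \<omega>) (\<lambda>_. eb K i))"
    "K \<in> elems m \<Longrightarrow> i < r K \<Longrightarrow> set_integrable lborel {0..c} (\<lambda>s. (coord K (qh \<l> s \<omega> K) i)\<^sup>2)"
    "e \<in> faces m \<Longrightarrow> set_integrable lborel {0..c} (\<lambda>s. LINT x:e|surface. face_dissipation \<l> (uh s \<omega>) (qh \<l> s \<omega>) e x)"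
proof -
  obtain U Q C where b: "0 \<le> U" "0 \<le> Q"
    "\<And>\<omega> s K x. good \<omega> \<Longrightarrow> 0 \<le> s \<Longrightarrow> ereal s \<le> hit \<omega> \<Longrightarrow> K \<in> elems m \<Longrightarrow> x \<in> K \<Longrightarrow> \<bar>uh s \<omega> K x\<bar> \<le> U"
    "\<And>\<omega> s \<l> K x. good \<omega> \<Longrightarrow> 0 \<le> s \<Longrightarrow> ereal s \<le> hit \<omega> \<Longrightarrow> \<l> \<in> L \<Longrightarrow> K \<in> elems m \<Longrightarrow> x \<in> K \<Longrightarrow> \<bar>qh \<l> s \<omega> K x\<bar> \<le> Q"
    "\<And>\<omega> s \<l> K i. good \<omega> \<Longrightarrow> 0 \<le> s \<Longrightarrow> ereal s \<le> hit \<omega> \<Longrightarrow> \<l> \<in> L \<Longrightarrow> K \<in> elems m \<Longrightarrow> i < r K \<Longrightarrow>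
        \<bar>b_form m P \<l> K (uh s \<omega>) (qh \<l> s \<omega>) (\<lambda>_. eb K i)\<bar> \<le> C"
    by (rule bounds) blast
  let ?J = "{0..c}"
  have J: "0 \<le> s" "ereal s \<le> hit \<omega>" "ereal s < \<tau>max \<omega>" if "s \<in> ?J" for s
  proof -
    have "ereal s \<le> ereal c" using that by simp
    then show "ereal s \<le> hit \<omega>" using c by (rule order_trans)
    then show "ereal s < \<tau>max \<omega>" by (rule hit_live[OF g])
  qed (use that in simp)
  have sub: "?J \<subseteq> {t. 0 \<le> t \<and> ereal t < \<tau>max \<omega>}" using J by auto
  let ?u = "\<lambda>s. if s \<in> ?J then uh s \<omega> else (\<lambda>_ _. 0)"
  let ?q = "\<lambda>s. if s \<in> ?J then qh \<l> s \<omega> else (\<lambda>_ _. 0)"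
  have u: "(\<lambda>(s, x). ?u s K x) \<in> borel_measurable (borel \<Otimes>\<^sub>M borel)" if "K \<in> elems m" for K
    by (rule path_measurable[OF _ path_props(1)[OF g J(1,2)] continuous_on_subset[OF coefs_continuous[OF good_space[OF g]] sub] that]) auto
  have q: "(\<lambda>(s, x). ?q s K x) \<in> borel_measurable (borel \<Otimes>\<^sub>M borel)" if "K \<in> elems m" for K
    by (rule path_measurable[OF _ path_props(2)[OF g J(1,2) l] continuous_on_subset[OF coefs_qh_continuous[OF l good_space[OF g]] sub] that]) auto
  have co: "(\<lambda>s. coord K (v s K) i) \<in> borel_measurable borel"
    if v: "(\<lambda>(s, x). v s K x) \<in> borel_measurable (borel \<Otimes>\<^sub>M borel)" and Ki: "K \<in> elems m" "i < r K" for v K i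
  proof -
    have e: "eb K i \<in> borel_measurable borel"
      by (rule borel_measurable_continuous_onI[OF polys_continuous[OF eb_polys[OF Ki]]])
    have "(\<lambda>p. eb K i (snd p) * (\<lambda>(s, x). v s K x) p) \<in> borel_measurable (borel \<Otimes>\<^sub>M borel)"
      by (rule borel_measurable_times[OF measurable_compose[OF measurable_snd e] v])
    then show ?thesis unfolding coord_def
      by (intro volume_integral_measurable Ki(1)) (simp add: case_prod_beta')
  qed
  have ub: "\<bar>coord K (uh s \<omega> K) i\<bar> \<le> U * (LINT x:K|lborel. \<bar>eb K i x\<bar>)" if "s \<in> ?J" "K \<in> elems m" "i < r K" for s K i
    by (rule coord_bounded[OF b(3)[OF g J(1,2)[OF that(1)]] path_props(1)[OF g J(1,2)[OF that(1)]] that(2,3)])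
  have qb: "\<bar>coord K (qh \<l> s \<omega> K) i\<bar> \<le> Q * (LINT x:K|lborel. \<bar>eb K i x\<bar>)" if "s \<in> ?J" "K \<in> elems m" "i < r K" for s K i
    by (rule coord_bounded[OF b(4)[OF g J(1,2)[OF that(1)] l] path_props(2)[OF g J(1,2)[OF that(1)] l] that(2,3)])
  have ifm: "(\<lambda>s. if s \<in> ?J then f s else 0) \<in> borel_measurable borel"
    if "h \<in> borel_measurable borel" "\<And>s. s \<in> ?J \<Longrightarrow> h s = f s" for h f :: "real \<Rightarrow> real"
  proof -
    have "(\<lambda>s. if s \<in> ?J then h s else 0) \<in> borel_measurable borel"
      by (intro measurable_If_set that(1)) auto
    moreover have "(\<lambda>s. if s \<in> ?J then h s else 0) = (\<lambda>s. if s \<in> ?J then f s else 0)" using that(2) by auto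
    ultimately show ?thesis by simp
  qed
  show "set_integrable lborel ?J (\<lambda>s. b_form m P \<l> K (uh s \<omega>) (qh \<l> s \<omega>) (\<lambda>_. eb K i))" if Ki: "K \<in> elems m" "i < r K"
    by (rule set_integrable_bounded_interval[OF ifm[OF b_form_measurable[OF l Ki u q]] b(5)[OF g J(1,2) l Ki]]) auto
  show "set_integrable lborel ?J (\<lambda>s. coord K (uh s \<omega> K) i * b_form m P \<l> K (uh s \<omega>) (qh \<l> s \<omega>) (\<lambda>_. eb K i))"
    if Ki: "K \<in> elems m" "i < r K"
  proof (rule set_integrable_bounded_interval[OF ifm[OF borel_measurable_times[OF co[of ?u, OF u[OF Ki(1)] Ki] b_form_measurable[OF l Ki u q]]]])
    fix s assume s: "s \<in> ?J"
    show "\<bar>coord K (uh s \<omega> K) i * b_form m P \<l> K (uh s \<omega>) (qh \<l> s \<omega>) (\<lambda>_. eb K i)\<bar> \<le> (U * (LINT x:K|lborel. \<bar>eb K i x\<bar>)) * C"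
      unfolding abs_mult using ub[OF s Ki] b(5)[OF g J(1,2)[OF s] l Ki] by (intro mult_mono) (auto intro: order_trans[OF abs_ge_zero])
  qed auto
  show "set_integrable lborel ?J (\<lambda>s. (coord K (qh \<l> s \<omega> K) i)\<^sup>2)" if Ki: "K \<in> elems m" "i < r K"
  proof (rule set_integrable_bounded_interval[OF ifm[OF borel_measurable_power[OF co[of ?q, OF q[OF Ki(1)] Ki], of 2]]])
    fix s assume s: "s \<in> ?J"
    have "\<bar>coord K (qh \<l> s \<omega> K) i\<bar>\<^sup>2 \<le> (Q * (LINT x:K|lborel. \<bar>eb K i x\<bar>))\<^sup>2"
      using qb[OF s Ki] by (rule power_mono) simp
    then show "\<bar>(coord K (qh \<l> s \<omega> K) i)\<^sup>2\<bar> \<le> (Q * (LINT x:K|lborel. \<bar>eb K i x\<bar>))\<^sup>2" by simp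
  qed auto
  show "set_integrable lborel ?J (\<lambda>s. LINT x:e|surface. face_dissipation \<l> (uh s \<omega>) (qh \<l> s \<omega>) e x)" if e: "e \<in> faces m"
  proof (rule set_integrable_bounded_interval[OF ifm[OF face_dissipation_integral(1)[OF l e u q]]])
    fix s assume s: "s \<in> ?J"
    have "\<bar>LINT x:e|surface. face_dissipation \<l> (?u s) (?q s) e x\<bar> \<le>
        (eta_q P \<l> e * (2 * U)\<^sup>2 + eta_u P \<l> e * (2 * Q)\<^sup>2) * (LINT x:e|surface. \<bar>ntrace P \<l> e x\<bar>)"
      by (rule face_dissipation_integral(2)[OF l e u q]) (use s b(3)[OF g J(1,2)[OF s]] b(4)[OF g J(1,2)[OF s] l] in auto)
    then show "\<bar>LINT x:e|surface. face_dissipation \<l> (uh s \<omega>) (qh \<l> s \<omega>) e x\<bar> \<le>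
        (eta_q P \<l> e * (2 * U)\<^sup>2 + eta_u P \<l> e * (2 * Q)\<^sup>2) * (LINT x:e|surface. \<bar>ntrace P \<l> e x\<bar>)"
      using s by simp
  qed auto
qed

text \<open>Time-integrated form of \<open>energy_identity\<close>, written in coordinates because
  the stochastic balance is available for each coordinate separately. It holds for each good path,
  before any expectation is taken.\<close>

lemma path_energy:
  assumes g: "good \<omega>" and c: "0 \<le> c" "c \<le> T" "ereal c \<le> hit \<omega>"
  shows "(\<Sum>K\<in>elems m. \<Sum>i<r K.
      (LINT s:{0..c}|lborel. 2 * coord K (uh s \<omega> K) i * (\<Sum>\<l>\<in>L. b_form m P \<l> K (uh s \<omega>) (qh \<l> s \<omega>) (\<lambda>_. eb K i)))
      + (\<Sum>\<l>\<in>L. LINT s:{0..c}|lborel. (coord K (qh \<l> s \<omega> K) i)\<^sup>2))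
    = - dissipation L m P uh qh c \<omega>"
proof -
  let ?J = "{0..c}"
  let ?b = "\<lambda>\<l> K s i. coord K (uh s \<omega> K) i * b_form m P \<l> K (uh s \<omega>) (qh \<l> s \<omega>) (\<lambda>_. eb K i)"
  let ?q = "\<lambda>\<l> K s i. (coord K (qh \<l> s \<omega> K) i)\<^sup>2"
  let ?d = "\<lambda>\<l> e s. LINT x:e|surface. face_dissipation \<l> (uh s \<omega>) (qh \<l> s \<omega>) e x"
  note int = path_integrable[OF g c(3)]
  have J: "0 \<le> s" "ereal s \<le> hit \<omega>" if "s \<in> ?J" for s
  proof -
    have "ereal s \<le> ereal c" using that by simp
    then show "ereal s \<le> hit \<omega>" using c(3) by (rule order_trans)
  qed (use that in simp)
  have i2: "set_integrable lborel ?J (\<lambda>s. 2 * ?b \<l> K s i + ?q \<l> K s i)" if "\<l> \<in> L" "K \<in> elems m" "i < r K" for \<l> K i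
    using that by (intro set_integral_add set_integrable_mult_right int)
  have 1: "(LINT s:?J|lborel. 2 * coord K (uh s \<omega> K) i * (\<Sum>\<l>\<in>L. b_form m P \<l> K (uh s \<omega>) (qh \<l> s \<omega>) (\<lambda>_. eb K i)))
      + (\<Sum>\<l>\<in>L. LINT s:?J|lborel. ?q \<l> K s i) = (\<Sum>\<l>\<in>L. LINT s:?J|lborel. 2 * ?b \<l> K s i + ?q \<l> K s i)"
    if Ki: "K \<in> elems m" "i < r K" for K i
  proof -
    have "(LINT s:?J|lborel. 2 * coord K (uh s \<omega> K) i * (\<Sum>\<l>\<in>L. b_form m P \<l> K (uh s \<omega>) (qh \<l> s \<omega>) (\<lambda>_. eb K i)))
       = (LINT s:?J|lborel. \<Sum>\<l>\<in>L. 2 * ?b \<l> K s i)"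
      by (simp add: sum_distrib_left mult.assoc)
    also have "\<dots> = (\<Sum>\<l>\<in>L. LINT s:?J|lborel. 2 * ?b \<l> K s i)"
      by (intro set_integral_finite_sum(2) set_integrable_mult_right int Ki)
    finally show ?thesis
      using int Ki by (simp add: set_integral_add(2) sum.distrib)
  qed
  have pt: "(\<Sum>\<l>\<in>L. \<Sum>K\<in>elems m. \<Sum>i<r K. 2 * ?b \<l> K s i + ?q \<l> K s i) = - (\<Sum>e\<in>faces m. \<Sum>\<l>\<in>L. ?d \<l> e s)" if s: "s \<in> ?J" for s
  proof -
    note pp = path_props[OF g J[OF s]]
    \<comment> \<open>Absence of transport across the boundary is known only on [0,T] before
      \<open>\<tau>max\<close>; this is where c <= T enters.\<close>
    have bd: "\<forall>K\<in>elems m. \<forall>e\<in>faces_of m K. e \<subseteq> frontier D \<longrightarrow>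
           (AE x in surface. x \<in> e \<longrightarrow> sigma_n m P \<l> K e x * uh s \<omega> K x = 0)" if "\<l> \<in> L" for \<l>
      using g hit_live[OF g J(2)[OF s]] s c(2) that unfolding good_def by auto
    have "(\<Sum>K\<in>elems m. \<Sum>i<r K. 2 * ?b \<l> K s i + ?q \<l> K s i) = - (\<Sum>e\<in>faces m. ?d \<l> e s)" if l: "\<l> \<in> L" for \<l>
    proof -
      have "(\<Sum>i<r K. 2 * ?b \<l> K s i + ?q \<l> K s i) = 2 * b_form m P \<l> K (uh s \<omega>) (qh \<l> s \<omega>) (uh s \<omega>) + (LINT x:K|lborel. (qh \<l> s \<omega> K x)\<^sup>2)"
        if K: "K \<in> elems m" for K
      proof -
        have "qh \<l> s \<omega> K \<in> polys k" using pp(2)[OF l] K by (simp add: dg_space_def)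
        then show ?thesis
          unfolding b_form_expand[OF l pp(1) pp(2)[OF l] K] by (simp add: parseval[OF K] sum.distrib sum_distrib_left)
      qed
      then have "(\<Sum>K\<in>elems m. \<Sum>i<r K. 2 * ?b \<l> K s i + ?q \<l> K s i)
          = (\<Sum>K\<in>elems m. 2 * b_form m P \<l> K (uh s \<omega>) (qh \<l> s \<omega>) (uh s \<omega>) + (LINT x:K|lborel. (qh \<l> s \<omega> K x)\<^sup>2))"
        by (rule sum.cong[OF refl])
      then show ?thesis using energy_identity[OF finL l pp(1) pp(2)[OF l] pp(3)[OF l] bd[OF l]] by simp
    qed
    then have "(\<Sum>\<l>\<in>L. \<Sum>K\<in>elems m. \<Sum>i<r K. 2 * ?b \<l> K s i + ?q \<l> K s i) = (\<Sum>\<l>\<in>L. - (\<Sum>e\<in>faces m. ?d \<l> e s))"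
      by (rule sum.cong[OF refl])
    also have "\<dots> = - (\<Sum>e\<in>faces m. \<Sum>\<l>\<in>L. ?d \<l> e s)"
      unfolding sum_negf by (subst sum.swap) simp
    finally show ?thesis .
  qed
  have "(\<Sum>K\<in>elems m. \<Sum>i<r K.
      (LINT s:?J|lborel. 2 * coord K (uh s \<omega> K) i * (\<Sum>\<l>\<in>L. b_form m P \<l> K (uh s \<omega>) (qh \<l> s \<omega>) (\<lambda>_. eb K i)))
      + (\<Sum>\<l>\<in>L. LINT s:?J|lborel. ?q \<l> K s i))
    = (\<Sum>K\<in>elems m. \<Sum>i<r K. \<Sum>\<l>\<in>L. LINT s:?J|lborel. 2 * ?b \<l> K s i + ?q \<l> K s i)"
    by (intro sum.cong refl 1) auto
  also have "\<dots> = (\<Sum>K\<in>elems m. \<Sum>\<l>\<in>L. \<Sum>i<r K. LINT s:?J|lborel. 2 * ?b \<l> K s i + ?q \<l> K s i)"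
    by (intro sum.cong refl sum.swap)
  also have "\<dots> = (\<Sum>\<l>\<in>L. \<Sum>K\<in>elems m. \<Sum>i<r K. LINT s:?J|lborel. 2 * ?b \<l> K s i + ?q \<l> K s i)"
    by (rule sum.swap)
  also have "\<dots> = (LINT s:?J|lborel. (\<Sum>\<l>\<in>L. \<Sum>K\<in>elems m. \<Sum>i<r K. 2 * ?b \<l> K s i + ?q \<l> K s i))"
  proof -
    have "(LINT s:?J|lborel. (\<Sum>\<l>\<in>L. \<Sum>K\<in>elems m. \<Sum>i<r K. 2 * ?b \<l> K s i + ?q \<l> K s i))
        = (\<Sum>\<l>\<in>L. LINT s:?J|lborel. (\<Sum>K\<in>elems m. \<Sum>i<r K. 2 * ?b \<l> K s i + ?q \<l> K s i))"
      by (intro set_integral_finite_sum set_integral_finite_sum(1) i2) auto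
    also have "\<dots> = (\<Sum>\<l>\<in>L. \<Sum>K\<in>elems m. LINT s:?J|lborel. (\<Sum>i<r K. 2 * ?b \<l> K s i + ?q \<l> K s i))"
      by (intro sum.cong refl set_integral_finite_sum set_integral_finite_sum(1) i2) auto
    also have "\<dots> = (\<Sum>\<l>\<in>L. \<Sum>K\<in>elems m. \<Sum>i<r K. LINT s:?J|lborel. 2 * ?b \<l> K s i + ?q \<l> K s i)"
      by (intro sum.cong refl set_integral_finite_sum i2) auto
    finally show ?thesis by simp
  qed
  also have "\<dots> = (LINT s:?J|lborel. - (\<Sum>e\<in>faces m. \<Sum>\<l>\<in>L. ?d \<l> e s))"
    by (rule set_lebesgue_integral_cong) (use pt in auto)
  also have "\<dots> = - (LINT s:?J|lborel. (\<Sum>e\<in>faces m. \<Sum>\<l>\<in>L. ?d \<l> e s))"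
    by (simp add: set_lebesgue_integral_def)
  also have "(LINT s:?J|lborel. (\<Sum>e\<in>faces m. \<Sum>\<l>\<in>L. ?d \<l> e s)) = (\<Sum>e\<in>faces m. LINT s:?J|lborel. (\<Sum>\<l>\<in>L. ?d \<l> e s))"
    by (intro set_integral_finite_sum(2) set_integral_finite_sum(1) int)
  also have "\<dots> = dissipation L m P uh qh c \<omega>"
    unfolding dissipation_def face_dissipation_def ..
  finally show ?thesis .
qed

end

section \<open>Energy estimate\<close>

context ldg_stopped begin

lemma coord_measurable:
  assumes t: "0 \<le> t" and K: "K \<in> elems m" and i: "i < r K"
  shows "(\<lambda>\<omega>. coord K (uh (\<tau> t \<omega>) \<omega> K) i) \<in> borel_measurable (F t)"
proof (rule borel_measurable_F_AE_eq[OF t])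
  show "(\<lambda>\<omega>. \<Sum>j\<le>N. coefs (\<tau> t \<omega>) \<omega> j K * coord K (\<beta> j K) i) \<in> borel_measurable (F t)"
    using stopped_coefs_measurable[OF t _ K] by (intro borel_measurable_sum borel_measurable_times) auto
  have bp: "\<beta> j K \<in> polys k" if "j \<le> N" for j using basis that K unfolding local_basis_def by blast
  show "AE \<omega> in M. coord K (uh (\<tau> t \<omega>) \<omega> K) i = (\<Sum>j\<le>N. coefs (\<tau> t \<omega>) \<omega> j K * coord K (\<beta> j K) i)"
    using AE_good
  proof eventually_elim
    case (elim \<omega>)
    note tp = \<tau>_props[OF elim t]
    have "coord K (uh (\<tau> t \<omega>) \<omega> K) i = (LINT x:K|lborel. \<Sum>j\<le>N. coefs (\<tau> t \<omega>) \<omega> j K * (eb K i x * \<beta> j K x))"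
      unfolding coord_def coef_expand[OF basis path_props(1)[OF elim tp(2,4)] K] by (simp add: sum_distrib_left mult_ac)
    also have "\<dots> = (\<Sum>j\<le>N. coefs (\<tau> t \<omega>) \<omega> j K * coord K (\<beta> j K) i)"
      unfolding coord_def by (intro set_integral_lincomb poly_product_integrable K eb_polys i bp) auto
    finally show ?case .
  qed
qed

text \<open>\<open>ito_energy_le\<close> works on a deterministic interval. The stopping is
  therefore moved into the coefficients: drift and integrands are set to zero after the hitting
  time, and the stopped coordinate is an Ito process with bounded data on all of [0,T].\<close>

lemma stopped_coord_energy:
  assumes K: "K \<in> elems m" and i: "i < r K" and t: "0 \<le> t" "t \<le> T"
  defines "R \<equiv> \<lambda>\<omega>. (LINT s:{0..\<tau> t \<omega>}|lborel. 2 * coord K (uh s \<omega> K) i * (\<Sum>\<l>\<in>L. b_form m P \<l> K (uh s \<omega>) (qh \<l> s \<omega>) (\<lambda>_. eb K i)))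
      + (\<Sum>\<l>\<in>L. LINT s:{0..\<tau> t \<omega>}|lborel. (coord K (qh \<l> s \<omega> K) i)\<^sup>2)"
  shows "integrable M (\<lambda>\<omega>. (coord K (uh (\<tau> t \<omega>) \<omega> K) i)\<^sup>2)" "integrable M R"
    "(\<integral>\<omega>. (coord K (uh (\<tau> t \<omega>) \<omega> K) i)\<^sup>2 \<partial>M) \<le> (coord K (uh0 K) i)\<^sup>2 + (\<integral>\<omega>. R \<omega> \<partial>M)"
proof -
  obtain U Q C where b: "0 \<le> U" "0 \<le> Q"
    "\<And>\<omega> s K x. good \<omega> \<Longrightarrow> 0 \<le> s \<Longrightarrow> ereal s \<le> hit \<omega> \<Longrightarrow> K \<in> elems m \<Longrightarrow> x \<in> K \<Longrightarrow> \<bar>uh s \<omega> K x\<bar> \<le> U"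
    "\<And>\<omega> s \<l> K x. good \<omega> \<Longrightarrow> 0 \<le> s \<Longrightarrow> ereal s \<le> hit \<omega> \<Longrightarrow> \<l> \<in> L \<Longrightarrow> K \<in> elems m \<Longrightarrow> x \<in> K \<Longrightarrow> \<bar>qh \<l> s \<omega> K x\<bar> \<le> Q"
    "\<And>\<omega> s \<l> K i. good \<omega> \<Longrightarrow> 0 \<le> s \<Longrightarrow> ereal s \<le> hit \<omega> \<Longrightarrow> \<l> \<in> L \<Longrightarrow> K \<in> elems m \<Longrightarrow> i < r K \<Longrightarrow>
        \<bar>b_form m P \<l> K (uh s \<omega>) (qh \<l> s \<omega>) (\<lambda>_. eb K i)\<bar> \<le> C"
    by (rule bounds) blast
  define c0 where "c0 = (LINT x:K|lborel. \<bar>eb K i x\<bar>)"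
  have c0: "0 \<le> c0" unfolding c0_def set_lebesgue_integral_def by (intro Bochner_Integration.integral_nonneg) auto
  \<comment> \<open>One constant for the stopped coordinate, the integrands and the drift, obtained
    by adding their three bounds.\<close>
  define C' where "C' = U * c0 + Q * c0 + real (card L) * \<bar>C\<bar>"
  define H where "H \<l> s \<omega> = (if ereal s \<le> hit \<omega> \<and> ereal s < \<tau>max \<omega> then coord K (qh \<l> s \<omega> K) i else 0)" for \<l> s \<omega>
  \<comment> \<open>Cutting the drift at the hitting time turns the random upper limit of its time
    integral into a deterministic one.\<close>
  define a where "a s \<omega> = (if ereal s \<le> hit \<omega> then \<Sum>\<l>\<in>L. b_form m P \<l> K (uh s \<omega>) (qh \<l> s \<omega>) (\<lambda>_. eb K i) else 0)" for s \<omega>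
  define X where "X s \<omega> = coord K (uh (\<tau> s \<omega>) \<omega> K) i" for s \<omega>
  have "(\<lambda>_. eb K i) \<in> dg_space m k" using eb_polys[OF K i] by (simp add: dg_space_def)
  then obtain I where I: "\<And>\<l> S. \<l> \<in> L \<Longrightarrow> 0 < S \<Longrightarrow> has_ito_integral M F (W \<l>) S (H \<l>) (I \<l>)"
    and eq: "AE \<omega> in M. \<forall>s\<ge>0. X s \<omega> = coord K (uh 0 \<omega> K) i
           + (LINT s:{0..\<tau> s \<omega>}|lborel. \<Sum>\<l>\<in>L. b_form m P \<l> K (uh s \<omega>) (qh \<l> s \<omega>) (\<lambda>_. eb K i)) - (\<Sum>\<l>\<in>L. I \<l> s \<omega>)"
    using solution_facts(8)[rule_format, OF K, of "\<lambda>_. eb K i" n]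
    unfolding X_def[abs_def] H_def[abs_def] hit_def[abs_def] \<tau>_def[abs_def] coord_def[abs_def] by blast
  have c1: "0 \<le> U * c0" "0 \<le> Q * c0" "0 \<le> real (card L) * \<bar>C\<bar>" using b(1,2) c0 by auto
  have Hb: "\<bar>H \<l> s \<omega>\<bar> \<le> C'" if "good \<omega>" "0 \<le> s" "\<l> \<in> L" for \<l> s \<omega>
  proof (cases "ereal s \<le> hit \<omega>")
    case True
    have "\<bar>coord K (qh \<l> s \<omega> K) i\<bar> \<le> Q * c0" unfolding c0_def
      by (rule coord_bounded[OF b(4)[OF that(1,2) True that(3)] path_props(2)[OF that(1,2) True that(3)] K i])
    then have "\<bar>H \<l> s \<omega>\<bar> \<le> Q * c0" using c1(2) unfolding H_def by (auto simp del: zero_le_mult_iff)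
    then show ?thesis unfolding C'_def using c1 by linarith
  qed (use c1 in \<open>simp add: H_def C'_def\<close>)
  have ab: "\<bar>a s \<omega>\<bar> \<le> C'" if "good \<omega>" "0 \<le> s" for s \<omega>
  proof (cases "ereal s \<le> hit \<omega>")
    case True
    have "\<bar>\<Sum>\<l>\<in>L. b_form m P \<l> K (uh s \<omega>) (qh \<l> s \<omega>) (\<lambda>_. eb K i)\<bar> \<le> (\<Sum>\<l>\<in>L. \<bar>C\<bar>)"
      using b(5)[OF that True _ K i] by (intro order_trans[OF sum_abs sum_mono]) (meson abs_ge_self order_trans)
    then show ?thesis using c1 True by (simp add: a_def C'_def)
  qed (use c1 in \<open>simp add: a_def C'_def\<close>)
  have Xb: "\<bar>X s \<omega>\<bar> \<le> C'" if "good \<omega>" "0 \<le> s" for s \<omega>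
  proof -
    note tp = \<tau>_props[OF that]
    have "\<bar>X s \<omega>\<bar> \<le> U * c0" unfolding c0_def X_def
      by (rule coord_bounded[OF b(3)[OF that(1) tp(2,4)] path_props(1)[OF that(1) tp(2,4)] K i])
    then show ?thesis unfolding C'_def using c1 by linarith
  qed
  \<comment> \<open>Translates between the two ways of stopping, through the integrand and through
    the upper limit.\<close>
  have cut: "(LINT s:{0..v}|lborel. g s) = (LINT s:{0..\<tau> v \<omega>}|lborel. f s)"
    if g: "good \<omega>" "0 \<le> v" and f: "\<And>s. s \<in> {0..v} \<Longrightarrow> g s = (if ereal s \<le> hit \<omega> then f s else 0)" for \<omega> v and f g :: "real \<Rightarrow> real"
    unfolding set_lebesgue_integral_def
  proof (rule Bochner_Integration.integral_cong[OF refl])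
    fix s show "indicator {0..v} s *\<^sub>R g s = indicator {0..\<tau> v \<omega>} s *\<^sub>R f s"
      using \<tau>_mem_iff[OF g, of s] f[of s] by (auto simp: indicator_def)
  qed
  have aint: "set_integrable lborel {0..v} (\<lambda>s. a s \<omega>)" if g: "good \<omega>" "0 \<le> v" for v \<omega>
  proof -
    have "set_integrable lborel {0..\<tau> v \<omega>} (\<lambda>s. \<Sum>\<l>\<in>L. b_form m P \<l> K (uh s \<omega>) (qh \<l> s \<omega>) (\<lambda>_. eb K i))"
      using path_integrable(1)[OF g(1) \<tau>_props(4)[OF g] _ K i] by (intro set_integral_finite_sum(1)) auto
    moreover have "indicator {0..v} s *\<^sub>R a s \<omega> = indicator {0..\<tau> v \<omega>} s *\<^sub>R (\<Sum>\<l>\<in>L. b_form m P \<l> K (uh s \<omega>) (qh \<l> s \<omega>) (\<lambda>_. eb K i))" for s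
      using \<tau>_mem_iff[OF g, of s] by (auto simp: indicator_def a_def)
    ultimately show ?thesis unfolding set_integrable_def by simp
  qed
  have X0: "X 0 \<omega> = coord K (uh0 K) i" if "good \<omega>" for \<omega>
  proof -
    have "\<tau> 0 \<omega> = 0" using \<tau>_props[OF that, of 0] by simp
    moreover have "uh 0 \<omega> K = uh0 K" using that K unfolding good_def by blast
    ultimately show ?thesis by (simp add: X_def)
  qed
  have eq': "AE \<omega> in M. \<forall>v\<in>{0..T}. X v \<omega> = X 0 \<omega> + (LINT s:{0..v}|lborel. a s \<omega>) - (\<Sum>\<l>\<in>L. I \<l> v \<omega>)"
    using AE_good eq
  proof eventually_elim
    case (elim \<omega>)
    have u0: "uh 0 \<omega> K = uh0 K" using elim(1) K unfolding good_def by blast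
    show ?case
    proof
      fix v assume v: "v \<in> {0..T}"
      have "(LINT s:{0..v}|lborel. a s \<omega>) = (LINT s:{0..\<tau> v \<omega>}|lborel. \<Sum>\<l>\<in>L. b_form m P \<l> K (uh s \<omega>) (qh \<l> s \<omega>) (\<lambda>_. eb K i))"
        by (rule cut[OF elim(1)]) (use v in \<open>auto simp: a_def\<close>)
      then show "X v \<omega> = X 0 \<omega> + (LINT s:{0..v}|lborel. a s \<omega>) - (\<Sum>\<l>\<in>L. I \<l> v \<omega>)"
        using elim(2)[rule_format, of v] v u0 X0[OF elim(1)] by simp
    qed
  qed
  have Xm: "X v \<in> borel_measurable (F v)" if "v \<in> {0..T}" for v
    unfolding X_def[abs_def] by (rule coord_measurable[OF _ K i]) (use that in simp)
  have Hb': "AE \<omega> in M. \<forall>s\<in>{0..T}. \<bar>H \<l> s \<omega>\<bar> \<le> C'" if "\<l> \<in> L" for \<l>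
    using AE_good by eventually_elim (use Hb that in auto)
  have a1: "AE \<omega> in M. set_integrable lborel {0..T} (\<lambda>s. a s \<omega>)"
    using AE_good by eventually_elim (use aint T in auto)
  have a2: "AE \<omega> in M. \<forall>s\<in>{0..T}. \<bar>a s \<omega>\<bar> \<le> C'"
    using AE_good by eventually_elim (use ab in auto)
  have Xb': "AE \<omega> in M. \<forall>s\<in>{0..T}. \<bar>X s \<omega>\<bar> \<le> C'"
    using AE_good by eventually_elim (use Xb in auto)
  note E = ito_energy_le[OF T I[OF _ T] Hb' a1 a2 Xm Xb' eq' t]
  show "integrable M (\<lambda>\<omega>. (coord K (uh (\<tau> t \<omega>) \<omega> K) i)\<^sup>2)" using E(1) unfolding X_def .
  have prog: "progressive F T (H \<l>)" if "\<l> \<in> L" for \<l>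
    using I[OF that T] unfolding has_ito_integral_def by blast
  have iH: "integrable M (\<lambda>\<omega>. LINT s:{0..t}|lborel. (H \<l> s \<omega>)\<^sup>2)" if "\<l> \<in> L" for \<l>
    by (rule progressive_bounded_square(2)[OF prog[OF that] less_imp_le[OF T] Hb'[OF that] t])
  let ?R = "\<lambda>\<omega>. (LINT s:{0..t}|lborel. 2 * X s \<omega> * a s \<omega>) + (\<Sum>\<l>\<in>L. LINT s:{0..t}|lborel. (H \<l> s \<omega>)\<^sup>2)"
  have iR: "integrable M ?R" using E(3) iH by (intro Bochner_Integration.integrable_add Bochner_Integration.integrable_sum)
  have RR: "AE \<omega> in M. R \<omega> = ?R \<omega>"
    using AE_good
  proof eventually_elim
    case (elim \<omega>)
    have "(LINT s:{0..t}|lborel. 2 * X s \<omega> * a s \<omega>) = (LINT s:{0..\<tau> t \<omega>}|lborel. 2 * coord K (uh s \<omega> K) i * (\<Sum>\<l>\<in>L. b_form m P \<l> K (uh s \<omega>) (qh \<l> s \<omega>) (\<lambda>_. eb K i)))"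
    proof (rule cut[OF elim t(1)])
      fix s assume "s \<in> {0..t}"
      \<comment> \<open>Up to the hitting time the stopped coordinate is the coordinate itself;
        afterwards a vanishes.\<close>
      then show "2 * X s \<omega> * a s \<omega> = (if ereal s \<le> hit \<omega> then 2 * coord K (uh s \<omega> K) i * (\<Sum>\<l>\<in>L. b_form m P \<l> K (uh s \<omega>) (qh \<l> s \<omega>) (\<lambda>_. eb K i)) else 0)"
        using \<tau>_before[of s \<omega>] by (simp add: X_def a_def)
    qed
    moreover have "(LINT s:{0..t}|lborel. (H \<l> s \<omega>)\<^sup>2) = (LINT s:{0..\<tau> t \<omega>}|lborel. (coord K (qh \<l> s \<omega> K) i)\<^sup>2)" for \<l>
      by (rule cut[OF elim t(1)]) (use hit_live[OF elim] in \<open>auto simp: H_def\<close>)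
    ultimately show ?case unfolding R_def by simp
  qed
  have Rm: "R \<in> borel_measurable M" by (rule borel_measurable_M_AE_eq[OF borel_measurable_integrable[OF iR] RR])
  show "integrable M R" using integrable_cong_AE[OF Rm borel_measurable_integrable[OF iR] RR] iR by blast
  have "(\<integral>\<omega>. R \<omega> \<partial>M) = (\<integral>\<omega>. ?R \<omega> \<partial>M)" by (rule integral_cong_AE[OF Rm borel_measurable_integrable[OF iR] RR])
  also have "\<dots> = (\<integral>\<omega>. (LINT s:{0..t}|lborel. 2 * X s \<omega> * a s \<omega>) \<partial>M) + (\<Sum>\<l>\<in>L. \<integral>\<omega>. (LINT s:{0..t}|lborel. (H \<l> s \<omega>)\<^sup>2) \<partial>M)"
    using E(3) iH by (simp add: Bochner_Integration.integral_add Bochner_Integration.integral_sum)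
  finally have R: "(\<integral>\<omega>. R \<omega> \<partial>M) = \<dots>" .
  have "AE \<omega> in M. (X 0 \<omega>)\<^sup>2 = (coord K (uh0 K) i)\<^sup>2" using AE_good by eventually_elim (simp add: X0)
  then have "(\<integral>\<omega>. (X 0 \<omega>)\<^sup>2 \<partial>M) = (\<integral>\<omega>. (coord K (uh0 K) i)\<^sup>2 \<partial>M)"
    using measurable_F_M[OF _ Xm[of 0]] T by (intro integral_cong_AE) auto
  then show "(\<integral>\<omega>. (coord K (uh (\<tau> t \<omega>) \<omega> K) i)\<^sup>2 \<partial>M) \<le> (coord K (uh0 K) i)\<^sup>2 + (\<integral>\<omega>. R \<omega> \<partial>M)"
    using E(4) unfolding R X_def by (simp add: prob_space)
qed

text \<open>The coordinate bounds are added over basis and elements. \<open>path_energy\<close>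
  identifies the sum of the right-hand sides with minus the dissipation, which thereby also inherits
  its integrability.\<close>

lemma stopped_energy:
  assumes t: "0 \<le> t" "t \<le> T"
  shows "integrable M (\<lambda>\<omega>. (L2_norm D (dg_fun m (uh (\<tau> t \<omega>) \<omega>)))\<^sup>2)"
    "integrable M (\<lambda>\<omega>. dissipation L m P uh qh (\<tau> t \<omega>) \<omega>)"
    "(\<integral>\<omega>. (L2_norm D (dg_fun m (uh (\<tau> t \<omega>) \<omega>)))\<^sup>2 \<partial>M) + (\<integral>\<omega>. dissipation L m P uh qh (\<tau> t \<omega>) \<omega> \<partial>M)
      \<le> (L2_norm D (dg_fun m uh0))\<^sup>2"
proof -
  let ?X = "\<lambda>K i \<omega>. (coord K (uh (\<tau> t \<omega>) \<omega> K) i)\<^sup>2"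
  let ?R = "\<lambda>K i \<omega>. (LINT s:{0..\<tau> t \<omega>}|lborel. 2 * coord K (uh s \<omega> K) i * (\<Sum>\<l>\<in>L. b_form m P \<l> K (uh s \<omega>) (qh \<l> s \<omega>) (\<lambda>_. eb K i)))
      + (\<Sum>\<l>\<in>L. LINT s:{0..\<tau> t \<omega>}|lborel. (coord K (qh \<l> s \<omega> K) i)\<^sup>2)"
  note S = stopped_coord_energy[OF _ _ t]
  let ?SX = "\<lambda>\<omega>. \<Sum>K\<in>elems m. \<Sum>i<r K. ?X K i \<omega>"
  let ?SR = "\<lambda>\<omega>. \<Sum>K\<in>elems m. \<Sum>i<r K. ?R K i \<omega>"
  let ?N = "\<lambda>\<omega>. (L2_norm D (dg_fun m (uh (\<tau> t \<omega>) \<omega>)))\<^sup>2"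
  let ?D = "\<lambda>\<omega>. dissipation L m P uh qh (\<tau> t \<omega>) \<omega>"
  have iX: "integrable M ?SX" by (intro Bochner_Integration.integrable_sum S(1)) auto
  have iR: "integrable M ?SR" by (rule Bochner_Integration.integrable_sum, rule Bochner_Integration.integrable_sum, rule S(2)) auto
  have iR': "integrable M (\<lambda>\<omega>. - ?SR \<omega>)" by (rule Bochner_Integration.integrable_minus[OF iR])
  have NX: "AE \<omega> in M. ?N \<omega> = ?SX \<omega>"
    using AE_good
  proof eventually_elim
    case (elim \<omega>)
    show ?case by (rule L2_norm_dg[OF path_props(1)[OF elim \<tau>_props(2,4)[OF elim t(1)]]])
  qed
  have DR: "AE \<omega> in M. ?D \<omega> = - ?SR \<omega>"
    using AE_good
  proof eventually_elim
    case (elim \<omega>)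
    note tp = \<tau>_props[OF elim t(1)]
    have "?SR \<omega> = - ?D \<omega>" by (rule path_energy[OF elim tp(2) order_trans[OF tp(3) t(2)] tp(4)])
    then show ?case by simp
  qed
  have Nm: "?N \<in> borel_measurable M" by (rule borel_measurable_M_AE_eq[OF borel_measurable_integrable[OF iX] NX])
  have Dm: "?D \<in> borel_measurable M" by (rule borel_measurable_M_AE_eq[OF borel_measurable_integrable[OF iR'] DR])
  show "integrable M ?N" using integrable_cong_AE[OF Nm borel_measurable_integrable[OF iX] NX] iX by blast
  show "integrable M ?D" using integrable_cong_AE[OF Dm borel_measurable_integrable[OF iR'] DR] iR' by blast
  have "(\<integral>\<omega>. ?N \<omega> \<partial>M) = (\<integral>\<omega>. ?SX \<omega> \<partial>M)" by (rule integral_cong_AE[OF Nm borel_measurable_integrable[OF iX] NX])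
  also have "\<dots> = (\<Sum>K\<in>elems m. \<integral>\<omega>. (\<Sum>i<r K. ?X K i \<omega>) \<partial>M)"
    by (intro Bochner_Integration.integral_sum Bochner_Integration.integrable_sum S(1)) auto
  also have "\<dots> = (\<Sum>K\<in>elems m. \<Sum>i<r K. \<integral>\<omega>. ?X K i \<omega> \<partial>M)"
    by (intro sum.cong refl Bochner_Integration.integral_sum S(1)) auto
  also have "\<dots> \<le> (\<Sum>K\<in>elems m. \<Sum>i<r K. (coord K (uh0 K) i)\<^sup>2 + (\<integral>\<omega>. ?R K i \<omega> \<partial>M))"
    by (intro sum_mono S(3)) auto
  also have "\<dots> = (L2_norm D (dg_fun m uh0))\<^sup>2 + (\<Sum>K\<in>elems m. \<Sum>i<r K. \<integral>\<omega>. ?R K i \<omega> \<partial>M)"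
    unfolding L2_norm_dg[OF uh0] by (simp add: sum.distrib)
  also have "(\<Sum>K\<in>elems m. \<Sum>i<r K. \<integral>\<omega>. ?R K i \<omega> \<partial>M) = (\<integral>\<omega>. ?SR \<omega> \<partial>M)"
  proof -
    have "(\<integral>\<omega>. ?SR \<omega> \<partial>M) = (\<Sum>K\<in>elems m. \<integral>\<omega>. (\<Sum>i<r K. ?R K i \<omega>) \<partial>M)"
      by (rule Bochner_Integration.integral_sum, rule Bochner_Integration.integrable_sum, rule S(2)) auto
    also have "\<dots> = (\<Sum>K\<in>elems m. \<Sum>i<r K. \<integral>\<omega>. ?R K i \<omega> \<partial>M)"
      by (rule sum.cong[OF refl], rule Bochner_Integration.integral_sum, rule S(2)) auto
    finally show ?thesis by simp
  qed
  also have "(\<integral>\<omega>. ?SR \<omega> \<partial>M) = - (\<integral>\<omega>. ?D \<omega> \<partial>M)"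
    using integral_cong_AE[OF Dm borel_measurable_integrable[OF iR'] DR] by simp
  finally show "(\<integral>\<omega>. ?N \<omega> \<partial>M) + (\<integral>\<omega>. ?D \<omega> \<partial>M) \<le> (L2_norm D (dg_fun m uh0))\<^sup>2" by simp
qed

end

text \<open>\<open>Fatou_square\<close> applied to square roots.\<close>

lemma (in filtered_prob_space) Fatou_nonneg:
  fixes f :: "'w \<Rightarrow> real"
  assumes i: "\<And>n. integrable M (f' n)" and nn: "\<And>n \<omega>. 0 \<le> f' n \<omega>" "\<And>\<omega>. 0 \<le> f \<omega>"
    and B: "\<And>n. (\<integral>\<omega>. f' n \<omega> \<partial>M) \<le> B" and lim: "AE \<omega> in M. (\<lambda>n. f' n \<omega>) \<longlonglongrightarrow> f \<omega>"
  shows "integrable M f" "(\<integral>\<omega>. f \<omega> \<partial>M) \<le> B"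
proof -
  have sq: "(sqrt (f' n \<omega>))\<^sup>2 = f' n \<omega>" "(sqrt (f \<omega>))\<^sup>2 = f \<omega>" for n \<omega> using nn by simp_all
  have "AE \<omega> in M. (\<lambda>n. sqrt (f' n \<omega>)) \<longlonglongrightarrow> sqrt (f \<omega>)"
    using lim by eventually_elim (rule tendsto_real_sqrt)
  then show "integrable M f" "(\<integral>\<omega>. f \<omega> \<partial>M) \<le> B"
    using Fatou_square(2,3)[of "\<lambda>n \<omega>. sqrt (f' n \<omega>)" "\<lambda>_. B" B "\<lambda>\<omega>. sqrt (f \<omega>)"] i B
    unfolding sq by auto
qed

section \<open>Removal of the stopping\<close>

context ldg_problem begin

text \<open>On the compact interval [0,t] the size of a living path is bounded, so a level n above
  that bound is not reached by time t.\<close>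

lemma eventually_\<tau>_eq:
  assumes g: "good \<omega>" and t: "0 \<le> t" "ereal t < \<tau>max \<omega>"
  shows "eventually (\<lambda>n. stopped_time m N \<beta> \<tau>max uh n t \<omega> = t) sequentially"
proof -
  have "continuous_on {0..t} (\<lambda>s. size s \<omega>)"
    by (rule size_continuous[OF good_space[OF g]]) (use less_max_mono[OF _ t(2)] in auto)
  then have "compact ((\<lambda>s. size s \<omega>) ` {0..t})" by (rule compact_continuous_image) simp
  then obtain B where B: "\<forall>y\<in>(\<lambda>s. size s \<omega>) ` {0..t}. norm y \<le> B" using compact_imp_bounded bounded_pos by metis
  obtain n0 :: nat where n0: "B < real n0" using reals_Archimedean2 by blast
  have "stopped_time m N \<beta> \<tau>max uh n t \<omega> = t" if "n0 \<le> n" for n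
  proof -
    interpret ldg_stopped M F L W D m P k r eb T N \<beta> uh0 \<tau>max uh qh n by unfold_locales
    have "ereal t \<le> hit \<omega>"
      unfolding hit_eq
    proof (rule Inf_greatest)
      fix z assume "z \<in> ereal ` {s. 0 \<le> s \<and> ereal s < \<tau>max \<omega> \<and> real n \<le> size s \<omega>}"
      then obtain s where s: "z = ereal s" "0 \<le> s" "real n \<le> size s \<omega>" by blast
      have "\<not> s \<le> t"
      proof
        assume "s \<le> t"
        then have "norm (size s \<omega>) \<le> B" using B s(2) by auto
        then show False using s(3) n0 that by simp
      qed
      then show "ereal t \<le> z" using s(1) by simp
    qed
    then show ?thesis using \<tau>_before[OF t(1)] unfolding \<tau>_def by blast
  qed
  then show ?thesis unfolding eventually_sequentially by blast
qed

lemma global_energy: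
  assumes ex: "AE \<omega> in M. ereal T < \<tau>max \<omega>" and t: "0 \<le> t" "t \<le> T"
  shows "integrable M (\<lambda>\<omega>. (L2_norm D (dg_fun m (uh t \<omega>)))\<^sup>2)"
    "integrable M (\<lambda>\<omega>. dissipation L m P uh qh t \<omega>)"
    "(\<integral>\<omega>. (L2_norm D (dg_fun m (uh t \<omega>)))\<^sup>2 \<partial>M) + (\<integral>\<omega>. dissipation L m P uh qh t \<omega> \<partial>M)
      \<le> (L2_norm D (dg_fun m uh0))\<^sup>2"
proof -
  let ?\<tau> = "\<lambda>n. stopped_time m N \<beta> \<tau>max uh n t"
  define A where "A n \<omega> = (L2_norm D (dg_fun m (uh (?\<tau> n \<omega>) \<omega>)))\<^sup>2" for n \<omega>
  define G where "G n \<omega> = dissipation L m P uh qh (?\<tau> n \<omega>) \<omega>" for n \<omega>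
  define A' where "A' \<omega> = (L2_norm D (dg_fun m (uh t \<omega>)))\<^sup>2" for \<omega>
  define G' where "G' \<omega> = dissipation L m P uh qh t \<omega>" for \<omega>
  let ?B = "(L2_norm D (dg_fun m uh0))\<^sup>2"
  have S: "integrable M (A n)" "integrable M (G n)" "(\<integral>\<omega>. A n \<omega> \<partial>M) + (\<integral>\<omega>. G n \<omega> \<partial>M) \<le> ?B" for n
  proof -
    interpret ldg_stopped M F L W D m P k r eb T N \<beta> uh0 \<tau>max uh qh n by unfold_locales
    show "integrable M (A n)" "integrable M (G n)" "(\<integral>\<omega>. A n \<omega> \<partial>M) + (\<integral>\<omega>. G n \<omega> \<partial>M) \<le> ?B"
      using stopped_energy[OF t] unfolding A_def[abs_def] G_def[abs_def] \<tau>_def[abs_def] by blast+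
  qed
  have nn: "0 \<le> A n \<omega>" "0 \<le> G n \<omega>" "0 \<le> A' \<omega>" "0 \<le> G' \<omega>" for n \<omega>
    by (auto simp: A_def G_def A'_def G'_def dissipation_nonneg)
  have le: "(\<integral>\<omega>. A n \<omega> \<partial>M) \<le> ?B" "(\<integral>\<omega>. G n \<omega> \<partial>M) \<le> ?B" for n
  proof -
    have "0 \<le> (\<integral>\<omega>. A n \<omega> \<partial>M)" "0 \<le> (\<integral>\<omega>. G n \<omega> \<partial>M)"
      by (rule Bochner_Integration.integral_nonneg, rule nn)+
    then show "(\<integral>\<omega>. A n \<omega> \<partial>M) \<le> ?B" "(\<integral>\<omega>. G n \<omega> \<partial>M) \<le> ?B" using S(3)[of n] by linarith+
  qed
  have ev: "AE \<omega> in M. eventually (\<lambda>n. A n \<omega> = A' \<omega> \<and> G n \<omega> = G' \<omega>) sequentially"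
    using AE_good ex
  proof eventually_elim
    case (elim \<omega>)
    have "ereal t \<le> ereal T" using t by simp
    then have "ereal t < \<tau>max \<omega>" using elim(2) by (rule le_less_trans)
    from eventually_\<tau>_eq[OF elim(1) t(1) this] show ?case
      by eventually_elim (simp add: A_def G_def A'_def G'_def)
  qed
  have limA: "AE \<omega> in M. (\<lambda>n. A n \<omega>) \<longlonglongrightarrow> A' \<omega>"
    and limG: "AE \<omega> in M. (\<lambda>n. G n \<omega>) \<longlonglongrightarrow> G' \<omega>"
    using ev by (eventually_elim, auto intro: tendsto_eventually elim: eventually_mono)+
  \<comment> \<open>Fatou's lemma is applied to the sum of norm and dissipation. Applied to each
    separately it would spend the initial energy twice; the separate limits above serve only for
    integrability.\<close>
  have limS: "AE \<omega> in M. (\<lambda>n. A n \<omega> + G n \<omega>) \<longlonglongrightarrow> A' \<omega> + G' \<omega>"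
    using limA limG by eventually_elim (rule tendsto_add)
  have iA: "integrable M A'" by (rule Fatou_nonneg(1)[OF S(1) nn(1,3) le(1) limA])
  have iG: "integrable M G'" by (rule Fatou_nonneg(1)[OF S(2) nn(2,4) le(2) limG])
  have "(\<integral>\<omega>. A' \<omega> + G' \<omega> \<partial>M) \<le> ?B"
    by (rule Fatou_nonneg(2)[OF _ _ _ _ limS]) (use S nn in auto)
  then have "(\<integral>\<omega>. A' \<omega> \<partial>M) + (\<integral>\<omega>. G' \<omega> \<partial>M) \<le> ?B" using iA iG by simp
  with iA iG show "integrable M (\<lambda>\<omega>. (L2_norm D (dg_fun m (uh t \<omega>)))\<^sup>2)"
    "integrable M (\<lambda>\<omega>. dissipation L m P uh qh t \<omega>)"
    "(\<integral>\<omega>. (L2_norm D (dg_fun m (uh t \<omega>)))\<^sup>2 \<partial>M) + (\<integral>\<omega>. dissipation L m P uh qh t \<omega> \<partial>M) \<le> ?B"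
    unfolding A'_def[abs_def] G'_def[abs_def] by blast+
qed

end

text \<open>The local basis of the scheme spans the polynomials and is orthonormalised on each
  element separately. The L2 product of an element is definite because its interior is
  nonempty.\<close>

lemma (in ldg_mesh) orthonormal_basis:
  assumes b: "local_basis m k N \<beta>" and fin: "finite L"
  obtains r eb where "ldg_basis D m L P k r eb"
proof -
  define Pr where "Pr K r e \<longleftrightarrow> (\<forall>i<r. e i \<in> polys k) \<and>
      (\<forall>i<r. \<forall>j<r. (LINT x:K|lborel. e i x * e j x) = (if i = j then 1 else 0)) \<and>
      (\<forall>p\<in>polys k. p = (\<lambda>x. \<Sum>i<r. (LINT x:K|lborel. e i x * p x) * e i x))"
    for K :: "(real^'n) set" and r :: nat and e :: "nat \<Rightarrow> real^'n \<Rightarrow> real"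
  have "\<exists>r e. Pr K r e" if K: "K \<in> elems m" for K
  proof -
    have int: "set_integrable lborel K (\<lambda>x. p x * q x)" if "p \<in> polys k" "q \<in> polys k" for p q
      using that elem_compact[OF K] polys_continuous
      by (intro set_integrable_continuous_compact continuous_intros) auto
    have bK: "\<And>j. j \<le> N \<Longrightarrow> \<beta> j K \<in> polys k" "\<And>p. p \<in> polys k \<Longrightarrow> \<exists>c. p = (\<lambda>x. \<Sum>j\<le>N. c j * \<beta> j K x)"
      using b K unfolding local_basis_def by blast+
    show ?thesis
    proof (rule gram_schmidt[of "polys k" "\<lambda>p q. LINT x:K|lborel. p x * q x" N "\<lambda>j. \<beta> j K"])
      show "(LINT x:K|lborel. (a * p x + b * q x) * s x) = a * (LINT x:K|lborel. p x * s x) + b * (LINT x:K|lborel. q x * s x)"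
        if "p \<in> polys k" "q \<in> polys k" "s \<in> polys k" for p q s and a b :: real
      proof -
        have "(LINT x:K|lborel. (a * p x + b * q x) * s x) = (LINT x:K|lborel. a * (p x * s x) + b * (q x * s x))"
          by (simp add: algebra_simps)
        then show ?thesis using int that by (simp add: set_integral_add(2))
      qed
      show "0 \<le> (LINT x:K|lborel. p x * p x)" for p :: "real^'n \<Rightarrow> real"
        unfolding set_lebesgue_integral_def by (intro Bochner_Integration.integral_nonneg) auto
      show "(LINT x:K|lborel. p x * q x) = (LINT x:K|lborel. q x * p x)" for p q :: "real^'n \<Rightarrow> real" by (simp add: mult.commute)
      show "p = (\<lambda>x. 0)" if "p \<in> polys k" "(LINT x:K|lborel. p x * p x) = 0" for p
        by (rule polys_L2_definite[OF that(1) elem_compact[OF K] elem_interior[OF K] that(2)])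
      fix r :: nat and e
      assume e: "\<And>i. i < r \<Longrightarrow> e i \<in> polys k"
        "\<And>i j. i < r \<Longrightarrow> j < r \<Longrightarrow> (LINT x:K|lborel. e i x * e j x) = (if i = j then 1 else 0)"
        "\<And>p. p \<in> polys k \<Longrightarrow> p = (\<lambda>x. \<Sum>i<r. (LINT x:K|lborel. p x * e i x) * e i x)"
      have "(LINT x:K|lborel. p x * e i x) = (LINT x:K|lborel. e i x * p x)" for p i by (simp add: mult.commute)
      note e3 = e(3)[unfolded this]
      show "\<exists>r e. Pr K r e" unfolding Pr_def
        by (intro exI[of _ r] exI[of _ e] conjI allI impI ballI) (use e(1,2) in simp, use e(2) in simp, rule e3)
    qed (rule polys_zero | (rule polys_lincomb; assumption) | (rule bK; assumption))+
  qed
  then obtain r e where "\<And>K. K \<in> elems m \<Longrightarrow> Pr K (r K) (e K)" by metis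
  then have Pr: "\<And>K. K \<in> elems m \<Longrightarrow> (\<forall>i<r K. e K i \<in> polys k)"
    "\<And>K. K \<in> elems m \<Longrightarrow> \<forall>i<r K. \<forall>j<r K. (LINT x:K|lborel. e K i x * e K j x) = (if i = j then 1 else 0)"
    "\<And>K. K \<in> elems m \<Longrightarrow> \<forall>p\<in>polys k. p = (\<lambda>x. \<Sum>i<r K. (LINT x:K|lborel. e K i x * p x) * e K i x)"
    unfolding Pr_def by blast+
  have "ldg_basis D m L P k r e"
    by unfold_locales (rule fin, use Pr(1) in blast, use Pr(2) in blast, rule Pr(3)[rule_format])
  then show thesis by (rule that)
qed

theorem theorem4p5:
  fixes M :: "'w measure" and F :: "real \<Rightarrow> 'w measure"
    and L :: "'l set" and W :: "'l \<Rightarrow> real \<Rightarrow> 'w \<Rightarrow> real"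
    and T \<kappa> :: real and k N :: nat
    and D :: "(real^'n::finite) set" and m :: "'n mesh" and P :: "('l, 'n) scheme"
    and \<beta> :: "nat \<Rightarrow> 'n broken"
    and ubar :: "real^'n \<Rightarrow> real" and u :: "real \<Rightarrow> 'w \<Rightarrow> real^'n \<Rightarrow> real"
    and uh0 :: "'n broken" and \<tau>max :: "'w \<Rightarrow> ereal"
    and uh :: "real \<Rightarrow> 'w \<Rightarrow> 'n broken" and qh :: "'l \<Rightarrow> real \<Rightarrow> 'w \<Rightarrow> 'n broken"
  assumes "T > 0"
    and "prob_space M" and "usual_filtration M F"
    and "finite L" and "independent_wiener_processes M F L W"
    and "polyhedral_domain D" and "conforming_mesh D m" and "shape_regular \<kappa> m"
    and "structural_assumption L m P"
    and "\<forall>\<l>\<in>L. \<forall>e\<in>faces m. eta_u P \<l> e \<ge> 0 \<and> eta_q P \<l> e \<ge> 0"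
    and "square_integrable ubar" and "\<exists>R. AE x in lborel. norm x > R \<longrightarrow> ubar x = 0"
    and "exact_solution M F L W T P ubar u" and "mesh_covers_support M T m u"
    and "local_basis m k N \<beta>"
    and "is_L2_projection D m k ubar uh0"
    and "ldg_solution M F L W m P k N \<beta> uh0 \<tau>max uh qh"
    and "no_boundary_transport M L T D m P \<tau>max uh"
  shows "let \<tau> = stopped_time m N \<beta> \<tau>max uh in
    (\<forall>n. \<forall>t\<in>{0..T}.
      integrable M (\<lambda>\<omega>. (L2_norm D (dg_fun m (uh (\<tau> n t \<omega>) \<omega>)))\<^sup>2) \<and>
      integrable M (\<lambda>\<omega>. dissipation L m P uh qh (\<tau> n t \<omega>) \<omega>) \<and>
      (\<integral>\<omega>. (L2_norm D (dg_fun m (uh (\<tau> n t \<omega>) \<omega>)))\<^sup>2 \<partial>M) - (L2_norm D (dg_fun m uh0))\<^sup>2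
        + (\<integral>\<omega>. dissipation L m P uh qh (\<tau> n t \<omega>) \<omega> \<partial>M) \<le> 0 \<and>
      0 \<le> (\<integral>\<omega>. dissipation L m P uh qh (\<tau> n t \<omega>) \<omega> \<partial>M) \<and>
      (\<integral>\<omega>. (L2_norm D (dg_fun m (uh (\<tau> n t \<omega>) \<omega>)))\<^sup>2 \<partial>M) \<le> (L2_norm D (dg_fun m uh0))\<^sup>2) \<and>
    ((AE \<omega> in M. ereal T < \<tau>max \<omega>) \<longrightarrow> (\<forall>t\<in>{0..T}.
      integrable M (\<lambda>\<omega>. (L2_norm D (dg_fun m (uh t \<omega>)))\<^sup>2) \<and>
      integrable M (\<lambda>\<omega>. dissipation L m P uh qh t \<omega>) \<and>
      (\<integral>\<omega>. (L2_norm D (dg_fun m (uh t \<omega>)))\<^sup>2 \<partial>M) - (L2_norm D (dg_fun m uh0))\<^sup>2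
        + (\<integral>\<omega>. dissipation L m P uh qh t \<omega> \<partial>M) \<le> 0 \<and>
      0 \<le> (\<integral>\<omega>. dissipation L m P uh qh t \<omega> \<partial>M) \<and>
      (\<integral>\<omega>. (L2_norm D (dg_fun m (uh t \<omega>)))\<^sup>2 \<partial>M) \<le> (L2_norm D (dg_fun m uh0))\<^sup>2))"
proof -
  have "ldg_mesh D m L P"
    by (intro ldg_mesh.intro mesh_domain.intro ldg_mesh_axioms.intro) fact+
  \<comment> \<open>The orthonormal basis is auxiliary: the claim refers only to the basis \<beta>,
    through the hitting times.\<close>
  then obtain r eb where eb: "ldg_basis D m L P k r eb"
    by (rule ldg_mesh.orthonormal_basis[OF _ assms(15,4)])
  have uh0: "uh0 \<in> dg_space m k" using assms(16) unfolding is_L2_projection_def by blast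
  interpret ldg_problem M F L W D m P k r eb T N \<beta> uh0 \<tau>max uh qh
    by (intro ldg_problem.intro wiener_family.intro filtered_prob_space.intro filtered_prob_space_axioms.intro
        wiener_family_axioms.intro ldg_problem_axioms.intro) (fact assms eb uh0)+
  define \<tau> where "\<tau> = stopped_time m N \<beta> \<tau>max uh"
  have nn: "0 \<le> (\<integral>\<omega>. dissipation L m P uh qh (s \<omega>) \<omega> \<partial>M)" "0 \<le> (\<integral>\<omega>. (L2_norm D (v \<omega>))\<^sup>2 \<partial>M)" for s v
    by (auto intro!: Bochner_Integration.integral_nonneg dissipation_nonneg)
  have stopped: "integrable M (\<lambda>\<omega>. (L2_norm D (dg_fun m (uh (\<tau> n t \<omega>) \<omega>)))\<^sup>2)"
    "integrable M (\<lambda>\<omega>. dissipation L m P uh qh (\<tau> n t \<omega>) \<omega>)"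
    "(\<integral>\<omega>. (L2_norm D (dg_fun m (uh (\<tau> n t \<omega>) \<omega>)))\<^sup>2 \<partial>M) + (\<integral>\<omega>. dissipation L m P uh qh (\<tau> n t \<omega>) \<omega> \<partial>M)
      \<le> (L2_norm D (dg_fun m uh0))\<^sup>2" if "t \<in> {0..T}" for n t
  proof -
    interpret s: ldg_stopped M F L W D m P k r eb T N \<beta> uh0 \<tau>max uh qh n by unfold_locales
    have st: "s.\<tau> = \<tau> n" by (intro ext) (simp add: s.\<tau>_def \<tau>_def)
    have "0 \<le> t" "t \<le> T" using that by auto
    note s.stopped_energy[OF this, unfolded st]
    then show "integrable M (\<lambda>\<omega>. (L2_norm D (dg_fun m (uh (\<tau> n t \<omega>) \<omega>)))\<^sup>2)"
      "integrable M (\<lambda>\<omega>. dissipation L m P uh qh (\<tau> n t \<omega>) \<omega>)"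
      "(\<integral>\<omega>. (L2_norm D (dg_fun m (uh (\<tau> n t \<omega>) \<omega>)))\<^sup>2 \<partial>M) + (\<integral>\<omega>. dissipation L m P uh qh (\<tau> n t \<omega>) \<omega> \<partial>M)
        \<le> (L2_norm D (dg_fun m uh0))\<^sup>2" by blast+
  qed
  have 1: "integrable M (\<lambda>\<omega>. (L2_norm D (dg_fun m (uh (\<tau> n t \<omega>) \<omega>)))\<^sup>2) \<and>
      integrable M (\<lambda>\<omega>. dissipation L m P uh qh (\<tau> n t \<omega>) \<omega>) \<and>
      (\<integral>\<omega>. (L2_norm D (dg_fun m (uh (\<tau> n t \<omega>) \<omega>)))\<^sup>2 \<partial>M) - (L2_norm D (dg_fun m uh0))\<^sup>2
        + (\<integral>\<omega>. dissipation L m P uh qh (\<tau> n t \<omega>) \<omega> \<partial>M) \<le> 0 \<and>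
      0 \<le> (\<integral>\<omega>. dissipation L m P uh qh (\<tau> n t \<omega>) \<omega> \<partial>M) \<and>
      (\<integral>\<omega>. (L2_norm D (dg_fun m (uh (\<tau> n t \<omega>) \<omega>)))\<^sup>2 \<partial>M) \<le> (L2_norm D (dg_fun m uh0))\<^sup>2"
    if "t \<in> {0..T}" for n t
    using stopped[OF that, of n] nn(1)[of "\<tau> n t"] by linarith
  have 2: "integrable M (\<lambda>\<omega>. (L2_norm D (dg_fun m (uh t \<omega>)))\<^sup>2) \<and>
      integrable M (\<lambda>\<omega>. dissipation L m P uh qh t \<omega>) \<and>
      (\<integral>\<omega>. (L2_norm D (dg_fun m (uh t \<omega>)))\<^sup>2 \<partial>M) - (L2_norm D (dg_fun m uh0))\<^sup>2
        + (\<integral>\<omega>. dissipation L m P uh qh t \<omega> \<partial>M) \<le> 0 \<and>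
      0 \<le> (\<integral>\<omega>. dissipation L m P uh qh t \<omega> \<partial>M) \<and>
      (\<integral>\<omega>. (L2_norm D (dg_fun m (uh t \<omega>)))\<^sup>2 \<partial>M) \<le> (L2_norm D (dg_fun m uh0))\<^sup>2"
    if "AE \<omega> in M. ereal T < \<tau>max \<omega>" "t \<in> {0..T}" for t
  proof -
    have "0 \<le> t" "t \<le> T" using that(2) by auto
    from global_energy[OF that(1) this] show ?thesis using nn(1)[of "\<lambda>_. t"] by linarith
  qed
  show ?thesis unfolding Let_def \<tau>_def[symmetric] using 1 2 by blast
qed

end
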